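(* Let $\mu \leq_c \nu$ be irreducible with domain $(I,J)$ and let $f: \mathbb{R} \to [0,\infty]$. (i) If $f$ is upper semianalytic, then $\widetilde{\mathbf{S}}_{\mu,\nu}(f) = \widetilde{\mathbf{I}}_{\mu,\nu}(f) \in [0,\infty]$. (ii) If $\widetilde{\mathbf{I}}_{\mu,\nu}(f) < \infty$, then there exists a dual minimizer, i.e. $(\varphi,\psi) \in \widetilde{\mathcal{D}}_{\mu,\nu}(f)$ with $\mu(\varphi)+\nu(\psi)=\widetilde{\mathbf{I}}_{\mu,\nu}(f)$.
   Context: **Measures.** All measures $\mu,\nu,\theta,\theta_i$ on $\mathbb{R}$ are finite with finite first moment; $\mu(\varphi)$ denotes $\int\varphi\,d\mu$. $\mu\leq_c\nu$ (convex order) means $\mu(\varphi)\le\nu(\varphi)$ for all convex $\varphi:\mathbb{R}\to\mathbb{R}$. The potential function is $u_\mu(x)=\int|x-y|\,\mu(dy)$. A pair $\mu\leq_c\nu$ is irreducible if $I=\{u_\mu<u_\nu\}$ is connected and $\mu(I)=\mu(\mathbb{R})$; $J$ is the union of $I$ and any endpoints of $I$ that are atoms of $\nu$; $(I,J)$ is the domain. **Generalized integral.** Let $\mu\leq_c\theta_1\leq_c\theta_2\leq_c\nu$. For concave $\chi:J\to\mathbb{R}$ let $-\chi''$ be the second derivative measure of $-\chi$ on $I$, $\Delta\chi$ the possible jumps of $\chi$ at endpoints of $I$ belonging to $J$, and $$(\theta_1-\theta_2)(\chi)=\tfrac12\int_I(u_{\theta_1}-u_{\theta_2})\,d\chi''+\int_{J\setminus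 I}|\Delta\chi|\,d(\theta_2-\theta_1)\in[0,\infty].$$ For Borel $\varphi,\psi:J\to\overline{\mathbb{R}}$, a concave $\chi:J\to\mathbb{R}$ is a concave moderator for $(\varphi,\psi)$ w.r.t. $\theta_1\leq_c\theta_2$ if $\varphi-\chi\in L^1(\theta_1)$ and $\psi+\chi\in L^1(\theta_2)$; then $\theta_1(\varphi)+\theta_2(\psi):=\theta_1(\varphi-\chi)+\theta_2(\psi+\chi)+(\theta_1-\theta_2)(\chi)\in(-\infty,\infty]$ (independent of the choice of $\chi$). $L^c(\theta_1,\theta_2)$ is the set of pairs $(\varphi,\psi)$ admitting a concave moderator with $(\theta_1-\theta_2)(\chi)<\infty$. The expression $\mu(\varphi)+\nu(\psi)$ is understood in this sense. **Auxiliary problems.** $\widetilde{\mathbf{S}}_{\mu,\nu}(f)=\sup_{\mu\leq_c\theta\leq_c\nu}\theta(f)$, where $\theta(f)$ is the outer integral if $f$ is not Borel. $\widetilde{\mathcal{D}}_{\mu,\nu}(f)$ is the set of $(\varphi,\psi)\in L^c(\mu,\nu)$ with $\varphi:J\to\overline{\mathbb{R}}$ concave, $\psi:J\to\overline{\mathbb{R}}$ convex and $\varphi+\psi\ge f$ on $J$ (when $f>-\infty$ on $J$, such $\varphi,\psi$ are real-valued on $J$). $\widetilde{\mathbf{I}}_{\mu,\nu}(f)=\inf_{(\varphi,\psi)\in\widetilde{\mathcal{D}}_{\mu,\nu}(f)}\{\mu(\varphi)+\nu(\psi)\}$, with $\inf\emptyset=\infty$. *)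

theory Defs
  imports "HOL-Analysis.Analysis"
begin

section \<open>Extended-real integrals\<close>

text \<open>In \<^typ>\<open>ereal\<close> one has \<infinity> - \<infinity> = \<infinity>; below, the integral is only
  applied where at least one of the two parts is finite, so that this plays no role.\<close>

definition ext_integral :: "'a measure \<Rightarrow> ('a \<Rightarrow> ereal) \<Rightarrow> ereal" where
  "ext_integral M f =
     enn2ereal (\<integral>\<^sup>+ x. e2ennreal (f x) \<partial>M) - enn2ereal (\<integral>\<^sup>+ x. e2ennreal (- f x) \<partial>M)"

definition ext_L1 :: "'a measure \<Rightarrow> ('a \<Rightarrow> ereal) set" where
  "ext_L1 M = {f \<in> borel_measurable M. (\<integral>\<^sup>+ x. e2ennreal \<bar>f x\<bar> \<partial>M) < \<infinity>}"

text \<open>For measurable f the outer integral is the integral of f, see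
  \<open>outer_integral_measurable\<close> below.\<close>

definition outer_integral :: "'a measure \<Rightarrow> ('a \<Rightarrow> ereal) \<Rightarrow> ereal" where
  "outer_integral M f =
     (INF g\<in>{g \<in> borel_measurable M. \<forall>x\<in>space M. f x \<le> g x}. ext_integral M g)"

lemma ext_integral_mono:
  assumes "\<And>x. x \<in> space M \<Longrightarrow> f x \<le> g x"
  shows "ext_integral M f \<le> ext_integral M g"
proof -
  have "(\<integral>\<^sup>+ x. e2ennreal (f x) \<partial>M) \<le> (\<integral>\<^sup>+ x. e2ennreal (g x) \<partial>M)"
    using assms by (intro nn_integral_mono e2ennreal_mono)
  moreover have "(\<integral>\<^sup>+ x. e2ennreal (- g x) \<partial>M) \<le> (\<integral>\<^sup>+ x. e2ennreal (- f x) \<partial>M)"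
    using assms by (intro nn_integral_mono e2ennreal_mono) simp
  ultimately show ?thesis
    unfolding ext_integral_def by (intro ereal_minus_mono) (simp_all add: less_eq_ennreal.rep_eq)
qed

lemma outer_integral_measurable:
  assumes "f \<in> borel_measurable M"
  shows "outer_integral M f = ext_integral M f"
  unfolding outer_integral_def
proof (rule antisym)
  show "(INF g\<in>{g \<in> borel_measurable M. \<forall>x\<in>space M. f x \<le> g x}. ext_integral M g)
      \<le> ext_integral M f"
    using assms by (intro INF_lower) auto
qed (auto intro!: INF_greatest ext_integral_mono)

section \<open>Extended-real convex functions and upper semianalytic functions\<close>

definition ext_convex_on :: "'a::real_vector set \<Rightarrow> ('a \<Rightarrow> ereal) \<Rightarrow> bool" where
  "ext_convex_on S f \<longleftrightarrow> convex {(x, t :: real). x \<in> S \<and> f x \<le> ereal t}"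

definition ext_concave_on :: "'a::real_vector set \<Rightarrow> ('a \<Rightarrow> ereal) \<Rightarrow> bool" where
  "ext_concave_on S f \<longleftrightarrow> ext_convex_on S (\<lambda>x. - f x)"

lemma ext_convex_on_ereal: "ext_convex_on S (\<lambda>x. ereal (f x)) \<longleftrightarrow> convex_on S f"
proof -
  have "{(x, t). x \<in> S \<and> ereal (f x) \<le> ereal t} = epigraph S f"
    by (auto simp: epigraph_def)
  then show ?thesis
    by (simp add: ext_convex_on_def convex_epigraph)
qed

text \<open>Analytic sets are the continuous images of the Baire space, together with the empty set;
  \<^typ>\<open>nat \<Rightarrow> nat\<close> carries the product of the discrete topologies.\<close>

definition analytic_set :: "'a::topological_space set \<Rightarrow> bool" where
  "analytic_set A \<longleftrightarrow>
     A = {} \<or> (\<exists>g :: (nat \<Rightarrow> nat) \<Rightarrow> 'a. continuous_on UNIV g \<and> range g = A)"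

definition upper_semianalytic :: "('a::topological_space \<Rightarrow> ereal) \<Rightarrow> bool" where
  "upper_semianalytic f \<longleftrightarrow> (\<forall>c :: real. analytic_set {x. ereal c < f x})"

section \<open>Convex order and irreducibility\<close>

definition finite_first_moment :: "real measure \<Rightarrow> bool" where
  "finite_first_moment M \<longleftrightarrow>
     sets M = sets borel \<and> finite_measure M \<and> integrable M (\<lambda>x. x)"

definition convex_order :: "real measure \<Rightarrow> real measure \<Rightarrow> bool"  (infix "\<le>\<^sub>c" 50) where
  "\<mu> \<le>\<^sub>c \<nu> \<longleftrightarrow>
     (\<forall>\<phi> :: real \<Rightarrow> real. convex_on UNIV \<phi> \<longrightarrow>
        ext_integral \<mu> (\<lambda>x. ereal (\<phi> x)) \<le> ext_integral \<nu> (\<lambda>x. ereal (\<phi> x)))"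

definition potential :: "real measure \<Rightarrow> real \<Rightarrow> real" where
  "potential \<mu> x = (LINT y|\<mu>. \<bar>x - y\<bar>)"

definition dom_I :: "real measure \<Rightarrow> real measure \<Rightarrow> real set" where
  "dom_I \<mu> \<nu> = {x. potential \<mu> x < potential \<nu> x}"

definition irreducible_pair :: "real measure \<Rightarrow> real measure \<Rightarrow> bool" where
  "irreducible_pair \<mu> \<nu> \<longleftrightarrow>
     \<mu> \<le>\<^sub>c \<nu> \<and> connected (dom_I \<mu> \<nu>) \<and> emeasure \<mu> (dom_I \<mu> \<nu>) = emeasure \<mu> UNIV"

text \<open>In the irreducible case I is an open interval, so its frontier consists of its (finite)
  endpoints.\<close>

definition dom_J :: "real measure \<Rightarrow> real measure \<Rightarrow> real set" where
  "dom_J \<mu> \<nu> = dom_I \<mu> \<nu> \<union> {x \<in> frontier (dom_I \<mu> \<nu>). emeasure \<nu> {x} > 0}"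

section \<open>The generalized integral\<close>

text \<open>The second derivative measure of a convex function g on an open interval I: the measure on
  the Borel sets of I that assigns to (a, b] the increment of the right derivative of g.\<close>

definition second_deriv_measure :: "real set \<Rightarrow> (real \<Rightarrow> real) \<Rightarrow> real measure" where
  "second_deriv_measure I g =
     extend_measure I {(a, b). a \<in> I \<and> b \<in> I \<and> a \<le> b} (\<lambda>(a, b). {a<..b})
       (\<lambda>(a, b). ennreal (vector_derivative g (at_right b) - vector_derivative g (at_right a)))"

definition boundary_jump :: "real set \<Rightarrow> (real \<Rightarrow> real) \<Rightarrow> real \<Rightarrow> real" where
  "boundary_jump I h x = h x - Lim (at x within I) h"

text \<open>The value \<open>(\<theta>1 - \<theta>2)(h)\<close> for concave h. The two minus signs of
  \<open>(u\<^sub>\<theta>\<^sub>1 - u\<^sub>\<theta>\<^sub>2) dh''\<close> are both moved, so that a nonnegative function is integrated against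
  the measure \<open>- h''\<close>. The set \<open>J - I\<close> has at most two points.\<close>

definition concave_gap ::
  "real set \<Rightarrow> real set \<Rightarrow> real measure \<Rightarrow> real measure \<Rightarrow> (real \<Rightarrow> real) \<Rightarrow> ereal" where
  "concave_gap I J \<theta>1 \<theta>2 h =
     enn2ereal (\<integral>\<^sup>+ x. ennreal (potential \<theta>2 x - potential \<theta>1 x)
                   \<partial>second_deriv_measure I (\<lambda>x. - h x)) / 2
     + ereal ((LINT x:J - I|\<theta>2. \<bar>boundary_jump I h x\<bar>)
              - (LINT x:J - I|\<theta>1. \<bar>boundary_jump I h x\<bar>))"

text \<open>Functions on J are represented by total functions whose values off J are irrelevant;
  accordingly all integrals are taken over J, on which the measures involved are concentrated.\<close>

definition concave_moderator ::
  "real set \<Rightarrow> real measure \<Rightarrow> real measure \<Rightarrow> (real \<Rightarrow> ereal) \<Rightarrow> (real \<Rightarrow> ereal)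
     \<Rightarrow> (real \<Rightarrow> real) \<Rightarrow> bool" where
  "concave_moderator J \<theta>1 \<theta>2 \<phi> \<psi> h \<longleftrightarrow>
     concave_on J h \<and>
     (\<lambda>x. \<phi> x - ereal (h x)) \<in> ext_L1 (restrict_space \<theta>1 J) \<and>
     (\<lambda>x. \<psi> x + ereal (h x)) \<in> ext_L1 (restrict_space \<theta>2 J)"

definition moderated_value ::
  "real set \<Rightarrow> real set \<Rightarrow> real measure \<Rightarrow> real measure \<Rightarrow> (real \<Rightarrow> ereal) \<Rightarrow> (real \<Rightarrow> ereal)
     \<Rightarrow> (real \<Rightarrow> real) \<Rightarrow> ereal" where
  "moderated_value I J \<theta>1 \<theta>2 \<phi> \<psi> h =
     ext_integral (restrict_space \<theta>1 J) (\<lambda>x. \<phi> x - ereal (h x))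
     + ext_integral (restrict_space \<theta>2 J) (\<lambda>x. \<psi> x + ereal (h x))
     + concave_gap I J \<theta>1 \<theta>2 h"

text \<open>The value \<open>\<theta>1(\<phi>) + \<theta>2(\<psi>)\<close>; it does not depend on the choice of the moderator.\<close>

definition pair_integral ::
  "real set \<Rightarrow> real set \<Rightarrow> real measure \<Rightarrow> real measure \<Rightarrow> (real \<Rightarrow> ereal) \<Rightarrow> (real \<Rightarrow> ereal)
     \<Rightarrow> ereal" where
  "pair_integral I J \<theta>1 \<theta>2 \<phi> \<psi> =
     moderated_value I J \<theta>1 \<theta>2 \<phi> \<psi> (SOME h. concave_moderator J \<theta>1 \<theta>2 \<phi> \<psi> h)"

definition Lc ::
  "real set \<Rightarrow> real set \<Rightarrow> real measure \<Rightarrow> real measure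
     \<Rightarrow> ((real \<Rightarrow> ereal) \<times> (real \<Rightarrow> ereal)) set" where
  "Lc I J \<theta>1 \<theta>2 =
     {(\<phi>, \<psi>). \<phi> \<in> borel_measurable (restrict_space borel J) \<and>
              \<psi> \<in> borel_measurable (restrict_space borel J) \<and>
              (\<exists>h. concave_moderator J \<theta>1 \<theta>2 \<phi> \<psi> h \<and> concave_gap I J \<theta>1 \<theta>2 h < \<infinity>)}"

section \<open>The auxiliary primal and dual problems\<close>

definition aux_primal :: "real measure \<Rightarrow> real measure \<Rightarrow> (real \<Rightarrow> ereal) \<Rightarrow> ereal" where
  "aux_primal \<mu> \<nu> f =
     (SUP \<theta>\<in>{\<theta>. finite_first_moment \<theta> \<and> \<mu> \<le>\<^sub>c \<theta> \<and> \<theta> \<le>\<^sub>c \<nu>}. outer_integral \<theta> f)"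

text \<open>If \<open>f > - \<infinity>\<close> on J, then admissible \<phi> and \<psi> are real-valued on J, so the convention for
  \<open>\<infinity> - \<infinity>\<close> in \<open>\<phi> + \<psi>\<close> is immaterial.\<close>

definition aux_dual_set ::
  "real measure \<Rightarrow> real measure \<Rightarrow> (real \<Rightarrow> ereal) \<Rightarrow> ((real \<Rightarrow> ereal) \<times> (real \<Rightarrow> ereal)) set" where
  "aux_dual_set \<mu> \<nu> f =
     {(\<phi>, \<psi>) \<in> Lc (dom_I \<mu> \<nu>) (dom_J \<mu> \<nu>) \<mu> \<nu>.
        ext_concave_on (dom_J \<mu> \<nu>) \<phi> \<and> ext_convex_on (dom_J \<mu> \<nu>) \<psi> \<and>
        (\<forall>x\<in>dom_J \<mu> \<nu>. f x \<le> \<phi> x + \<psi> x)}"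

definition aux_dual :: "real measure \<Rightarrow> real measure \<Rightarrow> (real \<Rightarrow> ereal) \<Rightarrow> ereal" where
  "aux_dual \<mu> \<nu> f =
     (INF (\<phi>, \<psi>)\<in>aux_dual_set \<mu> \<nu> f. pair_integral (dom_I \<mu> \<nu>) (dom_J \<mu> \<nu>) \<mu> \<nu> \<phi> \<psi>)"

end

theory Submission
  imports Defs "HOL-Complex_Analysis.Great_Picard"
begin

text \<open>A dual pair is written as \<open>(- A, C)\<close> with A and C convex and \<open>A \<le> C\<close> on J; its generalized
  integral is \<open>\<nu>(C - A) + (\<mu> - \<nu>)(- A)\<close>, which also equals \<open>\<mu>(C - A) + (\<mu> - \<nu>)(- C)\<close>. Writing convex
  functions as mixtures of hinge functions reduces such identities to statements about potentials;
  integrability is dealt with by truncating either the second derivative of A or the measures.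

  Modulo affine functions, a bound on the value of a pair bounds A and C pointwise on J, because
  \<open>u\<^sub>\<mu> < u\<^sub>\<nu>\<close> on I. A minimizing sequence thus has a pointwise convergent subsequence, and Fatou's
  lemma makes its limit a minimizer. The same argument shows that the dual value is continuous along
  increasing sequences of functions.

  For upper semianalytic f, Choquet's capacitability argument then reduces the inequality between
  dual and primal value to a compact subset of the hypograph of f, and this to a decreasing sequence of
  Lipschitz functions. For those, the Hahn-Banach theorem gives a positive functional between
  \<mu> and \<nu> in convex order; the measure with its potential is the required one.\<close>

text \<open>The integrals of A and C against \<mu> and \<nu> may be infinite one by one; only their
  combination in the generalized integral makes sense. Identities are therefore stated additively in
  \<open>ennreal\<close>, and a subtraction occurs only where a truncation has made every term
  finite. The truncated measures have the potential max(u_\<mu>, u_\<nu> - \<epsilon> h) on I, where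
  h is concave and affine off a single point: such a measure agrees with \<nu> on a large part of I
  and with \<mu> off a compact interval in J. In the compactness argument the tangent of C is
  controlled apart from C minus its tangent: from below by A <= C, from above because \<mu> charges
  some interval inside I. No continuity of the dual value along decreasing sequences is at hand. The
  Lipschitz functions lie strictly above the compact set, so each of them dominates a whole stage of
  the capacitability construction. All of them enter the Hahn-Banach cone together, which makes one
  functional serve them all. This functional need not be an integral, but its values at |t - x| form
  a potential and determine it on Lipschitz functions that are constant far out.\<close>

lemma convex_real_mem:
  fixes S :: "real set"
  assumes "convex S" "a \<in> S" "b \<in> S" "a \<le> x" "x \<le> b"
  shows "x \<in> S"
  using assms by (meson is_interval_convex_1 mem_is_interval_1_I)

section \<open>Right derivatives of convex functions\<close>

definition rderiv :: "(real \<Rightarrow> real) \<Rightarrow> real \<Rightarrow> real" where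
  "rderiv A x = vector_derivative A (at_right x)"

text \<open>The slopes from x fall as y decreases to x, so their limit is their infimum
  \<open>?S\<close>, and \<open>convex_le_Inf_differential\<close> gives the supporting line for
  exactly this infimum.\<close>

lemma convex_on_right_derivative:
  fixes A :: "real \<Rightarrow> real"
  assumes A: "convex_on I A" and I: "open I" and x: "x \<in> I"
  shows "((\<lambda>y. (A y - A x) / (y - x)) \<longlongrightarrow> rderiv A x) (at_right x)"
    and "y \<in> I \<Longrightarrow> A x + rderiv A x * (y - x) \<le> A y"
proof -
  let ?S = "Inf ((\<lambda>t. (A x - A t) / (x - t)) ` ({x<..} \<inter> I))"
  have sub: "A x + ?S * (y - x) \<le> A y" if "y \<in> I" for y
    using convex_le_Inf_differential[OF A _ that, of x] x I by (simp add: interior_open)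
  have ge: "?S \<le> (A y - A x) / (y - x)" if "y \<in> I" "x < y" for y
    using sub[OF that(1)] that by (simp add: field_simps)
  have lim: "((\<lambda>y. (A y - A x) / (y - x)) \<longlongrightarrow> ?S) (at_right x)"
  proof (rule tendstoI)
    fix e :: real assume e: "0 < e"
    have ne: "{x<..} \<inter> I \<noteq> {}"
    proof -
      obtain b where "b > x" "{x..<b} \<subseteq> I" using open_right[OF I x, of "x+1"] by auto
      then have "(x + b) / 2 \<in> {x<..} \<inter> I" by auto
      then show ?thesis by blast
    qed
    have "\<exists>s\<in>(\<lambda>t. (A x - A t) / (x - t)) ` ({x<..} \<inter> I). s < ?S + e"
      by (rule cInf_lessD) (use ne e in auto)
    then obtain z where z: "x < z" "z \<in> I" "(A x - A z) / (x - z) < ?S + e" by auto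
    have "\<forall>\<^sub>F y in at_right x. y \<in> {x<..<z}"
      using z(1) by (rule eventually_at_right_real)
    then show "\<forall>\<^sub>F y in at_right x. dist ((A y - A x) / (y - x)) ?S < e"
    proof eventually_elim
      case (elim y)
      have "y \<in> I" using convex_real_mem[OF convex_on_imp_convex[OF A] x z(2)] elim by auto
      moreover have "(A x - A y) / (x - y) \<le> (A x - A z) / (x - z)"
        using convex_on_slope_le(1)[OF A x z(2)] elim by auto
      moreover have "(A x - A y) / (x - y) = (A y - A x) / (y - x)"
        by (metis minus_diff_eq minus_divide_divide)
      ultimately show ?case using ge[of y] elim z by (auto simp: dist_real_def)
    qed
  qed
  have "(A has_vector_derivative ?S) (at_right x)"
    using lim by (simp add: has_real_derivative_iff_has_vector_derivative[symmetric] has_field_derivative_iff)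
  then have eq: "rderiv A x = ?S"
    unfolding rderiv_def by (intro vector_derivative_within) (simp_all add: trivial_limit_at_right_real)
  show "((\<lambda>y. (A y - A x) / (y - x)) \<longlongrightarrow> rderiv A x) (at_right x)"
    using lim eq by simp
  show "y \<in> I \<Longrightarrow> A x + rderiv A x * (y - x) \<le> A y"
    using sub eq by simp
qed

lemma rderiv_eqI:
  assumes "((\<lambda>y. (A y - A x) / (y - x)) \<longlongrightarrow> s) (at_right x)"
  shows "rderiv A x = s"
proof -
  have "(A has_vector_derivative s) (at_right x)"
    using assms by (simp add: has_real_derivative_iff_has_vector_derivative[symmetric] has_field_derivative_iff)
  then show ?thesis
    unfolding rderiv_def by (intro vector_derivative_within) (simp_all add: trivial_limit_at_right_real)
qed

lemma rderiv_cong: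
  assumes "open U" "x \<in> U" "\<And>y. y \<in> U \<Longrightarrow> A y = B y"
  shows "rderiv A x = rderiv B x"
proof -
  have ev: "\<forall>\<^sub>F y in nhds x. y \<in> U \<longrightarrow> A y = B y"
    using assms by (auto simp: always_eventually)
  have "\<forall>\<^sub>F y in nhds x. A y = B y"
    using assms eventually_nhds by blast
  then have "(A has_vector_derivative D) (at_right x) = (B has_vector_derivative D) (at_right x)" for D
    using assms by (intro has_vector_derivative_cong_ev) (auto elim: eventually_mono)
  then show ?thesis by (simp add: rderiv_def vector_derivative_def)
qed

lemma rderiv_diff_le:
  assumes A: "convex_on I A" and I: "open I" and xy: "x \<in> I" "y \<in> I"
  shows "rderiv A x * (y - x) \<le> A y - A x" "A y - A x \<le> rderiv A y * (y - x)"
  using convex_on_right_derivative(2)[OF A I xy] convex_on_right_derivative(2)[OF A I xy(2,1)]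
  by (simp_all add: algebra_simps)

lemma rderiv_mono:
  assumes A: "convex_on I A" and I: "open I" and xy: "x \<in> I" "y \<in> I" "x \<le> y"
  shows "rderiv A x \<le> rderiv A y"
proof (cases "x = y")
  case False
  with xy rderiv_diff_le[OF A I xy(1,2)] have "rderiv A x * (y - x) \<le> rderiv A y * (y - x)" "0 < y - x"
    by linarith+
  then show ?thesis using mult_le_cancel_right_pos by blast
qed simp

text \<open>Right-continuity in the form that the Stieltjes construction asks for. A point z whose
  slope from x is below \<open>rderiv A x + e\<close> is kept fixed; by continuity of A the slope
  from a nearby y > x to z is still below, and it bounds \<open>rderiv A y\<close>.\<close>

lemma rderiv_right_cont:
  assumes A: "convex_on I A" and I: "open I" and x: "x \<in> I" and e: "0 < (e::real)"
  shows "\<exists>y\<in>I. x < y \<and> rderiv A y < rderiv A x + e"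
proof -
  have conv: "convex I" using A convex_on_imp_convex by blast
  have ev1: "\<forall>\<^sub>F y in at_right x. (A y - A x) / (y - x) < rderiv A x + e"
    using convex_on_right_derivative(1)[OF A I x] e by (auto intro: order_tendstoD)
  have ev2: "\<forall>\<^sub>F y in at_right x. y \<in> I"
    using I x by (auto intro: eventually_at_in_open' filter_leD[OF at_le, rotated] simp: eventually_at_topological)
  have ev3: "\<forall>\<^sub>F y in at_right x. x < y" by (simp add: eventually_at_right_less)
  obtain z where z: "(A z - A x) / (z - x) < rderiv A x + e" "z \<in> I" "x < z"
    using eventually_happens[OF eventually_conj[OF ev1 eventually_conj[OF ev2 ev3]]]
    by (auto simp: trivial_limit_at_right_real)
  have "continuous_on I A" using A I by (rule convex_on_continuous[rotated])
  then have "isCont A x" using I x continuous_on_eq_continuous_at by blast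
  then have "(A \<longlongrightarrow> A x) (at_right x)"
    using continuous_at_imp_continuous_at_within continuous_within by blast
  then have "((\<lambda>y. (A z - A y) / (z - y)) \<longlongrightarrow> (A z - A x) / (z - x)) (at_right x)"
    using z by (intro tendsto_intros) auto
  then have ev4: "\<forall>\<^sub>F y in at_right x. (A z - A y) / (z - y) < rderiv A x + e"
    using z by (auto intro: order_tendstoD)
  have ev5: "\<forall>\<^sub>F y in at_right x. y \<in> {x<..<z}" using z by (intro eventually_at_right_real)
  obtain y where y: "(A z - A y) / (z - y) < rderiv A x + e" "y \<in> I" "y \<in> {x<..<z}"
    using eventually_happens[OF eventually_conj[OF ev4 eventually_conj[OF ev2 ev5]]]
    by (auto simp: trivial_limit_at_right_real)
  have "rderiv A y \<le> (A z - A y) / (z - y)"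
    using rderiv_diff_le(1)[OF A I y(2) z(2)] y by (simp add: field_simps)
  then show ?thesis using y by (intro bexI[of _ y]) auto
qed

section \<open>The second derivative measure\<close>

lemma sets_Ioc_in_open:
  fixes I :: "real set"
  assumes I: "open I" "convex I"
  shows "sigma_sets I ((\<lambda>(a, b). {a<..b}) ` {(a, b). a \<in> I \<and> b \<in> I \<and> a \<le> b}) = sets (restrict_space borel I)"
    (is "sigma_sets I ?G = _")
proof (rule antisym)
  have sub: "{a<..b} \<subseteq> I" if "a \<in> I" "b \<in> I" for a b
    using convex_real_mem[OF I(2) that] by auto
  have Ib: "I \<in> sets borel" using I by simp
  show "sigma_sets I ?G \<subseteq> sets (restrict_space borel I)"
  proof -
    have "?G \<subseteq> sets (restrict_space borel I)"
    proof
      fix X assume "X \<in> ?G"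
      then obtain a b where "a \<in> I" "b \<in> I" "X = {a<..b}" by auto
      then show "X \<in> sets (restrict_space borel I)"
        using sub Ib by (auto simp: sets_restrict_space_iff)
    qed
    from sets.sigma_sets_subset[OF this] show ?thesis by (simp add: space_restrict_space)
  qed
  have op: "U \<in> sigma_sets I ?G" if U: "open U" "U \<subseteq> I" for U
  proof -
    \<comment> \<open>The closed interval is required to lie in U, so that both endpoints lie in I,
      as the generator \<open>?G\<close> demands.\<close>
    let ?Q = "{(a::rat, b::rat). {real_of_rat a..real_of_rat b} \<subseteq> U \<and> real_of_rat a \<le> real_of_rat b}"
    have "U = (\<Union>(a,b)\<in>?Q. {real_of_rat a<..real_of_rat b})"
    proof (intro antisym subsetI)
      fix x assume x: "x \<in> U"
      then obtain e where e: "e > 0" "\<And>y. \<bar>y - x\<bar> < e \<Longrightarrow> y \<in> U" using U by (auto simp: open_real)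
      obtain a where a: "x - e < of_rat a" "of_rat a < x" using of_rat_dense[of "x-e" x] e by auto
      obtain b where b: "x < of_rat b" "of_rat b < x + e" using of_rat_dense[of x "x+e"] e by auto
      have "{real_of_rat a..real_of_rat b} \<subseteq> U" using a b by (auto intro!: e(2))
      then show "x \<in> (\<Union>(a,b)\<in>?Q. {real_of_rat a<..real_of_rat b})" using a b by force
    qed auto
    moreover have "(\<Union>(a,b)\<in>?Q. {real_of_rat a<..real_of_rat b}) \<in> sigma_sets I ?G"
    proof (rule sigma_sets_UNION)
      show "countable ((\<lambda>(a, b). {real_of_rat a<..real_of_rat b}) ` ?Q)" by simp
      fix X assume "X \<in> (\<lambda>(a, b). {real_of_rat a<..real_of_rat b}) ` ?Q"
      then obtain a b where ab: "{real_of_rat a..real_of_rat b} \<subseteq> U" "real_of_rat a \<le> real_of_rat b"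
         "X = {real_of_rat a<..real_of_rat b}" by auto
      then have "real_of_rat a \<in> I" "real_of_rat b \<in> I" using U by auto
      with ab show "X \<in> sigma_sets I ?G" by (intro sigma_sets.Basic) force
    qed
    ultimately show ?thesis by simp
  qed
  have "sets (restrict_space borel I) = sigma_sets I ((\<inter>) I ` {S. open S})"
    unfolding sets_restrict_space borel_def
    using sigma_sets_Int[of I UNIV "{S. open S}"] I by (simp add: sigma_sets.Basic)
  also have "\<dots> \<subseteq> sigma_sets I ?G"
    by (rule sigma_sets_mono) (use I op in auto)
  finally show "sets (restrict_space borel I) \<subseteq> sigma_sets I ?G" .
qed

text \<open>The Stieltjes measure of F is realised as the image of Lebesgue measure on the range of F
  under the generalised inverse of F; this works uniformly for bounded and unbounded I.\<close>

lemma stieltjes_measure_on_open: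
  fixes I :: "real set" and F :: "real \<Rightarrow> real"
  assumes I: "open I" "convex I"
    and mono: "\<And>x y. x \<in> I \<Longrightarrow> y \<in> I \<Longrightarrow> x \<le> y \<Longrightarrow> F x \<le> F y"
    and rc: "\<And>x e. x \<in> I \<Longrightarrow> 0 < e \<Longrightarrow> \<exists>y\<in>I. x < y \<and> F y < F x + e"
  obtains M where "sets M = sets (restrict_space borel I)"
    "\<And>a b. a \<in> I \<Longrightarrow> b \<in> I \<Longrightarrow> a \<le> b \<Longrightarrow> emeasure M {a<..b} = ennreal (F b - F a)"
proof -
  have ivl: "is_interval I" using I is_interval_convex_1 by blast
  \<comment> \<open>P is the union of the intervals \<open>{F a<..F b}\<close>: jumps of F are
    filled in, and the generalised inverse q has its values inside I on it.\<close>
  define P where "P = {p. \<exists>a\<in>I. \<exists>b\<in>I. F a < p \<and> p \<le> F b}"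
  define q where "q p = Inf {x\<in>I. p \<le> F x}" for p
  have q: "q p \<in> I" "\<And>x. x \<in> I \<Longrightarrow> q p \<le> x \<longleftrightarrow> p \<le> F x" if pP: "p \<in> P" for p
  proof -
    obtain a b where ab: "a \<in> I" "b \<in> I" "F a < p" "p \<le> F b" using pP by (auto simp: P_def)
    have lb: "a \<le> x" if "x \<in> {x\<in>I. p \<le> F x}" for x
      using that ab mono[of x a] by force
    have bdd: "bdd_below {x\<in>I. p \<le> F x}" using lb by (rule bdd_belowI)
    have "a \<le> q p" unfolding q_def by (rule cInf_greatest) (use ab lb in auto)
    moreover have "q p \<le> b" unfolding q_def by (rule cInf_lower) (use ab bdd in auto)
    ultimately show qI: "q p \<in> I" using convex_real_mem[OF I(2) ab(1,2)] by auto
    \<comment> \<open>By right-continuity of F the infimum is attained; this is what makes q p <= x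
      equivalent to p <= F x.\<close>
    have ge: "p \<le> F (q p)"
    proof (rule ccontr)
      assume "\<not> p \<le> F (q p)"
      then obtain y where y: "y \<in> I" "q p < y" "F y < p" using rc[OF qI, of "p - F (q p)"] by auto
      have "y \<le> Inf {x\<in>I. p \<le> F x}"
      proof (rule cInf_greatest)
        fix x assume x: "x \<in> {x\<in>I. p \<le> F x}"
        show "y \<le> x"
        proof (rule ccontr)
          assume "\<not> y \<le> x"
          then show False using mono[of x y] x y by auto
        qed
      qed (use ab in auto)
      then show False using y by (simp add: q_def)
    qed
    fix x assume x: "x \<in> I"
    show "q p \<le> x \<longleftrightarrow> p \<le> F x"
    proof
      assume "q p \<le> x" then show "p \<le> F x" using mono[OF qI x] ge by simp
    next
      assume "p \<le> F x" then show "q p \<le> x" unfolding q_def using x bdd by (intro cInf_lower) auto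
    qed
  qed
  have "is_interval P" unfolding is_interval_1 P_def by (blast intro: less_le_trans order_trans)
  then have Pb[measurable]: "P \<in> sets borel"
    by (intro real_interval_borel_measurable)
  have qm: "q \<in> measurable (restrict_space lborel P) (restrict_space borel I)"
  proof (rule measurable_restrict_space2)
    show "q \<in> space (restrict_space lborel P) \<rightarrow> I" using q by (auto simp: space_restrict_space)
    show "q \<in> borel_measurable (restrict_space lborel P)"
    proof (rule borel_measurableI_le)
      fix y
      have "{x \<in> P. q x \<le> y} \<in> sets borel"
      proof (cases "y \<in> I")
        case True
        then have "{x \<in> P. q x \<le> y} = P \<inter> {..F y}" using q by auto
        then show ?thesis by simp
      next
        case False
        then have "{x \<in> P. q x \<le> y} = {} \<or> {x \<in> P. q x \<le> y} = P"
          using q(1) convex_real_mem[OF I(2)] by (auto simp: set_eq_iff) (metis linorder_le_cases)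
        then show ?thesis by (metis Pb sets.empty_sets)
      qed
      then show "{x \<in> space (restrict_space lborel P). q x \<le> y} \<in> sets (restrict_space lborel P)"
        by (auto simp: space_restrict_space sets_restrict_space_iff)
    qed
  qed
  define M where "M = distr (restrict_space lborel P) (restrict_space borel I) q"
  have "emeasure M {a<..b} = ennreal (F b - F a)" if ab: "a \<in> I" "b \<in> I" "a \<le> b" for a b
  proof -
    have sub: "{a<..b} \<subseteq> I"
      using convex_real_mem[OF I(2) ab(1,2)] by auto
    then have "{a<..b} \<in> sets (restrict_space borel I)"
      using I by (auto simp: sets_restrict_space_iff)
    then have "emeasure M {a<..b} = emeasure (restrict_space lborel P) (q -` {a<..b} \<inter> P)"
      unfolding M_def using qm by (subst emeasure_distr) (auto simp: space_restrict_space)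
    also have "q -` {a<..b} \<inter> P = {F a<..F b}"
    proof (intro set_eqI iffI)
      fix p assume "p \<in> q -` {a<..b} \<inter> P"
      then show "p \<in> {F a<..F b}" using q(2)[of p a] q(2)[of p b] ab by auto
    next
      fix p assume p: "p \<in> {F a<..F b}"
      then have "p \<in> P" using ab by (auto simp: P_def)
      then show "p \<in> q -` {a<..b} \<inter> P" using q(2)[of p a] q(2)[of p b] ab p by auto
    qed
    also have "emeasure (restrict_space lborel P) {F a<..F b} = emeasure lborel {F a<..F b}"
    proof (rule emeasure_restrict_space)
      show "{F a<..F b} \<subseteq> P" using ab by (auto simp: P_def)
    qed (use Pb in simp)
    also have "\<dots> = ennreal (F b - F a)" using mono ab by simp
    finally show ?thesis .
  qed
  then show thesis by (intro that[of M]) (simp_all add: M_def)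
qed

text \<open>\<open>extend_measure\<close> takes the prescribed values only if some measure takes
  them; \<open>stieltjes_measure_on_open\<close>, applied to the right derivative, supplies
  one.\<close>

lemma second_deriv_measure:
  assumes A: "convex_on I A" and I: "open I"
  shows sets_second_deriv_measure: "sets (second_deriv_measure I A) = sets (restrict_space borel I)"
    and space_second_deriv_measure: "space (second_deriv_measure I A) = I"
    and emeasure_second_deriv_measure: "a \<in> I \<Longrightarrow> b \<in> I \<Longrightarrow> a \<le> b \<Longrightarrow>
      emeasure (second_deriv_measure I A) {a<..b} = ennreal (rderiv A b - rderiv A a)"
proof -
  have conv: "convex I" using A convex_on_imp_convex by blast
  have sub: "(\<lambda>(a, b). {a<..b}) ` {(a, b). a \<in> I \<and> b \<in> I \<and> a \<le> b} \<subseteq> Pow I"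
  proof clarify
    fix a b x assume "a \<in> I" "b \<in> I" "x \<in> {a<..b}"
    then show "x \<in> I" using convex_real_mem[OF conv, of a b x] by simp
  qed
  show s: "sets (second_deriv_measure I A) = sets (restrict_space borel I)"
    unfolding second_deriv_measure_def sets_extend_measure[OF sub] using sets_Ioc_in_open[OF I conv] by simp
  then show "space (second_deriv_measure I A) = I"
    by (metis sets_eq_imp_space_eq space_borel space_restrict_space Int_UNIV_right)
  obtain M where M: "sets M = sets (restrict_space borel I)"
    "\<And>a b. a \<in> I \<Longrightarrow> b \<in> I \<Longrightarrow> a \<le> b \<Longrightarrow> emeasure M {a<..b} = ennreal (rderiv A b - rderiv A a)"
    using stieltjes_measure_on_open[OF I conv rderiv_mono[OF A I] rderiv_right_cont[OF A I]] by blast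
  assume ab: "a \<in> I" "b \<in> I" "a \<le> b"
  show "emeasure (second_deriv_measure I A) {a<..b} = ennreal (rderiv A b - rderiv A a)"
  proof -
    have "emeasure (second_deriv_measure I A) ((\<lambda>(a, b). {a<..b}) (a, b)) =
        (\<lambda>(a, b). ennreal (vector_derivative A (at_right b) - vector_derivative A (at_right a))) (a, b)"
    proof (rule emeasure_extend_measure[OF second_deriv_measure_def _ sub])
      show "positive (sets (second_deriv_measure I A)) (emeasure M)"
        "countably_additive (sets (second_deriv_measure I A)) (emeasure M)"
        using emeasure_positive[of M] emeasure_countably_additive[of M] M(1) s by simp_all
    qed (use M(2) ab in \<open>auto simp: rderiv_def\<close>)
    then show ?thesis by (simp add: rderiv_def)
  qed
qed

section \<open>Representation of convex functions by hinge functions\<close>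

text \<open>The increments of g are of second order: over n equal steps the bounds telescope to (F b
  - F a) * (b - a) / n, which tends to 0.\<close>

lemma darboux_const:
  fixes g F :: "real \<Rightarrow> real"
  assumes "\<And>x y. a \<le> x \<Longrightarrow> x \<le> y \<Longrightarrow> y \<le> b \<Longrightarrow> \<bar>g y - g x\<bar> \<le> (F y - F x) * (y - x)" and ab: "a \<le> b"
  shows "g b = g a"
proof (rule ccontr)
  assume ne: "g b \<noteq> g a"
  have *: "\<bar>g b - g a\<bar> \<le> (F b - F a) * (b - a) / real n" if n: "n > 0" for n :: nat
  proof -
    define h where "h = (b - a) / real n"
    define x where "x i = a + real i * h" for i
    have step: "x (Suc i) - x i = (b - a) / n" for i by (simp add: x_def distrib_right flip: h_def)
    have x0: "x 0 = a" "x n = b" using n by (simp_all add: x_def h_def)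
    have x01: "a \<le> x i" for i using ab by (simp add: x_def h_def)
    have xb: "x (Suc i) \<le> b" if "i < n" for i
    proof -
      have "real (Suc i) * ((b - a) / real n) \<le> real n * ((b - a) / real n)"
        using that ab by (intro mult_right_mono) auto
      then show ?thesis using n by (simp add: x_def h_def)
    qed
    have "\<bar>g b - g a\<bar> = \<bar>\<Sum>i<n. g (x (Suc i)) - g (x i)\<bar>"
      using sum_lessThan_telescope[of "\<lambda>i. g (x i)" n] x0 by simp
    also have "\<dots> \<le> (\<Sum>i<n. \<bar>g (x (Suc i)) - g (x i)\<bar>)" by (rule sum_abs)
    also have "\<dots> \<le> (\<Sum>i<n. (F (x (Suc i)) - F (x i)) * ((b - a) / n))"
    proof (rule sum_mono)
      fix i assume i: "i \<in> {..<n}"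
      have "x i \<le> x (Suc i)" using step[of i] ab by (smt (verit) divide_nonneg_nonneg of_nat_0_le_iff)
      then show "\<bar>g (x (Suc i)) - g (x i)\<bar> \<le> (F (x (Suc i)) - F (x i)) * ((b - a) / n)"
        using assms(1)[of "x i" "x (Suc i)"] x01 xb i step by simp
    qed
    also have "\<dots> = (F b - F a) * (b - a) / real n"
      using sum_lessThan_telescope[of "\<lambda>i. F (x i)" n] x0
      by (subst sum_distrib_right[symmetric]) simp
    finally show ?thesis .
  qed
  obtain n :: nat where n: "(F b - F a) * (b - a) / \<bar>g b - g a\<bar> < real n" "n > 0"
    using reals_Archimedean2[of "max 0 ((F b - F a) * (b - a) / \<bar>g b - g a\<bar>)"] by auto
  then have "(F b - F a) * (b - a) / real n < \<bar>g b - g a\<bar>" using ne by (simp add: field_simps)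
  with *[OF n(2)] show False by simp
qed

text \<open>For t in I, a hinge with kink t that opens away from the base point c and vanishes at c.
  The kink t = c belongs to the left branch, in accordance with the half-open intervals
  \<open>{a<..b}\<close> of the second derivative measure. For t outside I, the indicator of t,
  which carries a jump at an end of I.\<close>

definition krn :: "real set \<Rightarrow> real \<Rightarrow> real \<Rightarrow> real \<Rightarrow> real" where
  "krn I c t x = (if t \<in> I then if c < t then max 0 (x - t) else max 0 (t - x)
                  else if x = t then 1 else 0)"

text \<open>Lam I J A integrates against the second derivative of A on I plus the jumps of A on J - I;
  it is written as a functional, since the two parts live on different spaces.\<close>

definition Lam :: "real set \<Rightarrow> real set \<Rightarrow> (real \<Rightarrow> real) \<Rightarrow> (real \<Rightarrow> ennreal) \<Rightarrow> ennreal" where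
  "Lam I J A g = (\<integral>\<^sup>+t. g t \<partial>second_deriv_measure I A)
     + (\<Sum>e\<in>J - I. ennreal \<bar>boundary_jump I A e\<bar> * g e)"

lemma krn_nonneg [simp]: "0 \<le> krn I c t x" by (simp add: krn_def)

lemma extend_measure_cong:
  assumes "\<And>i. i \<in> K \<Longrightarrow> m i = m' i"
  shows "extend_measure \<Omega> K G m = extend_measure \<Omega> K G m'"
proof -
  have 1: "(\<forall>i\<in>K. M (G i) = m i) \<longleftrightarrow> (\<forall>i\<in>K. M (G i) = m' i)" for M using assms by auto
  have 2: "(\<forall>i\<in>K. m i = 0) \<longleftrightarrow> (\<forall>i\<in>K. m' i = 0)" using assms by auto
  show ?thesis by (simp only: extend_measure_def 1 2)
qed

text \<open>Kept free of \<mu> and \<nu> because three instances occur: (I, J) itself, (I, closure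
  I) while it is not yet known which ends an intermediate measure charges, and the whole
  line.\<close>

locale interval_pair =
  fixes I J :: "real set"
  assumes open_I: "open I" and conv_I: "convex I" and conv_J: "convex J"
    and I_J: "I \<subseteq> J" and J_front: "J - I \<subseteq> frontier I" and I_ne: "I \<noteq> {}"
begin

lemma I_borel [measurable]: "I \<in> sets borel" using open_I by simp

lemma between_in_I:
  assumes c: "c \<in> I" and e: "e \<in> J" and X: "c < X \<and> X < e \<or> e < X \<and> X < c"
  shows "X \<in> I"
proof (cases "e \<in> I")
  case True
  with c X show ?thesis using convex_real_mem[OF conv_I c True, of X] convex_real_mem[OF conv_I True c, of X] by auto
next
  case False
  then have "e \<in> closure I" using e J_front by (auto simp: frontier_def)
  then have "\<exists>p\<in>I. dist p e < \<bar>e - X\<bar>" using X by (auto simp: closure_approachable)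
  then obtain p where p: "p \<in> I" "\<bar>p - e\<bar> < \<bar>e - X\<bar>" by (auto simp: dist_real_def)
  show ?thesis
    using convex_real_mem[OF conv_I c p(1), of X] convex_real_mem[OF conv_I p(1) c, of X] p(2) X by auto
qed

lemma end_side:
  assumes e: "e \<in> J - I"
  shows "(\<forall>t\<in>I. t < e) \<or> (\<forall>t\<in>I. e < t)"
proof (rule ccontr)
  assume "\<not> ?thesis"
  then obtain s t where st: "s \<in> I" "t \<in> I" "s \<le> e" "e \<le> t" by (meson not_le)
  then have "e \<in> I" using convex_real_mem[OF conv_I st(1,2)] by simp
  with e show False by simp
qed

lemma finite_ends: "finite (J - I)"
proof -
  have "e \<in> {Inf I, Sup I}" if e: "e \<in> J - I" for e
  proof -
    have cl: "e \<in> closure I" using e J_front by (auto simp: frontier_def)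
    have app: "\<exists>p\<in>I. \<bar>p - e\<bar> < d" if "d > 0" for d
      using cl that by (auto simp: closure_approachable dist_real_def)
    from end_side[OF e] show ?thesis
    proof
      assume *: "\<forall>t\<in>I. t < e"
      have "Sup I = e"
      proof (rule cSup_eq_non_empty)
        fix y assume y: "\<And>x. x \<in> I \<Longrightarrow> x \<le> y"
        show "e \<le> y"
        proof (rule ccontr)
          assume "\<not> e \<le> y"
          then obtain p where "p \<in> I" "\<bar>p - e\<bar> < e - y" using app[of "e - y"] by auto
          with y[of p] show False by auto
        qed
      qed (use * I_ne in \<open>auto intro: less_imp_le\<close>)
      then show ?thesis by simp
    next
      assume *: "\<forall>t\<in>I. e < t"
      have "Inf I = e"
      proof (rule cInf_eq_non_empty)
        fix y assume y: "\<And>x. x \<in> I \<Longrightarrow> y \<le> x"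
        show "y \<le> e"
        proof (rule ccontr)
          assume "\<not> y \<le> e"
          then obtain p where "p \<in> I" "\<bar>p - e\<bar> < y - e" using app[of "y - e"] by auto
          with y[of p] show False by auto
        qed
      qed (use * I_ne in \<open>auto intro: less_imp_le\<close>)
      then show ?thesis by simp
    qed
  qed
  then have "J - I \<subseteq> {Inf I, Sup I}" by blast
  then show ?thesis by (rule finite_subset) simp
qed

lemma J_borel [measurable]: "J \<in> sets borel"
proof -
  have "J = I \<union> (J - I)" using I_J by blast
  also have "\<dots> \<in> sets borel" using finite_ends by (intro sets.Un) (auto intro: finite_imp_closed borel_closed)
  finally show ?thesis .
qed

lemma convex_on_I: "convex_on J A \<Longrightarrow> convex_on I A"
  using convex_on_subset I_J conv_I by blast

lemma measurable_krn [measurable]: "(\<lambda>(t, x). krn I c t x) \<in> borel_measurable (borel \<Otimes>\<^sub>M borel)"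
  unfolding krn_def by measurable

lemma measurable_krn1 [measurable]: "(\<lambda>t. krn I c t x) \<in> borel_measurable borel"
  and measurable_krn2 [measurable]: "(\<lambda>x. krn I c t x) \<in> borel_measurable borel"
  unfolding krn_def by measurable

lemma measurable_sdm:
  assumes A: "convex_on J A" and g: "g \<in> measurable borel N"
  shows "g \<in> measurable (second_deriv_measure I A) N"
  using measurable_restrict_space1[OF g, of I]
  by (subst measurable_cong_sets[OF sets_second_deriv_measure[OF convex_on_I[OF A] open_I] refl])

lemma emeasure_sdm_Ioc:
  assumes A: "convex_on J A" and ab: "a \<in> I" "b \<in> I"
  shows "emeasure (second_deriv_measure I A) {a<..b} = ennreal (rderiv A b - rderiv A a)"
proof (cases "a \<le> b")
  case False
  then show ?thesis using rderiv_mono[OF convex_on_I[OF A] open_I ab(2,1)]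
    by (simp add: ennreal_neg)
qed (use emeasure_second_deriv_measure[OF convex_on_I[OF A] open_I ab] in simp)

lemma sets_sdm_Ioc:
  assumes A: "convex_on J A" and ab: "a \<in> I" "b \<in> I"
  shows "{a<..b} \<in> sets (second_deriv_measure I A)"
proof -
  have "{a<..b} \<subseteq> I" using convex_real_mem[OF conv_I ab] by auto
  then show ?thesis
    using open_I by (simp add: sets_second_deriv_measure[OF convex_on_I[OF A] open_I] sets_restrict_space_iff)
qed

text \<open>The integral \<open>q\<close> and A minus the linear part of its tangent at c obey the
  same two-sided bound on increments: slope at the left point times y - x from below, slope at the
  right point times y - x from above. Their difference thus has second-order increments and is
  constant by \<open>darboux_const\<close>; at x = c the integral vanishes.\<close>

lemma hinge_integral_I:
  assumes A: "convex_on J A" and c: "c \<in> I" and x: "x \<in> I"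
  shows "(\<integral>\<^sup>+t. ennreal (krn I c t x) \<partial>second_deriv_measure I A) = ennreal (A x - A c - rderiv A c * (x - c))"
proof -
  let ?M = "second_deriv_measure I A" and ?F = "rderiv A"
  note meas = measurable_sdm[OF A]
  have sp: "space ?M = I" using space_second_deriv_measure[OF convex_on_I[OF A] open_I] .
  define Q where "Q x = (\<integral>\<^sup>+t. ennreal (krn I c t x) \<partial>?M)" for x
  have fin: "Q x < \<infinity>" if x: "x \<in> I" for x
  proof -
    have "Q x \<le> (\<integral>\<^sup>+t. ennreal \<bar>x - c\<bar> * (indicator {c<..x} t + indicator {x<..c} t) \<partial>?M)"
      unfolding Q_def by (intro nn_integral_mono) (auto simp: krn_def indicator_def sp intro!: ennreal_leI)
    also have "\<dots> = ennreal \<bar>x - c\<bar> * (emeasure ?M {c<..x} + emeasure ?M {x<..c})"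
      using sets_sdm_Ioc[OF A] c x by (subst nn_integral_cmult) (auto simp: nn_integral_add)
    also have "\<dots> < \<infinity>" using c x by (simp add: emeasure_sdm_Ioc[OF A] ennreal_mult_less_top)
    finally show ?thesis .
  qed
  define q where "q x = enn2real (Q x)" for x
  have Qq: "Q x = ennreal (q x)" if "x \<in> I" for x using fin[OF that] by (simp add: q_def less_top)
  have q0: "0 \<le> q x" for x by (simp add: q_def)
  have bounds: "(?F x - ?F c) * (y - x) \<le> q y - q x \<and> q y - q x \<le> (?F y - ?F c) * (y - x)"
    if xy: "x \<in> I" "y \<in> I" "x \<le> y" for x y
  proof -
    \<comment> \<open>Increments of the slope may be negative, so their negative part is moved to
      the other side as an indicator term; both sides are then nonnegative integrals that can be
      compared pointwise.\<close>
    have i: "(\<integral>\<^sup>+t. ennreal (krn I c t z) + ennreal (y - x) * indicator {a<..b} t \<partial>?M)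
        = ennreal (q z + (y - x) * max 0 (?F b - ?F a))" if "z \<in> I" "a \<in> I" "b \<in> I" for z a b
    proof -
      have "(\<integral>\<^sup>+t. ennreal (krn I c t z) + ennreal (y - x) * indicator {a<..b} t \<partial>?M)
        = Q z + ennreal (y - x) * emeasure ?M {a<..b}"
        unfolding Q_def using that sets_sdm_Ioc[OF A]
        by (subst nn_integral_add) (auto intro!: meas nn_integral_cmult_indicator borel_measurable_times_ennreal)
      also have "\<dots> = ennreal (q z) + ennreal (y - x) * ennreal (max 0 (?F b - ?F a))"
        using that by (simp add: Qq emeasure_sdm_Ioc[OF A] max_def ennreal_neg)
      finally show ?thesis using xy q0 by (simp add: ennreal_mult[symmetric] ennreal_plus[symmetric] del: ennreal_plus)
    qed
    have "(\<integral>\<^sup>+t. ennreal (krn I c t x) + ennreal (y - x) * indicator {c<..x} t \<partial>?M)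
       \<le> (\<integral>\<^sup>+t. ennreal (krn I c t y) + ennreal (y - x) * indicator {x<..c} t \<partial>?M)"
      using xy by (intro nn_integral_mono) (auto simp: krn_def sp indicator_def ennreal_plus[symmetric] simp del: ennreal_plus intro!: ennreal_leI)
    then have 1: "q x + (y - x) * max 0 (?F x - ?F c) \<le> q y + (y - x) * max 0 (?F c - ?F x)"
      using xy c q0 by (simp add: i ennreal_le_iff del: ennreal_plus)
    have "(\<integral>\<^sup>+t. ennreal (krn I c t y) + ennreal (y - x) * indicator {y<..c} t \<partial>?M)
       \<le> (\<integral>\<^sup>+t. ennreal (krn I c t x) + ennreal (y - x) * indicator {c<..y} t \<partial>?M)"
      using xy by (intro nn_integral_mono) (auto simp: krn_def sp indicator_def ennreal_plus[symmetric] simp del: ennreal_plus intro!: ennreal_leI)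
    then have 2: "q y + (y - x) * max 0 (?F c - ?F y) \<le> q x + (y - x) * max 0 (?F y - ?F c)"
      using xy c q0 by (simp add: i ennreal_le_iff del: ennreal_plus)
    have m: "(y - x) * max 0 (a - b) - (y - x) * max 0 (b - a) = (a - b) * (y - x)" for a b
      by (auto simp: max_def algebra_simps)
    show ?thesis using 1 2 m[of "?F x" "?F c"] m[of "?F y" "?F c"] by linarith
  qed
  define g where "g x = A x - ?F c * x - q x" for x
  have gb: "\<bar>g y - g x\<bar> \<le> (?F y - ?F x) * (y - x)" if xy: "x \<in> I" "y \<in> I" "x \<le> y" for x y
    using bounds[OF xy] rderiv_diff_le[OF convex_on_I[OF A] open_I xy(1,2)]
    unfolding g_def by (auto simp: algebra_simps abs_le_iff)
  have gc: "g x = g c"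
  proof (cases "c \<le> x")
    case True
    show ?thesis by (rule darboux_const[where F="?F"]) (use True gb convex_real_mem[OF conv_I c x] in auto)
  next
    case False
    have "g c = g x" by (rule darboux_const[where F="?F"]) (use False gb convex_real_mem[OF conv_I x c] in auto)
    then show ?thesis ..
  qed
  have "Q c = 0" unfolding Q_def by (subst nn_integral_0_iff_AE) (auto intro!: meas AE_I2 simp: krn_def sp)
  then have "q c = 0" by (simp add: q_def)
  with gc have "q x = A x - A c - ?F c * (x - c)" by (simp add: g_def algebra_simps)
  then show ?thesis using Qq[OF x] by (simp add: Q_def)
qed

text \<open>The midpoint X of c and x lies in I even when x is an end. The supporting line at c is
  known at X, and convexity carries it over to x.\<close>

lemma subgradient_J:
  assumes A: "convex_on J A" and c: "c \<in> I" and x: "x \<in> J"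
  shows "A c + rderiv A c * (x - c) \<le> A x"
proof (cases "x = c")
  case False
  define X where "X = (c + x) / 2"
  have XI: "X \<in> I" by (rule between_in_I[OF c x]) (use False in \<open>auto simp: X_def\<close>)
  have "A ((1 - 1/2) *\<^sub>R c + (1/2) *\<^sub>R x) \<le> (1 - 1/2) * A c + 1/2 * A x"
    using c x I_J by (intro convex_onD[OF A]) auto
  moreover have "(1 - 1/2) *\<^sub>R c + (1/2) *\<^sub>R x = X" by (simp add: X_def field_simps)
  moreover have "A c + rderiv A c * (X - c) \<le> A X"
    using convex_on_right_derivative(2)[OF convex_on_I[OF A] open_I c XI] .
  moreover have "X - c = (x - c) / 2" by (simp add: X_def field_simps)
  ultimately show ?thesis by simp
qed simp

lemma krn_between_le:
  assumes "c \<le> X \<and> X \<le> e \<or> e \<le> X \<and> X \<le> c" and "t \<in> I"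
  shows "krn I c t X \<le> krn I c t e"
  using assms by (auto simp: krn_def)

lemma tilde_between_le:
  assumes A: "convex_on J A" and c: "c \<in> I" and e: "e \<in> J"
    and X: "c \<le> X \<and> X \<le> e \<or> e \<le> X \<and> X \<le> c"
  shows "A X - A c - rderiv A c * (X - c) \<le> A e - A c - rderiv A c * (e - c)"
proof (cases "e = c")
  case True with X show ?thesis by auto
next
  case False
  define s where "s = (X - c) / (e - c)"
  have s: "0 \<le> s" "s \<le> 1" using X False by (auto simp: s_def divide_simps)
  have Xs: "X = c + s * (e - c)" using False by (simp add: s_def)
  have "A ((1 - s) *\<^sub>R c + s *\<^sub>R e) \<le> (1 - s) * A c + s * A e"
    using c e I_J s by (intro convex_onD[OF A]) auto
  moreover have "(1 - s) *\<^sub>R c + s *\<^sub>R e = X" by (simp add: Xs algebra_simps)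
  ultimately have "A X - A c - rderiv A c * (X - c) \<le> s * (A e - A c - rderiv A c * (e - c))"
    by (simp add: Xs algebra_simps)
  also have "\<dots> \<le> 1 * (A e - A c - rderiv A c * (e - c))"
    using s subgradient_J[OF A c e] by (intro mult_right_mono) auto
  finally show ?thesis by simp
qed

text \<open>Along points of I tending to e the hinge integrals tend to \<open>?Q\<close>, so A has
  the limit tangent plus \<open>?Q\<close> at e from inside. The excess of A e over that limit is
  the jump, and the two terms add up to A minus its tangent.\<close>

lemma hinge_integral_end:
  assumes A: "convex_on J A" and c: "c \<in> I" and e: "e \<in> J - I"
  shows "(\<integral>\<^sup>+t. ennreal (krn I c t e) \<partial>second_deriv_measure I A) + ennreal \<bar>boundary_jump I A e\<bar>
    = ennreal (A e - A c - rderiv A c * (e - c))"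
    and convex_end_limit: "\<exists>l. (A \<longlongrightarrow> l) (at e within I)" and "at e within I \<noteq> bot"
proof -
  let ?M = "second_deriv_measure I A" and ?T = "\<lambda>x. A x - A c - rderiv A c * (x - c)"
  note meas = measurable_sdm[OF A]
  have sp: "space ?M = I" using space_second_deriv_measure[OF convex_on_I[OF A] open_I] .
  let ?Q = "\<integral>\<^sup>+t. ennreal (krn I c t e) \<partial>?M"
  have ec: "e \<noteq> c" using c e by auto
  have kt: "(\<lambda>n. ennreal (krn I c t (X n))) \<longlonglongrightarrow> ennreal (krn I c t e)" if "X \<longlonglongrightarrow> e" "t \<in> I" for X t
    using that by (auto simp: krn_def intro!: tendsto_intros)
  define X where "X n = e + (c - e) * inverse (real (Suc (Suc n)))" for n
  have Xlim: "X \<longlonglongrightarrow> e"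
  proof -
    have "(\<lambda>n. inverse (real (Suc (Suc n)))) \<longlonglongrightarrow> 0" using LIMSEQ_inverse_real_of_nat by (rule LIMSEQ_Suc)
    from tendsto_add[OF tendsto_const[of e] tendsto_mult[OF tendsto_const[of "c - e"] this]]
    show ?thesis by (simp add: X_def[abs_def])
  qed
  have Xb: "c < X n \<and> X n < e \<or> e < X n \<and> X n < c" for n
  proof -
    define s where "s = inverse (real (Suc (Suc n)))"
    have i: "0 < s" "s < 1" by (auto simp: s_def field_simps)
    have "X n - e = (c - e) * s" "X n - c = (e - c) * (1 - s)" by (simp_all add: X_def s_def algebra_simps)
    then have "e < c \<Longrightarrow> 0 < X n - e \<and> X n - c < 0" "c < e \<Longrightarrow> X n - e < 0 \<and> 0 < X n - c"
      using i by (simp_all add: zero_less_mult_iff mult_less_0_iff)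
    then show ?thesis using ec by (cases "e < c") auto
  qed
  have XI: "X n \<in> I" for n using between_in_I[OF c _ Xb] e by auto
  \<comment> \<open>Fatou along the special sequence X shows first that \<open>?Q\<close> is finite;
    only then can the kernel at e serve as a dominating function for arbitrary sequences.\<close>
  have Qle: "?Q \<le> ennreal (?T e)"
  proof -
    have "?Q = (\<integral>\<^sup>+t. liminf (\<lambda>n. ennreal (krn I c t (X n))) \<partial>?M)"
      using kt[OF Xlim] by (intro nn_integral_cong lim_imp_Liminf[symmetric]) (auto simp: sp)
    also have "\<dots> \<le> liminf (\<lambda>n. \<integral>\<^sup>+t. ennreal (krn I c t (X n)) \<partial>?M)"
      by (intro nn_integral_liminf meas) measurable
    also have "\<dots> \<le> liminf (\<lambda>n. ennreal (?T e))"
    proof (intro Liminf_mono always_eventually allI)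
      fix n
      have "?T (X n) \<le> ?T e" using tilde_between_le[OF A c, of e "X n"] e Xb[of n] by auto
      then show "(\<integral>\<^sup>+t. ennreal (krn I c t (X n)) \<partial>?M) \<le> ennreal (?T e)"
        by (subst hinge_integral_I[OF A c XI]) (rule ennreal_leI)
    qed
    finally show ?thesis by (simp add: Liminf_const)
  qed
  then have Qfin: "?Q < \<infinity>" by (simp add: order_le_less_trans)
  have lim: "(A \<longlongrightarrow> A c + rderiv A c * (e - c) + enn2real ?Q) (at e within I)"
    unfolding tendsto_at_iff_sequentially
  proof (intro allI impI)
    fix Y assume Y: "\<forall>i. Y i \<in> I - {e}" "Y \<longlonglongrightarrow> e"
    let ?P = "\<lambda>x. c \<le> x \<and> x \<le> e \<or> e \<le> x \<and> x \<le> c"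
    have ev: "\<forall>\<^sub>F n in sequentially. ?P (Y n)"
    proof (cases "c < e")
      case True
      then have "\<forall>\<^sub>F n in sequentially. c < Y n" using order_tendstoD(1)[OF Y(2)] by simp
      then show ?thesis
      proof eventually_elim
        case (elim n)
        have "Y n < e" using end_side[OF e] True c Y(1) by (metis DiffD1 less_asym)
        with elim show ?case by auto
      qed
    next
      case False
      then have "\<forall>\<^sub>F n in sequentially. Y n < c" using order_tendstoD(2)[OF Y(2)] ec by simp
      then show ?thesis
      proof eventually_elim
        case (elim n)
        have "e < Y n" using end_side[OF e] False c Y(1) ec by (metis DiffD1)
        with elim show ?case by auto
      qed
    qed
    \<comment> \<open>Finitely many terms of Y may lie beyond c, where the kernel at e does not
      dominate; they are replaced by c.\<close>
    define Z where "Z n = (if ?P (Y n) then Y n else c)" for n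
    have ZI: "Z n \<in> I" for n using Y c by (auto simp: Z_def)
    have ZY: "\<forall>\<^sub>F n in sequentially. Z n = Y n" using ev by eventually_elim (simp add: Z_def)
    have Zlim: "Z \<longlonglongrightarrow> e" using Y(2) ZY by (subst tendsto_cong) auto
    have "(\<lambda>n. \<integral>\<^sup>+t. ennreal (krn I c t (Z n)) \<partial>?M) \<longlonglongrightarrow> ?Q"
    proof (rule nn_integral_dominated_convergence)
      show "AE t in ?M. ennreal (krn I c t (Z j)) \<le> ennreal (krn I c t e)" for j
        using krn_between_le[of c "Z j" e] linear[of c e] by (intro AE_I2 ennreal_leI) (auto simp: Z_def sp)
    qed (use Qfin kt[OF Zlim] in \<open>auto intro!: meas AE_I2 simp: sp\<close>)
    then have "(\<lambda>n. enn2real (ennreal (?T (Z n)))) \<longlonglongrightarrow> enn2real ?Q"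
      using Qfin by (intro tendsto_enn2real) (auto simp: hinge_integral_I[OF A c ZI] less_top)
    moreover have "enn2real (ennreal (?T (Z n))) = ?T (Z n)" for n
      using subgradient_J[OF A c subsetD[OF I_J ZI[of n]]] by (intro enn2real_ennreal) linarith
    ultimately have "(\<lambda>n. ?T (Z n)) \<longlonglongrightarrow> enn2real ?Q" by simp
    from tendsto_add[OF this tendsto_add[OF tendsto_const[of "A c"] tendsto_mult[OF tendsto_const[of "rderiv A c"] tendsto_diff[OF Zlim tendsto_const[of c]]]]]
    have "(\<lambda>n. A (Z n)) \<longlonglongrightarrow> A c + rderiv A c * (e - c) + enn2real ?Q" by (simp add: algebra_simps)
    moreover have "\<forall>\<^sub>F n in sequentially. A (Z n) = (A \<circ> Y) n" using ZY by eventually_elim simp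
    ultimately show "(A \<circ> Y) \<longlonglongrightarrow> A c + rderiv A c * (e - c) + enn2real ?Q"
      using Lim_transform_eventually by blast
  qed
  have nt: "at e within I \<noteq> bot"
  proof -
    have "e \<in> closure I" "e \<notin> I" using e J_front by (auto simp: frontier_def)
    then show ?thesis by (auto simp: closure_def trivial_limit_within)
  qed
  show "\<exists>l. (A \<longlongrightarrow> l) (at e within I)" "at e within I \<noteq> bot" using lim nt by blast+
  have bj: "boundary_jump I A e = ?T e - enn2real ?Q"
    unfolding boundary_jump_def using tendsto_Lim[OF nt lim] by simp
  have T0: "0 \<le> ?T e" using subgradient_J[OF A c, of e] e by auto
  have "enn2real ?Q \<le> ?T e" using Qle T0 by (metis enn2real_leI)
  then have "ennreal (enn2real ?Q) + ennreal \<bar>boundary_jump I A e\<bar> = ennreal (?T e)"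
    by (simp add: bj ennreal_plus[symmetric] del: ennreal_plus)
  then show "?Q + ennreal \<bar>boundary_jump I A e\<bar> = ennreal (?T e)" using Qfin by (simp add: less_top)
qed

lemma hinge_representation:
  assumes A: "convex_on J A" and c: "c \<in> I" and x: "x \<in> J"
  shows "Lam I J A (\<lambda>t. ennreal (krn I c t x)) = ennreal (A x - A c - rderiv A c * (x - c))"
proof (cases "x \<in> I")
  case True
  have "(\<Sum>e\<in>J - I. ennreal \<bar>boundary_jump I A e\<bar> * ennreal (krn I c e x)) = 0"
    using True by (intro sum.neutral) (auto simp: krn_def)
  then show ?thesis unfolding Lam_def using hinge_integral_I[OF A c True] by simp
next
  case False
  have "(\<Sum>e\<in>J - I. ennreal \<bar>boundary_jump I A e\<bar> * ennreal (krn I c e x))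
     = (\<Sum>e\<in>J - I. if e = x then ennreal \<bar>boundary_jump I A e\<bar> else 0)"
    by (intro sum.cong) (auto simp: krn_def)
  also have "\<dots> = ennreal \<bar>boundary_jump I A x\<bar>" using False x finite_ends by (subst sum.delta) auto
  finally show ?thesis unfolding Lam_def using hinge_integral_end(1)[OF A c, of x] False x by simp
qed

section \<open>Integration calculus for the functional \<open>Lam\<close>\<close>

lemma Lam_mono:
  assumes A: "convex_on J A" and "\<And>t. t \<in> J \<Longrightarrow> g t \<le> h t"
  shows "Lam I J A g \<le> Lam I J A h"
  unfolding Lam_def using assms(2) I_J
  by (intro add_mono nn_integral_mono sum_mono mult_left_mono)
     (auto simp: space_second_deriv_measure[OF convex_on_I[OF A] open_I])

lemma Lam_cong:
  assumes A: "convex_on J A" and "\<And>t. t \<in> J \<Longrightarrow> g t = h t"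
  shows "Lam I J A g = Lam I J A h"
  by (rule antisym) (auto intro!: Lam_mono[OF A] simp: assms(2))

lemma Lam_add:
  assumes A: "convex_on J A" and [measurable]: "g \<in> borel_measurable borel" "h \<in> borel_measurable borel"
  shows "Lam I J A (\<lambda>t. g t + h t) = Lam I J A g + Lam I J A h"
  unfolding Lam_def
  by (subst nn_integral_add) (auto intro!: measurable_sdm[OF A] simp: sum.distrib distrib_left add_ac)

lemma Lam_cmult:
  assumes A: "convex_on J A" and [measurable]: "g \<in> borel_measurable borel"
  shows "Lam I J A (\<lambda>t. a * g t) = a * Lam I J A g"
  unfolding Lam_def
  by (subst nn_integral_cmult) (auto intro!: measurable_sdm[OF A] simp: sum_distrib_left distrib_left mult_ac)

lemma Lam_SUP:
  assumes A: "convex_on J A" and [measurable]: "\<And>n. g n \<in> borel_measurable borel"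
    and inc: "\<And>n t. g n t \<le> g (Suc n) t"
  shows "Lam I J A (\<lambda>t. SUP n. g n t) = (SUP n. Lam I J A (g n))"
proof -
  have i: "incseq g" using inc by (intro incseq_SucI) (auto simp: le_fun_def)
  have "(\<lambda>n. Lam I J A (g n)) \<longlonglongrightarrow> Lam I J A (\<lambda>t. SUP n. g n t)"
    unfolding Lam_def
  proof (intro tendsto_add tendsto_sum)
    have i2: "incseq (\<lambda>n. \<integral>\<^sup>+t. g n t \<partial>second_deriv_measure I A)"
      by (intro incseq_SucI nn_integral_mono inc)
    show "(\<lambda>n. \<integral>\<^sup>+t. g n t \<partial>second_deriv_measure I A) \<longlonglongrightarrow> (\<integral>\<^sup>+t. (SUP n. g n t) \<partial>second_deriv_measure I A)"
      using LIMSEQ_SUP[OF i2] i by (subst nn_integral_monotone_convergence_SUP) (auto intro!: measurable_sdm[OF A])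
    fix e
    have i3: "incseq (\<lambda>n. ennreal \<bar>boundary_jump I A e\<bar> * g n e)"
      by (intro incseq_SucI mult_left_mono inc) simp
    show "(\<lambda>n. ennreal \<bar>boundary_jump I A e\<bar> * g n e) \<longlonglongrightarrow> ennreal \<bar>boundary_jump I A e\<bar> * (SUP n. g n e)"
      using LIMSEQ_SUP[OF i3] by (simp add: SUP_mult_left_ennreal)
  qed
  moreover have "incseq (\<lambda>n. Lam I J A (g n))" by (intro incseq_SucI Lam_mono[OF A] inc)
  ultimately show ?thesis using LIMSEQ_SUP LIMSEQ_unique by blast
qed

lemma sigma_finite_sdm:
  assumes A: "convex_on J A"
  shows "sigma_finite_measure (second_deriv_measure I A)"
proof
  let ?B = "(\<lambda>(a::rat, b::rat). {real_of_rat a<..real_of_rat b}) ` {(a, b). real_of_rat a \<in> I \<and> real_of_rat b \<in> I}"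
  have "I \<subseteq> \<Union>?B"
  proof
    fix x assume x: "x \<in> I"
    then obtain d where d: "d > 0" "\<And>y. \<bar>y - x\<bar> < d \<Longrightarrow> y \<in> I" using open_I by (auto simp: open_real)
    obtain a where a: "x - d < of_rat a" "of_rat a < x" using of_rat_dense[of "x-d" x] d by auto
    obtain b where b: "x < of_rat b" "of_rat b < x + d" using of_rat_dense[of x "x+d"] d by auto
    have "real_of_rat a \<in> I" "real_of_rat b \<in> I" using a b by (auto intro!: d(2))
    then show "x \<in> \<Union>?B" using a b by force
  qed
  moreover have "\<Union>?B \<subseteq> I"
  proof clarify
    fix x a b assume "real_of_rat a \<in> I" "real_of_rat b \<in> I" "x \<in> {real_of_rat a<..real_of_rat b}"
    then show "x \<in> I" using convex_real_mem[OF conv_I, of "real_of_rat a" "real_of_rat b" x] by simp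
  qed
  ultimately show "\<exists>B. countable B \<and> B \<subseteq> sets (second_deriv_measure I A) \<and> \<Union>B = space (second_deriv_measure I A) \<and>
      (\<forall>a\<in>B. emeasure (second_deriv_measure I A) a \<noteq> \<infinity>)"
    using sets_sdm_Ioc[OF A] emeasure_sdm_Ioc[OF A]
    by (intro exI[of _ ?B]) (auto simp: space_second_deriv_measure[OF convex_on_I[OF A] open_I])
qed

lemma measurable_Lam:
  assumes A: "convex_on J A"
    and k[measurable]: "(\<lambda>(t, x). k t x) \<in> borel_measurable (borel \<Otimes>\<^sub>M borel)"
  shows "(\<lambda>x. Lam I J A (\<lambda>t. k t x)) \<in> borel_measurable (borel :: real measure)"
proof -
  interpret M: sigma_finite_measure "second_deriv_measure I A" by (rule sigma_finite_sdm[OF A])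
  have "(\<lambda>z. (snd z, fst z)) \<in> measurable (borel \<Otimes>\<^sub>M restrict_space borel I) (borel \<Otimes>\<^sub>M borel)"
    by (intro measurable_Pair measurable_fst measurable_compose[OF measurable_snd] measurable_restrict_space1) auto
  from measurable_compose[OF this k]
  have "(\<lambda>(x, t). k t x) \<in> borel_measurable (borel \<Otimes>\<^sub>M second_deriv_measure I A)"
    by (subst measurable_cong_sets[OF sets_pair_measure_cong[OF refl sets_second_deriv_measure[OF convex_on_I[OF A] open_I]] refl])
       (simp add: case_prod_beta)
  then have [measurable]: "(\<lambda>x. \<integral>\<^sup>+t. k t x \<partial>second_deriv_measure I A) \<in> borel_measurable borel"
    by (rule M.borel_measurable_nn_integral)
  have [measurable]: "(\<lambda>x. k t x) \<in> borel_measurable borel" for t by measurable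
  show ?thesis unfolding Lam_def by measurable
qed

text \<open>Values off J are arbitrary: right derivatives at points of the open set I and limits
  within I do not see them.\<close>

lemma Lam_fun_cong:
  assumes AB: "\<And>x. x \<in> J \<Longrightarrow> A x = B x"
  shows "Lam I J A = Lam I J B"
proof -
  have r: "rderiv A x = rderiv B x" if "x \<in> I" for x
    using rderiv_cong[OF open_I that, of A B] AB I_J by auto
  have "second_deriv_measure I A = second_deriv_measure I B"
    unfolding second_deriv_measure_def rderiv_def[symmetric]
    using r by (intro extend_measure_cong) auto
  moreover have "boundary_jump I A e = boundary_jump I B e" if e: "e \<in> J" for e
  proof -
    have "\<forall>\<^sub>F x in at e within I. A x = B x"
      using AB I_J by (auto simp: eventually_at_filter intro!: always_eventually)
    then have "(A \<longlongrightarrow> l) (at e within I) \<longleftrightarrow> (B \<longlongrightarrow> l) (at e within I)" for l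
      by (rule tendsto_cong)
    then show ?thesis using AB[OF e] by (simp add: boundary_jump_def Topological_Spaces.Lim_def)
  qed
  ultimately show ?thesis unfolding Lam_def fun_eq_iff by (auto intro!: sum.cong)
qed

text \<open>Tonelli on the I-part, which is \<sigma>-finite by \<open>sigma_finite_sdm\<close>; the
  jump part is a finite sum.\<close>

lemma Lam_nn_integral:
  assumes A: "convex_on J A" and \<theta>: "sets \<theta> = sets borel" "finite_measure \<theta>"
    and k[measurable]: "(\<lambda>(t, x). k t x) \<in> borel_measurable (borel \<Otimes>\<^sub>M borel)"
  shows "(\<integral>\<^sup>+x. Lam I J A (\<lambda>t. k t x) \<partial>\<theta>) = Lam I J A (\<lambda>t. \<integral>\<^sup>+x. k t x \<partial>\<theta>)"
proof -
  interpret T: finite_measure \<theta> by fact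
  interpret M: sigma_finite_measure "second_deriv_measure I A" by (rule sigma_finite_sdm[OF A])
  interpret P: pair_sigma_finite "second_deriv_measure I A" \<theta> ..
  have ms: "sets (second_deriv_measure I A \<Otimes>\<^sub>M \<theta>) = sets (restrict_space borel I \<Otimes>\<^sub>M borel)"
    using sets_second_deriv_measure[OF convex_on_I[OF A] open_I] \<theta>(1) by (intro sets_pair_measure_cong) auto
  have "(\<lambda>z. k (fst z) (snd z)) \<in> borel_measurable (restrict_space borel I \<Otimes>\<^sub>M borel)"
  proof -
    have "(\<lambda>z. (fst z, snd z)) \<in> measurable (restrict_space borel I \<Otimes>\<^sub>M borel) (borel \<Otimes>\<^sub>M borel)"
      by (intro measurable_Pair measurable_snd measurable_compose[OF measurable_fst] measurable_restrict_space1) auto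
    from measurable_compose[OF this k] show ?thesis by (simp add: case_prod_beta)
  qed
  then have km: "(\<lambda>(t, x). k t x) \<in> borel_measurable (second_deriv_measure I A \<Otimes>\<^sub>M \<theta>)"
    by (subst measurable_cong_sets[OF ms refl]) (simp add: case_prod_beta)
  have k2: "(\<lambda>x. k t x) \<in> borel_measurable \<theta>" for t
    by (subst measurable_cong_sets[OF \<theta>(1) refl]) measurable
  have k3: "(\<lambda>x. \<integral>\<^sup>+t. k t x \<partial>second_deriv_measure I A) \<in> borel_measurable \<theta>"
    using M.borel_measurable_nn_integral[of "\<lambda>x t. k t x" \<theta>] measurable_pair_swap[OF km] by (simp add: case_prod_beta)
  have "(\<integral>\<^sup>+x. Lam I J A (\<lambda>t. k t x) \<partial>\<theta>) = (\<integral>\<^sup>+x. \<integral>\<^sup>+t. k t x \<partial>second_deriv_measure I A \<partial>\<theta>)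
      + (\<integral>\<^sup>+x. (\<Sum>e\<in>J - I. ennreal \<bar>boundary_jump I A e\<bar> * k e x) \<partial>\<theta>)"
    unfolding Lam_def using k2 k3 by (intro nn_integral_add) auto
  also have "(\<integral>\<^sup>+x. (\<Sum>e\<in>J - I. ennreal \<bar>boundary_jump I A e\<bar> * k e x) \<partial>\<theta>)
      = (\<Sum>e\<in>J - I. ennreal \<bar>boundary_jump I A e\<bar> * (\<integral>\<^sup>+x. k e x \<partial>\<theta>))"
    using k2 by (subst nn_integral_sum) (auto simp: nn_integral_cmult)
  also have "(\<integral>\<^sup>+x. \<integral>\<^sup>+t. k t x \<partial>second_deriv_measure I A \<partial>\<theta>) = (\<integral>\<^sup>+t. \<integral>\<^sup>+x. k t x \<partial>\<theta> \<partial>second_deriv_measure I A)"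
    by (rule P.Fubini'[OF km])
  finally show ?thesis by (simp add: Lam_def)
qed

end

section \<open>Potentials and convex order\<close>

abbreviation mass :: "real measure \<Rightarrow> real" where "mass \<theta> \<equiv> measure \<theta> UNIV"
abbreviation mean :: "real measure \<Rightarrow> real" where "mean \<theta> \<equiv> (LINT x|\<theta>. x)"

text \<open>The convex order in terms of potentials. Among measures with finite first moment it is
  equivalent to \<open>\<le>\<^sub>c\<close>, by \<open>convex_order_imp_pot_le\<close> and
  \<open>pot_le_imp_convex_order\<close>.\<close>

definition pot_le :: "real measure \<Rightarrow> real measure \<Rightarrow> bool" where
  "pot_le \<theta>1 \<theta>2 \<longleftrightarrow> finite_first_moment \<theta>1 \<and> finite_first_moment \<theta>2 \<and> mass \<theta>1 = mass \<theta>2 \<and>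
     mean \<theta>1 = mean \<theta>2 \<and> (\<forall>t. potential \<theta>1 t \<le> potential \<theta>2 t)"

lemma ffmD:
  assumes "finite_first_moment \<theta>"
  shows "sets \<theta> = sets borel" "space \<theta> = UNIV" "finite_measure \<theta>" "integrable \<theta> (\<lambda>x. x)"
  using assms sets_eq_imp_space_eq[of \<theta> borel] by (auto simp: finite_first_moment_def)

lemma ffm_integrable:
  assumes \<theta>: "finite_first_moment \<theta>" and g: "g \<in> borel_measurable borel"
    and le: "AE x in \<theta>. \<bar>g x\<bar> \<le> a + b * \<bar>x\<bar>"
  shows "integrable \<theta> (g :: real \<Rightarrow> real)"
proof (rule Bochner_Integration.integrable_bound)
  interpret finite_measure \<theta> using ffmD(3)[OF \<theta>] .
  show "integrable \<theta> (\<lambda>x. \<bar>a\<bar> + \<bar>b\<bar> * \<bar>x\<bar>)" using ffmD(4)[OF \<theta>] by auto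
  show "g \<in> borel_measurable \<theta>" using g by (subst measurable_cong_sets[OF ffmD(1)[OF \<theta>] refl])
  show "AE x in \<theta>. norm (g x) \<le> norm (\<bar>a\<bar> + \<bar>b\<bar> * \<bar>x\<bar>)"
    using le
  proof eventually_elim
    case (elim x)
    have "b * \<bar>x\<bar> \<le> \<bar>b\<bar> * \<bar>x\<bar>" by (intro mult_right_mono) auto
    with elim show ?case by simp
  qed
qed

lemma ffm_integrable_affine: "finite_first_moment \<theta> \<Longrightarrow> integrable \<theta> (\<lambda>x. a + b * x)"
  by (rule ffm_integrable[where a="\<bar>a\<bar>" and b="\<bar>b\<bar>"])
     (auto simp: abs_mult[symmetric] intro!: AE_I2 order_trans[OF abs_triangle_ineq])

lemma ffm_integrable_abs: "finite_first_moment \<theta> \<Longrightarrow> integrable \<theta> (\<lambda>x. \<bar>t - x\<bar>)"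
  by (rule ffm_integrable[where a="\<bar>t\<bar>" and b=1]) (auto intro!: AE_I2)

lemma integral_affine: "finite_first_moment \<theta> \<Longrightarrow> (LINT x|\<theta>. a + b * x) = a * mass \<theta> + b * mean \<theta>"
proof -
  assume \<theta>: "finite_first_moment \<theta>"
  interpret finite_measure \<theta> using ffmD(3)[OF \<theta>] .
  have "(LINT x|\<theta>. a + b * x) = (LINT x|\<theta>. a) + (LINT x|\<theta>. b * x)"
    using ffmD(4)[OF \<theta>] by (intro Bochner_Integration.integral_add) auto
  then show ?thesis using ffmD(2)[OF \<theta>] by simp
qed

lemma ext_integral_real:
  assumes "integrable M f"
  shows "ext_integral M (\<lambda>x. ereal (f x)) = ereal (LINT x|M. f x)"
proof -
  have f: "(\<integral>\<^sup>+x. ennreal (f x) \<partial>M) < \<infinity>" "(\<integral>\<^sup>+x. ennreal (- f x) \<partial>M) < \<infinity>"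
    using assms by (auto simp: real_integrable_def less_top)
  have "ext_integral M (\<lambda>x. ereal (f x)) = enn2ereal (\<integral>\<^sup>+x. ennreal (f x) \<partial>M) - enn2ereal (\<integral>\<^sup>+x. ennreal (- f x) \<partial>M)"
    by (simp add: ext_integral_def ennreal.abs_eq[symmetric])
  also have "\<dots> = ereal (enn2real (\<integral>\<^sup>+x. ennreal (f x) \<partial>M)) - ereal (enn2real (\<integral>\<^sup>+x. ennreal (- f x) \<partial>M))"
  proof -
    have "enn2ereal x = ereal (enn2real x)" if "x < \<infinity>" for x using that by (cases x) auto
    then show ?thesis using f by simp
  qed
  finally show ?thesis using real_lebesgue_integral_def[OF assms] by simp
qed

lemma convex_order_integral_le:
  assumes "\<theta>1 \<le>\<^sub>c \<theta>2" "convex_on UNIV \<phi>" "integrable \<theta>1 \<phi>" "integrable \<theta>2 \<phi>"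
  shows "(LINT x|\<theta>1. \<phi> x) \<le> (LINT x|\<theta>2. \<phi> x)"
  using assms unfolding convex_order_def by (auto simp: ext_integral_real)

lemma convex_on_abs_diff: "convex_on UNIV (\<lambda>x::real. \<bar>t - x\<bar>)"
  using convex_on_dist[of UNIV t] by (simp add: dist_real_def)

lemma convex_on_affine: "convex S \<Longrightarrow> convex_on S (\<lambda>x::real. a + b * x)"
  by (intro convex_onI) (auto simp: algebra_simps)

text \<open>Constants and the identity are convex together with their negatives, which forces
  equality of mass and mean; the potentials are integrals of the convex functions |t - x|.\<close>

lemma convex_order_imp_pot_le:
  assumes \<theta>: "finite_first_moment \<theta>1" "finite_first_moment \<theta>2" and le: "\<theta>1 \<le>\<^sub>c \<theta>2"
  shows "pot_le \<theta>1 \<theta>2"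
proof -
  have aff: "a * mass \<theta>1 + b * mean \<theta>1 \<le> a * mass \<theta>2 + b * mean \<theta>2" for a b
    using convex_order_integral_le[OF le convex_on_affine ffm_integrable_affine ffm_integrable_affine, of a b] \<theta>
    by (simp add: integral_affine)
  have "mass \<theta>1 = mass \<theta>2" using aff[of 1 0] aff[of "-1" 0] by simp
  moreover have "mean \<theta>1 = mean \<theta>2" using aff[of 0 1] aff[of 0 "-1"] by simp
  ultimately show ?thesis
    using convex_order_integral_le[OF le convex_on_abs_diff ffm_integrable_abs ffm_integrable_abs] \<theta>
    by (simp add: pot_le_def potential_def)
qed

text \<open>Up to an affine function a hinge is half an absolute value; s encodes both its slope and
  the side to which it opens.\<close>

lemma hinge_eq_abs: "max 0 (s * (x - t)) = \<bar>s\<bar> / 2 * \<bar>t - x\<bar> + (- s * t / 2 + s / 2 * x)" for s t x :: real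
proof -
  have 1: "max 0 (s * (x - t)) = \<bar>s * (x - t)\<bar> / 2 + s * (x - t) / 2" by (simp add: max_def)
  have 2: "\<bar>s * (x - t)\<bar> / 2 = \<bar>s\<bar> / 2 * \<bar>t - x\<bar>" by (simp add: abs_mult abs_minus_commute)
  have 3: "s * (x - t) / 2 = - s * t / 2 + s / 2 * x" by (simp add: field_simps)
  show ?thesis unfolding 1 2 3 ..
qed

lemma ffm_integrable_hinge:
  assumes \<theta>: "finite_first_moment \<theta>"
  shows "integrable \<theta> (\<lambda>x. max 0 (s * (x - t)))"
  unfolding hinge_eq_abs
  by (rule Bochner_Integration.integrable_add[OF integrable_mult_right[OF ffm_integrable_abs[OF \<theta>]] ffm_integrable_affine[OF \<theta>]])

lemma integral_hinge:
  assumes \<theta>: "finite_first_moment \<theta>"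
  shows "(LINT x|\<theta>. max 0 (s * (x - t))) = \<bar>s\<bar> / 2 * potential \<theta> t + (- s * t / 2 * mass \<theta> + s / 2 * mean \<theta>)"
  unfolding hinge_eq_abs potential_def integral_affine[OF \<theta>, symmetric]
  by (subst Bochner_Integration.integral_add[OF integrable_mult_right[OF ffm_integrable_abs[OF \<theta>]] ffm_integrable_affine[OF \<theta>]])
     simp

text \<open>The affine parts in \<open>hinge_eq_abs\<close> have equal integrals, as mass and mean
  agree, so only the potentials are left. This is the origin of the factor 1/2 in
  \<open>pot_diff\<close>.\<close>

lemma pot_le_hinge:
  assumes le: "pot_le \<theta>1 \<theta>2"
  shows "(LINT x|\<theta>2. max 0 (s * (x - t))) = (LINT x|\<theta>1. max 0 (s * (x - t))) + \<bar>s\<bar> * ((potential \<theta>2 t - potential \<theta>1 t) / 2)"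
proof -
  have "finite_first_moment \<theta>1" "finite_first_moment \<theta>2" "mass \<theta>1 = mass \<theta>2" "mean \<theta>1 = mean \<theta>2"
    using le by (auto simp: pot_le_def)
  then show ?thesis unfolding integral_hinge[OF \<open>finite_first_moment \<theta>1\<close>] integral_hinge[OF \<open>finite_first_moment \<theta>2\<close>]
    by (simp add: algebra_simps diff_divide_distrib)
qed

lemma continuous_potential:
  assumes \<theta>: "finite_first_moment \<theta>"
  shows "\<bar>potential \<theta> x - potential \<theta> y\<bar> \<le> mass \<theta> * \<bar>x - y\<bar>" and "continuous_on S (potential \<theta>)"
proof -
  interpret finite_measure \<theta> using ffmD(3)[OF \<theta>] .
  have lip: "\<bar>potential \<theta> x - potential \<theta> y\<bar> \<le> mass \<theta> * \<bar>x - y\<bar>" for x y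
  proof -
    have "potential \<theta> x - potential \<theta> y = (LINT z|\<theta>. \<bar>x - z\<bar> - \<bar>y - z\<bar>)"
      unfolding potential_def using ffm_integrable_abs[OF \<theta>] by simp
    also have "\<bar>\<dots>\<bar> \<le> (LINT z|\<theta>. \<bar>\<bar>x - z\<bar> - \<bar>y - z\<bar>\<bar>)" by (rule integral_abs_bound)
    also have "\<dots> \<le> (LINT z|\<theta>. \<bar>x - y\<bar>)"
      using ffm_integrable_abs[OF \<theta>] by (intro integral_mono) auto
    finally show ?thesis using ffmD(2)[OF \<theta>] by simp
  qed
  then show "\<bar>potential \<theta> x - potential \<theta> y\<bar> \<le> mass \<theta> * \<bar>x - y\<bar>" .
  show "continuous_on S (potential \<theta>)"
  proof (rule continuous_onI)
    fix x e :: real assume "0 < e"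
    then show "\<exists>d>0. \<forall>x'\<in>S. dist x' x < d \<longrightarrow> dist (potential \<theta> x') (potential \<theta> x) \<le> e"
    proof (intro exI[of _ "e / (mass \<theta> + 1)"] conjI ballI impI)
      fix y assume "dist y x < e / (mass \<theta> + 1)"
      then have "mass \<theta> * \<bar>y - x\<bar> \<le> mass \<theta> * (e / (mass \<theta> + 1))"
        by (intro mult_left_mono) (auto simp: dist_real_def)
      also have "\<dots> \<le> e" using \<open>0 < e\<close> add_nonneg_pos[OF measure_nonneg zero_less_one, of \<theta> UNIV] by (simp add: field_simps)
      finally show "dist (potential \<theta> y) (potential \<theta> x) \<le> e" using lip[of y x] by (simp add: dist_real_def)
    qed (use \<open>0 < e\<close> add_nonneg_pos[OF measure_nonneg zero_less_one, of \<theta> UNIV] in simp)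
  qed
qed

lemma convex_potential:
  assumes \<theta>: "finite_first_moment \<theta>"
  shows "convex_on UNIV (potential \<theta>)"
proof (rule convex_onI)
  fix t x y :: real assume t: "0 < t" "t < 1"
  have "potential \<theta> ((1 - t) *\<^sub>R x + t *\<^sub>R y) \<le> (LINT z|\<theta>. (1 - t) * \<bar>x - z\<bar> + t * \<bar>y - z\<bar>)"
    unfolding potential_def
  proof (intro integral_mono)
    fix z
    have "\<bar>(1 - t) *\<^sub>R x + t *\<^sub>R y - z\<bar> = \<bar>(1 - t) * (x - z) + t * (y - z)\<bar>" by (simp add: algebra_simps)
    also have "\<dots> \<le> (1 - t) * \<bar>x - z\<bar> + t * \<bar>y - z\<bar>"
      using t by (intro order_trans[OF abs_triangle_ineq]) (simp add: abs_mult)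
    finally show "\<bar>(1 - t) *\<^sub>R x + t *\<^sub>R y - z\<bar> \<le> (1 - t) * \<bar>x - z\<bar> + t * \<bar>y - z\<bar>" .
  qed (use ffm_integrable_abs[OF \<theta>] in auto)
  then show "potential \<theta> ((1 - t) *\<^sub>R x + t *\<^sub>R y) \<le> (1 - t) * potential \<theta> x + t * potential \<theta> y"
    using ffm_integrable_abs[OF \<theta>] by (simp add: potential_def)
qed simp

section \<open>Weak duality\<close>

context interval_pair
begin

text \<open>Measurability on the whole line is part of the notion because convexity on J says
  nothing about values off J; \<open>cvx_restrict\<close> makes any function convex on J
  fit.\<close>

definition cvx :: "(real \<Rightarrow> real) \<Rightarrow> bool" where
  "cvx A \<longleftrightarrow> convex_on J A \<and> A \<in> borel_measurable borel"

definition carried :: "real measure \<Rightarrow> bool" where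
  "carried \<theta> \<longleftrightarrow> finite_first_moment \<theta> \<and> (AE x in \<theta>. x \<in> J)"

text \<open>In both cases the integral of the kernel \<open>krn I c t\<close> against \<theta>2
  minus that against \<theta>1: half the difference of potentials for a hinge, the difference of
  atoms for an end.\<close>

definition pot_diff :: "real measure \<Rightarrow> real measure \<Rightarrow> real \<Rightarrow> real" where
  "pot_diff \<theta>1 \<theta>2 t = (if t \<in> I then (potential \<theta>2 t - potential \<theta>1 t) / 2 else measure \<theta>2 {t} - measure \<theta>1 {t})"

text \<open>A minus its right tangent at c, which is what the mixture of kernels represents
  (\<open>Lam_krn\<close>).\<close>

definition tilde :: "(real \<Rightarrow> real) \<Rightarrow> real \<Rightarrow> real \<Rightarrow> real" where
  "tilde A c x = A x - A c - rderiv A c * (x - c)"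

text \<open>The generalized value (\<theta>1 - \<theta>2)(-A); the agreement with
  \<open>concave_gap\<close> is \<open>concave_gap_eq\<close>.\<close>

definition gap :: "real measure \<Rightarrow> real measure \<Rightarrow> (real \<Rightarrow> real) \<Rightarrow> ennreal" where
  "gap \<theta>1 \<theta>2 A = Lam I J A (\<lambda>t. ennreal (pot_diff \<theta>1 \<theta>2 t))"

lemma cvxD: "cvx A \<Longrightarrow> convex_on J A" "cvx A \<Longrightarrow> A \<in> borel_measurable borel"
  by (simp_all add: cvx_def)

lemma cvx_add: "cvx A \<Longrightarrow> cvx B \<Longrightarrow> cvx (\<lambda>x. A x + B x)"
  by (auto simp: cvx_def intro: convex_on_add)

lemma cvx_affine: "cvx (\<lambda>x. a + b * x)"
  using convex_on_affine[OF conv_J] by (simp add: cvx_def)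

lemma convex_on_max:
  fixes f g :: "'a::real_vector \<Rightarrow> real"
  assumes f: "convex_on S f" and g: "convex_on S g"
  shows "convex_on S (\<lambda>x. max (f x) (g x))"
proof (rule convex_onI)
  fix t x y assume t: "0 < t" "t < (1::real)" and xy: "x \<in> S" "y \<in> S"
  have "f ((1 - t) *\<^sub>R x + t *\<^sub>R y) \<le> (1 - t) * f x + t * f y"
    "g ((1 - t) *\<^sub>R x + t *\<^sub>R y) \<le> (1 - t) * g x + t * g y"
    using t xy convex_onD[OF f] convex_onD[OF g] by auto
  moreover have "(1 - t) * f x + t * f y \<le> (1 - t) * max (f x) (g x) + t * max (f y) (g y)"
    "(1 - t) * g x + t * g y \<le> (1 - t) * max (f x) (g x) + t * max (f y) (g y)"
    using t by (auto intro!: add_mono mult_left_mono)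
  ultimately show "max (f ((1 - t) *\<^sub>R x + t *\<^sub>R y)) (g ((1 - t) *\<^sub>R x + t *\<^sub>R y))
      \<le> (1 - t) * max (f x) (g x) + t * max (f y) (g y)" by linarith
qed (use f convex_on_imp_convex in auto)

lemma cvx_max: "cvx A \<Longrightarrow> cvx B \<Longrightarrow> cvx (\<lambda>x. max (A x) (B x))"
  by (auto simp: cvx_def intro: convex_on_max)

text \<open>A convex function is continuous on the open set I, and J - I is finite, so the extension
  by 0 is Borel.\<close>

lemma cvx_restrict:
  assumes A: "convex_on J A"
  shows "cvx (\<lambda>x. if x \<in> J then A x else 0)"
proof -
  have "continuous_on I A" by (rule convex_on_continuous[OF open_I convex_on_I[OF A]])
  then have [measurable]: "(\<lambda>x. indicator I x *\<^sub>R A x) \<in> borel_measurable borel"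
    by (intro borel_measurable_continuous_on_indicator) auto
  have "(\<lambda>x. if x \<in> J then A x else 0) = (\<lambda>x. indicator I x *\<^sub>R A x + (\<Sum>e\<in>J - I. A e * indicator {e} x))"
  proof
    fix x
    have "(\<Sum>e\<in>J - I. A e * indicator {e} x) = (\<Sum>e\<in>J - I. if e = x then A x else 0)"
      by (intro sum.cong) auto
    also have "\<dots> = (if x \<in> J - I then A x else 0)" using finite_ends by (subst sum.delta) auto
    finally show "(if x \<in> J then A x else 0) = indicator I x *\<^sub>R A x + (\<Sum>e\<in>J - I. A e * indicator {e} x)"
      using I_J by (auto simp: indicator_def)
  qed
  moreover have "(\<lambda>x. indicator I x *\<^sub>R A x + (\<Sum>e\<in>J - I. A e * indicator {e} x)) \<in> borel_measurable borel"
    by measurable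
  ultimately have "(\<lambda>x. if x \<in> J then A x else 0) \<in> borel_measurable borel" by (simp only:)
  moreover have "convex_on J (\<lambda>x. if x \<in> J then A x else 0)"
    using A convexD[OF conv_J] by (auto simp: convex_on_def)
  ultimately show ?thesis by (simp add: cvx_def)
qed

lemma carriedD: "carried \<theta> \<Longrightarrow> finite_first_moment \<theta>" "carried \<theta> \<Longrightarrow> AE x in \<theta>. x \<in> J"
  by (simp_all add: carried_def)

lemma measurable_carried: "carried \<theta> \<Longrightarrow> f \<in> measurable borel N \<Longrightarrow> f \<in> measurable \<theta> N"
  using measurable_cong_sets[OF ffmD(1)[OF carriedD(1)] refl] by blast

lemma end_side_J:
  assumes e: "e \<in> J - I"
  shows "(\<forall>t\<in>I. t < e) \<and> (\<forall>x\<in>J. x \<le> e) \<or> (\<forall>t\<in>I. e < t) \<and> (\<forall>x\<in>J. e \<le> x)"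
proof -
  obtain c where c: "c \<in> I" using I_ne by auto
  from end_side[OF e] show ?thesis
  proof
    assume *: "\<forall>t\<in>I. t < e"
    have "x \<le> e" if "x \<in> J" for x
      using between_in_I[OF c that, of e] * c e by (metis DiffD2 not_le)
    with * show ?thesis by blast
  next
    assume *: "\<forall>t\<in>I. e < t"
    have "e \<le> x" if "x \<in> J" for x
      using between_in_I[OF c that, of e] * c e by (metis DiffD2 not_le)
    with * show ?thesis by blast
  qed
qed

lemma end_sequence:
  assumes e: "e \<in> J - I"
  obtains X where "\<And>n. X n \<in> I" "X \<longlonglongrightarrow> (e::real)"
proof -
  have "e \<in> closure I" using e J_front by (auto simp: frontier_def)
  then show ?thesis using that unfolding closure_sequential by blast
qed

text \<open>Testing against the tent functions with apex e gives the value of an atom at an end e in the limit.\<close>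

lemma end_hinge_limit:
  assumes e: "e \<in> J - I" and \<theta>: "carried \<theta>" and X: "\<And>n. X n \<in> I" "X \<longlonglongrightarrow> e"
  shows "(\<lambda>n. LINT x|\<theta>. max 0 ((x - X n) / (e - X n))) \<longlonglongrightarrow> measure \<theta> {e}"
    and "t \<in> I \<Longrightarrow> measure \<theta> {e} \<le> (LINT x|\<theta>. max 0 ((x - t) / (e - t)))"
proof -
  interpret finite_measure \<theta> using ffmD(3)[OF carriedD(1)[OF \<theta>]] .
  have le1: "max 0 ((x - t) / (e - t)) \<le> 1" if "x \<in> J" "t \<in> I" for x t
    using end_side_J[OF e] that by (auto simp: divide_simps)
  have lim0: "(\<lambda>n. max 0 ((x - X n) / (e - X n))) \<longlonglongrightarrow> indicator {e} x" if x: "x \<in> J" for x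
  proof (cases "x = e")
    case True
    have "e \<noteq> X n" for n using X(1)[of n] e by auto
    then show ?thesis using True by simp
  next
    case False
    have "\<forall>\<^sub>F n in sequentially. max 0 ((x - X n) / (e - X n)) = 0"
      using end_side_J[OF e]
    proof
      assume *: "(\<forall>t\<in>I. t < e) \<and> (\<forall>x\<in>J. x \<le> e)"
      then have "x < e" using x False by force
      then have "\<forall>\<^sub>F n in sequentially. x < X n" using order_tendstoD(1)[OF X(2)] by simp
      then show ?thesis
      proof eventually_elim
        case (elim n)
        then show ?case using * X(1)[of n] by (auto simp: max_def divide_simps)
      qed
    next
      assume *: "(\<forall>t\<in>I. e < t) \<and> (\<forall>x\<in>J. e \<le> x)"
      then have "e < x" using x False by force
      then have "\<forall>\<^sub>F n in sequentially. X n < x" using order_tendstoD(2)[OF X(2)] by simp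
      then show ?thesis
      proof eventually_elim
        case (elim n)
        then show ?case using * X(1)[of n] by (auto simp: max_def divide_simps)
      qed
    qed
    then show ?thesis using False by (auto intro: tendsto_eventually)
  qed
  have "(\<lambda>n. LINT x|\<theta>. max 0 ((x - X n) / (e - X n))) \<longlonglongrightarrow> (LINT x|\<theta>. indicator {e} x)"
  proof (rule integral_dominated_convergence[where w="\<lambda>_. 1"])
    show "AE x in \<theta>. (\<lambda>n. max 0 ((x - X n) / (e - X n))) \<longlonglongrightarrow> indicator {e} x"
      using carriedD(2)[OF \<theta>] by eventually_elim (rule lim0)
    show "AE x in \<theta>. norm (max 0 ((x - X n) / (e - X n))) \<le> 1" for n
      using carriedD(2)[OF \<theta>] by eventually_elim (use le1 X(1) in auto)
  qed (auto intro!: measurable_carried[OF \<theta>])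
  then show "(\<lambda>n. LINT x|\<theta>. max 0 ((x - X n) / (e - X n))) \<longlonglongrightarrow> measure \<theta> {e}"
    using ffmD[OF carriedD(1)[OF \<theta>]] by simp
  assume t: "t \<in> I"
  then have te: "t \<noteq> e" using e by auto
  have "measure \<theta> {e} = (LINT x|\<theta>. indicator {e} x)" using ffmD[OF carriedD(1)[OF \<theta>]] by simp
  also have "\<dots> \<le> (LINT x|\<theta>. max 0 ((x - t) / (e - t)))"
    using ffm_integrable_hinge[OF carriedD(1)[OF \<theta>], of "1 / (e - t)" t] te ffmD[OF carriedD(1)[OF \<theta>]]
    by (intro integral_mono integrable_real_indicator) (auto simp: indicator_def less_top[symmetric])
  finally show "measure \<theta> {e} \<le> (LINT x|\<theta>. max 0 ((x - t) / (e - t)))" .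
qed

text \<open>The functions with apex e used in \<open>end_hinge_limit\<close> are hinges, hence
  ordered by \<open>pot_le_hinge\<close>, and the order passes to the limit.\<close>

lemma end_atom_mono:
  assumes e: "e \<in> J - I" and c1: "carried \<theta>1" and c2: "carried \<theta>2" and le: "pot_le \<theta>1 \<theta>2"
  shows "measure \<theta>1 {e} \<le> measure \<theta>2 {e}"
proof -
  obtain X where X: "\<And>n. X n \<in> I" "X \<longlonglongrightarrow> e" using end_sequence[OF e] by blast
  show ?thesis
  proof (rule LIMSEQ_le[OF end_hinge_limit(1)[OF e c1 X] end_hinge_limit(1)[OF e c2 X]], intro exI allI impI)
    fix n
    show "(LINT x|\<theta>1. max 0 ((x - X n) / (e - X n))) \<le> (LINT x|\<theta>2. max 0 ((x - X n) / (e - X n)))"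
      using pot_le_hinge[OF le, of "1 / (e - X n)" "X n"] le by (simp add: pot_le_def)
  qed
qed

lemma pot_diff_nonneg:
  assumes "carried \<theta>1" "carried \<theta>2" "pot_le \<theta>1 \<theta>2" "t \<in> J"
  shows "0 \<le> pot_diff \<theta>1 \<theta>2 t"
  using assms end_atom_mono[of t \<theta>1 \<theta>2] by (auto simp: pot_diff_def pot_le_def)

lemma measurable_pot_diff [measurable]:
  assumes "finite_first_moment \<theta>1" "finite_first_moment \<theta>2"
  shows "pot_diff \<theta>1 \<theta>2 \<in> borel_measurable borel"
proof -
  have [measurable]: "potential \<theta>1 \<in> borel_measurable borel" "potential \<theta>2 \<in> borel_measurable borel"
    using continuous_potential(2) assms by (auto intro!: borel_measurable_continuous_onI)
  have c: "countable {t. measure \<theta> {t} \<noteq> 0}" if "finite_first_moment \<theta>" for \<theta>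
    using finite_measure.countable_support[OF ffmD(3)[OF that]] .
  have m: "(\<lambda>t. measure \<theta> {t}) \<in> borel_measurable borel" if "finite_first_moment \<theta>" for \<theta> :: "real measure"
    by (rule measurable_discrete_difference[of "\<lambda>_. 0", OF _ c[OF that]]) auto
  show ?thesis unfolding pot_diff_def using m[OF assms(1)] m[OF assms(2)] by measurable
qed

text \<open>Kernels are either hinges, compared by \<open>pot_le_hinge\<close>, or indicators of
  ends, compared by their atoms. The additive form avoids subtraction in \<open>ennreal\<close>, and
  finiteness is recorded to allow cancellation later.\<close>

lemma krn_integral_diff:
  assumes c1: "carried \<theta>1" and c2: "carried \<theta>2" and le: "pot_le \<theta>1 \<theta>2" and t: "t \<in> J"
  shows "(\<integral>\<^sup>+x. ennreal (krn I c t x) \<partial>\<theta>2) = (\<integral>\<^sup>+x. ennreal (krn I c t x) \<partial>\<theta>1) + ennreal (pot_diff \<theta>1 \<theta>2 t)"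
    and "(\<integral>\<^sup>+x. ennreal (krn I c t x) \<partial>\<theta>2) < \<infinity>"
proof -
  have "(\<integral>\<^sup>+x. ennreal (krn I c t x) \<partial>\<theta>2) = (\<integral>\<^sup>+x. ennreal (krn I c t x) \<partial>\<theta>1) + ennreal (pot_diff \<theta>1 \<theta>2 t) \<and>
    (\<integral>\<^sup>+x. ennreal (krn I c t x) \<partial>\<theta>2) < \<infinity>"
  proof (cases "t \<in> I")
    case True
    define s :: real where "s = (if c < t then 1 else -1)"
    have k: "krn I c t x = max 0 (s * (x - t))" for x using True by (simp add: krn_def s_def)
    have i: "(\<integral>\<^sup>+x. ennreal (krn I c t x) \<partial>\<theta>) = ennreal (LINT x|\<theta>. max 0 (s * (x - t)))" if "carried \<theta>" for \<theta>
      unfolding k using ffm_integrable_hinge[OF carriedD(1)[OF that]] by (intro nn_integral_eq_integral) auto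
    have "0 \<le> (LINT x|\<theta>1. max 0 (s * (x - t)))" by (intro Bochner_Integration.integral_nonneg) auto
    then show ?thesis
      using True le pot_diff_nonneg[OF c1 c2 le t] unfolding i[OF c1] i[OF c2] pot_le_hinge[OF le]
      by (simp add: pot_diff_def s_def)
  next
    case False
    have i: "(\<integral>\<^sup>+x. ennreal (krn I c t x) \<partial>\<theta>) = ennreal (measure \<theta> {t})" if "carried \<theta>" for \<theta>
    proof -
      interpret finite_measure \<theta> using ffmD(3)[OF carriedD(1)[OF that]] .
      have "(\<integral>\<^sup>+x. ennreal (krn I c t x) \<partial>\<theta>) = (\<integral>\<^sup>+x. indicator {t} x \<partial>\<theta>)"
        using False by (intro nn_integral_cong) (auto simp: krn_def indicator_def)
      then show ?thesis using ffmD(1)[OF carriedD(1)[OF that]] by (simp add: emeasure_eq_measure)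
    qed
    show ?thesis unfolding i[OF c1] i[OF c2] using False pot_diff_nonneg[OF c1 c2 le t]
      by (simp add: pot_diff_def ennreal_plus[symmetric] del: ennreal_plus)
  qed
  then show "(\<integral>\<^sup>+x. ennreal (krn I c t x) \<partial>\<theta>2) = (\<integral>\<^sup>+x. ennreal (krn I c t x) \<partial>\<theta>1) + ennreal (pot_diff \<theta>1 \<theta>2 t)"
    "(\<integral>\<^sup>+x. ennreal (krn I c t x) \<partial>\<theta>2) < \<infinity>" by blast+
qed

lemma nn_integral_Lam_krn:
  assumes A: "convex_on J A" and \<theta>: "carried \<theta>" and K[measurable]: "K \<in> sets borel"
  shows "(\<integral>\<^sup>+x. Lam I J A (\<lambda>t. ennreal (krn I c t x) * indicator K t) \<partial>\<theta>)
    = Lam I J A (\<lambda>t. (\<integral>\<^sup>+x. ennreal (krn I c t x) \<partial>\<theta>) * indicator K t)"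
proof -
  have "(\<integral>\<^sup>+x. Lam I J A (\<lambda>t. ennreal (krn I c t x) * indicator K t) \<partial>\<theta>)
    = Lam I J A (\<lambda>t. \<integral>\<^sup>+x. ennreal (krn I c t x) * indicator K t \<partial>\<theta>)"
    using ffmD[OF carriedD(1)[OF \<theta>]] by (intro Lam_nn_integral[OF A]) measurable
  also have "\<dots> = Lam I J A (\<lambda>t. (\<integral>\<^sup>+x. ennreal (krn I c t x) \<partial>\<theta>) * indicator K t)"
    by (intro Lam_cong[OF A] nn_integral_multc) (auto intro!: measurable_carried[OF \<theta>])
  finally show ?thesis .
qed

lemma measurable_krn_integral [measurable]:
  assumes \<theta>: "carried \<theta>"
  shows "(\<lambda>t. \<integral>\<^sup>+x. ennreal (krn I c t x) \<partial>\<theta>) \<in> borel_measurable borel"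
proof -
  interpret finite_measure \<theta> using ffmD(3)[OF carriedD(1)[OF \<theta>]] .
  have "(\<lambda>(t, x). ennreal (krn I c t x)) \<in> borel_measurable (borel \<Otimes>\<^sub>M \<theta>)"
    by (subst measurable_cong_sets[OF sets_pair_measure_cong[OF refl ffmD(1)[OF carriedD(1)[OF \<theta>]]] refl]) measurable
  then show ?thesis by (rule borel_measurable_nn_integral)
qed

text \<open>\<open>krn_integral_diff\<close> integrated over t, with Tonelli on both sides. The set
  K cuts the second derivative of A down, so that the same identity is available with finite
  terms.\<close>

lemma hinge_integral_order:
  assumes A: "convex_on J A" and c1: "carried \<theta>1" and c2: "carried \<theta>2" and le: "pot_le \<theta>1 \<theta>2"
    and K[measurable]: "K \<in> sets borel"
  shows "(\<integral>\<^sup>+x. Lam I J A (\<lambda>t. ennreal (krn I c t x) * indicator K t) \<partial>\<theta>2)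
    = (\<integral>\<^sup>+x. Lam I J A (\<lambda>t. ennreal (krn I c t x) * indicator K t) \<partial>\<theta>1)
       + Lam I J A (\<lambda>t. ennreal (pot_diff \<theta>1 \<theta>2 t) * indicator K t)"
proof -
  note [measurable] = measurable_krn_integral[OF c1] measurable_pot_diff[OF carriedD(1)[OF c1] carriedD(1)[OF c2]]
  show ?thesis
    unfolding nn_integral_Lam_krn[OF A c1 K] nn_integral_Lam_krn[OF A c2 K]
    by (subst Lam_add[OF A, symmetric]) (auto intro!: Lam_cong[OF A] simp: krn_integral_diff(1)[OF c1 c2 le] distrib_right)
qed

lemma Lam_krn:
  assumes A: "convex_on J A" and c: "c \<in> I" and x: "x \<in> J"
  shows "Lam I J A (\<lambda>t. ennreal (krn I c t x)) = ennreal (tilde A c x)"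
  using hinge_representation[OF A c x] by (simp add: tilde_def)

lemma tilde_nonneg: "convex_on J A \<Longrightarrow> c \<in> I \<Longrightarrow> x \<in> J \<Longrightarrow> 0 \<le> tilde A c x"
  using subgradient_J[of A c x] by (simp add: tilde_def)

text \<open>Jensen's inequality with its exact defect: the case K = UNIV of
  \<open>hinge_integral_order\<close>, where the mixture of kernels is
  \<open>tilde A c\<close>.\<close>

lemma tilde_integral_order:
  assumes A: "convex_on J A" and c: "c \<in> I" and c1: "carried \<theta>1" and c2: "carried \<theta>2" and le: "pot_le \<theta>1 \<theta>2"
  shows "(\<integral>\<^sup>+x. ennreal (tilde A c x) \<partial>\<theta>2) = (\<integral>\<^sup>+x. ennreal (tilde A c x) \<partial>\<theta>1) + gap \<theta>1 \<theta>2 A"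
proof -
  have "(\<integral>\<^sup>+x. ennreal (tilde A c x) \<partial>\<theta>) = (\<integral>\<^sup>+x. Lam I J A (\<lambda>t. ennreal (krn I c t x) * indicator UNIV t) \<partial>\<theta>)"
    if "carried \<theta>" for \<theta>
    by (rule nn_integral_cong_AE, use carriedD(2)[OF that] in eventually_elim) (simp add: Lam_krn[OF A c])
  then show ?thesis using hinge_integral_order[OF A c1 c2 le, of UNIV c] c1 c2 by (simp add: gap_def)
qed

text \<open>B is convex on J only, so the definition of the convex order does not apply to it. Its
  tangent at c is subtracted to apply \<open>tilde_integral_order\<close>, and put back using equal
  mass and mean.\<close>

lemma convex_J_integral_mono:
  assumes B: "cvx B" and c1: "carried \<theta>1" and c2: "carried \<theta>2" and le: "pot_le \<theta>1 \<theta>2"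
    and i: "integrable \<theta>1 B" "integrable \<theta>2 B"
  shows "(LINT x|\<theta>1. B x) \<le> (LINT x|\<theta>2. B x)"
proof -
  obtain c where c: "c \<in> I" using I_ne by auto
  let ?a = "B c - rderiv B c * c" and ?b = "rderiv B c"
  have t: "tilde B c x = B x - (?a + ?b * x)" for x by (simp add: tilde_def algebra_simps)
  have it: "integrable \<theta> (tilde B c)" "(LINT x|\<theta>. tilde B c x) = (LINT x|\<theta>. B x) - (?a * mass \<theta> + ?b * mean \<theta>)"
    "(\<integral>\<^sup>+x. ennreal (tilde B c x) \<partial>\<theta>) = ennreal (LINT x|\<theta>. tilde B c x)" "0 \<le> (LINT x|\<theta>. tilde B c x)"
    if "carried \<theta>" "integrable \<theta> B" for \<theta>
  proof -
    note f = carriedD(1)[OF that(1)]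
    show 1: "integrable \<theta> (tilde B c)" unfolding t using that(2) ffm_integrable_affine[OF f] by auto
    show "(LINT x|\<theta>. tilde B c x) = (LINT x|\<theta>. B x) - (?a * mass \<theta> + ?b * mean \<theta>)"
      unfolding t by (subst Bochner_Integration.integral_diff) (use that(2) ffm_integrable_affine[OF f] in \<open>auto simp only: integral_affine[OF f]\<close>)
    have 2: "AE x in \<theta>. 0 \<le> tilde B c x"
      using carriedD(2)[OF that(1)] by eventually_elim (rule tilde_nonneg[OF cvxD(1)[OF B] c])
    show "(\<integral>\<^sup>+x. ennreal (tilde B c x) \<partial>\<theta>) = ennreal (LINT x|\<theta>. tilde B c x)"
      by (rule nn_integral_eq_integral[OF 1 2])
    show "0 \<le> (LINT x|\<theta>. tilde B c x)" using 2 by (rule integral_nonneg_AE)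
  qed
  have "ennreal (LINT x|\<theta>1. tilde B c x) \<le> ennreal (LINT x|\<theta>2. tilde B c x)"
    using tilde_integral_order[OF cvxD(1)[OF B] c c1 c2 le] it(3)[OF c1 i(1)] it(3)[OF c2 i(2)] by simp
  then have "(LINT x|\<theta>1. tilde B c x) \<le> (LINT x|\<theta>2. tilde B c x)" using it(4)[OF c2 i(2)] by (simp add: ennreal_le_iff)
  then show ?thesis using it(2)[OF c1 i(1)] it(2)[OF c2 i(2)] le by (simp add: pot_le_def)
qed

end

lemma ennreal_add_le: "ennreal (a + b) \<le> ennreal a + ennreal b"
proof (cases "0 \<le> a"; cases "0 \<le> b")
  assume "\<not> 0 \<le> a" "0 \<le> b"
  then have "ennreal (a + b) \<le> ennreal b" by (intro ennreal_leI) simp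
  then show ?thesis using \<open>\<not> 0 \<le> a\<close> by (simp add: ennreal_neg)
next
  assume "0 \<le> a" "\<not> 0 \<le> b"
  then have "ennreal (a + b) \<le> ennreal a" by (intro ennreal_leI) simp
  then show ?thesis using \<open>\<not> 0 \<le> b\<close> by (simp add: ennreal_neg)
qed (simp_all add: ennreal_neg)

section \<open>Truncated convex functions and weak duality for general pairs\<close>

context interval_pair
begin

text \<open>For t in J - I the kernel is the indicator of an extreme point of J: a proper convex
  combination equals t only if both points do.\<close>

lemma krn_convex:
  assumes t: "t \<in> J" and xy: "x \<in> J" "y \<in> J" and s: "0 < s" "s < 1"
  shows "krn I c t ((1 - s) * x + s * y) \<le> (1 - s) * krn I c t x + s * krn I c t y"
proof (cases "t \<in> I")
  case True
  have m: "max 0 ((1 - s) * a + s * b) \<le> (1 - s) * max 0 a + s * max 0 b" for a b :: real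
  proof -
    have "(1 - s) * a \<le> (1 - s) * max 0 a" "s * b \<le> s * max 0 b" using s by (auto intro!: mult_left_mono)
    moreover have "0 \<le> (1 - s) * max 0 a" "0 \<le> s * max 0 b" using s by auto
    ultimately show ?thesis by linarith
  qed
  have "(1 - s) * x + s * y - t = (1 - s) * (x - t) + s * (y - t)"
    "t - ((1 - s) * x + s * y) = (1 - s) * (t - x) + s * (t - y)" by (simp_all add: algebra_simps)
  then show ?thesis using True m[of "x - t" "y - t"] m[of "t - x" "t - y"] by (simp add: krn_def)
next
  case False
  show ?thesis
  proof (cases "(1 - s) * x + s * y = t")
    case eq: True
    have "(1 - s) * (x - t) + s * (y - t) = 0" using eq by (simp add: algebra_simps)
    moreover have "(x \<le> t \<and> y \<le> t) \<or> (t \<le> x \<and> t \<le> y)" using end_side_J[of t] t False xy by auto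
    ultimately have "x = t \<and> y = t"
      using s by (smt (verit, best) mult_pos_pos mult_pos_neg mult_nonneg_nonneg mult_nonneg_nonpos)
    then show ?thesis by (simp add: krn_def False)
  qed (use False s in \<open>simp add: krn_def\<close>)
qed

text \<open>A mixture of the kernels \<open>krn I c t\<close> over t in K inherits their convexity;
  the finiteness assumption allows the return from \<open>ennreal\<close> to the reals.\<close>

lemma trunc_convex:
  assumes A: "convex_on J A" and K[measurable]: "K \<in> sets borel"
    and fin: "\<And>x. x \<in> J \<Longrightarrow> Lam I J A (\<lambda>t. ennreal (krn I c t x) * indicator K t) < \<infinity>"
  shows "cvx (\<lambda>x. enn2real (Lam I J A (\<lambda>t. ennreal (krn I c t x) * indicator K t)))"
proof -
  let ?L = "\<lambda>x. Lam I J A (\<lambda>t. ennreal (krn I c t x) * indicator K t)"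
  have "convex_on J (\<lambda>x. enn2real (?L x))"
  proof (rule convex_onI)
    fix s x y assume s: "0 < s" "s < (1::real)" and xy: "x \<in> J" "y \<in> J"
    have z: "(1 - s) * x + s * y \<in> J" using convexD[OF conv_J xy, of "1 - s" s] s by simp
    have "?L ((1 - s) * x + s * y) \<le> Lam I J A (\<lambda>t. ennreal (1 - s) * (ennreal (krn I c t x) * indicator K t)
         + ennreal s * (ennreal (krn I c t y) * indicator K t))"
    proof (rule Lam_mono[OF A])
      fix t assume "t \<in> J"
      then have "ennreal (krn I c t ((1 - s) * x + s * y)) \<le> ennreal (1 - s) * ennreal (krn I c t x) + ennreal s * ennreal (krn I c t y)"
        using krn_convex[of t x y s c] s xy by (simp add: ennreal_mult[symmetric] ennreal_plus[symmetric] ennreal_leI del: ennreal_plus)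
      then show "ennreal (krn I c t ((1 - s) * x + s * y)) * indicator K t
         \<le> ennreal (1 - s) * (ennreal (krn I c t x) * indicator K t) + ennreal s * (ennreal (krn I c t y) * indicator K t)"
        by (auto simp: indicator_def)
    qed
    also have "\<dots> = ennreal (1 - s) * ?L x + ennreal s * ?L y"
      by (subst Lam_add[OF A]) (auto simp: Lam_cmult[OF A])
    also have "\<dots> = ennreal ((1 - s) * enn2real (?L x) + s * enn2real (?L y))"
      using s fin[OF xy(1)] fin[OF xy(2)]
      by (cases "?L x"; cases "?L y") (auto simp: ennreal_mult[symmetric] ennreal_plus[symmetric] simp del: ennreal_plus)
    finally have "enn2real (?L ((1 - s) * x + s * y)) \<le> (1 - s) * enn2real (?L x) + s * enn2real (?L y)"
      using s by (intro enn2real_leI) auto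
    then show "enn2real (?L ((1 - s) *\<^sub>R x + s *\<^sub>R y)) \<le> (1 - s) * enn2real (?L x) + s * enn2real (?L y)"
      by simp
  qed (rule conv_J)
  moreover have "?L \<in> borel_measurable borel"
    by (rule measurable_Lam[OF A]) measurable
  ultimately show ?thesis by (simp add: cvx_def)
qed

text \<open>The sets K n exhaust J and are chosen such that cutting the second derivative down to K n
  makes every convex function integrable.\<close>

lemma exhaustion:
  assumes c: "c \<in> I" and \<nu>: "carried \<nu>"
  obtains K :: "nat \<Rightarrow> real set" where "\<And>n. K n \<in> sets borel" "\<And>n. K n \<subseteq> K (Suc n)" "J \<subseteq> (\<Union>n. K n)"
    "\<And>A n. convex_on J A \<Longrightarrow> (\<integral>\<^sup>+x. Lam I J A (\<lambda>t. ennreal (krn I c t x) * indicator (K n) t) \<partial>\<nu>) < \<infinity>"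
proof -
  note [measurable] = measurable_krn_integral[OF \<nu>]
  \<comment> \<open>For every t in J some point of Q makes the kernel at t positive: a rational
    beyond t as seen from c, or t itself if t is an end. Adding c keeps Q nonempty for the
    enumeration.\<close>
  define Q where "Q = (\<rat> \<inter> I) \<union> (J - I) \<union> {c}"
  have Q: "countable Q" "Q \<noteq> {}" "Q \<subseteq> J"
    using countable_rat finite_ends I_J c by (auto simp: Q_def countable_finite countable_Int1)
  define q where "q = from_nat_into Q"
  have rQ: "range q = Q" unfolding q_def using range_from_nat_into[OF Q(2,1)] .
  have ex: "\<exists>i. 0 < krn I c t (q i)" if t: "t \<in> J" for t
  proof -
    have "\<exists>r\<in>Q. 0 < krn I c t r"
    proof (cases "t \<in> I")
      case True
      then obtain d where d: "d > 0" "\<And>y. \<bar>y - t\<bar> < d \<Longrightarrow> y \<in> I" using open_I by (auto simp: open_real)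
      show ?thesis
      proof (cases "c < t")
        case ct: True
        obtain r where r: "t < of_rat r" "of_rat r < t + d" using of_rat_dense[of t "t+d"] d by auto
        then have "real_of_rat r \<in> Q" using d(2) by (auto simp: Q_def)
        then show ?thesis using r ct True by (intro bexI[of _ "of_rat r"]) (auto simp: krn_def)
      next
        case ct: False
        obtain r where r: "t - d < of_rat r" "of_rat r < t" using of_rat_dense[of "t-d" t] d by auto
        then have "real_of_rat r \<in> Q" using d(2) by (auto simp: Q_def)
        then show ?thesis using r ct True by (intro bexI[of _ "of_rat r"]) (auto simp: krn_def)
      qed
    next
      case False
      then show ?thesis using t by (intro bexI[of _ t]) (auto simp: krn_def Q_def)
    qed
    then show ?thesis using rQ by force
  qed
  define S where "S n t = (\<Sum>i<n. ennreal (krn I c t (q i)))" for n t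
  have [measurable]: "S n \<in> borel_measurable borel" for n unfolding S_def by measurable
  \<comment> \<open>On \<open>K n\<close> the \<nu>-integral of the kernel is at most n times a sum
    of its values at finitely many points \<open>q i\<close>. Mixing over t turns that sum into
    finitely many values of \<open>tilde A c\<close>, which are finite for every A, although
    \<open>K n\<close> does not depend on A.\<close>
  define K where "K n = {t. (\<integral>\<^sup>+x. ennreal (krn I c t x) \<partial>\<nu>) \<le> of_nat n * S n t}" for n
  have Kb[measurable]: "K n \<in> sets borel" for n unfolding K_def by measurable
  have S_mono: "S n t \<le> S m t" if "n \<le> m" for n m t
    unfolding S_def by (rule sum_mono2) (use that in auto)
  have fin: "(\<integral>\<^sup>+x. ennreal (krn I c t x) \<partial>\<nu>) < \<infinity>" if "t \<in> J" for t
    using krn_integral_diff(2)[OF \<nu> \<nu> _ that] carriedD[OF \<nu>] by (simp add: pot_le_def)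
  show thesis
  proof (rule that[of K])
    show "K n \<subseteq> K (Suc n)" for n
      unfolding K_def using S_mono[of n "Suc n"]
      by (auto elim!: order_trans intro!: mult_mono simp del: of_nat_Suc)
    show "J \<subseteq> (\<Union>n. K n)"
    proof
      fix t assume t: "t \<in> J"
      obtain i where i: "0 < krn I c t (q i)" using ex[OF t] by auto
      obtain r where r: "(\<integral>\<^sup>+x. ennreal (krn I c t x) \<partial>\<nu>) = ennreal r" "0 \<le> r"
        using fin[OF t] by (cases "\<integral>\<^sup>+x. ennreal (krn I c t x) \<partial>\<nu>") auto
      obtain n0 :: nat where n0: "r / krn I c t (q i) < real n0" using reals_Archimedean2 by blast
      define n where "n = max n0 (Suc i)"
      have "r \<le> real n0 * krn I c t (q i)" using n0 i by (simp add: field_simps)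
      also have "\<dots> \<le> real n * krn I c t (q i)" using i by (intro mult_right_mono) (auto simp: n_def)
      finally have "ennreal r \<le> of_nat n * ennreal (krn I c t (q i))"
        by (simp add: ennreal_of_nat_eq_real_of_nat ennreal_mult[symmetric] ennreal_leI)
      also have "\<dots> \<le> of_nat n * S n t"
        unfolding S_def by (intro mult_left_mono member_le_sum) (auto simp: n_def)
      finally show "t \<in> (\<Union>n. K n)" using r by (auto simp: K_def)
    qed
    fix A n assume A: "convex_on J A"
    have "(\<integral>\<^sup>+x. Lam I J A (\<lambda>t. ennreal (krn I c t x) * indicator (K n) t) \<partial>\<nu>)
        = Lam I J A (\<lambda>t. (\<integral>\<^sup>+x. ennreal (krn I c t x) \<partial>\<nu>) * indicator (K n) t)"
      by (rule nn_integral_Lam_krn[OF A \<nu> Kb])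
    also have "\<dots> \<le> Lam I J A (\<lambda>t. of_nat n * S n t)"
      by (intro Lam_mono[OF A]) (auto simp: K_def indicator_def)
    also have "\<dots> = of_nat n * Lam I J A (S n)" by (rule Lam_cmult[OF A]) measurable
    also have "Lam I J A (S n) = (\<Sum>i<n. ennreal (tilde A c (q i)))"
    proof -
      have "Lam I J A (\<lambda>t. \<Sum>i<m. ennreal (krn I c t (q i))) = (\<Sum>i<m. ennreal (tilde A c (q i)))" for m
      proof (induction m)
        case 0
        then show ?case by (simp add: Lam_def)
      next
        case (Suc m)
        have "q m \<in> J" using rQ Q(3) by blast
        then show ?case using Suc by (simp add: Lam_add[OF A] Lam_krn[OF A c])
      qed
      then show ?thesis by (simp add: S_def[abs_def])
    qed
    also have "of_nat n * \<dots> < \<infinity>" by (simp add: ennreal_mult_less_top of_nat_less_top)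
    finally show "(\<integral>\<^sup>+x. Lam I J A (\<lambda>t. ennreal (krn I c t x) * indicator (K n) t) \<partial>\<nu>) < \<infinity>" .
  qed (rule Kb)
qed

text \<open>With finite integrals this says no more than that the integral of C against \<theta> is
  at most that against \<nu>. In general A and C are truncated to \<open>R A m\<close> and
  \<open>T n\<close>. Truncation may destroy A <= C, so the maximum of the two is used: it is
  convex, dominates \<open>R A m\<close>, and \<open>convex_J_integral_mono\<close> applies to
  it.\<close>

lemma weak_duality:
  assumes A: "cvx A" and C: "cvx C" and AC: "\<And>x. x \<in> J \<Longrightarrow> A x \<le> C x"
    and \<theta>: "carried \<theta>" and \<nu>: "carried \<nu>" and le: "pot_le \<theta> \<nu>"
  shows "(\<integral>\<^sup>+x. ennreal (C x - A x) \<partial>\<theta>) \<le> (\<integral>\<^sup>+x. ennreal (C x - A x) \<partial>\<nu>) + gap \<theta> \<nu> A"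
proof (cases "gap \<theta> \<nu> A")
  case top
  then show ?thesis by simp
next
  case (real g)
  note [measurable] = cvxD(2)[OF A] cvxD(2)[OF C]
  obtain c where c: "c \<in> I" using I_ne by auto
  obtain K where K: "\<And>n. K n \<in> sets borel" "\<And>n. K n \<subseteq> K (Suc n)" "J \<subseteq> (\<Union>n. K n)"
    "\<And>A n. convex_on J A \<Longrightarrow> (\<integral>\<^sup>+x. Lam I J A (\<lambda>t. ennreal (krn I c t x) * indicator (K n) t) \<partial>\<nu>) < \<infinity>"
    using exhaustion[OF c \<nu>] by blast
  define L where "L B n x = Lam I J B (\<lambda>t. ennreal (krn I c t x) * indicator (K n) t)" for B n x
  define R where "R B n x = enn2real (L B n x)" for B n x
  have Lle: "L B n x \<le> ennreal (tilde B c x)" if "convex_on J B" "x \<in> J" for B n x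
    unfolding L_def Lam_krn[OF that(1) c that(2), symmetric]
    by (intro Lam_mono[OF that(1)]) (auto simp: indicator_def)
  have Lfin: "L B n x < \<infinity>" if "convex_on J B" "x \<in> J" for B n x
    using order_le_less_trans[OF Lle[OF that] ennreal_less_top] by simp
  have Rc: "cvx (R B n)" if "convex_on J B" for B n
    unfolding R_def L_def using Lfin[OF that] by (intro trunc_convex[OF that K(1)]) (simp add: L_def)
  have R0: "0 \<le> R B n x" for B n x by (simp add: R_def)
  have Rle: "R B n x \<le> tilde B c x" if "convex_on J B" "x \<in> J" for B n x
    unfolding R_def using Lle[OF that] tilde_nonneg[OF that(1) c that(2)] by (intro enn2real_leI)
  have Rlim: "(\<lambda>n. R B n x) \<longlonglongrightarrow> tilde B c x" if B: "convex_on J B" and x: "x \<in> J" for B x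
  proof -
    have inc: "incseq (\<lambda>n. L B n x)"
      unfolding L_def using K(2) by (intro incseq_SucI Lam_mono[OF B] mult_left_mono) (auto simp: indicator_def)
    have "(SUP n. L B n x) = Lam I J B (\<lambda>t. SUP n. ennreal (krn I c t x) * indicator (K n) t)"
      unfolding L_def using K(1,2) by (subst Lam_SUP[OF B]) (auto intro!: mult_left_mono borel_measurable_times_ennreal simp: indicator_def)
    also have "\<dots> = Lam I J B (\<lambda>t. ennreal (krn I c t x))"
    proof (rule Lam_cong[OF B])
      fix t assume "t \<in> J"
      then obtain n where n: "t \<in> K n" using K(3) by auto
      show "(SUP n. ennreal (krn I c t x) * indicator (K n) t) = ennreal (krn I c t x)"
        by (rule antisym) (auto intro!: SUP_least SUP_upper2[of n] simp: n indicator_def)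
    qed
    finally have "(\<lambda>n. L B n x) \<longlonglongrightarrow> ennreal (tilde B c x)"
      using LIMSEQ_SUP[OF inc] by (simp add: Lam_krn[OF B c x])
    then have "(\<lambda>n. R B n x) \<longlonglongrightarrow> enn2real (ennreal (tilde B c x))"
      unfolding R_def by (intro tendsto_enn2real) auto
    then show ?thesis using tilde_nonneg[OF B c x] by simp
  qed
  have Li: "(\<integral>\<^sup>+x. L B n x \<partial>\<nu>) = (\<integral>\<^sup>+x. L B n x \<partial>\<theta>) + Lam I J B (\<lambda>t. ennreal (pot_diff \<theta> \<nu> t) * indicator (K n) t)"
    if "convex_on J B" for B n
    unfolding L_def by (rule hinge_integral_order[OF that \<theta> \<nu> le K(1)])
  have LR: "(\<integral>\<^sup>+x. ennreal (R B n x) \<partial>\<kappa>) = (\<integral>\<^sup>+x. L B n x \<partial>\<kappa>)" if "convex_on J B" "carried \<kappa>" for B n \<kappa>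
    by (rule nn_integral_cong_AE, use carriedD(2)[OF that(2)] in eventually_elim)
       (use Lfin[OF that(1)] in \<open>simp add: R_def less_top\<close>)
  have Rint: "integrable \<kappa> (R B n)" if "convex_on J B" "\<kappa> = \<theta> \<or> \<kappa> = \<nu>" for B n \<kappa>
  proof (rule integrableI_bounded)
    have car: "carried \<kappa>" using that \<theta> \<nu> by auto
    show "R B n \<in> borel_measurable \<kappa>" using measurable_carried[OF car cvxD(2)[OF Rc[OF that(1)]]] .
    have "(\<integral>\<^sup>+x. L B n x \<partial>\<kappa>) < \<infinity>"
      using that(2) Li[OF that(1), of n] K(4)[OF that(1), of n] by (auto simp: L_def)
    then show "(\<integral>\<^sup>+x. ennreal (norm (R B n x)) \<partial>\<kappa>) < \<infinity>" using LR[OF that(1) car] R0 by simp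
  qed
  \<comment> \<open>The affine function a0 + a1 * x is the tangent of C at c minus the tangent of A
    at c. Hence \<open>T n\<close> increases to C minus the tangent of A, and subtracting
    \<open>tilde A c\<close> leaves C - A in the limit.\<close>
  define a0 a1 where "a0 = C c - A c - (rderiv C c - rderiv A c) * c" and "a1 = rderiv C c - rderiv A c"
  define T where "T n x = (a0 + a1 * x) + R C n x" for n x
  have Tc: "cvx (T n)" for n unfolding T_def by (intro cvx_add cvx_affine Rc cvxD(1)[OF C])
  have Tint: "integrable \<kappa> (T n)" if "\<kappa> = \<theta> \<or> \<kappa> = \<nu>" for \<kappa> n
    unfolding T_def using that carriedD(1) \<theta> \<nu>
    by (intro Bochner_Integration.integrable_add ffm_integrable_affine Rint cvxD(1)[OF C]) auto
  have Clim: "(\<lambda>n. T n x - tilde A c x) \<longlonglongrightarrow> C x - A x" if x: "x \<in> J" for x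
  proof -
    have "(\<lambda>n. (a0 + a1 * x) + R C n x - tilde A c x) \<longlonglongrightarrow> (a0 + a1 * x) + tilde C c x - tilde A c x"
      by (intro tendsto_intros Rlim cvxD(1)[OF C] x)
    then show ?thesis by (simp add: T_def tilde_def a0_def a1_def algebra_simps)
  qed
  have Tle: "T n x - tilde A c x \<le> C x - A x" if x: "x \<in> J" for x n
    using Rle[OF cvxD(1)[OF C] x, of n] by (simp add: T_def tilde_def a0_def a1_def algebra_simps)
  have [measurable]: "T n \<in> borel_measurable borel" "R A n \<in> borel_measurable borel" "tilde A c \<in> borel_measurable borel" for n
    using cvxD(2)[OF Tc] cvxD(2)[OF Rc[OF cvxD(1)[OF A]]] by (auto simp: tilde_def[abs_def])
  have RA: "(LINT x|\<nu>. R A m x) \<le> (LINT x|\<theta>. R A m x) + g" for m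
  proof -
    have "(\<integral>\<^sup>+x. ennreal (R A m x) \<partial>\<nu>) \<le> (\<integral>\<^sup>+x. ennreal (R A m x) \<partial>\<theta>) + gap \<theta> \<nu> A"
      unfolding LR[OF cvxD(1)[OF A] \<theta>] LR[OF cvxD(1)[OF A] \<nu>] Li[OF cvxD(1)[OF A]] gap_def
      by (intro add_left_mono Lam_mono[OF cvxD(1)[OF A]]) (auto simp: indicator_def)
    moreover have "(\<integral>\<^sup>+x. ennreal (R A m x) \<partial>\<kappa>) = ennreal (LINT x|\<kappa>. R A m x)" if "\<kappa> = \<theta> \<or> \<kappa> = \<nu>" for \<kappa>
      using Rint[OF cvxD(1)[OF A] that] R0 by (intro nn_integral_eq_integral) auto
    moreover have "0 \<le> (LINT x|\<kappa>. R A m x)" for \<kappa> using R0 by (intro Bochner_Integration.integral_nonneg) auto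
    ultimately show ?thesis using real by (simp add: ennreal_plus[symmetric] ennreal_le_iff del: ennreal_plus)
  qed
  \<comment> \<open>The positive part equals max(R, T) - R: the first term is monotone in the convex
    order, and the loss in the second is at most g by \<open>RA\<close>.\<close>
  have main: "(LINT x|\<theta>. max 0 (T n x - R A m x)) \<le> (LINT x|\<nu>. max 0 (T n x - R A m x)) + g" for n m
  proof -
    have eq: "(LINT x|\<kappa>. max 0 (T n x - R A m x)) = (LINT x|\<kappa>. max (R A m x) (T n x)) - (LINT x|\<kappa>. R A m x)"
      if "\<kappa> = \<theta> \<or> \<kappa> = \<nu>" for \<kappa>
    proof -
      have "(\<lambda>x. max 0 (T n x - R A m x)) = (\<lambda>x. max (R A m x) (T n x) - R A m x)" by (auto simp: max_def)
      then show ?thesis using Rint[OF cvxD(1)[OF A] that, of m] Tint[OF that, of n]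
        by (simp add: Bochner_Integration.integral_diff integrable_max)
    qed
    have "(LINT x|\<theta>. max (R A m x) (T n x)) \<le> (LINT x|\<nu>. max (R A m x) (T n x))"
      using Rint[OF cvxD(1)[OF A]] Tint
      by (intro convex_J_integral_mono[OF cvx_max[OF Rc[OF cvxD(1)[OF A]] Tc] \<theta> \<nu> le]) auto
    then show ?thesis using RA[of m] by (simp add: eq)
  qed
  have step: "(\<integral>\<^sup>+x. ennreal (T n x - tilde A c x) \<partial>\<theta>) \<le> (\<integral>\<^sup>+x. ennreal (C x - A x) \<partial>\<nu>) + ennreal g" for n
  proof -
    have b: "AE x in \<kappa>. norm (max 0 (T n x - R A m x)) \<le> norm (T n x)" for m \<kappa>
    proof (rule AE_I2)
      fix x
      show "norm (max 0 (T n x - R A m x)) \<le> norm (T n x)" using R0[of A m x] by (auto simp: max_def abs_if)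
    qed
    have i1: "integrable \<kappa> (\<lambda>x. max 0 (T n x - R A m x))" if "\<kappa> = \<theta> \<or> \<kappa> = \<nu>" for \<kappa> m
    proof (rule Bochner_Integration.integrable_bound[OF Tint[OF that] _ b])
      have "carried \<kappa>" using that \<theta> \<nu> by blast
      then show "(\<lambda>x. max 0 (T n x - R A m x)) \<in> borel_measurable \<kappa>" by (rule measurable_carried) measurable
    qed
    have b2: "AE x in \<nu>. norm (max 0 (T n x - tilde A c x)) \<le> norm (T n x)"
      using carriedD(2)[OF \<nu>]
    proof eventually_elim
      case (elim x)
      then show ?case using tilde_nonneg[OF cvxD(1)[OF A] c elim] by (auto simp: max_def)
    qed
    have i2: "integrable \<nu> (\<lambda>x. max 0 (T n x - tilde A c x))"
    proof (rule Bochner_Integration.integrable_bound[OF Tint _ b2])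
      show "(\<lambda>x. max 0 (T n x - tilde A c x)) \<in> borel_measurable \<nu>" by (rule measurable_carried[OF \<nu>]) measurable
    qed simp
    \<comment> \<open>The index m goes to infinity first, with n fixed: as the truncations of A are
      nonnegative, \<open>T n\<close> dominates all integrands.\<close>
    have lim: "(\<lambda>m. LINT x|\<nu>. max 0 (T n x - R A m x)) \<longlonglongrightarrow> (LINT x|\<nu>. max 0 (T n x - tilde A c x))"
    proof (rule integral_dominated_convergence[where w="\<lambda>x. norm (T n x)"])
      show "AE x in \<nu>. (\<lambda>m. max 0 (T n x - R A m x)) \<longlonglongrightarrow> max 0 (T n x - tilde A c x)"
        using carriedD(2)[OF \<nu>] by eventually_elim (intro tendsto_intros Rlim cvxD(1)[OF A])
      show "AE x in \<nu>. norm (max 0 (T n x - R A m x)) \<le> norm (T n x)" for m by (rule b)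
      show "integrable \<nu> (\<lambda>x. norm (T n x))" using Tint by simp
    qed (rule measurable_carried[OF \<nu>], measurable)+
    have le1: "(\<integral>\<^sup>+x. ennreal (T n x - tilde A c x) \<partial>\<theta>) \<le> ennreal (LINT x|\<theta>. max 0 (T n x - R A m x))" for m
    proof -
      have "(\<integral>\<^sup>+x. ennreal (T n x - tilde A c x) \<partial>\<theta>) \<le> (\<integral>\<^sup>+x. ennreal (max 0 (T n x - R A m x)) \<partial>\<theta>)"
        by (rule nn_integral_mono_AE, use carriedD(2)[OF \<theta>] in eventually_elim)
           (use Rle[OF cvxD(1)[OF A]] in \<open>auto intro!: ennreal_leI simp: le_max_iff_disj\<close>)
      also have "\<dots> = ennreal (LINT x|\<theta>. max 0 (T n x - R A m x))"
        by (intro nn_integral_eq_integral i1) auto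
      finally show ?thesis .
    qed
    have "(\<integral>\<^sup>+x. ennreal (T n x - tilde A c x) \<partial>\<theta>) \<le> ennreal ((LINT x|\<nu>. max 0 (T n x - tilde A c x)) + g)"
    proof (rule LIMSEQ_le_const[of "\<lambda>m. ennreal ((LINT x|\<nu>. max 0 (T n x - R A m x)) + g)"])
      show "(\<lambda>m. ennreal ((LINT x|\<nu>. max 0 (T n x - R A m x)) + g)) \<longlonglongrightarrow> ennreal ((LINT x|\<nu>. max 0 (T n x - tilde A c x)) + g)"
        by (intro tendsto_ennrealI tendsto_intros lim)
      show "\<exists>N. \<forall>m\<ge>N. (\<integral>\<^sup>+x. ennreal (T n x - tilde A c x) \<partial>\<theta>) \<le> ennreal ((LINT x|\<nu>. max 0 (T n x - R A m x)) + g)"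
        using order_trans[OF le1 ennreal_leI[OF main]] by blast
    qed
    also have "\<dots> = (\<integral>\<^sup>+x. ennreal (max 0 (T n x - tilde A c x)) \<partial>\<nu>) + ennreal g"
    proof (subst nn_integral_eq_integral[OF i2])
      have "0 \<le> (LINT x|\<nu>. max 0 (T n x - tilde A c x))" by (intro Bochner_Integration.integral_nonneg) simp
      then show "ennreal ((LINT x|\<nu>. max 0 (T n x - tilde A c x)) + g) = ennreal (LINT x|\<nu>. max 0 (T n x - tilde A c x)) + ennreal g"
        using real by simp
    qed simp
    also have "\<dots> \<le> (\<integral>\<^sup>+x. ennreal (C x - A x) \<partial>\<nu>) + ennreal g"
      by (intro add_right_mono nn_integral_mono_AE, use carriedD(2)[OF \<nu>] in eventually_elim)
         (use Tle AC in \<open>auto intro!: ennreal_leI\<close>)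
    finally show ?thesis .
  qed
  \<comment> \<open>Then n goes to infinity, by Fatou on the side of \<theta>; the side of \<nu> was
    already bounded uniformly in n through \<open>Tle\<close>.\<close>
  have "(\<integral>\<^sup>+x. ennreal (C x - A x) \<partial>\<theta>) = (\<integral>\<^sup>+x. liminf (\<lambda>n. ennreal (T n x - tilde A c x)) \<partial>\<theta>)"
    by (rule nn_integral_cong_AE, use carriedD(2)[OF \<theta>] in eventually_elim)
       (intro lim_imp_Liminf[symmetric] tendsto_ennrealI Clim, auto)
  also have "\<dots> \<le> liminf (\<lambda>n. \<integral>\<^sup>+x. ennreal (T n x - tilde A c x) \<partial>\<theta>)"
    by (intro nn_integral_liminf measurable_carried[OF \<theta>]) measurable
  also have "\<dots> \<le> liminf (\<lambda>n. (\<integral>\<^sup>+x. ennreal (C x - A x) \<partial>\<nu>) + ennreal g)"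
    using step by (intro Liminf_mono always_eventually) auto
  finally show ?thesis using real by (simp add: Liminf_const)
qed

end

section \<open>Measures with a prescribed potential\<close>

interpretation whole: interval_pair UNIV UNIV
  by unfold_locales auto

lemma whole_carried: "whole.carried \<theta> \<longleftrightarrow> finite_first_moment \<theta>"
  by (simp add: whole.carried_def)

text \<open>\<open>tilde_integral_order\<close> on the whole line. If the \<nu>-side integral of
  \<open>?t\<close> is finite, \<phi> is integrable for both measures. Otherwise the positive part
  of \<phi> has infinite integral against \<theta>2, since \<open>?t\<close> exceeds it by at most
  an integrable affine term.\<close>

lemma pot_le_imp_convex_order:
  assumes le: "pot_le \<theta>1 \<theta>2"
  shows "\<theta>1 \<le>\<^sub>c \<theta>2"
  unfolding convex_order_def
proof (intro allI impI)
  fix \<phi> :: "real \<Rightarrow> real" assume \<phi>: "convex_on UNIV \<phi>"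
  have f: "finite_first_moment \<theta>1" "finite_first_moment \<theta>2" using le by (auto simp: pot_le_def)
  then have c: "whole.carried \<theta>1" "whole.carried \<theta>2" by (simp_all add: whole_carried)
  have cv: "whole.cvx \<phi>" using whole.cvx_restrict[OF \<phi>] by simp
  let ?t = "whole.tilde \<phi> 0"
  have t: "\<phi> x = ?t x + (\<phi> 0 + rderiv \<phi> 0 * x)" for x by (simp add: whole.tilde_def)
  have t0: "0 \<le> ?t x" for x using whole.tilde_nonneg[OF \<phi>] by simp
  have tm: "?t \<in> borel_measurable borel" using whole.cvxD(2)[OF cv] by (simp add: whole.tilde_def[abs_def])
  have int: "integrable \<theta> \<phi>" if "finite_first_moment \<theta>" "(\<integral>\<^sup>+x. ennreal (?t x) \<partial>\<theta>) < \<infinity>" for \<theta>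
  proof -
    have "integrable \<theta> ?t" using that(2) t0 measurable_cong_sets[OF ffmD(1)[OF that(1)] refl] tm
      by (intro integrableI_bounded) auto
    from Bochner_Integration.integrable_add[OF this ffm_integrable_affine[OF that(1), of "\<phi> 0" "rderiv \<phi> 0"]]
    show ?thesis by (simp only: t[symmetric])
  qed
  have ord: "(\<integral>\<^sup>+x. ennreal (?t x) \<partial>\<theta>2) = (\<integral>\<^sup>+x. ennreal (?t x) \<partial>\<theta>1) + whole.gap \<theta>1 \<theta>2 \<phi>"
    by (rule whole.tilde_integral_order[OF \<phi> _ c le]) simp
  show "ext_integral \<theta>1 (\<lambda>x. ereal (\<phi> x)) \<le> ext_integral \<theta>2 (\<lambda>x. ereal (\<phi> x))"
  proof (cases "(\<integral>\<^sup>+x. ennreal (?t x) \<partial>\<theta>2) < \<infinity>")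
    case True
    then have i: "integrable \<theta>1 \<phi>" "integrable \<theta>2 \<phi>" using int f ord by auto
    show ?thesis using whole.convex_J_integral_mono[OF cv c le i] by (simp add: ext_integral_real i)
  next
    case False
    have neg: "(\<integral>\<^sup>+x. ennreal (- (\<phi> 0 + rderiv \<phi> 0 * x)) \<partial>\<theta>2) < \<infinity>"
      using ffm_integrable_affine[OF f(2), of "\<phi> 0" "rderiv \<phi> 0"] by (auto simp: real_integrable_def less_top)
    have mm: "\<And>g::real \<Rightarrow> ennreal. g \<in> borel_measurable borel \<Longrightarrow> g \<in> borel_measurable \<theta>2"
      using measurable_cong_sets[OF ffmD(1)[OF f(2)] refl] by blast
    have [measurable]: "\<phi> \<in> borel_measurable borel" by (rule whole.cvxD(2)[OF cv])
    have "(\<integral>\<^sup>+x. ennreal (?t x) \<partial>\<theta>2) \<le> (\<integral>\<^sup>+x. ennreal (\<phi> x) + ennreal (- (\<phi> 0 + rderiv \<phi> 0 * x)) \<partial>\<theta>2)"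
    proof (intro nn_integral_mono)
      fix x
      have "?t x = \<phi> x + (- (\<phi> 0 + rderiv \<phi> 0 * x))" by (simp add: whole.tilde_def)
      then show "ennreal (?t x) \<le> ennreal (\<phi> x) + ennreal (- (\<phi> 0 + rderiv \<phi> 0 * x))"
        by (metis ennreal_add_le)
    qed
    also have "\<dots> = (\<integral>\<^sup>+x. ennreal (\<phi> x) \<partial>\<theta>2) + (\<integral>\<^sup>+x. ennreal (- (\<phi> 0 + rderiv \<phi> 0 * x)) \<partial>\<theta>2)"
      by (intro nn_integral_add mm) auto
    finally have ge: "(\<integral>\<^sup>+x. ennreal (?t x) \<partial>\<theta>2)
        \<le> (\<integral>\<^sup>+x. ennreal (\<phi> x) \<partial>\<theta>2) + (\<integral>\<^sup>+x. ennreal (- (\<phi> 0 + rderiv \<phi> 0 * x)) \<partial>\<theta>2)" .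
    have "(\<integral>\<^sup>+x. ennreal (\<phi> x) \<partial>\<theta>2) = \<infinity>"
    proof (rule ccontr)
      assume "(\<integral>\<^sup>+x. ennreal (\<phi> x) \<partial>\<theta>2) \<noteq> \<infinity>"
      then have "(\<integral>\<^sup>+x. ennreal (\<phi> x) \<partial>\<theta>2) + (\<integral>\<^sup>+x. ennreal (- (\<phi> 0 + rderiv \<phi> 0 * x)) \<partial>\<theta>2) < \<infinity>"
        using neg by (simp add: less_top)
      with ge False show False using order_le_less_trans by blast
    qed
    then have "ext_integral \<theta>2 (\<lambda>x. ereal (\<phi> x)) = \<infinity>"
      by (simp add: ext_integral_def ennreal.abs_eq[symmetric])
    then show ?thesis by simp
  qed
qed

text \<open>From the right, the difference quotients of |x - y| in x tend to 1 for y <= x and to -1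
  for y > x; they are bounded by 1, so dominated convergence applies.\<close>

lemma rderiv_potential:
  assumes \<theta>: "finite_first_moment \<theta>"
  shows "rderiv (potential \<theta>) x = 2 * measure \<theta> {..x} - mass \<theta>"
proof (rule rderiv_eqI, unfold tendsto_at_iff_sequentially, intro allI impI)
  fix X assume X: "\<forall>i. X i \<in> {x<..} - {x}" "X \<longlonglongrightarrow> x"
  interpret finite_measure \<theta> using ffmD(3)[OF \<theta>] .
  have mm: "\<And>g::real \<Rightarrow> real. g \<in> borel_measurable borel \<Longrightarrow> g \<in> borel_measurable \<theta>"
    using measurable_cong_sets[OF ffmD(1)[OF \<theta>] refl] by blast
  let ?q = "\<lambda>n y. (\<bar>X n - y\<bar> - \<bar>x - y\<bar>) / (X n - x)"
  have Xx: "x < X n" for n using X(1) by auto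
  have "(\<lambda>n. LINT y|\<theta>. ?q n y) \<longlonglongrightarrow> (LINT y|\<theta>. 2 * indicator {..x} y - 1)"
  proof (rule integral_dominated_convergence[where w="\<lambda>_. 1"])
    show "AE y in \<theta>. (\<lambda>n. ?q n y) \<longlonglongrightarrow> 2 * indicator {..x} y - 1"
    proof (rule AE_I2)
      fix y
      have "\<forall>\<^sub>F n in sequentially. ?q n y = 2 * indicator {..x} y - 1"
      proof (cases "y \<le> x")
        case True
        then show ?thesis using Xx by (intro always_eventually allI) (auto simp: field_simps abs_if less_le_not_le, (smt (verit) Xx)+)
      next
        case False
        then have "\<forall>\<^sub>F n in sequentially. X n < y" using order_tendstoD(2)[OF X(2)] by simp
        then show ?thesis
        proof eventually_elim
          case (elim n)
          then show ?case using False Xx[of n] by (simp add: field_simps)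
        qed
      qed
      then show "(\<lambda>n. ?q n y) \<longlonglongrightarrow> 2 * indicator {..x} y - 1" by (rule tendsto_eventually)
    qed
    show "AE y in \<theta>. norm (?q n y) \<le> 1" for n using Xx[of n] by (intro AE_I2) (auto simp: divide_simps)
  qed (auto intro!: mm)
  also have "(LINT y|\<theta>. 2 * indicator {..x} y - 1) = 2 * measure \<theta> {..x} - mass \<theta>"
    using ffmD[OF \<theta>] by (subst Bochner_Integration.integral_diff) (auto simp: less_top[symmetric] emeasure_eq_measure)
  also have "(\<lambda>n. LINT y|\<theta>. ?q n y) = (\<lambda>y. (potential \<theta> y - potential \<theta> x) / (y - x)) \<circ> X"
    using ffm_integrable_abs[OF \<theta>] by (simp add: potential_def fun_eq_iff)
  finally show "((\<lambda>y. (potential \<theta> y - potential \<theta> x) / (y - x)) \<circ> X) \<longlonglongrightarrow> 2 * measure \<theta> {..x} - mass \<theta>" .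
qed

text \<open>The mass of \<open>{x<..y}\<close> is half the increment of the right derivative of the
  potential, in which the slope b of the affine difference cancels. Half-open intervals inside U
  generate the Borel sets of U.\<close>

lemma potential_determines_locally:
  assumes \<theta>: "finite_first_moment \<theta>1" "finite_first_moment \<theta>2" and U: "open U" "convex U"
    and eq: "\<And>x. x \<in> U \<Longrightarrow> potential \<theta>2 x = potential \<theta>1 x + (a + b * x)"
    and S: "S \<in> sets borel" "S \<subseteq> U"
  shows "emeasure \<theta>1 S = emeasure \<theta>2 S"
proof -
  have d: "rderiv (potential \<theta>2) x = rderiv (potential \<theta>1) x + b" if x: "x \<in> U" for x
  proof (rule rderiv_eqI)
    have "((\<lambda>y. (potential \<theta>1 y - potential \<theta>1 x) / (y - x) + b) \<longlongrightarrow> rderiv (potential \<theta>1) x + b) (at_right x)"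
      by (intro tendsto_intros convex_on_right_derivative(1)[OF convex_potential[OF \<theta>(1)]]) auto
    moreover have "\<forall>\<^sub>F y in at_right x. (potential \<theta>1 y - potential \<theta>1 x) / (y - x) + b = (potential \<theta>2 y - potential \<theta>2 x) / (y - x)"
    proof -
      have "\<forall>\<^sub>F y in at_right x. y \<in> U \<and> x < y"
        using U(1) x by (auto simp: eventually_at_topological)
      then show ?thesis
      proof eventually_elim
        case (elim y)
        have "potential \<theta>2 y - potential \<theta>2 x = potential \<theta>1 y - potential \<theta>1 x + b * (y - x)"
          using elim x by (simp add: eq algebra_simps)
        then show ?case using elim by (simp add: add_divide_distrib)
      qed
    qed
    ultimately show "((\<lambda>y. (potential \<theta>2 y - potential \<theta>2 x) / (y - x)) \<longlongrightarrow> rderiv (potential \<theta>1) x + b) (at_right x)"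
      by (rule Lim_transform_eventually)
  qed
  have ioc: "emeasure \<theta> {x<..y} = ennreal ((rderiv (potential \<theta>) y - rderiv (potential \<theta>) x) / 2)"
    if f: "finite_first_moment \<theta>" and xy: "x \<le> y" for \<theta> x y
  proof -
    interpret finite_measure \<theta> using ffmD(3)[OF f] .
    have "{..y} - {..x} = {x<..y}" by auto
    then have "measure \<theta> {x<..y} = measure \<theta> {..y} - measure \<theta> {..x}"
      using finite_measure_Diff[of "{..y}" "{..x}"] ffmD(1)[OF f] xy by auto
    then have "measure \<theta> {x<..y} = (rderiv (potential \<theta>) y - rderiv (potential \<theta>) x) / 2"
      by (simp add: rderiv_potential[OF f])
    then show ?thesis by (simp only: emeasure_eq_measure)
  qed
  let ?E = "(\<lambda>(a, b). {a<..b}) ` {(a, b). a \<in> U \<and> b \<in> U \<and> a \<le> b}"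
  have sub: "{x<..y} \<subseteq> U" if "x \<in> U" "y \<in> U" for x y using convex_real_mem[OF U(2) that] by auto
  have "restrict_space \<theta>1 U = restrict_space \<theta>2 U"
  proof (rule measure_eqI_generator_eq_countable[where E="?E" and \<Omega>=U
      and A="(\<lambda>(a::rat, b::rat). {real_of_rat a<..real_of_rat b}) ` {(a, b). real_of_rat a \<in> U \<and> real_of_rat b \<in> U \<and> real_of_rat a \<le> real_of_rat b}"])
    show "Int_stable ?E"
    proof (rule Int_stableI)
      fix X Y assume "X \<in> ?E" "Y \<in> ?E"
      then obtain a b a' b' where *: "a \<in> U" "b \<in> U" "a \<le> b" "X = {a<..b}" "a' \<in> U" "b' \<in> U" "a' \<le> b'" "Y = {a'<..b'}" by auto
      then have "X \<inter> Y = {max a a'<..max (max a a') (min b b')}" by (auto simp: max_def min_def)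
      moreover have "max a a' \<in> U" "max (max a a') (min b b') \<in> U" using * by (auto simp: max_def min_def)
      ultimately show "X \<inter> Y \<in> ?E" by (auto intro!: image_eqI[where x="(max a a', max (max a a') (min b b'))"])
    qed
    show "?E \<subseteq> Pow U" using sub by auto
    show "sets (restrict_space \<theta>1 U) = sigma_sets U ?E" "sets (restrict_space \<theta>2 U) = sigma_sets U ?E"
      unfolding sets_Ioc_in_open[OF U] using \<theta>[THEN ffmD(1)] by (auto cong: sets_restrict_space_cong)
    show "emeasure (restrict_space \<theta>1 U) X = emeasure (restrict_space \<theta>2 U) X" if X: "X \<in> ?E" for X
    proof -
      obtain x y where "x \<in> U" "y \<in> U" "x \<le> y" "X = {x<..y}" using X by auto
      then show ?thesis using U \<theta>[THEN ffmD(1)] sub by (simp add: emeasure_restrict_space ioc \<theta> d)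
    qed
    show "\<Union>((\<lambda>(a::rat, b::rat). {real_of_rat a<..real_of_rat b}) ` {(a, b). real_of_rat a \<in> U \<and> real_of_rat b \<in> U \<and> real_of_rat a \<le> real_of_rat b}) = U" (is "?L = U")
    proof
      show "?L \<subseteq> U" using sub by auto
      show "U \<subseteq> ?L"
      proof
        fix x assume x: "x \<in> U"
        then obtain d where d: "d > 0" "\<And>y. \<bar>y - x\<bar> < d \<Longrightarrow> y \<in> U" using U(1) by (auto simp: open_real)
        obtain a where a: "x - d < of_rat a" "of_rat a < x" using of_rat_dense[of "x-d" x] d by auto
        obtain b where b: "x < of_rat b" "of_rat b < x + d" using of_rat_dense[of x "x+d"] d by auto
        have "real_of_rat a \<in> U" "real_of_rat b \<in> U" using a b by (auto intro!: d(2))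
        then show "x \<in> ?L" using a b by force
      qed
    qed
    show "emeasure (restrict_space \<theta>1 U) X \<noteq> \<infinity>" for X
      using finite_measure.emeasure_finite[OF finite_measure_restrict_space[OF ffmD(3)[OF \<theta>(1)]], of U] U \<theta>[THEN ffmD(1)] ffmD(2)[OF \<theta>(1)]
      by simp
  qed auto
  then have "emeasure (restrict_space \<theta>1 U) S = emeasure (restrict_space \<theta>2 U) S" by simp
  then show ?thesis using S U \<theta>[THEN ffmD(1)] by (simp add: emeasure_restrict_space)
qed

text \<open>Both tails are treated at once: s = 1 and s = -1 stand for the limits at minus and plus infinity.\<close>

lemma exists_measure_of_potential:
  assumes le: "pot_le \<mu> \<nu>" and u: "convex_on UNIV u"
    and lu: "\<And>t. potential \<mu> t \<le> u t" and uu: "\<And>t. u t \<le> potential \<nu> t"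
  obtains \<theta> where "finite_first_moment \<theta>" "potential \<theta> = u" "mass \<theta> = mass \<mu>" "mean \<theta> = mean \<mu>"
proof -
  have f: "finite_first_moment \<mu>" "finite_first_moment \<nu>" and eqs: "mass \<nu> = mass \<mu>" "mean \<nu> = mean \<mu>"
    using le by (auto simp: pot_le_def)
  define m b where "m = mass \<mu>" and "b = mean \<mu>"
  \<comment> \<open>Half of \<open>P s x\<close> is to become the integral of max 0 (s * (x - t))
    against the measure sought; for \<mu> and \<nu> the corresponding formula is \<open>hin\<close>,
    which encloses \<open>P s\<close> between their hinge integrals.\<close>
  define P where "P s x = u x + s * (m * x - b)" for s x :: real
  define M where "M = second_deriv_measure UNIV u"
  have sM: "sets M = sets borel" unfolding M_def using sets_second_deriv_measure[OF u] by simp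
  have spM: "space M = UNIV" unfolding M_def using space_second_deriv_measure[OF u] by simp
  have mM: "\<And>g::real \<Rightarrow> ennreal. g \<in> borel_measurable borel \<Longrightarrow> g \<in> borel_measurable M"
    using measurable_cong_sets[OF sM refl] by blast
  have hin: "2 * (LINT z|\<theta>. max 0 (- s * (z - x))) = potential \<theta> x + s * (m * x - b)"
    if "\<theta> = \<mu> \<or> \<theta> = \<nu>" "\<bar>s\<bar> = 1" for \<theta> s x
  proof -
    have g: "finite_first_moment \<theta>" "mass \<theta> = m" "mean \<theta> = b" using that(1) f eqs by (auto simp: m_def b_def)
    show ?thesis unfolding integral_hinge[OF g(1)] g(2,3) using that(2) by (simp add: algebra_simps)
  qed
  have P0: "0 \<le> P s x" if s: "\<bar>s\<bar> = 1" for s x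
  proof -
    have "0 \<le> 2 * (LINT z|\<mu>. max 0 (- s * (z - x)))" by (auto intro!: Bochner_Integration.integral_nonneg)
    also have "\<dots> \<le> P s x" using hin[of \<mu> s x] s lu[of x] by (simp add: P_def)
    finally show ?thesis .
  qed
  have Ple: "P s x \<le> 2 * (LINT z|\<nu>. max 0 (- s * (z - x)))" if s: "\<bar>s\<bar> = 1" for s x
    using hin[of \<nu> s x] s uu[of x] by (simp add: P_def)
  have s2: "s * s = 1" if "\<bar>s\<bar> = 1" for s :: real using that by (auto simp: abs_if split: if_splits)
  \<comment> \<open>Towards the end where the hinge leaves all mass behind, \<open>P s\<close> is
    squeezed between 0 and a hinge integral of \<nu>, which vanishes by dominated
    convergence.\<close>
  have Plim: "(\<lambda>n. P s (- s * (real n * a))) \<longlonglongrightarrow> 0" if s: "\<bar>s\<bar> = 1" and a: "a > 0" for s a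
  proof (rule tendsto_sandwich[OF _ _ tendsto_const])
    show "\<forall>\<^sub>F n in sequentially. 0 \<le> P s (- s * (real n * a))" using P0[OF s] by simp
    show "\<forall>\<^sub>F n in sequentially. P s (- s * (real n * a)) \<le> 2 * (LINT z|\<nu>. max 0 (- s * (z - (- s * (real n * a)))))"
      by (intro always_eventually allI Ple[OF s])
    have "(\<lambda>n. LINT z|\<nu>. max 0 (- s * (z - (- s * (real n * a))))) \<longlonglongrightarrow> (LINT z|\<nu>. 0)"
    proof (rule integral_dominated_convergence[where w="\<lambda>z. \<bar>z\<bar>"])
      have e: "- s * (z - (- s * (real n * a))) = - s * z - real n * a" for z n
      proof -
        have "- s * (z - (- s * (real n * a))) = - s * z - (s * s) * (real n * a)" by algebra
        then show ?thesis using s2[OF s] by simp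
      qed
      show "AE z in \<nu>. (\<lambda>n. max 0 (- s * (z - (- s * (real n * a))))) \<longlonglongrightarrow> 0"
      proof (rule AE_I2)
        fix z
        obtain N :: nat where N: "\<bar>z\<bar> / a < real N" using reals_Archimedean2 by blast
        have "max 0 (- s * (z - (- s * (real n * a)))) = 0" if "n \<ge> N" for n
        proof -
          have "\<bar>z\<bar> < real N * a" using N a by (simp add: field_simps)
          also have "\<dots> \<le> real n * a" using that a by (intro mult_right_mono) auto
          finally have "\<bar>- s * z\<bar> < real n * a" using s by (simp add: abs_mult)
          then show ?thesis unfolding e by auto
        qed
        then show "(\<lambda>n. max 0 (- s * (z - (- s * (real n * a))))) \<longlonglongrightarrow> 0"
          by (intro tendsto_eventually) (auto simp: eventually_sequentially)
      qed
      show "AE z in \<nu>. norm (max 0 (- s * (z - (- s * (real n * a))))) \<le> \<bar>z\<bar>" for n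
        unfolding e
      proof (rule AE_I2)
        fix z
        have "\<bar>- s * z\<bar> = \<bar>z\<bar>" "0 \<le> real n * a" using s a by (auto simp: abs_mult)
        then show "norm (max 0 (- s * z - real n * a)) \<le> \<bar>z\<bar>" by (auto simp: max_def)
      qed
      have mm: "\<And>g::real \<Rightarrow> real. g \<in> borel_measurable borel \<Longrightarrow> g \<in> borel_measurable \<nu>"
        using measurable_cong_sets[OF ffmD(1)[OF f(2)] refl] by blast
      show "(\<lambda>z. max 0 (- s * (z - (- s * (real n * a))))) \<in> borel_measurable \<nu>" for n by (rule mm) measurable
      show "integrable \<nu> (\<lambda>z. \<bar>z\<bar>)" using ffmD(4)[OF f(2)] by (rule integrable_abs)
    qed simp
    from tendsto_mult[OF tendsto_const[of 2] this]
    show "(\<lambda>n. 2 * (LINT z|\<nu>. max 0 (- s * (z - (- s * (real n * a)))))) \<longlonglongrightarrow> 0" by simp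
  qed
  have sub: "P s c + (rderiv u c + s * m) * (y - c) \<le> P s y" for s c y
    using convex_on_right_derivative(2)[OF u _ , of c y] by (simp add: P_def algebra_simps)
  \<comment> \<open>A slope of the wrong sign would make \<open>P s\<close> grow linearly in the
    direction in which it is bounded by a fixed hinge integral of \<nu>.\<close>
  have slope: "0 \<le> s * (rderiv u c + s * m)" if s: "\<bar>s\<bar> = 1" for s c
  proof (rule ccontr)
    assume "\<not> ?thesis"
    then have neg: "s * (rderiv u c + s * m) < 0" by simp
    let ?g = "- (s * (rderiv u c + s * m))"
    have "P s c + ?g * real n \<le> P s (- s * (real n * 1) + c)" for n
      using sub[of s c "c - s * real n"] by (simp add: algebra_simps)
    also have "\<dots> n \<le> 2 * (LINT z|\<nu>. max 0 (- s * (z - c)))" for n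
    proof -
      have "(LINT z|\<nu>. max 0 (- s * (z - (- s * (real n * 1) + c)))) \<le> (LINT z|\<nu>. max 0 (- s * (z - c)))"
      proof (intro integral_mono ffm_integrable_hinge f)
        fix z
        have "- s * (z - (- s * (real n * 1) + c)) = - s * (z - c) - real n"
        proof -
          have "- s * (z - (- s * (real n * 1) + c)) = - s * (z - c) - (s * s) * real n" by algebra
          then show ?thesis using s2[OF s] by simp
        qed
        then show "max 0 (- s * (z - (- s * (real n * 1) + c))) \<le> max 0 (- s * (z - c))" by auto
      qed
      with Ple[OF s, of "- s * (real n * 1) + c"] show ?thesis by simp
    qed
    finally have *: "P s c + ?g * real n \<le> 2 * (LINT z|\<nu>. max 0 (- s * (z - c)))" for n .
    obtain n :: nat where "2 * (LINT z|\<nu>. max 0 (- s * (z - c))) / ?g < real n" using reals_Archimedean2 by blast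
    then have "2 * (LINT z|\<nu>. max 0 (- s * (z - c))) < ?g * real n" using neg by (simp add: field_simps)
    with *[of n] P0[OF s, of c] show False by simp
  qed
  have hinge: "(\<integral>\<^sup>+t. ennreal (max 0 (s * (x - t))) \<partial>M) = ennreal (P s x)" if s: "\<bar>s\<bar> = 1" for s x
  proof -
    obtain n0 :: nat where n0: "\<bar>x\<bar> < real n0" using reals_Archimedean2 by blast
    \<comment> \<open>The base point of the kernel is sent to the end -s * infinity, starting beyond
      x. The kernel then increases to the full hinge, and the tangent at \<open>c n\<close> has to
      be shown to disappear.\<close>
    define c where "c n = - s * (real (n + n0))" for n
    have sx: "\<bar>s * x\<bar> = \<bar>x\<bar>" using s by (simp add: abs_mult)
    have sc: "s * c n = - real (n + n0)" for n
    proof -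
      have "s * c n = - ((s * s) * real (n + n0))" unfolding c_def by algebra
      then show ?thesis using s2[OF s] by simp
    qed
    have s1: "s = 1 \<or> s = -1" using s by (auto simp: abs_if split: if_splits)
    \<comment> \<open>The extra case for s = -1 comes from the convention that the kink t = c
      belongs to the left branch of \<open>krn\<close>.\<close>
    have K: "krn UNIV (c n) t x = (if - real (n + n0) < s * t \<or> s = -1 \<and> - real (n + n0) = s * t then max 0 (s * (x - t)) else 0)" for n t
      using s1
    proof
      assume [simp]: "s = 1"
      have "c n < x" using n0 by (simp add: c_def)
      then show ?thesis by (auto simp: krn_def c_def)
    next
      assume [simp]: "s = -1"
      have "x < c n" using n0 by (simp add: c_def)
      then show ?thesis by (auto simp: krn_def c_def)
    qed
    have I: "(\<integral>\<^sup>+t. ennreal (krn UNIV (c n) t x) \<partial>M) = ennreal (P s x - (P s (c n) + (rderiv u (c n) + s * m) * (x - c n)))" for n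
      unfolding M_def by (subst whole.hinge_integral_I[OF u]) (auto simp: P_def algebra_simps)
    have "(\<lambda>n. \<integral>\<^sup>+t. ennreal (krn UNIV (c n) t x) \<partial>M) \<longlonglongrightarrow> (\<integral>\<^sup>+t. ennreal (max 0 (s * (x - t))) \<partial>M)"
    proof (rule nn_integral_LIMSEQ)
      show "incseq (\<lambda>n t. ennreal (krn UNIV (c n) t x))"
      proof (intro incseq_SucI le_funI ennreal_leI)
        fix k t
        have lt: "- real (Suc k + n0) < - real (k + n0)" by simp
        show "krn UNIV (c k) t x \<le> krn UNIV (c (Suc k)) t x"
        proof (cases "- real (Suc k + n0) < s * t")
          case True
          then have "krn UNIV (c (Suc k)) t x = max 0 (s * (x - t))" using K[of "Suc k" t] by presburger
          then show ?thesis using K[of k t] by (metis max.cobounded1 order_refl)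
        next
          case False
          then have "krn UNIV (c k) t x = 0" using K[of k t] lt by (smt (verit))
          then show ?thesis by simp
        qed
      qed
      show "(\<lambda>n. ennreal (krn UNIV (c n) t x)) \<longlonglongrightarrow> ennreal (max 0 (s * (x - t)))" for t
      proof (rule tendsto_eventually)
        obtain N :: nat where N: "- (s * t) < real N" using reals_Archimedean2 by blast
        show "\<forall>\<^sub>F n in sequentially. ennreal (krn UNIV (c n) t x) = ennreal (max 0 (s * (x - t)))"
          unfolding eventually_sequentially
        proof (intro exI[of _ N] allI impI)
          fix n assume "N \<le> n"
          then have "- real (n + n0) < s * t" using N by simp
          then show "ennreal (krn UNIV (c n) t x) = ennreal (max 0 (s * (x - t)))" using K[of n t] by presburger
        qed
      qed
      show "(\<lambda>t. ennreal (krn UNIV (c n) t x)) \<in> borel_measurable M" for n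
        by (rule mM) (rule measurable_compose[OF whole.measurable_krn1 measurable_ennreal])
    qed
    moreover have "(\<lambda>n. P s x - (P s (c n) + (rderiv u (c n) + s * m) * (x - c n))) \<longlonglongrightarrow> P s x - (0 + 0)"
    proof (intro tendsto_diff tendsto_const tendsto_add)
      show "(\<lambda>n. P s (c n)) \<longlonglongrightarrow> 0" using LIMSEQ_ignore_initial_segment[OF Plim[OF s, of 1], of n0] by (simp add: c_def)
      show "(\<lambda>n. (rderiv u (c n) + s * m) * (x - c n)) \<longlonglongrightarrow> 0"
      proof (rule tendsto_sandwich[OF _ _ tendsto_const])
        have e: "(rderiv u (c n) + s * m) * (x - c n) = (s * (rderiv u (c n) + s * m)) * (s * x + real (n + n0))" for n
        proof -
          have "(s * (rderiv u (c n) + s * m)) * (s * x + real (n + n0)) = (s * (rderiv u (c n) + s * m)) * (s * (x - c n))"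
          proof -
            have "s * (x - c n) = s * x + real (n + n0)" using sc[of n] by (simp add: right_diff_distrib)
            then show ?thesis by (simp only:)
          qed
          also have "\<dots> = (s * s) * ((rderiv u (c n) + s * m) * (x - c n))" by (simp only: mult_ac)
          finally show ?thesis unfolding s2[OF s] mult_1_left by (rule sym)
        qed
        have pos: "0 \<le> s * x + real (n + n0)" "s * x + real (n + n0) \<le> 4 * (real (n + n0) * (1/2))" for n
          using sx n0 by auto
        show "\<forall>\<^sub>F n in sequentially. 0 \<le> (rderiv u (c n) + s * m) * (x - c n)"
          unfolding e by (intro always_eventually allI mult_nonneg_nonneg[OF slope[OF s] pos(1)])
        show "\<forall>\<^sub>F n in sequentially. (rderiv u (c n) + s * m) * (x - c n) \<le> 4 * P s (- s * (real (n + n0) * (1/2)))"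
        proof (intro always_eventually allI)
          fix n
          \<comment> \<open>Halfway between 0 and \<open>c n\<close> the supporting line at
            \<open>c n\<close> already has half of |c n| behind it, so slope times that distance is
            at most \<open>P s ?y\<close>. The distance from \<open>c n\<close> to x is at most 2 *
            (n + n0), four times as large, which explains the factor 4.\<close>
          let ?y = "- s * (real (n + n0) * (1/2))"
          have "s * (?y - c n) = real (n + n0) * (1/2)"
          proof -
            have "s * (?y - c n) = - ((s * s) * (real (n + n0) * (1/2))) - s * c n" by algebra
            then have "s * (?y - c n) = - (1 * (real (n + n0) * (1/2))) - - real (n + n0)" by (simp only: sc s2[OF s])
            moreover have "- (1 * (r * (1/2))) - - r = r * (1/2)" for r :: real by (simp add: field_simps)
            ultimately show ?thesis by (simp only:)
          qed
          then have "(s * (rderiv u (c n) + s * m)) * (real (n + n0) * (1/2)) = (s * s) * ((rderiv u (c n) + s * m) * (?y - c n))"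
            by (metis mult.assoc mult.commute mult.left_commute)
          also have "\<dots> \<le> P s ?y" using sub[of s "c n" ?y] P0[OF s, of "c n"] s2[OF s] by simp
          finally have "(s * (rderiv u (c n) + s * m)) * (real (n + n0) * (1/2)) \<le> P s ?y" .
          then have 4: "4 * ((s * (rderiv u (c n) + s * m)) * (real (n + n0) * (1/2))) \<le> 4 * P s ?y"
            by (rule mult_left_mono) simp
          have "(s * (rderiv u (c n) + s * m)) * (s * x + real (n + n0)) \<le> (s * (rderiv u (c n) + s * m)) * (4 * (real (n + n0) * (1/2)))"
            by (rule mult_left_mono[OF pos(2) slope[OF s]])
          also have "\<dots> = 4 * ((s * (rderiv u (c n) + s * m)) * (real (n + n0) * (1/2)))" by (simp only: mult.left_commute)
          also note 4
          finally show "(rderiv u (c n) + s * m) * (x - c n) \<le> 4 * P s ?y" unfolding e .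
        qed
        from tendsto_mult[OF tendsto_const[of 4] LIMSEQ_ignore_initial_segment[OF Plim[OF s, of "1/2"], of n0]]
        show "(\<lambda>n. 4 * P s (- s * (real (n + n0) * (1/2)))) \<longlonglongrightarrow> 0" by simp
      qed
    qed
    from tendsto_ennrealI[OF this] have "(\<lambda>n. \<integral>\<^sup>+t. ennreal (krn UNIV (c n) t x) \<partial>M) \<longlonglongrightarrow> ennreal (P s x)"
      unfolding I by simp
    ultimately show ?thesis using LIMSEQ_unique by blast
  qed
  note hp = hinge[of 1, simplified] and hm = hinge[of "-1", simplified]
  \<comment> \<open>The second derivative of a potential is twice the measure.\<close>
  define \<theta> where "\<theta> = scale_measure (1 / 2) M"
  have s\<theta>: "sets \<theta> = sets borel" "space \<theta> = UNIV" by (simp_all add: \<theta>_def sM spM space_scale_measure)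
  have m\<theta>: "\<And>g::real \<Rightarrow> real. g \<in> borel_measurable borel \<Longrightarrow> g \<in> borel_measurable \<theta>"
    using measurable_cong_sets[OF s\<theta>(1) refl] by blast
  have n\<theta>: "(\<integral>\<^sup>+t. g t \<partial>\<theta>) = 1 / 2 * (\<integral>\<^sup>+t. g t \<partial>M)" if "g \<in> borel_measurable borel" for g
    unfolding \<theta>_def by (rule nn_integral_scale_measure[OF mM[OF that]])
  have half: "1 / 2 * ennreal r = ennreal (r / 2)" if "0 \<le> r" for r
    using that by (simp add: divide_ennreal[symmetric] ennreal_divide_times mult.commute ennreal_times_divide)
  have hs: "has_bochner_integral \<theta> (\<lambda>t. max 0 (s * (x - t))) (P s x / 2)" if "\<bar>s\<bar> = 1" for s x
  proof (rule has_bochner_integral_nn_integral)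
    show "(\<integral>\<^sup>+t. ennreal (max 0 (s * (x - t))) \<partial>\<theta>) = ennreal (P s x / 2)"
      using P0[OF that] by (subst n\<theta>) (auto simp: hinge[OF that] half)
  qed (use P0[OF that] in \<open>auto intro!: m\<theta>\<close>)
  have fin: "finite_measure \<theta>"
  proof
    have "emeasure \<theta> UNIV = (\<integral>\<^sup>+t. 1 \<partial>\<theta>)" using s\<theta> by simp
    also have "\<dots> \<le> (\<integral>\<^sup>+t. ennreal (max 0 (1 * (1 - t)) + max 0 (-1 * (-1 - t))) \<partial>\<theta>)"
    proof (rule nn_integral_mono)
      fix t :: real
      have "1 \<le> max 0 (1 * (1 - t)) + max 0 (-1 * (-1 - t))" by auto
      from ennreal_leI[OF this] show "1 \<le> ennreal (max 0 (1 * (1 - t)) + max 0 (-1 * (-1 - t)))" by simp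
    qed
    also have "\<dots> < \<infinity>"
    proof -
      have "integrable \<theta> (\<lambda>t. max 0 (1 * (1 - t)) + max 0 (-1 * (-1 - t)))"
        using hs[of 1 1] hs[of "-1" "-1"] by (intro Bochner_Integration.integrable_add) (auto simp: has_bochner_integral_iff)
      then show ?thesis by (auto simp: integrable_iff_bounded)
    qed
    finally show "emeasure \<theta> (space \<theta>) \<noteq> \<infinity>" using s\<theta> by simp
  qed
  interpret finite_measure \<theta> by (rule fin)
  have h1: "has_bochner_integral \<theta> (\<lambda>t. \<bar>x - t\<bar>) (u x)" for x
  proof -
    have "has_bochner_integral \<theta> (\<lambda>t. max 0 (1 * (x - t)) + max 0 (-1 * (x - t))) (P 1 x / 2 + P (-1) x / 2)"
      by (intro has_bochner_integral_add hs) auto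
    moreover have "(\<lambda>t. max 0 (1 * (x - t)) + max 0 (-1 * (x - t))) = (\<lambda>t. \<bar>x - t\<bar>)" by (auto simp: fun_eq_iff)
    moreover have "P 1 x / 2 + P (-1) x / 2 = u x" by (simp add: P_def field_simps)
    ultimately show ?thesis by simp
  qed
  have h2: "has_bochner_integral \<theta> (\<lambda>t. x - t) (m * x - b)" for x
  proof -
    have "has_bochner_integral \<theta> (\<lambda>t. max 0 (1 * (x - t)) - max 0 (-1 * (x - t))) (P 1 x / 2 - P (-1) x / 2)"
      by (intro has_bochner_integral_diff hs) auto
    moreover have "(\<lambda>t. max 0 (1 * (x - t)) - max 0 (-1 * (x - t))) = (\<lambda>t. x - t)" by (auto simp: fun_eq_iff)
    moreover have "P 1 x / 2 - P (-1) x / 2 = m * x - b" by (simp add: P_def field_simps)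
    ultimately show ?thesis by simp
  qed
  have h3: "has_bochner_integral \<theta> (\<lambda>t. t) b"
    using has_bochner_integral_minus[OF h2[of 0]] by simp
  have h4: "has_bochner_integral \<theta> (\<lambda>t. 1) m"
    using has_bochner_integral_add[OF h2[of 1] h3] by simp
  show thesis
  proof (rule that[of \<theta>])
    show "finite_first_moment \<theta>" using s\<theta> fin h3 by (auto simp: finite_first_moment_def has_bochner_integral_iff)
    show "potential \<theta> = u" using h1 by (auto simp: potential_def has_bochner_integral_iff)
    show "mass \<theta> = mass \<mu>" using h4 s\<theta> by (simp add: has_bochner_integral_iff m_def)
    show "mean \<theta> = mean \<mu>" using h3 by (simp add: has_bochner_integral_iff b_def)
  qed
qed

section \<open>Irreducible pairs\<close>

text \<open>A nonempty I is required to have a base point for tangents; the case of empty I is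
  \<open>degenerate_duality\<close>.\<close>

locale irreducible =
  fixes \<mu> \<nu> :: "real measure"
  assumes ffm_\<mu>: "finite_first_moment \<mu>" and ffm_\<nu>: "finite_first_moment \<nu>"
    and irr: "irreducible_pair \<mu> \<nu>" and dom_ne: "dom_I \<mu> \<nu> \<noteq> {}"
begin

abbreviation I where "I \<equiv> dom_I \<mu> \<nu>"
abbreviation J where "J \<equiv> dom_J \<mu> \<nu>"

definition d :: "real \<Rightarrow> real" where "d t = potential \<nu> t - potential \<mu> t"

lemma pot_le_\<mu>\<nu>: "pot_le \<mu> \<nu>"
  using convex_order_imp_pot_le[OF ffm_\<mu> ffm_\<nu>] irr by (simp add: irreducible_pair_def)

lemma d_nonneg: "0 \<le> d t" using pot_le_\<mu>\<nu> by (simp add: pot_le_def d_def)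
lemma d_pos: "t \<in> I \<longleftrightarrow> 0 < d t" by (simp add: dom_I_def d_def)
lemma d_zero: "t \<notin> I \<Longrightarrow> d t = 0" using d_pos d_nonneg by (metis order_le_less)
lemma continuous_d: "continuous_on S d"
  unfolding d_def[abs_def] by (intro continuous_intros continuous_potential(2) ffm_\<mu> ffm_\<nu>)

lemma open_dom: "open I"
  unfolding dom_I_def using continuous_potential(2) ffm_\<mu> ffm_\<nu> by (intro open_Collect_less) auto

lemma convex_dom: "convex I"
  using irr by (simp add: irreducible_pair_def is_interval_connected_1 flip: is_interval_convex_1)

text \<open>Intermediate measures are first shown to live on closure I; the ends outside J can be
  removed only afterwards, in \<open>carried_between\<close>.\<close>

sublocale cl: interval_pair I "closure I"
proof
  show "open I" "convex I" "I \<noteq> {}" by (rule open_dom convex_dom dom_ne)+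
  show "convex (closure I)" by (rule convex_closure[OF convex_dom])
  show "I \<subseteq> closure I" by (rule closure_subset)
  show "closure I - I \<subseteq> frontier I" by (simp add: frontier_def interior_open open_dom)
qed

sublocale interval_pair I J
proof
  show "open I" "convex I" "I \<noteq> {}" by (rule open_dom convex_dom dom_ne)+
  show "I \<subseteq> J" "J - I \<subseteq> frontier I" by (auto simp: dom_J_def)
  have Jc: "J \<subseteq> closure I" by (auto simp: dom_J_def frontier_def intro: closure_subset[THEN subsetD])
  obtain c where c: "c \<in> I" using dom_ne by auto
  have bt: "x \<in> J" if ab: "a \<in> J" "b \<in> J" and x: "a \<le> x" "x \<le> b" for a b x
  proof -
    have "x = a \<or> x = b \<or> x = c \<or> x \<in> I"
      using cl.between_in_I[OF c, of a x] cl.between_in_I[OF c, of b x] Jc ab x by fastforce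
    then show ?thesis using ab c by (auto simp: dom_J_def)
  qed
  show "convex J" unfolding is_interval_convex_1[symmetric] is_interval_1 using bt by blast
qed

lemma AE_\<mu>_I: "AE x in \<mu>. x \<in> I"
proof -
  interpret finite_measure \<mu> using ffmD(3)[OF ffm_\<mu>] .
  have "emeasure \<mu> (space \<mu> - I) = emeasure \<mu> (space \<mu>) - emeasure \<mu> I"
    using ffmD[OF ffm_\<mu>] by (intro emeasure_compl) auto
  also have "\<dots> = 0" using irr ffmD(2)[OF ffm_\<mu>] by (simp add: irreducible_pair_def)
  finally show ?thesis using ffmD[OF ffm_\<mu>] by (intro AE_I[of _ _ "space \<mu> - I"]) auto
qed

lemma carried_\<mu>: "carried \<mu>"
  using AE_\<mu>_I ffm_\<mu> I_J by (auto simp: carried_def)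

lemma \<mu>_end: "e \<notin> I \<Longrightarrow> measure \<mu> {e} = 0"
proof -
  assume e: "e \<notin> I"
  interpret finite_measure \<mu> using ffmD(3)[OF ffm_\<mu>] .
  have "AE x in \<mu>. x \<notin> {e}" using AE_\<mu>_I by eventually_elim (use e in auto)
  then have "{e} \<in> null_sets \<mu>" using ffmD[OF ffm_\<mu>] by (subst (asm) AE_iff_null_sets[symmetric]) auto
  then show ?thesis by (simp add: measure_eq_0_null_sets)
qed

text \<open>At t outside I the potentials of \<mu>, \<theta> and \<nu> coincide. A hinge with kink t
  that opens away from I has \<mu>-integral 0, hence also \<theta>-integral 0, so \<theta> has no
  mass beyond t.\<close>

lemma cl_carried:
  assumes \<theta>: "pot_le \<mu> \<theta>" "pot_le \<theta> \<nu>"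
  shows "cl.carried \<theta>"
proof -
  have f: "finite_first_moment \<theta>" using \<theta> by (simp add: pot_le_def)
  have side: "AE x in \<theta>. s * (x - t) \<le> 0" if t: "t \<notin> I" and s: "\<bar>s\<bar> = 1" and side: "\<And>x. x \<in> I \<Longrightarrow> s * (x - t) \<le> 0" for s t
  proof -
    have "(LINT x|\<mu>. max 0 (s * (x - t))) = (LINT x|\<mu>. 0)"
      by (intro integral_cong_AE, insert AE_\<mu>_I) (auto intro!: measurable_carried[OF carried_\<mu>] simp: max_def dest!: side elim: eventually_mono)
    moreover have "potential \<theta> t = potential \<mu> t"
    proof (rule antisym)
      have "potential \<theta> t \<le> potential \<nu> t" using \<theta>(2) by (simp add: pot_le_def)
      then show "potential \<theta> t \<le> potential \<mu> t" using d_zero[OF t] by (simp add: d_def)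
    qed (use \<theta>(1) in \<open>simp add: pot_le_def\<close>)
    ultimately have "(LINT x|\<theta>. max 0 (s * (x - t))) = 0"
      using pot_le_hinge[OF \<theta>(1), of s t] by simp
    then have "AE x in \<theta>. max 0 (s * (x - t)) = 0"
      using integral_nonneg_eq_0_iff_AE[OF ffm_integrable_hinge[OF f], of s t] by simp
    then show ?thesis by eventually_elim (metis max.cobounded2)
  qed
  have up: "AE x in \<theta>. x \<le> Sup I" if b: "bdd_above I"
  proof -
    have "Sup I \<notin> I"
    proof
      assume "Sup I \<in> I"
      then obtain e where "e > 0" "\<And>y. \<bar>y - Sup I\<bar> < e \<Longrightarrow> y \<in> I" using open_I by (auto simp: open_real)
      from this(2)[of "Sup I + e / 2"] this(1) cSup_upper[OF _ b, of "Sup I + e / 2"] show False by auto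
    qed
    from side[OF this, of 1] cSup_upper[OF _ b] show ?thesis by simp
  qed
  have down: "AE x in \<theta>. Inf I \<le> x" if b: "bdd_below I"
  proof -
    have "Inf I \<notin> I"
    proof
      assume "Inf I \<in> I"
      then obtain e where "e > 0" "\<And>y. \<bar>y - Inf I\<bar> < e \<Longrightarrow> y \<in> I" using open_I by (auto simp: open_real)
      from this(2)[of "Inf I - e / 2"] this(1) cInf_lower[OF _ b, of "Inf I - e / 2"] show False by auto
    qed
    from side[OF this, of "-1"] cInf_lower[OF _ b] show ?thesis by simp
  qed
  have "AE x in \<theta>. (bdd_above I \<longrightarrow> x \<le> Sup I) \<and> (bdd_below I \<longrightarrow> Inf I \<le> x)"
    using up down by (auto simp: AE_conj_iff)
  then have "AE x in \<theta>. x \<in> closure I"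
  proof eventually_elim
    case (elim x)
    show ?case unfolding closure_approachable
    proof (intro allI impI)
      fix e :: real assume e: "0 < e"
      have 1: "\<exists>p\<in>I. p < x + e"
      proof (cases "bdd_below I")
        case True
        then show ?thesis using elim e cInf_lessD[OF dom_ne, of "x + e"] by auto
      next
        case False
        then show ?thesis unfolding bdd_below_def by (metis not_le)
      qed
      have 2: "\<exists>p\<in>I. x - e < p"
      proof (cases "bdd_above I")
        case True
        then show ?thesis using elim e less_cSup_iff[OF dom_ne True, of "x - e"] by auto
      next
        case False
        then show ?thesis unfolding bdd_above_def by (metis not_le)
      qed
      obtain p q where pq: "p \<in> I" "p < x + e" "q \<in> I" "x - e < q" using 1 2 by auto
      show "\<exists>y\<in>I. dist y x < e"
      proof (cases "x - e < p \<or> q < x + e")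
        case True
        then show ?thesis using pq by (auto simp: dist_real_def intro: bexI[of _ p] bexI[of _ q])
      next
        case False
        then have "p \<le> x" "x \<le> q" using e by auto
        then show ?thesis using convex_real_mem[OF convex_dom pq(1,3)] e by (intro bexI[of _ x]) auto
      qed
    qed
  qed
  then show ?thesis using f by (simp add: cl.carried_def)
qed

text \<open>An end outside J is no atom of \<nu>, hence none of \<theta> by
  \<open>end_atom_mono\<close> for the pair (I, closure I); there are only finitely many such
  ends.\<close>

lemma carried_between:
  assumes \<theta>: "pot_le \<mu> \<theta>" "pot_le \<theta> \<nu>"
  shows "carried \<theta>"
proof -
  have f: "finite_first_moment \<theta>" using \<theta> by (simp add: pot_le_def)
  interpret T: finite_measure \<theta> using ffmD(3)[OF f] .
  interpret N: finite_measure \<nu> using ffmD(3)[OF ffm_\<nu>] .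
  have n: "pot_le \<nu> \<nu>" using ffm_\<nu> by (simp add: pot_le_def)
  have "e \<in> null_sets \<theta>" if e: "e \<in> (\<lambda>e. {e}) ` (closure I - J)" for e
  proof -
    obtain x where x: "x \<in> closure I - J" "e = {x}" using e by auto
    then have xe: "x \<in> closure I - I" using I_J by auto
    then have "x \<in> frontier I" by (simp add: frontier_def interior_open open_dom)
    then have "measure \<nu> {x} = 0" using x(1) xe by (auto simp: dom_J_def N.emeasure_eq_measure zero_less_measure_iff)
    then have "measure \<theta> {x} = 0"
      using cl.end_atom_mono[OF xe cl_carried[OF \<theta>] cl_carried[OF pot_le_\<mu>\<nu> n] \<theta>(2)] by (simp add: measure_le_0_iff)
    then show ?thesis using x(2) ffmD(1)[OF f] by (auto simp: null_sets_def T.emeasure_eq_measure)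
  qed
  moreover have "countable (closure I - J)"
    using finite_subset[OF _ cl.finite_ends, of "closure I - J"] I_J by (auto intro!: countable_finite)
  ultimately have "(\<Union>e\<in>closure I - J. {e}) \<in> null_sets \<theta>"
    by (intro null_sets_UN') auto
  then have "AE x in \<theta>. x \<notin> closure I - J" using AE_not_in by fastforce
  moreover have "AE x in \<theta>. x \<in> closure I" using cl_carried[OF \<theta>] by (simp add: cl.carried_def)
  ultimately have "AE x in \<theta>. x \<in> J" by eventually_elim auto
  then show ?thesis using f by (simp add: carried_def)
qed

lemma carried_\<nu>: "carried \<nu>"
  using carried_between[OF pot_le_\<mu>\<nu>] ffm_\<nu> by (simp add: pot_le_def)

lemma \<nu>_end_pos: "e \<in> J - I \<Longrightarrow> 0 < measure \<nu> {e}"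
  using finite_measure.emeasure_eq_measure[OF ffmD(3)[OF ffm_\<nu>]] by (auto simp: dom_J_def)

lemma pot_diff_pos: "t \<in> J \<Longrightarrow> 0 < pot_diff \<mu> \<nu> t"
  using d_pos[of t] \<nu>_end_pos[of t] \<mu>_end[of t] by (auto simp: pot_diff_def d_def)

text \<open>Compactness of the segment from c to x, with irreducibility in quantitative form. If no
  constant worked, pot_diff / |x - t| would tend to 0 along points of I with a limit l in the
  segment. For l in I this contradicts u_\<mu> < u_\<nu>; otherwise l = x is an end in J, and the
  quotient tends to the atom of \<nu> at x, which is positive.\<close>

lemma krn_le_pot_diff:
  assumes c: "c \<in> I" and x: "x \<in> J"
  obtains B where "0 \<le> B" "\<And>t. t \<in> J \<Longrightarrow> krn I c t x \<le> B * pot_diff \<mu> \<nu> t"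
proof -
  have "\<exists>n::nat. \<forall>t\<in>I. t \<in> closed_segment c x \<longrightarrow> \<bar>x - t\<bar> \<le> real (Suc n) * pot_diff \<mu> \<nu> t"
  proof (rule ccontr)
    assume "\<not> ?thesis"
    then obtain T where T: "\<And>n. T n \<in> I" "\<And>n. T n \<in> closed_segment c x" "\<And>n::nat. real (Suc n) * pot_diff \<mu> \<nu> (T n) < \<bar>x - T n\<bar>"
      by (metis not_le)
    have "compact (closed_segment c x)" by simp
    then obtain l r where l: "l \<in> closed_segment c x" "strict_mono r" "(T \<circ> r) \<longlonglongrightarrow> l"
      using T(2) unfolding compact_def by meson
    have tnz: "T n \<noteq> x" for n
    proof
      assume "T n = x"
      then have "real (Suc n) * pot_diff \<mu> \<nu> (T n) < 0" using T(3)[of n] by simp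
      moreover have "0 < pot_diff \<mu> \<nu> (T n)" using T(1)[of n] I_J by (intro pot_diff_pos) auto
      ultimately show False by (simp add: mult_less_0_iff)
    qed
    have small: "(\<lambda>n. pot_diff \<mu> \<nu> (T (r n)) / \<bar>x - T (r n)\<bar>) \<longlonglongrightarrow> 0"
    proof (rule tendsto_sandwich[OF _ _ tendsto_const])
      show "\<forall>\<^sub>F n in sequentially. 0 \<le> pot_diff \<mu> \<nu> (T (r n)) / \<bar>x - T (r n)\<bar>"
        using pot_diff_pos T(1) I_J by (intro always_eventually allI divide_nonneg_nonneg) (auto intro: less_imp_le)
      show "\<forall>\<^sub>F n in sequentially. pot_diff \<mu> \<nu> (T (r n)) / \<bar>x - T (r n)\<bar> \<le> inverse (real (Suc (r n)))"
        using T(3) tnz by (intro always_eventually allI) (auto simp: divide_simps mult.commute intro: less_imp_le)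
      show "(\<lambda>n. inverse (real (Suc (r n)))) \<longlonglongrightarrow> 0"
        using LIMSEQ_subseq_LIMSEQ[OF LIMSEQ_inverse_real_of_nat l(2)] by (simp add: comp_def)
    qed
    show False
    proof (cases "l \<in> I")
      case True
      have bnd: "\<bar>x - T (r n)\<bar> \<le> \<bar>x - c\<bar>" for n using T(2)[of "r n"] by (auto simp: closed_segment_eq_real_ivl split: if_splits)
      have "(\<lambda>n. pot_diff \<mu> \<nu> (T (r n))) \<longlonglongrightarrow> 0"
      proof (rule tendsto_sandwich[OF _ _ tendsto_const])
        show "\<forall>\<^sub>F n in sequentially. 0 \<le> pot_diff \<mu> \<nu> (T (r n))"
          using pot_diff_pos T(1) I_J by (intro always_eventually allI) (auto intro: less_imp_le)
        show "\<forall>\<^sub>F n in sequentially. pot_diff \<mu> \<nu> (T (r n)) \<le> pot_diff \<mu> \<nu> (T (r n)) / \<bar>x - T (r n)\<bar> * \<bar>x - c\<bar>"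
        proof (intro always_eventually allI)
          fix n
          have "pot_diff \<mu> \<nu> (T (r n)) = pot_diff \<mu> \<nu> (T (r n)) / \<bar>x - T (r n)\<bar> * \<bar>x - T (r n)\<bar>" using tnz[of "r n"] by simp
          also have "\<dots> \<le> pot_diff \<mu> \<nu> (T (r n)) / \<bar>x - T (r n)\<bar> * \<bar>x - c\<bar>"
            using bnd[of n] pot_diff_pos[of "T (r n)"] T(1)[of "r n"] I_J by (intro mult_left_mono divide_nonneg_nonneg) auto
          finally show "pot_diff \<mu> \<nu> (T (r n)) \<le> pot_diff \<mu> \<nu> (T (r n)) / \<bar>x - T (r n)\<bar> * \<bar>x - c\<bar>" .
        qed
        show "(\<lambda>n. pot_diff \<mu> \<nu> (T (r n)) / \<bar>x - T (r n)\<bar> * \<bar>x - c\<bar>) \<longlonglongrightarrow> 0"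
          using tendsto_mult[OF small tendsto_const[of "\<bar>x - c\<bar>"]] by simp
      qed
      moreover have "(\<lambda>n. pot_diff \<mu> \<nu> (T (r n))) \<longlonglongrightarrow> d l / 2"
      proof -
        have "isCont d l" using continuous_d[of UNIV] by (simp add: continuous_on_eq_continuous_at)
        from isCont_tendsto_compose[OF this l(3)[unfolded comp_def]]
        show ?thesis using T(1) by (auto simp: pot_diff_def d_def intro!: tendsto_divide)
      qed
      ultimately have "d l = 0" using LIMSEQ_unique by fastforce
      with True d_pos[of l] show False by simp
    next
      case False
      have lx: "l = x"
      proof (rule ccontr)
        assume "l \<noteq> x"
        moreover have "l \<noteq> c" using c False by auto
        ultimately have "c < l \<and> l < x \<or> x < l \<and> l < c"
          using l(1) by (auto simp: closed_segment_eq_real_ivl split: if_splits)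
        with between_in_I[OF c x] False show False by blast
      qed
      then have e: "x \<in> J - I" using x False by simp
      have lim: "(\<lambda>n. (LINT y|\<theta>. max 0 ((y - T (r n)) / (x - T (r n))))) \<longlonglongrightarrow> measure \<theta> {x}" if "carried \<theta>" for \<theta>
        using end_hinge_limit(1)[OF e that, of "\<lambda>n. T (r n)"] T(1) l(3) lx by (simp add: comp_def)
      have "(\<lambda>n. (LINT y|\<nu>. max 0 ((y - T (r n)) / (x - T (r n)))) - (LINT y|\<mu>. max 0 ((y - T (r n)) / (x - T (r n)))))
          \<longlonglongrightarrow> measure \<nu> {x} - measure \<mu> {x}"
        by (intro tendsto_diff lim carried_\<mu> carried_\<nu>)
      moreover have "(LINT y|\<nu>. max 0 ((y - T (r n)) / (x - T (r n)))) - (LINT y|\<mu>. max 0 ((y - T (r n)) / (x - T (r n))))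
          = pot_diff \<mu> \<nu> (T (r n)) / \<bar>x - T (r n)\<bar>" for n
        using pot_le_hinge[OF pot_le_\<mu>\<nu>, of "1 / (x - T (r n))" "T (r n)"] T(1)[of "r n"] by (simp add: pot_diff_def)
      ultimately have "(\<lambda>n. pot_diff \<mu> \<nu> (T (r n)) / \<bar>x - T (r n)\<bar>) \<longlonglongrightarrow> measure \<nu> {x} - measure \<mu> {x}"
        by simp
      from LIMSEQ_unique[OF this small] have "measure \<nu> {x} - measure \<mu> {x} = 0" .
      with \<nu>_end_pos[OF e] \<mu>_end[of x] e show False by simp
    qed
  qed
  then obtain n :: nat where n: "\<And>t. t \<in> I \<Longrightarrow> t \<in> closed_segment c x \<Longrightarrow> \<bar>x - t\<bar> \<le> real (Suc n) * pot_diff \<mu> \<nu> t" by blast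
  \<comment> \<open>The second argument of the maximum serves the kernel at t = x when x is an end,
    which is 1 there and outside the reach of the segment estimate.\<close>
  define B where "B = (if x \<in> I then real (Suc n) else max (real (Suc n)) (1 / pot_diff \<mu> \<nu> x))"
  show thesis
  proof (rule that[of B])
    show "0 \<le> B" by (auto simp: B_def)
    fix t assume t: "t \<in> J"
    have B: "real (Suc n) * pot_diff \<mu> \<nu> t \<le> B * pot_diff \<mu> \<nu> t"
      using pot_diff_pos[OF t] by (intro mult_right_mono) (auto simp: B_def)
    have B0: "0 \<le> B * pot_diff \<mu> \<nu> t" using B pot_diff_pos[OF t] by (smt (verit) mult_nonneg_nonneg of_nat_0_le_iff)
    show "krn I c t x \<le> B * pot_diff \<mu> \<nu> t"
    proof (cases "t \<in> I")
      case True
      show ?thesis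
      proof (cases "t \<in> closed_segment c x")
        case seg: True
        have "krn I c t x \<le> \<bar>x - t\<bar>" unfolding krn_def by (simp add: True) linarith
        then show ?thesis using n[OF True seg] B by linarith
      next
        case False
        then have "krn I c t x = 0" using True by (auto simp: krn_def closed_segment_eq_real_ivl split: if_splits)
        then show ?thesis using B0 by simp
      qed
    next
      case False
      show ?thesis
      proof (cases "x = t")
        case True
        have "1 = 1 / pot_diff \<mu> \<nu> x * pot_diff \<mu> \<nu> t" using pot_diff_pos[OF t] True by simp
        also have "\<dots> \<le> B * pot_diff \<mu> \<nu> t"
          using pot_diff_pos[OF t] False True by (intro mult_right_mono) (auto simp: B_def)
        finally show ?thesis using True False by (simp add: krn_def)
      qed (use False B0 in \<open>simp add: krn_def\<close>)
    qed
  qed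
qed

text \<open>Source of all pointwise compactness: B depends on x and c but not on A, so a bounded gap
  bounds every convex function at x modulo its tangent at c.\<close>

lemma tilde_le_gap:
  assumes c: "c \<in> I" and x: "x \<in> J"
  obtains B where "0 \<le> B" "\<And>A. convex_on J A \<Longrightarrow> ennreal (tilde A c x) \<le> ennreal B * gap \<mu> \<nu> A"
proof -
  obtain B where B: "0 \<le> B" "\<And>t. t \<in> J \<Longrightarrow> krn I c t x \<le> B * pot_diff \<mu> \<nu> t"
    using krn_le_pot_diff[OF c x] by blast
  note [measurable] = measurable_pot_diff[OF ffm_\<mu> ffm_\<nu>]
  show thesis
  proof (rule that[OF B(1)])
    fix A assume A: "convex_on J A"
    have "Lam I J A (\<lambda>t. ennreal (krn I c t x)) \<le> Lam I J A (\<lambda>t. ennreal B * ennreal (pot_diff \<mu> \<nu> t))"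
      using B pot_diff_pos by (intro Lam_mono[OF A]) (auto simp: ennreal_mult[symmetric] less_imp_le intro!: ennreal_leI)
    then show "ennreal (tilde A c x) \<le> ennreal B * gap \<mu> \<nu> A"
      by (simp add: Lam_krn[OF A c x] Lam_cmult[OF A] gap_def)
  qed
qed

end

section \<open>Intermediate measures that differ from the first marginal on a compact set\<close>

text \<open>The chord L of u over x, y lies above v, because u >= v at its ends. Off I this is the
  claim, as u = v there. Inside I the interval is shrunk until it lies in closure I, and convexity
  of u there is used with end values still below L.\<close>

lemma convex_glue:
  fixes u v :: "real \<Rightarrow> real"
  assumes v: "convex_on UNIV v" and ge: "\<And>x. v x \<le> u x" and off: "\<And>x. x \<notin> I \<Longrightarrow> u x = v x"
    and u: "convex_on (closure I) u" and I: "open I"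
  shows "convex_on UNIV u"
proof (rule convex_on_linorderI)
  fix t x y :: real assume t: "0 < t" "t < 1" and xy: "x < y"
  let ?z = "(1 - t) * x + t * y"
  have z: "x < ?z" "?z < y"
  proof -
    have "?z - x = t * (y - x)" "y - ?z = (1 - t) * (y - x)" by (simp_all add: algebra_simps)
    then have "0 < ?z - x" "0 < y - ?z" using t xy by (auto simp del: diff_gt_0_iff_gt)
    then show "x < ?z" "?z < y" by auto
  qed
  define k where "k = (u y - u x) / (y - x)"
  define L where "L w = k * (w - x) + u x" for w
  have Laff: "L ((1 - r) * a + r * b) = (1 - r) * L a + r * L b" for r a b
    by (simp add: L_def algebra_simps)
  have Lz: "L ?z = (1 - t) * u x + t * u y"
  proof -
    have "?z - x = t * (y - x)" by (simp add: algebra_simps)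
    then have "L ?z = (u y - u x) / (y - x) * (t * (y - x)) + u x" by (simp only: L_def k_def)
    also have "\<dots> = t * (u y - u x) + u x" using xy by simp
    finally show ?thesis by (simp add: algebra_simps)
  qed
  have Lx: "L x = u x" "L y = u y" using xy by (simp_all add: L_def k_def)
  have vL: "v w \<le> L w" if w: "x \<le> w" "w \<le> y" for w
  proof -
    define s where "s = (w - x) / (y - x)"
    have "s * (y - x) = w - x" using xy by (simp add: s_def)
    then have s: "0 \<le> s" "s \<le> 1" "w = (1 - s) * x + s * y"
      using w xy by (auto simp: s_def divide_simps, simp add: algebra_simps)
    have "v w \<le> (1 - s) * v x + s * v y" using convex_onD[OF v s(1,2), of x y] s(3) by simp
    also have "\<dots> \<le> (1 - s) * u x + s * u y" using s ge by (intro add_mono mult_left_mono) auto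
    also have "\<dots> = L w"
    proof -
      have "L w = s * (u y - u x) + u x" by (simp add: L_def k_def s_def)
      then show ?thesis by (simp add: algebra_simps)
    qed
    finally show ?thesis .
  qed
  \<comment> \<open>The new end is a itself if a lies in I, and otherwise a frontier point of I on
    the way to \<open>?z\<close>, where u = v is below the chord.\<close>
  have pt: "\<exists>x'\<in>closure I. x' \<in> closed_segment a ?z \<and> x' \<noteq> ?z \<and> u x' \<le> L x'" if zI: "?z \<in> I" and a: "a = x \<or> a = y" for a
  proof (cases "a \<in> I")
    case True
    then show ?thesis using a z Lx closure_subset[of I] by (intro bexI[of _ a]) auto
  next
    case False
    have "closed_segment a ?z \<inter> frontier I \<noteq> {}"
      by (rule connected_Int_frontier) (use zI False in auto)
    then obtain x' where x': "x' \<in> closed_segment a ?z" "x' \<in> frontier I" by auto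
    then have "x' \<in> closure I" "x' \<notin> I" using I by (auto simp: frontier_def interior_open)
    moreover have "x \<le> x'" "x' \<le> y" using x'(1) a z by (auto simp: closed_segment_eq_real_ivl split: if_splits)
    ultimately show ?thesis using x'(1) off vL zI by (intro bexI[of _ x']) auto
  qed
  show "u ((1 - t) *\<^sub>R x + t *\<^sub>R y) \<le> (1 - t) * u x + t * u y"
  proof (cases "?z \<in> I")
    case False
    then show ?thesis using vL[of ?z] z off Lz by simp
  next
    case True
    obtain x' where x': "x' \<in> closure I" "x' \<le> ?z" "x' \<noteq> ?z" "u x' \<le> L x'"
      using pt[OF True, of x] z by (auto simp: closed_segment_eq_real_ivl)
    obtain y' where y': "y' \<in> closure I" "?z \<le> y'" "y' \<noteq> ?z" "u y' \<le> L y'"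
      using pt[OF True, of y] z by (auto simp: closed_segment_eq_real_ivl)
    define s where "s = (?z - x') / (y' - x')"
    have "s * (y' - x') = ?z - x'" using x' y' by (simp add: s_def)
    then have s3: "?z = (1 - s) * x' + s * y'" by (simp add: algebra_simps)
    have s12: "0 \<le> s" "s \<le> 1" using x' y' by (auto simp: s_def divide_simps)
    note s = s12 s3
    have "u ?z \<le> (1 - s) * u x' + s * u y'" using convex_onD[OF u s(1,2) x'(1) y'(1)] s(3) by simp
    also have "\<dots> \<le> (1 - s) * L x' + s * L y'" using s x' y' by (intro add_mono mult_left_mono) auto
    also have "\<dots> = L ((1 - s) * x' + s * y')" by (rule Laff[symmetric])
    finally show ?thesis using s(3) Lz by simp
  qed
qed simp

lemma concave_on_min:
  fixes f g :: "'a::real_vector \<Rightarrow> real"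
  assumes "concave_on S f" "concave_on S g"
  shows "concave_on S (\<lambda>x. min (f x) (g x))"
proof -
  have "convex_on S (\<lambda>x. max (- f x) (- g x))"
    using assms by (intro whole.convex_on_max) (simp_all add: concave_on_def)
  moreover have "(\<lambda>x. max (- f x) (- g x)) = (\<lambda>x. - min (f x) (g x))" by (auto simp: max_def min_def)
  ultimately show ?thesis by (simp add: concave_on_def)
qed

lemma (in interval_pair) exhausting_intervals:
  obtains a b :: "nat \<Rightarrow> real" where "\<And>k. a k \<in> I" "\<And>k. b k \<in> I" "\<And>x. x \<in> I \<Longrightarrow> \<forall>\<^sub>F k in sequentially. a k < x \<and> x < b k"
proof -
  have near: "\<exists>q\<in>\<rat> \<inter> I. q < x" "\<exists>q\<in>\<rat> \<inter> I. x < q" if x: "x \<in> I" for x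
  proof -
    obtain d where d: "d > 0" "\<And>y. \<bar>y - x\<bar> < d \<Longrightarrow> y \<in> I" using open_I x by (auto simp: open_real)
    obtain a where a: "x - d < of_rat a" "of_rat a < x" using of_rat_dense[of "x-d" x] d by auto
    obtain b where b: "x < of_rat b" "of_rat b < x + d" using of_rat_dense[of x "x+d"] d by auto
    show "\<exists>q\<in>\<rat> \<inter> I. q < x" using a by (intro bexI[of _ "of_rat a"]) (auto intro!: d(2))
    show "\<exists>q\<in>\<rat> \<inter> I. x < q" using b by (intro bexI[of _ "of_rat b"]) (auto intro!: d(2))
  qed
  have ne: "\<rat> \<inter> I \<noteq> {}" using near I_ne by blast
  have ct: "countable (\<rat> \<inter> I)" by (rule countable_Int1[OF countable_rat])
  define q where "q = from_nat_into (\<rat> \<inter> I)"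
  have rq: "range q = \<rat> \<inter> I" unfolding q_def by (rule range_from_nat_into[OF ne ct])
  define a b where "a k = Min (q ` {..k})" and "b k = Max (q ` {..k})" for k
  have "a k \<in> q ` {..k}" "b k \<in> q ` {..k}" for k unfolding a_def b_def by (intro Min_in Max_in; auto)+
  then have ab: "a k \<in> I" "b k \<in> I" for k using rq by blast+
  show thesis
  proof (rule that[OF ab])
    fix x assume x: "x \<in> I"
    obtain i j where ij: "q i < x" "x < q j" using near[OF x] unfolding rq[symmetric] by auto
    have "a k < x \<and> x < b k" if "k \<ge> max i j" for k
    proof -
      have "a k \<le> q i" "q j \<le> b k" unfolding a_def b_def using that by (auto intro!: Min_le Max_ge)
      with ij show ?thesis by simp
    qed
    then show "\<forall>\<^sub>F k in sequentially. a k < x \<and> x < b k" unfolding eventually_sequentially by blast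
  qed
qed

context irreducible
begin

text \<open>If I is bounded in the direction s, then d is continuous and vanishes at that end. If it
  is unbounded, d is at most twice a hinge integral of \<nu>, which tends to 0 as the kink moves
  out.\<close>

lemma d_decay:
  assumes s: "\<bar>s\<bar> = 1" and \<epsilon>: "0 < \<epsilon>" and c: "c \<in> I"
  obtains b where "b \<in> I" "0 < s * (b - c)" "\<And>x. x \<in> I \<Longrightarrow> 0 \<le> s * (x - b) \<Longrightarrow> d x \<le> \<epsilon>"
proof -
  have ss: "s * s = 1" using s by (auto simp: abs_if split: if_splits)
  then have ss': "s * (s * x) = x" for x by (simp flip: mult.assoc)
  let ?W = "(\<lambda>x. s * x) ` I"
  have gr: "\<exists>y\<in>I. s * x < s * y" if x: "x \<in> I" for x
  proof -
    obtain e where e: "e > 0" "\<And>y. \<bar>y - x\<bar> < e \<Longrightarrow> y \<in> I" using open_I x by (auto simp: open_real)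
    have "x + s * (e / 2) \<in> I" using e(1) s by (intro e(2)) (auto simp: abs_mult)
    moreover have "s * (x + s * (e / 2)) = s * x + e / 2" by (simp only: distrib_left ss')
    ultimately show ?thesis using e(1) by (intro bexI[of _ "x + s * (e / 2)"]) auto
  qed
  have "\<exists>R. (\<forall>x\<in>I. R < s * x \<longrightarrow> d x \<le> \<epsilon>) \<and> (\<exists>x\<in>I. R < s * x)"
  proof (cases "bdd_above ?W")
    case True
    define R where "R = Sup ?W"
    have up: "s * x \<le> R" if "x \<in> I" for x unfolding R_def using True that by (intro cSup_upper) auto
    have "s * R \<notin> I" using gr[of "s * R"] up ss' by (metis not_le)
    then have d0: "d (s * R) = 0" by (rule d_zero)
    have "isCont d (s * R)" using continuous_d[of UNIV] by (simp add: continuous_on_eq_continuous_at)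
    then obtain \<delta> where \<delta>: "\<delta> > 0" "\<And>x. \<bar>x - s * R\<bar> < \<delta> \<Longrightarrow> \<bar>d x\<bar> < \<epsilon>"
      using \<epsilon> d0 unfolding continuous_at_eps_delta dist_real_def by (metis diff_zero)
    show ?thesis
    proof (intro exI[of _ "R - \<delta>"] conjI ballI impI)
      fix x assume x: "x \<in> I" "R - \<delta> < s * x"
      have "\<bar>x - s * R\<bar> = \<bar>s * (x - s * R)\<bar>" using s by (simp add: abs_mult)
      also have "s * (x - s * R) = s * x - R" by (simp only: right_diff_distrib ss')
      finally have "\<bar>x - s * R\<bar> < \<delta>" using x up[OF x(1)] by auto
      then show "d x \<le> \<epsilon>" using \<delta>(2) by force
    next
      show "\<exists>x\<in>I. R - \<delta> < s * x"
        using less_cSup_iff[OF _ True, of "R - \<delta>"] I_ne \<delta>(1) by (auto simp: R_def)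
    qed
  next
    case False
    have hin: "d x \<le> 2 * (LINT y|\<nu>. max 0 (s * (y - x)))" for x
    proof -
      have "0 \<le> (LINT y|\<mu>. max 0 (s * (y - x)))" by (intro Bochner_Integration.integral_nonneg) auto
      moreover have "(LINT y|\<nu>. max 0 (s * (y - x))) = (LINT y|\<mu>. max 0 (s * (y - x))) + (potential \<nu> x - potential \<mu> x) / 2"
        using pot_le_hinge[OF pot_le_\<mu>\<nu>, of s x] s by simp
      moreover have "b = a + q / 2 \<Longrightarrow> 0 \<le> a \<Longrightarrow> q \<le> 2 * b" for a b q :: real by simp
      ultimately show ?thesis unfolding d_def by blast
    qed
    have "(\<lambda>n. LINT y|\<nu>. max 0 (s * y - real n)) \<longlonglongrightarrow> (LINT y|\<nu>. 0)"
    proof (rule integral_dominated_convergence[where w="\<lambda>y. \<bar>y\<bar>"])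
      show "AE y in \<nu>. (\<lambda>n. max 0 (s * y - real n)) \<longlonglongrightarrow> 0"
      proof (rule AE_I2)
        fix y
        obtain N :: nat where N: "s * y < real N" using reals_Archimedean2 by blast
        then show "(\<lambda>n. max 0 (s * y - real n)) \<longlonglongrightarrow> 0"
          by (intro tendsto_eventually) (auto simp: eventually_sequentially intro!: exI[of _ N])
      qed
      show "AE y in \<nu>. norm (max 0 (s * y - real n)) \<le> \<bar>y\<bar>" for n
      proof (rule AE_I2)
        fix y
        have "\<bar>s * y\<bar> = \<bar>y\<bar>" using s by (simp add: abs_mult)
        then show "norm (max 0 (s * y - real n)) \<le> \<bar>y\<bar>" by (auto simp: max_def)
      qed
      show "integrable \<nu> (\<lambda>y. \<bar>y\<bar>)" using ffmD(4)[OF ffm_\<nu>] by (rule integrable_abs)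
    qed (rule measurable_carried[OF carried_\<nu>], measurable)+
    then have "\<forall>\<^sub>F n in sequentially. (LINT y|\<nu>. max 0 (s * y - real n)) < \<epsilon> / 2"
      using \<epsilon> by (intro order_tendstoD(2)) auto
    then obtain n :: nat where n: "(LINT y|\<nu>. max 0 (s * y - real n)) < \<epsilon> / 2"
      by (auto simp: eventually_sequentially)
    have "d x \<le> \<epsilon>" if x: "real n < s * x" for x
    proof -
      have "(LINT y|\<nu>. max 0 (s * (y - x))) \<le> (LINT y|\<nu>. max 0 (s * (y - s * real n)))"
      proof (intro integral_mono ffm_integrable_hinge ffm_\<nu>)
        fix y
        have e1: "s * (y - s * real n) = s * y - real n" by (simp only: right_diff_distrib ss')
        have e2: "s * (y - x) = s * y - s * x" by (rule right_diff_distrib)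
        show "max 0 (s * (y - x)) \<le> max 0 (s * (y - s * real n))" unfolding e1 e2 using x by auto
      qed
      also have "\<dots> = (LINT y|\<nu>. max 0 (s * y - real n))" by (simp only: right_diff_distrib ss')
      finally show ?thesis using hin[of x] n by simp
    qed
    then show ?thesis using False by (intro exI[of _ "real n"]) (auto simp: bdd_above_def not_le)
  qed
  then obtain R x0 where R: "\<And>x. x \<in> I \<Longrightarrow> R < s * x \<Longrightarrow> d x \<le> \<epsilon>" "x0 \<in> I" "R < s * x0" by blast
  obtain x1 where x1: "x1 \<in> I" "s * c < s * x1" using gr[OF c] by blast
  define b where "b = (if s * x0 \<le> s * x1 then x1 else x0)"
  show thesis
  proof (rule that[of b])
    show "b \<in> I" using R x1 by (simp add: b_def)
    show "0 < s * (b - c)" using x1 by (auto simp: b_def right_diff_distrib)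
    fix x assume "x \<in> I" "0 \<le> s * (x - b)"
    then show "d x \<le> \<epsilon>" using R by (intro R(1)) (auto simp: b_def right_diff_distrib split: if_splits)
  qed
qed

text \<open>The profile that \<open>intermediate_measures\<close> subtracts from the potential of
  \<nu>. Concavity keeps the difference convex; being affine off p it alters the measure at p only,
  and p is no atom of \<nu>. At ends in J it vanishes at a linear rate, so that atoms there survive
  in the limit; at all other ends it stays at 1 while d tends to 0, so that \<epsilon> * h overtakes
  d.\<close>

lemma barrier:
  obtains h :: "real \<Rightarrow> real" and p C where
    "concave_on UNIV h" "continuous_on UNIV h" "\<And>x. x \<in> I \<Longrightarrow> 0 < h x" "\<And>e. e \<in> J - I \<Longrightarrow> h e = 0"
    "\<And>x e. x \<in> I \<Longrightarrow> e \<in> J - I \<Longrightarrow> h x \<le> C * \<bar>x - e\<bar>" "0 \<le> C"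
    "measure \<nu> {p} = 0" "\<exists>a b. \<forall>x. x < p \<longrightarrow> h x = a + b * x" "\<exists>a b. \<forall>x. p < x \<longrightarrow> h x = a + b * x"
    "\<And>\<epsilon> c. 0 < \<epsilon> \<Longrightarrow> c \<in> I \<Longrightarrow> \<exists>a b. a \<in> J \<and> b \<in> J \<and> a < c \<and> c < b \<and>
        (\<forall>x\<in>I. x < a \<or> b < x \<longrightarrow> d x \<le> \<epsilon> * h x)"
proof -
  interpret N: finite_measure \<nu> using ffmD(3)[OF ffm_\<nu>] .
  obtain c0 where c0: "c0 \<in> I" using I_ne by auto
  have "\<exists>p\<in>I. measure \<nu> {p} = 0"
  proof (rule ccontr)
    assume "\<not> ?thesis"
    then have "I \<subseteq> {x. measure \<nu> {x} \<noteq> 0}" by auto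
    then have "countable I" using N.countable_support countable_subset by blast
    moreover obtain e where e: "e > 0" "\<And>y. \<bar>y - c0\<bar> < e \<Longrightarrow> y \<in> I" using open_I c0 by (auto simp: open_real)
    moreover have "{c0 - e<..<c0 + e} \<subseteq> I" by (auto intro!: e(2))
    ultimately show False using countable_subset uncountable_open_interval[of "c0 - e" "c0 + e"] by auto
  qed
  then obtain p where p: "p \<in> I" "measure \<nu> {p} = 0" by blast
  define ends where "ends s e \<longleftrightarrow> e \<in> J - I \<and> (\<forall>t\<in>I. 0 < s * (e - t))" for s e :: real
  \<comment> \<open>\<open>ends s e\<close> says that e is the end in J on the side s. H s is the
    affine function with value 1 at p and 0 at that end, or the constant 1 if there is no such end;
    h uses H (-1) left of p and H 1 right of p.\<close>
  define H where "H s x = (if \<exists>e. ends s e then (x - (SOME e. ends s e)) / (p - (SOME e. ends s e)) else 1)" for s x :: real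
  have ends_uniq: "e = e'" if "ends s e" "ends s e'" "\<bar>s\<bar> = 1" for s e e'
  proof (rule ccontr)
    assume ne: "e \<noteq> e'"
    have *: "False" if "ends s e" "ends s e'" "0 < s * (e' - e)" for e e'
    proof -
      have lt: "e < e' \<and> c0 < e \<or> e' < e \<and> e < c0"
      proof -
        have "0 < s * (e - c0)" using that c0 by (auto simp: ends_def)
        then show ?thesis using that(3) by (auto simp: zero_less_mult_iff)
      qed
      then have "e \<in> I" using between_in_I[OF c0, of e' e] that by (auto simp: ends_def)
      then show False using that by (auto simp: ends_def)
    qed
    have "0 < s * (e' - e) \<or> 0 < s * (e - e')" using ne that(3)
      by (auto simp: zero_less_mult_iff abs_if split: if_splits)
    then show False using *[of e e'] *[of e' e] that by blast
  qed
  have Hval: "H s x = (x - e) / (p - e)" if "ends s e" "\<bar>s\<bar> = 1" for s e x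
  proof -
    have "(SOME e. ends s e) = e" using ends_uniq that by (metis someI)
    then show ?thesis using that by (auto simp: H_def)
  qed
  have Haff: "\<exists>a b. \<forall>x. H s x = a + b * x" if "\<bar>s\<bar> = 1" for s
  proof (cases "\<exists>e. ends s e")
    case True
    then obtain e where "ends s e" by blast
    then have "\<forall>x. H s x = - e / (p - e) + 1 / (p - e) * x" using Hval[of s e] that by (simp add: diff_divide_distrib)
    then show ?thesis by blast
  next
    case False
    then have "\<forall>x. H s x = 1 + 0 * x" by (simp add: H_def)
    then show ?thesis by blast
  qed
  have Hpos: "0 < H s x" if "\<bar>s\<bar> = 1" "x \<in> I" for s x
  proof (cases "\<exists>e. ends s e")
    case True
    then obtain e where e: "ends s e" by blast
    then have "0 < s * (e - x)" "0 < s * (e - p)" using that p by (auto simp: ends_def)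
    then have "0 < (x - e) / (p - e)" by (auto simp: zero_less_mult_iff zero_less_divide_iff)
    then show ?thesis using Hval[OF e that(1)] by simp
  qed (simp add: H_def)
  have Hcmp: "H s x \<le> 1 \<longleftrightarrow> 0 \<le> s * (x - p) \<or> \<not> (\<exists>e. ends s e)" "1 \<le> H s x \<longleftrightarrow> s * (x - p) \<le> 0 \<or> \<not> (\<exists>e. ends s e)"
    if "\<bar>s\<bar> = 1" for s x
  proof -
    have s1: "s = 1 \<or> s = -1" using that by (auto simp: abs_if split: if_splits)
    show "H s x \<le> 1 \<longleftrightarrow> 0 \<le> s * (x - p) \<or> \<not> (\<exists>e. ends s e)"
    proof (cases "\<exists>e. ends s e")
      case True
      then obtain e where e: "ends s e" by blast
      then have "0 < s * (e - p)" using p by (auto simp: ends_def)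
      then show ?thesis using s1 True unfolding Hval[OF e that]
        by (auto simp: divide_le_eq_1 le_divide_eq_1)
    qed (simp add: H_def)
    show "1 \<le> H s x \<longleftrightarrow> s * (x - p) \<le> 0 \<or> \<not> (\<exists>e. ends s e)"
    proof (cases "\<exists>e. ends s e")
      case True
      then obtain e where e: "ends s e" by blast
      then have "0 < s * (e - p)" using p by (auto simp: ends_def)
      then show ?thesis using s1 True unfolding Hval[OF e that]
        by (auto simp: divide_le_eq_1 le_divide_eq_1)
    qed (simp add: H_def)
  qed
  define h where "h x = min (H 1 x) (H (-1) x)" for x
  have hl: "h x = H (-1) x" if "x < p" for x
    using Hcmp(1)[of "-1" x] Hcmp(2)[of 1 x] that by (auto simp: h_def)
  have hr: "h x = H 1 x" if "p < x" for x
    using Hcmp(1)[of 1 x] Hcmp(2)[of "-1" x] that by (auto simp: h_def)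
  obtain a1 b1 where ab1: "\<And>x. H 1 x = a1 + b1 * x" using Haff[of 1] by auto
  obtain a2 b2 where ab2: "\<And>x. H (-1) x = a2 + b2 * x" using Haff[of "-1"] by auto
  have heq: "h = (\<lambda>x. min (a1 + b1 * x) (a2 + b2 * x))" by (simp add: h_def[abs_def] ab1 ab2)
  have end_cases: "ends 1 e \<or> ends (-1) e" if "e \<in> J - I" for e
    using end_side[OF that] that by (auto simp: ends_def)
  define C where "C = (\<Sum>e\<in>J - I. 1 / \<bar>p - e\<bar>)"
  have hend: "h x \<le> 1 / \<bar>p - e\<bar> * \<bar>x - e\<bar>" if xe: "x \<in> I" "e \<in> J - I" for x e
  proof -
    obtain s where s: "ends s e" "s = 1 \<or> s = -1" using end_cases[OF xe(2)] by auto
    then have "h x \<le> (x - e) / (p - e)" using Hval[OF s(1)] by (auto simp: h_def)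
    also have "\<dots> \<le> \<bar>(x - e) / (p - e)\<bar>" by (rule abs_ge_self)
    finally show ?thesis by (simp add: abs_divide)
  qed
  show thesis
  proof (rule that[of h C p])
    show "concave_on UNIV h" unfolding heq
      using convex_on_affine[of UNIV "- a1" "- b1"] convex_on_affine[of UNIV "- a2" "- b2"]
      by (intro concave_on_min) (simp_all add: concave_on_def algebra_simps)
    show "continuous_on UNIV h" unfolding heq by (intro continuous_intros)
    show "0 < h x" if "x \<in> I" for x using Hpos[of 1 x] Hpos[of "-1" x] that by (simp add: h_def)
    show "h e = 0" if e: "e \<in> J - I" for e
    proof -
      from end_cases[OF e] show ?thesis
      proof
        assume s: "ends 1 e"
        then have "p < e" using p by (auto simp: ends_def)
        then show ?thesis using hr[of e] Hval[OF s] by simp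
      next
        assume s: "ends (-1) e"
        then have "e < p" using p by (auto simp: ends_def)
        then show ?thesis using hl[of e] Hval[OF s] by simp
      qed
    qed
    show "h x \<le> C * \<bar>x - e\<bar>" if "x \<in> I" "e \<in> J - I" for x e
    proof -
      have "1 / \<bar>p - e\<bar> \<le> C" unfolding C_def using finite_ends that(2) by (intro member_le_sum) auto
      then show ?thesis using hend[OF that] by (meson abs_ge_zero mult_right_mono order_trans)
    qed
    show "0 \<le> C" by (auto simp: C_def intro!: sum_nonneg)
    show "measure \<nu> {p} = 0" by (rule p(2))
    show "\<exists>a b. \<forall>x. x < p \<longrightarrow> h x = a + b * x" using hl ab2 by auto
    show "\<exists>a b. \<forall>x. p < x \<longrightarrow> h x = a + b * x" using hr ab1 by auto
    fix \<epsilon> c :: real assume \<epsilon>: "0 < \<epsilon>" and c: "c \<in> I"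
    \<comment> \<open>If the side s has an end in J, this end is chosen as b and the comparison is
      void, since no point of I lies beyond it.\<close>
    have one: "\<exists>b\<in>J. 0 < s * (b - c) \<and> (\<forall>x\<in>I. 0 < s * (x - b) \<longrightarrow> d x \<le> \<epsilon> * h x)" if s: "s = 1 \<or> s = -1" for s
    proof (cases "\<exists>e. ends s e")
      case True
      then obtain e where e: "ends s e" by blast
      have "\<not> 0 < s * (x - e)" if "x \<in> I" for x
        using e that s by (auto simp: ends_def)
      then show ?thesis using e c by (intro bexI[of _ e]) (auto simp: ends_def)
    next
      case False
      obtain b0 where b0: "b0 \<in> I" "0 < s * (b0 - p)" "\<And>x. x \<in> I \<Longrightarrow> 0 \<le> s * (x - b0) \<Longrightarrow> d x \<le> \<epsilon>"
        using d_decay[of s \<epsilon> p] s \<epsilon> p(1) by (metis abs_1 abs_minus_cancel)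
      obtain b1 where b1: "b1 \<in> I" "0 < s * (b1 - c)"
        using d_decay[of s \<epsilon> c] s \<epsilon> c by (metis abs_1 abs_minus_cancel)
      define b where "b = (if 0 \<le> s * (b1 - b0) then b1 else b0)"
      have b: "b \<in> I" "0 < s * (b - c)" "0 \<le> s * (b - b0)"
        using s b0 b1 by (auto simp: b_def)
      have "d x \<le> \<epsilon> * h x" if x: "x \<in> I" "0 < s * (x - b)" for x
      proof -
        have "0 \<le> s * (x - b0)" "0 < s * (x - p)" using x b b0 s by auto
        then have "d x \<le> \<epsilon>" and "h x = H s x" using b0(3)[OF x(1)] hl[of x] hr[of x] s by auto
        then show ?thesis using False by (simp add: H_def)
      qed
      then show ?thesis using b I_J by (intro bexI[of _ b]) auto
    qed
    obtain b where b: "b \<in> J" "0 < 1 * (b - c)" "\<forall>x\<in>I. 0 < 1 * (x - b) \<longrightarrow> d x \<le> \<epsilon> * h x" using one[of 1] by blast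
    obtain a where a: "a \<in> J" "0 < -1 * (a - c)" "\<forall>x\<in>I. 0 < -1 * (x - a) \<longrightarrow> d x \<le> \<epsilon> * h x" using one[of "-1"] by blast
    show "\<exists>a b. a \<in> J \<and> b \<in> J \<and> a < c \<and> c < b \<and> (\<forall>x\<in>I. x < a \<or> b < x \<longrightarrow> d x \<le> \<epsilon> * h x)"
      using a b by (intro exI[of _ a] exI[of _ b]) auto
  qed
qed

end

context interval_pair
begin

lemma Lam_liminf:
  assumes A: "convex_on J A" and [measurable]: "\<And>n. g n \<in> borel_measurable borel"
    and le: "\<And>t. t \<in> J \<Longrightarrow> f t \<le> liminf (\<lambda>n. g n t)"
  shows "Lam I J A f \<le> liminf (\<lambda>n. Lam I J A (g n))"
proof -
  have "Lam I J A f \<le> Lam I J A (\<lambda>t. SUP n. INF m\<in>{n..}. g m t)"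
    using le by (intro Lam_mono[OF A]) (simp add: liminf_SUP_INF)
  also have "\<dots> = (SUP n. Lam I J A (\<lambda>t. INF m\<in>{n..}. g m t))"
    by (intro Lam_SUP[OF A]) (auto intro!: INF_superset_mono borel_measurable_INF)
  also have "\<dots> \<le> (SUP n. INF m\<in>{n..}. Lam I J A (g m))"
    by (intro SUP_mono' INF_greatest Lam_mono[OF A] INF_lower) auto
  finally show ?thesis by (simp add: liminf_SUP_INF)
qed

end

lemma liminf_add_le_const:
  fixes f g :: "nat \<Rightarrow> ennreal"
  assumes "x \<le> liminf f" "y \<le> liminf g" "\<And>k. f k + g k \<le> Z"
  shows "x + y \<le> Z"
proof -
  have "x + y \<le> (SUP n. INF m\<in>{n..}. f m) + (SUP n. INF m\<in>{n..}. g m)"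
    using assms(1,2) by (intro add_mono) (simp_all add: liminf_SUP_INF)
  also have "\<dots> = (SUP n. (INF m\<in>{n..}. f m) + (INF m\<in>{n..}. g m))"
    by (intro ennreal_SUP_add[symmetric] incseq_SucI INF_superset_mono) auto
  also have "\<dots> \<le> Z"
  proof (rule SUP_least)
    fix n
    have "(INF m\<in>{n..}. f m) + (INF m\<in>{n..}. g m) \<le> f n + g n" by (intro add_mono INF_lower) auto
    also have "\<dots> \<le> Z" by (rule assms(3))
    finally show "(INF m\<in>{n..}. f m) + (INF m\<in>{n..}. g m) \<le> Z" .
  qed
  finally show ?thesis .
qed

context irreducible
begin

text \<open>These measures approximate \<nu> but differ from \<mu> only on a compact interval inside
  J, where convex functions are bounded. All differences of integrals against \<mu> and
  \<open>\<theta> k\<close> are therefore finite.\<close>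

lemma intermediate_measures:
  obtains \<theta> :: "nat \<Rightarrow> real measure" where
    "\<And>k. pot_le \<mu> (\<theta> k)" "\<And>k. pot_le (\<theta> k) \<nu>"
    "\<And>k c. c \<in> I \<Longrightarrow> \<exists>a b. a \<in> J \<and> b \<in> J \<and> a < c \<and> c < b \<and>
        (\<forall>S\<in>sets borel. S \<subseteq> J - {a..b} \<longrightarrow> emeasure (\<theta> k) S = emeasure \<mu> S) \<and>
        (\<forall>t\<in>J - {a..b}. pot_diff \<mu> (\<theta> k) t = 0)"
    "\<And>t. t \<in> J \<Longrightarrow> (\<lambda>k. pot_diff \<mu> (\<theta> k) t) \<longlonglongrightarrow> pot_diff \<mu> \<nu> t"
    "\<And>f. f \<in> borel_measurable borel \<Longrightarrow> (\<integral>\<^sup>+x. f x \<partial>\<nu>) \<le> liminf (\<lambda>k. \<integral>\<^sup>+x. f x \<partial>\<theta> k)"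
proof (rule barrier)
  fix h :: "real \<Rightarrow> real" and p C
  assume h: "concave_on UNIV h" "continuous_on UNIV h" "\<And>x. x \<in> I \<Longrightarrow> 0 < h x" "\<And>e. e \<in> J - I \<Longrightarrow> h e = 0"
    "\<And>x e. x \<in> I \<Longrightarrow> e \<in> J - I \<Longrightarrow> h x \<le> C * \<bar>x - e\<bar>" "0 \<le> C"
    and p: "measure \<nu> {p} = 0" "\<exists>a b. \<forall>x. x < p \<longrightarrow> h x = a + b * x" "\<exists>a b. \<forall>x. p < x \<longrightarrow> h x = a + b * x"
    and hd: "\<And>\<epsilon> c. 0 < \<epsilon> \<Longrightarrow> c \<in> I \<Longrightarrow> \<exists>a b. a \<in> J \<and> b \<in> J \<and> a < c \<and> c < b \<and>
        (\<forall>x\<in>I. x < a \<or> b < x \<longrightarrow> d x \<le> \<epsilon> * h x)"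
  obtain a b where ab: "\<And>k::nat. a k \<in> I" "\<And>k. b k \<in> I" "\<And>x. x \<in> I \<Longrightarrow> \<forall>\<^sub>F k in sequentially. a k < x \<and> x < b k"
    using exhausting_intervals by blast
  \<comment> \<open>On the compact interval d / h has a positive minimum; with \<epsilon> below it,
    the potential of \<nu> minus \<epsilon> * h wins the maximum in \<open>u\<close> there.\<close>
  have "\<exists>\<epsilon>. 0 < \<epsilon> \<and> \<epsilon> \<le> 1 / real (Suc k) \<and> (\<forall>x\<in>{a k..b k}. \<epsilon> * h x \<le> d x)" for k
  proof -
    have sub: "{a k..b k} \<subseteq> I" using convex_real_mem[OF conv_I ab(1,2)[of k]] by auto
    show ?thesis
    proof (cases "{a k..b k} = {}")
      case True
      then show ?thesis by (intro exI[of _ "1 / real (Suc k)"]) auto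
    next
      case False
      have "continuous_on {a k..b k} (\<lambda>x. d x / h x)"
      proof (intro continuous_on_divide continuous_d)
        show "continuous_on {a k..b k} h" using h(2) continuous_on_subset by blast
        show "\<forall>x\<in>{a k..b k}. h x \<noteq> 0" using h(3) sub by fastforce
      qed
      then obtain x0 where x0: "x0 \<in> {a k..b k}" "\<And>x. x \<in> {a k..b k} \<Longrightarrow> d x0 / h x0 \<le> d x / h x"
        using continuous_attains_inf[OF compact_Icc False] by blast
      have "0 < d x0 / h x0" using x0(1) sub h(3) d_pos by auto
      then show ?thesis
      proof (intro exI[of _ "min (1 / real (Suc k)) (d x0 / h x0)"] conjI ballI)
        fix x assume x: "x \<in> {a k..b k}"
        have "0 < h x" using h(3) sub x by auto
        moreover have "min (1 / real (Suc k)) (d x0 / h x0) \<le> d x / h x" using x0(2)[OF x] by linarith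
        ultimately show "min (1 / real (Suc k)) (d x0 / h x0) * h x \<le> d x" by (simp add: pos_le_divide_eq)
      qed auto
    qed
  qed
  then obtain \<epsilon> where \<epsilon>: "\<And>k. 0 < \<epsilon> k" "\<And>k. \<epsilon> k \<le> 1 / real (Suc k)" "\<And>k x. x \<in> {a k..b k} \<Longrightarrow> \<epsilon> k * h x \<le> d x"
    by metis
  have \<epsilon>0: "\<epsilon> \<longlonglongrightarrow> 0"
  proof (rule tendsto_sandwich[OF _ _ tendsto_const])
    show "\<forall>\<^sub>F n in sequentially. 0 \<le> \<epsilon> n" using \<epsilon>(1) less_imp_le by (intro always_eventually) blast
    show "\<forall>\<^sub>F n in sequentially. \<epsilon> n \<le> inverse (real (Suc n))" using \<epsilon>(2) by (simp add: inverse_eq_divide)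
    show "(\<lambda>n. inverse (real (Suc n))) \<longlonglongrightarrow> 0" by (rule LIMSEQ_inverse_real_of_nat)
  qed
  \<comment> \<open>Beyond an end in J the affine continuation of h is negative and would push the
    second term above the potential of \<nu>; hence the separate case off I, and the gluing in
    \<open>ucv\<close>.\<close>
  define u where "u k x = (if x \<in> I then max (potential \<mu> x) (potential \<nu> x - \<epsilon> k * h x) else potential \<mu> x)" for k x
  have eqoff: "potential \<nu> x = potential \<mu> x" if "x \<notin> I" for x using d_zero[OF that] by (simp add: d_def)
  have lu: "potential \<mu> x \<le> u k x" for k x by (simp add: u_def)
  have uu: "u k x \<le> potential \<nu> x" for k x
    using pot_le_\<mu>\<nu> h(3)[of x] \<epsilon>(1)[of k] eqoff[of x] by (auto simp: u_def pot_le_def intro: less_imp_le)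
  have hcl: "0 \<le> h x" if xcl: "x \<in> closure I" for x
  proof -
    obtain X where X: "\<And>n. X n \<in> I" "X \<longlonglongrightarrow> x" using xcl unfolding closure_sequential by blast
    have "isCont h x" using h(2) by (simp add: continuous_on_eq_continuous_at)
    from isCont_tendsto_compose[OF this X(2)] show ?thesis
      using X(1) h(3) by (intro LIMSEQ_le_const[of "\<lambda>n. h (X n)"]) (auto intro: less_imp_le)
  qed
  \<comment> \<open>On closure I the formula with the maximum is valid at the ends as well, because
    h >= 0 and both potentials agree there.\<close>
  have ucv: "convex_on UNIV (u k)" for k
  proof (rule convex_glue[OF convex_potential[OF ffm_\<mu>] lu _ _ open_I])
    show "u k x = potential \<mu> x" if "x \<notin> I" for x using that by (simp add: u_def)
    have "convex_on UNIV (\<lambda>x. potential \<nu> x + \<epsilon> k * (- h x))"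
      using h(1) \<epsilon>(1)[of k] by (intro convex_on_add convex_potential[OF ffm_\<nu>] convex_on_cmul) (auto simp: concave_on_def)
    then have "convex_on UNIV (\<lambda>x. max (potential \<mu> x) (potential \<nu> x + \<epsilon> k * (- h x)))"
      by (rule convex_on_max[OF convex_potential[OF ffm_\<mu>]])
    then have "convex_on (closure I) (\<lambda>x. max (potential \<mu> x) (potential \<nu> x + \<epsilon> k * (- h x)))"
      by (rule convex_on_subset) (auto intro: convex_closure[OF conv_I])
    moreover have "u k x = max (potential \<mu> x) (potential \<nu> x + \<epsilon> k * (- h x))" if "x \<in> closure I" for x
    proof (cases "x \<in> I")
      case False
      have "0 \<le> \<epsilon> k * h x" using hcl[OF that] \<epsilon>(1)[of k] by (intro mult_nonneg_nonneg) auto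
      then show ?thesis using False eqoff[of x] by (simp add: u_def max_absorb1)
    qed (simp add: u_def)
    ultimately show "convex_on (closure I) (u k)"
      using convexD[OF convex_closure[OF conv_I]] by (simp add: convex_on_def)
  qed
  have "\<exists>\<theta>. finite_first_moment \<theta> \<and> potential \<theta> = u k \<and> mass \<theta> = mass \<mu> \<and> mean \<theta> = mean \<mu>" for k
    using exists_measure_of_potential[OF pot_le_\<mu>\<nu> ucv lu uu, of k] by blast
  then obtain \<theta> where \<theta>: "\<And>k. finite_first_moment (\<theta> k)" "\<And>k. potential (\<theta> k) = u k" "\<And>k. mass (\<theta> k) = mass \<mu>" "\<And>k. mean (\<theta> k) = mean \<mu>"
    by metis
  have le1: "pot_le \<mu> (\<theta> k)" for k using \<theta> lu ffm_\<mu> by (simp add: pot_le_def)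
  have le2: "pot_le (\<theta> k) \<nu>" for k using \<theta> uu ffm_\<nu> pot_le_\<mu>\<nu> by (simp add: pot_le_def)
  have car: "carried (\<theta> k)" for k by (rule carried_between[OF le1 le2])
  \<comment> \<open>Where d <= \<epsilon> * h the maximum is the potential of \<mu>, so
    \<open>\<theta> k\<close> and \<mu> coincide on both sides of the interval.\<close>
  have local: "\<exists>a b. a \<in> J \<and> b \<in> J \<and> a < c \<and> c < b \<and>
        (\<forall>S\<in>sets borel. S \<subseteq> J - {a..b} \<longrightarrow> emeasure (\<theta> k) S = emeasure \<mu> S) \<and>
        (\<forall>t\<in>J - {a..b}. pot_diff \<mu> (\<theta> k) t = 0)" if c: "c \<in> I" for k c
  proof -
    obtain a b where ab: "a \<in> J" "b \<in> J" "a < c" "c < b" "\<And>x. x \<in> I \<Longrightarrow> x < a \<or> b < x \<Longrightarrow> d x \<le> \<epsilon> k * h x"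
      using hd[OF \<epsilon>(1)[of k] c] by blast
    have eq: "potential (\<theta> k) x = potential \<mu> x + (0 + 0 * x)" if "x < a \<or> b < x" for x
      using ab(5)[OF _ that] that by (auto simp: \<theta>(2) u_def d_def)
    have S1: "emeasure (\<theta> k) S = emeasure \<mu> S" if "S \<in> sets borel" "S \<subseteq> {..<a}" for S
      by (rule potential_determines_locally[OF ffm_\<mu> \<theta>(1)[of k], of "{..<a}" 0 0, symmetric]) (use that eq in auto)
    have S2: "emeasure (\<theta> k) S = emeasure \<mu> S" if "S \<in> sets borel" "S \<subseteq> {b<..}" for S
      by (rule potential_determines_locally[OF ffm_\<mu> \<theta>(1)[of k], of "{b<..}" 0 0, symmetric]) (use that eq in auto)
    have S: "emeasure (\<theta> k) S = emeasure \<mu> S" if S: "S \<in> sets borel" "S \<subseteq> J - {a..b}" for S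
    proof -
      have e: "S = (S \<inter> {..<a}) \<union> (S \<inter> {b<..})" using S(2) by auto
      have "emeasure \<kappa> S = emeasure \<kappa> (S \<inter> {..<a}) + emeasure \<kappa> (S \<inter> {b<..})" if "sets \<kappa> = sets borel" for \<kappa>
        using S(1) that ab(3,4) by (subst e, subst plus_emeasure[symmetric]) auto
      then show ?thesis using S1[of "S \<inter> {..<a}"] S2[of "S \<inter> {b<..}"] S(1) ffmD(1)[OF \<theta>(1)[of k]] ffmD(1)[OF ffm_\<mu>] by simp
    qed
    have "pot_diff \<mu> (\<theta> k) t = 0" if t: "t \<in> J - {a..b}" for t
    proof (cases "t \<in> I")
      case True
      then show ?thesis using eq[of t] t by (auto simp: pot_diff_def)
    next
      case False
      have "emeasure (\<theta> k) {t} = emeasure \<mu> {t}" using t by (intro S) auto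
      then show ?thesis using False by (simp add: pot_diff_def measure_def)
    qed
    then show ?thesis using ab S by blast
  qed
  have lim: "(\<lambda>k. pot_diff \<mu> (\<theta> k) t) \<longlonglongrightarrow> pot_diff \<mu> \<nu> t" if t: "t \<in> J" for t
  proof (cases "t \<in> I")
    case True
    have "(\<lambda>k. (max (potential \<mu> t) (potential \<nu> t - \<epsilon> k * h t) - potential \<mu> t) / 2)
        \<longlonglongrightarrow> (max (potential \<mu> t) (potential \<nu> t - 0 * h t) - potential \<mu> t) / 2"
      by (intro tendsto_intros \<epsilon>0) auto
    moreover have "max (potential \<mu> t) (potential \<nu> t - 0 * h t) = potential \<nu> t"
      using pot_le_\<mu>\<nu> by (simp add: pot_le_def)
    ultimately show ?thesis using True by (simp add: pot_diff_def \<theta>(2) u_def)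
  next
    case False
    with t have e: "t \<in> J - I" by simp
    have up: "measure (\<theta> k) {t} \<le> measure \<nu> {t}" for k by (rule end_atom_mono[OF e car carried_\<nu> le2])
    \<comment> \<open>In the tent with foot X n, the slope 1 / |t - X n| cancels the factor |X n -
      t| from the linear bound of h at t; the loss of atom is bounded independently of n.\<close>
    have lo: "measure \<nu> {t} - \<epsilon> k * C / 2 \<le> measure (\<theta> k) {t}" for k
    proof -
      obtain X where X: "\<And>n. X n \<in> I" "X \<longlonglongrightarrow> t" using end_sequence[OF e] by blast
      show ?thesis
      proof (rule LIMSEQ_le_const[OF end_hinge_limit(1)[OF e car[of k] X]], intro exI allI impI)
        fix n
        let ?s = "1 / (t - X n)"
        have xt: "X n \<noteq> t" using X(1)[of n] e by auto
        have "measure \<nu> {t} \<le> (LINT x|\<nu>. max 0 ((x - X n) / (t - X n)))"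
          by (rule end_hinge_limit(2)[OF e carried_\<nu> X X(1)])
        also have "\<dots> = (LINT x|\<theta> k. max 0 ((x - X n) / (t - X n))) + \<bar>?s\<bar> * ((potential \<nu> (X n) - potential (\<theta> k) (X n)) / 2)"
          using pot_le_hinge[OF le2[of k], of ?s "X n"] by simp
        also have "\<bar>?s\<bar> * ((potential \<nu> (X n) - potential (\<theta> k) (X n)) / 2) \<le> \<bar>?s\<bar> * (\<epsilon> k * (C * \<bar>X n - t\<bar>) / 2)"
        proof (intro mult_left_mono divide_right_mono)
          have "potential \<nu> (X n) - potential (\<theta> k) (X n) \<le> \<epsilon> k * h (X n)" using X(1)[of n] by (simp add: \<theta>(2) u_def)
          also have "\<dots> \<le> \<epsilon> k * (C * \<bar>X n - t\<bar>)" using \<epsilon>(1)[of k] h(5)[OF X(1) e] by (intro mult_left_mono) auto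
          finally show "potential \<nu> (X n) - potential (\<theta> k) (X n) \<le> \<epsilon> k * (C * \<bar>X n - t\<bar>)" .
        qed auto
        also have "\<bar>?s\<bar> * (\<epsilon> k * (C * \<bar>X n - t\<bar>) / 2) = \<epsilon> k * C / 2"
          using xt by (simp add: abs_divide abs_minus_commute)
        finally show "measure \<nu> {t} - \<epsilon> k * C / 2 \<le> (LINT x|\<theta> k. max 0 ((x - X n) / (t - X n)))" by simp
      qed
    qed
    have "(\<lambda>k. measure (\<theta> k) {t}) \<longlonglongrightarrow> measure \<nu> {t}"
    proof (rule tendsto_sandwich[OF _ _ _ tendsto_const])
      have "(\<lambda>k. measure \<nu> {t} - \<epsilon> k * C / 2) \<longlonglongrightarrow> measure \<nu> {t} - 0 * C / 2" by (intro tendsto_intros \<epsilon>0) auto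
      then show "(\<lambda>k. measure \<nu> {t} - \<epsilon> k * C / 2) \<longlonglongrightarrow> measure \<nu> {t}" by simp
      show "\<forall>\<^sub>F k in sequentially. measure \<nu> {t} - \<epsilon> k * C / 2 \<le> measure (\<theta> k) {t}"
        by (rule always_eventually, rule allI, rule lo)
      show "\<forall>\<^sub>F k in sequentially. measure (\<theta> k) {t} \<le> measure \<nu> {t}"
        by (rule always_eventually, rule allI, rule up)
    qed
    then have "(\<lambda>k. measure (\<theta> k) {t} - measure \<mu> {t}) \<longlonglongrightarrow> measure \<nu> {t} - measure \<mu> {t}"
      by (intro tendsto_intros)
    then show ?thesis using False by (simp add: pot_diff_def)
  qed
  have fatou: "(\<integral>\<^sup>+x. f x \<partial>\<nu>) \<le> liminf (\<lambda>k. \<integral>\<^sup>+x. f x \<partial>\<theta> k)" if f[measurable]: "f \<in> borel_measurable borel" for f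
  proof -
    \<comment> \<open>On \<open>U k\<close> the potentials of \<nu> and \<open>\<theta> k\<close>
      differ by \<epsilon> * h, which is affine on each side of p, so the measures agree there. The
      removed point p is \<nu>-null, and the atoms at the ends are treated separately.\<close>
    define U where "U k = {a k<..<b k} - {p}" for k
    have Ub[measurable]: "U k \<in> sets borel" for k by (simp add: U_def)
    have UI: "U k \<subseteq> I" for k
    proof
      fix x assume "x \<in> U k"
      then show "x \<in> I" using convex_real_mem[OF conv_I ab(1,2), of k x k] by (simp add: U_def)
    qed
    have Ueq: "emeasure \<nu> S = emeasure (\<theta> k) S" if S: "S \<in> sets borel" "S \<subseteq> U k" for S k
    proof -
      obtain a1 b1 where 1: "\<And>x. x < p \<Longrightarrow> h x = a1 + b1 * x" using p(2) by blast
      obtain a2 b2 where 2: "\<And>x. p < x \<Longrightarrow> h x = a2 + b2 * x" using p(3) by blast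
      have pot: "potential (\<theta> k) x = potential \<nu> x - \<epsilon> k * h x" if "x \<in> {a k<..<b k}" for x
      proof -
        have "x \<in> I" using that convex_real_mem[OF conv_I ab(1,2), of k x k] by simp
        then show ?thesis using \<epsilon>(3)[of x k] that by (simp add: \<theta>(2) u_def d_def)
      qed
      have i: "open ({a k<..<b k} \<inter> {..<p})" "convex ({a k<..<b k} \<inter> {..<p})"
        "open ({a k<..<b k} \<inter> {p<..})" "convex ({a k<..<b k} \<inter> {p<..})"
        by (auto intro!: convex_Int convex_real_interval)
      have S1: "emeasure \<nu> (S \<inter> {..<p}) = emeasure (\<theta> k) (S \<inter> {..<p})"
      proof (rule potential_determines_locally[OF ffm_\<nu> \<theta>(1)[of k] i(1,2), of "- \<epsilon> k * a1" "- \<epsilon> k * b1"])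
        show "potential (\<theta> k) x = potential \<nu> x + (- \<epsilon> k * a1 + - \<epsilon> k * b1 * x)" if "x \<in> {a k<..<b k} \<inter> {..<p}" for x
          using pot[of x] 1[of x] that by (simp add: algebra_simps)
      qed (use S in \<open>auto simp: U_def\<close>)
      have S2: "emeasure \<nu> (S \<inter> {p<..}) = emeasure (\<theta> k) (S \<inter> {p<..})"
      proof (rule potential_determines_locally[OF ffm_\<nu> \<theta>(1)[of k] i(3,4), of "- \<epsilon> k * a2" "- \<epsilon> k * b2"])
        show "potential (\<theta> k) x = potential \<nu> x + (- \<epsilon> k * a2 + - \<epsilon> k * b2 * x)" if "x \<in> {a k<..<b k} \<inter> {p<..}" for x
          using pot[of x] 2[of x] that by (simp add: algebra_simps)
      qed (use S in \<open>auto simp: U_def\<close>)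
      have e: "S = (S \<inter> {..<p}) \<union> (S \<inter> {p<..})" using S(2) by (auto simp: U_def)
      have "emeasure \<kappa> S = emeasure \<kappa> (S \<inter> {..<p}) + emeasure \<kappa> (S \<inter> {p<..})" if "sets \<kappa> = sets borel" for \<kappa>
        using S(1) that by (subst e, subst plus_emeasure[symmetric]) auto
      then show ?thesis using S1 S2 ffmD(1)[OF \<theta>(1)[of k]] ffmD(1)[OF ffm_\<nu>] by simp
    qed
    have Uint: "(\<integral>\<^sup>+x. f x * indicator (U k) x \<partial>\<nu>) = (\<integral>\<^sup>+x. f x * indicator (U k) x \<partial>\<theta> k)" for k
    proof -
      have "restrict_space \<nu> (U k) = restrict_space (\<theta> k) (U k)"
      proof (rule measure_eqI)
        show "sets (restrict_space \<nu> (U k)) = sets (restrict_space (\<theta> k) (U k))"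
          using ffmD(1)[OF \<theta>(1)[of k]] ffmD(1)[OF ffm_\<nu>] by (intro sets_restrict_space_cong) simp
        fix S assume "S \<in> sets (restrict_space \<nu> (U k))"
        then have "S \<in> sets borel" "S \<subseteq> U k"
          using ffmD(1,2)[OF ffm_\<nu>] Ub[of k] by (simp_all add: sets_restrict_space_iff)
        then show "emeasure (restrict_space \<nu> (U k)) S = emeasure (restrict_space (\<theta> k) (U k)) S"
          using Ueq[of S k] ffmD(1,2)[OF \<theta>(1)[of k]] ffmD(1,2)[OF ffm_\<nu>] Ub[of k]
          by (subst (1 2) emeasure_restrict_space) simp_all
      qed
      moreover have "integral\<^sup>N (restrict_space \<kappa> (U k)) f = (\<integral>\<^sup>+x. f x * indicator (U k) x \<partial>\<kappa>)"
        if "finite_first_moment \<kappa>" for \<kappa>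
        using ffmD(1,2)[OF that] by (intro nn_integral_restrict_space) simp
      ultimately show ?thesis using \<theta>(1) ffm_\<nu> by metis
    qed
    let ?E = "\<lambda>\<kappa>. \<Sum>e\<in>J - I. f e * emeasure \<kappa> {e}"
    have E: "(\<integral>\<^sup>+x. f x * indicator (J - I) x \<partial>\<kappa>) = ?E \<kappa>" if "sets \<kappa> = sets borel" for \<kappa>
      using that finite_ends by (intro nn_integral_indicator_finite) auto
    have lower: "(\<integral>\<^sup>+x. f x * indicator (U k) x \<partial>\<nu>) + ?E (\<theta> k) \<le> (\<integral>\<^sup>+x. f x \<partial>\<theta> k)" for k
    proof -
      have "(\<integral>\<^sup>+x. f x * indicator (U k) x \<partial>\<nu>) + ?E (\<theta> k)
          = (\<integral>\<^sup>+x. f x * indicator (U k) x + f x * indicator (J - I) x \<partial>\<theta> k)"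
        unfolding Uint E[OF ffmD(1)[OF \<theta>(1)[of k]], symmetric]
        by (intro nn_integral_add[symmetric] measurable_carried[OF car]) measurable
      also have "\<dots> \<le> (\<integral>\<^sup>+x. f x \<partial>\<theta> k)"
        using UI by (intro nn_integral_mono) (auto simp: indicator_def)
      finally show ?thesis .
    qed
    have "(\<integral>\<^sup>+x. f x \<partial>\<nu>) = (\<integral>\<^sup>+x. f x * indicator (I - {p}) x + f x * indicator (J - I) x \<partial>\<nu>)"
    proof (rule nn_integral_cong_AE)
      interpret N: finite_measure \<nu> using ffmD(3)[OF ffm_\<nu>] .
      have "{p} \<in> null_sets \<nu>" using p(1) ffmD(1)[OF ffm_\<nu>] by (auto simp: null_sets_def N.emeasure_eq_measure)
      from AE_not_in[OF this] carriedD(2)[OF carried_\<nu>]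
      show "AE x in \<nu>. f x = f x * indicator (I - {p}) x + f x * indicator (J - I) x"
        by eventually_elim (auto simp: indicator_def)
    qed
    also have "\<dots> = (\<integral>\<^sup>+x. f x * indicator (I - {p}) x \<partial>\<nu>) + ?E \<nu>"
      unfolding E[OF ffmD(1)[OF ffm_\<nu>], symmetric] by (intro nn_integral_add measurable_carried[OF carried_\<nu>]) measurable
    also have "\<dots> \<le> liminf (\<lambda>k. \<integral>\<^sup>+x. f x * indicator (U k) x \<partial>\<nu>) + ?E \<nu>"
    proof (rule add_right_mono)
      have "(\<integral>\<^sup>+x. f x * indicator (I - {p}) x \<partial>\<nu>) \<le> (\<integral>\<^sup>+x. liminf (\<lambda>k. f x * indicator (U k) x) \<partial>\<nu>)"
      proof (rule nn_integral_mono)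
        fix x
        show "f x * indicator (I - {p}) x \<le> liminf (\<lambda>k. f x * indicator (U k) x)"
        proof (cases "x \<in> I - {p}")
          case True
          then have "\<forall>\<^sub>F k in sequentially. f x \<le> f x * indicator (U k) x"
            using ab(3)[of x] by (auto simp: U_def elim!: eventually_mono)
          then have "f x \<le> liminf (\<lambda>k. f x * indicator (U k) x)" by (rule Liminf_bounded)
          then show ?thesis using True by simp
        qed simp
      qed
      also have "\<dots> \<le> liminf (\<lambda>k. \<integral>\<^sup>+x. f x * indicator (U k) x \<partial>\<nu>)"
        by (intro nn_integral_liminf measurable_carried[OF carried_\<nu>]) measurable
      finally show "(\<integral>\<^sup>+x. f x * indicator (I - {p}) x \<partial>\<nu>) \<le> liminf (\<lambda>k. \<integral>\<^sup>+x. f x * indicator (U k) x \<partial>\<nu>)" .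
    qed
    also have "\<dots> \<le> liminf (\<lambda>k. \<integral>\<^sup>+x. f x \<partial>\<theta> k)"
    proof -
      have at: "(\<lambda>k. emeasure (\<theta> k) {e}) \<longlonglongrightarrow> emeasure \<nu> {e}" if e: "e \<in> J - I" for e
      proof -
        have "(\<lambda>k. measure (\<theta> k) {e}) \<longlonglongrightarrow> measure \<nu> {e}"
          using lim[of e] e \<mu>_end[of e] by (simp add: pot_diff_def)
        then show ?thesis
          using finite_measure.emeasure_eq_measure[OF ffmD(3)[OF \<theta>(1)]] finite_measure.emeasure_eq_measure[OF ffmD(3)[OF ffm_\<nu>]]
          by (simp add: tendsto_ennrealI)
      qed
      have El: "?E \<nu> \<le> liminf (\<lambda>k. ?E (\<theta> k))"
      proof -
        have "?E \<nu> = (\<integral>\<^sup>+e. f e * emeasure \<nu> {e} \<partial>count_space (J - I))"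
          using finite_ends by (simp add: nn_integral_count_space_finite)
        also have "\<dots> \<le> (\<integral>\<^sup>+e. liminf (\<lambda>k. f e * emeasure (\<theta> k) {e}) \<partial>count_space (J - I))"
        proof (rule nn_integral_mono)
          fix e assume e: "e \<in> space (count_space (J - I))"
          show "f e * emeasure \<nu> {e} \<le> liminf (\<lambda>k. f e * emeasure (\<theta> k) {e})"
          \<comment> \<open>Multiplication by an infinite value is not continuous at 0; here \<nu>
            charges e, so \<open>\<theta> k\<close> eventually charges it too.\<close>
          proof (cases "f e = \<infinity>")
            case True
            have pos: "0 < emeasure \<nu> {e}" using e by (auto simp: dom_J_def)
            then have "\<forall>\<^sub>F k in sequentially. 0 < emeasure (\<theta> k) {e}"
              using at[of e] e by (intro order_tendstoD(1)) auto
            then have "\<forall>\<^sub>F k in sequentially. \<infinity> \<le> f e * emeasure (\<theta> k) {e}"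
              by eventually_elim (simp add: True ennreal_top_mult)
            then have "\<infinity> \<le> liminf (\<lambda>k. f e * emeasure (\<theta> k) {e})" by (rule Liminf_bounded)
            then show ?thesis by (simp add: top_unique)
          next
            case False
            then have "(\<lambda>k. f e * emeasure (\<theta> k) {e}) \<longlonglongrightarrow> f e * emeasure \<nu> {e}"
              using at[of e] e finite_measure.emeasure_finite[OF ffmD(3)[OF ffm_\<nu>], of "{e}"]
              by (intro tendsto_mult_ennreal tendsto_const) (auto simp: less_top)
            then show ?thesis by (simp add: lim_imp_Liminf)
          qed
        qed
        also have "\<dots> \<le> liminf (\<lambda>k. \<integral>\<^sup>+e. f e * emeasure (\<theta> k) {e} \<partial>count_space (J - I))"
          by (rule nn_integral_liminf) simp
        also have "\<dots> = liminf (\<lambda>k. ?E (\<theta> k))"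
          using finite_ends by (simp add: nn_integral_count_space_finite)
        finally show ?thesis .
      qed
      let ?F = "\<lambda>k. \<integral>\<^sup>+x. f x * indicator (U k) x \<partial>\<nu>"
      have "liminf ?F + ?E \<nu> \<le> liminf ?F + liminf (\<lambda>k. ?E (\<theta> k))" by (intro add_left_mono El)
      also have "\<dots> = (SUP n. (INF m\<in>{n..}. ?F m) + (INF m\<in>{n..}. ?E (\<theta> m)))"
        unfolding liminf_SUP_INF by (intro ennreal_SUP_add[symmetric] incseq_SucI INF_superset_mono) auto
      also have "\<dots> \<le> (SUP n. INF m\<in>{n..}. \<integral>\<^sup>+x. f x \<partial>\<theta> m)"
      proof (intro SUP_mono' INF_greatest)
        fix n m :: nat assume m: "m \<in> {n..}"
        have "(INF m\<in>{n..}. ?F m) + (INF m\<in>{n..}. ?E (\<theta> m)) \<le> ?F m + ?E (\<theta> m)"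
          using m by (intro add_mono INF_lower)
        also note lower
        finally show "(INF m\<in>{n..}. ?F m) + (INF m\<in>{n..}. ?E (\<theta> m)) \<le> (\<integral>\<^sup>+x. f x \<partial>\<theta> m)" .
      qed
      finally show ?thesis by (simp add: liminf_SUP_INF)
    qed
    finally show ?thesis .
  qed
  show thesis by (rule that[of \<theta>, OF le1 le2 local lim fatou])
qed

end

section \<open>The duality identity\<close>

context irreducible
begin

lemma pot_diff_add:
  "pot_diff \<theta>1 \<theta>2 t + pot_diff \<theta>2 \<theta>3 t = pot_diff \<theta>1 \<theta>3 t"
  by (simp add: pot_diff_def add_divide_distrib[symmetric])

lemma gap_add:
  assumes A: "convex_on J A" and c: "carried \<theta>1" "carried \<theta>2" "carried \<theta>3" and le: "pot_le \<theta>1 \<theta>2" "pot_le \<theta>2 \<theta>3"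
  shows "gap \<theta>1 \<theta>2 A + gap \<theta>2 \<theta>3 A = gap \<theta>1 \<theta>3 A"
proof -
  have m: "(\<lambda>t. ennreal (pot_diff \<theta>1 \<theta>2 t)) \<in> borel_measurable borel" "(\<lambda>t. ennreal (pot_diff \<theta>2 \<theta>3 t)) \<in> borel_measurable borel"
    using measurable_pot_diff[OF carriedD(1)[OF c(1)] carriedD(1)[OF c(2)]] measurable_pot_diff[OF carriedD(1)[OF c(2)] carriedD(1)[OF c(3)]]
    by measurable
  show ?thesis unfolding gap_def Lam_add[OF A m, symmetric]
    using pot_diff_nonneg[OF c(1,2) le(1)] pot_diff_nonneg[OF c(2,3) le(2)]
    by (intro Lam_cong[OF A]) (simp add: pot_diff_add ennreal_plus[symmetric] del: ennreal_plus)
qed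

lemma gap_mono:
  assumes A: "convex_on J A" and le: "pot_le \<mu> \<theta>" "pot_le \<theta> \<nu>"
  shows "gap \<mu> \<theta> A \<le> gap \<mu> \<nu> A"
  using gap_add[OF A carried_\<mu> carried_between[OF le] carried_\<nu> le] by (metis le_iff_add)

text \<open>An affine summand shifts the right derivative by a constant and has no jumps. Dual pairs
  can thus be normalized by a common affine function without changing their value.\<close>

lemma gap_affine:
  assumes A: "cvx A"
  shows "gap \<theta>1 \<theta>2 (\<lambda>x. A x + (a + b * x)) = gap \<theta>1 \<theta>2 A"
proof -
  have A2: "convex_on J (\<lambda>x. A x + (a + b * x))" using cvxD(1)[OF cvx_add[OF A cvx_affine]] .
  have r: "rderiv (\<lambda>x. A x + (a + b * x)) x = rderiv A x + b" if "x \<in> I" for x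
  proof (rule rderiv_eqI)
    have "((\<lambda>y. (A y - A x) / (y - x) + b) \<longlongrightarrow> rderiv A x + b) (at_right x)"
      by (intro tendsto_intros convex_on_right_derivative(1)[OF convex_on_I[OF cvxD(1)[OF A]] open_I that])
    moreover have "\<forall>\<^sub>F y in at_right x. (A y - A x) / (y - x) + b = (A y + (a + b * y) - (A x + (a + b * x))) / (y - x)"
    proof -
      have "\<forall>\<^sub>F y in at_right x. x < y" by (rule eventually_at_right_less)
      then show ?thesis
      proof eventually_elim
        case (elim y)
        have "A y + (a + b * y) - (A x + (a + b * x)) = (A y - A x) + b * (y - x)" by (simp add: algebra_simps)
        then have "(A y + (a + b * y) - (A x + (a + b * x))) / (y - x) = (A y - A x) / (y - x) + b * (y - x) / (y - x)"
          by (simp only: add_divide_distrib)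
        then show ?case using elim by simp
      qed
    qed
    ultimately show "((\<lambda>y. (A y + (a + b * y) - (A x + (a + b * x))) / (y - x)) \<longlongrightarrow> rderiv A x + b) (at_right x)"
      by (rule Lim_transform_eventually)
  qed
  have "second_deriv_measure I (\<lambda>x. A x + (a + b * x)) = second_deriv_measure I A"
    unfolding second_deriv_measure_def rderiv_def[symmetric] by (rule extend_measure_cong) (auto simp: r)
  moreover have "boundary_jump I (\<lambda>x. A x + (a + b * x)) e = boundary_jump I A e" if e: "e \<in> J - I" for e
  proof -
    obtain c where c: "c \<in> I" using I_ne by auto
    obtain l where l: "(A \<longlongrightarrow> l) (at e within I)" using convex_end_limit[OF cvxD(1)[OF A] c e] by blast
    have "((\<lambda>x. A x + (a + b * x)) \<longlongrightarrow> l + (a + b * e)) (at e within I)" by (intro tendsto_intros l)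
    then show ?thesis
      using tendsto_Lim[OF hinge_integral_end(3)[OF cvxD(1)[OF A] c e] l]
        tendsto_Lim[OF hinge_integral_end(3)[OF cvxD(1)[OF A] c e], of "\<lambda>x. A x + (a + b * x)"]
      by (simp add: boundary_jump_def)
  qed
  ultimately show ?thesis by (simp add: gap_def Lam_def)
qed

text \<open>Outside \<open>{a..b}\<close> the two measures agree, and on it a convex function is
  bounded, between its tangent at c and its larger end value. Thus the defect in Jensen's inequality
  becomes an honest difference of finite integrals.\<close>

lemma local_integral:
  assumes \<theta>: "pot_le \<mu> \<theta>" "pot_le \<theta> \<nu>" and ab: "a \<in> J" "b \<in> J" "a < c" "c < b" and c: "c \<in> I"
    and agree: "\<forall>S\<in>sets borel. S \<subseteq> J - {a..b} \<longrightarrow> emeasure \<theta> S = emeasure \<mu> S"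
    and zero: "\<forall>t\<in>J - {a..b}. pot_diff \<mu> \<theta> t = 0"
  shows local_outside: "f \<in> borel_measurable borel \<Longrightarrow>
      (\<integral>\<^sup>+x. f x * indicator (J - {a..b}) x \<partial>\<theta>) = (\<integral>\<^sup>+x. f x * indicator (J - {a..b}) x \<partial>\<mu>)"
    and local_integrable: "cvx A \<Longrightarrow> \<kappa> = \<mu> \<or> \<kappa> = \<theta> \<Longrightarrow> integrable \<kappa> (\<lambda>x. indicator {a..b} x * A x)"
    and local_gap: "cvx A \<Longrightarrow> gap \<mu> \<theta> A = ennreal ((LINT x|\<theta>. indicator {a..b} x * A x) - (LINT x|\<mu>. indicator {a..b} x * A x))"
    and local_gap_nonneg: "cvx A \<Longrightarrow> (LINT x|\<mu>. indicator {a..b} x * A x) \<le> (LINT x|\<theta>. indicator {a..b} x * A x)"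
proof -
  have car: "carried \<theta>" by (rule carried_between[OF \<theta>])
  note f\<theta> = carriedD(1)[OF car]
  let ?K = "{a..b}"
  have KJ: "?K \<subseteq> J" using convex_real_mem[OF conv_J ab(1,2)] by auto
  have req: "restrict_space \<theta> (J - ?K) = restrict_space \<mu> (J - ?K)"
  proof (rule measure_eqI)
    show "sets (restrict_space \<theta> (J - ?K)) = sets (restrict_space \<mu> (J - ?K))"
      using ffmD(1)[OF f\<theta>] ffmD(1)[OF ffm_\<mu>] by (intro sets_restrict_space_cong) simp
    fix S assume "S \<in> sets (restrict_space \<theta> (J - ?K))"
    then have S: "S \<in> sets borel" "S \<subseteq> J - ?K"
      using ffmD(1,2)[OF f\<theta>] by (simp_all add: sets_restrict_space_iff)
    then show "emeasure (restrict_space \<theta> (J - ?K)) S = emeasure (restrict_space \<mu> (J - ?K)) S"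
      using agree ffmD(1,2)[OF f\<theta>] ffmD(1,2)[OF ffm_\<mu>] by (subst (1 2) emeasure_restrict_space) simp_all
  qed
  show out: "(\<integral>\<^sup>+x. f x * indicator (J - ?K) x \<partial>\<theta>) = (\<integral>\<^sup>+x. f x * indicator (J - ?K) x \<partial>\<mu>)" for f
  proof -
    have "integral\<^sup>N (restrict_space \<kappa> (J - ?K)) f = (\<integral>\<^sup>+x. f x * indicator (J - ?K) x \<partial>\<kappa>)"
      if "finite_first_moment \<kappa>" for \<kappa>
      using ffmD(1,2)[OF that] by (intro nn_integral_restrict_space) simp
    then show ?thesis using req f\<theta> ffm_\<mu> by metis
  qed
  have outl: "(LINT x|\<theta>. indicator (J - ?K) x * f x) = (LINT x|\<mu>. indicator (J - ?K) x * f x)" for f :: "real \<Rightarrow> real"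
  proof -
    have "integral\<^sup>L (restrict_space \<kappa> (J - ?K)) f = (LINT x|\<kappa>. indicator (J - ?K) x * f x)"
      if "finite_first_moment \<kappa>" for \<kappa>
      using ffmD(1,2)[OF that] by (subst integral_restrict_space) simp_all
    then show ?thesis using req f\<theta> ffm_\<mu> by metis
  qed
  have intg: "integrable \<kappa> (\<lambda>x. indicator ?K x * A x)" if A: "cvx A" and \<kappa>: "\<kappa> = \<mu> \<or> \<kappa> = \<theta>" for A \<kappa>
  proof -
    have fk: "finite_first_moment \<kappa>" using \<kappa> f\<theta> ffm_\<mu> by auto
    let ?B = "\<bar>A a\<bar> + \<bar>A b\<bar> + \<bar>A c\<bar> + \<bar>rderiv A c\<bar> * (b - a)"
    have le: "\<bar>indicator ?K x * A x\<bar> \<le> ?B + 0 * \<bar>x\<bar>" for x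
    proof (cases "x \<in> ?K")
      case True
      then have xJ: "x \<in> J" using KJ by auto
      have "A x \<le> max (A a) (A b)"
        using convex_on_le_max[OF convex_on_subset[OF cvxD(1)[OF A] KJ]] True by auto
      moreover have "A c + rderiv A c * (x - c) \<le> A x" by (rule subgradient_J[OF cvxD(1)[OF A] c xJ])
      moreover have "\<bar>rderiv A c * (x - c)\<bar> \<le> \<bar>rderiv A c\<bar> * (b - a)"
        using True ab by (auto simp: abs_mult intro!: mult_left_mono)
      moreover have "0 \<le> \<bar>rderiv A c\<bar> * (b - a)" using ab by simp
      ultimately show ?thesis using True by (auto simp: abs_le_iff)
    qed (use ab in simp)
    have m: "(\<lambda>x. indicator ?K x * A x) \<in> borel_measurable borel" using cvxD(2)[OF A] by measurable
    show ?thesis by (rule ffm_integrable[OF fk m AE_I2[OF le]])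
  qed
  then show "cvx A \<Longrightarrow> \<kappa> = \<mu> \<or> \<kappa> = \<theta> \<Longrightarrow> integrable \<kappa> (\<lambda>x. indicator {a..b} x * A x)" by blast
  assume A: "cvx A"
  have tcv: "cvx (tilde A c)"
  proof -
    have "tilde A c = (\<lambda>x. A x + ((rderiv A c * c - A c) + (- rderiv A c) * x))"
      by (auto simp: tilde_def fun_eq_iff algebra_simps)
    moreover have "cvx (\<lambda>x. A x + ((rderiv A c * c - A c) + (- rderiv A c) * x))" by (rule cvx_add[OF A cvx_affine])
    ultimately show ?thesis by (simp only:)
  qed
  \<comment> \<open>The base point c lies in the interval, so a kernel with kink outside it does not
    open before leaving the interval.\<close>
  have kz: "krn I c t x = 0" if "t \<in> J - ?K" "x \<in> ?K" for t x
    using that ab by (auto simp: krn_def)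
  have Lt: "ennreal (tilde A c x) * indicator ?K x = Lam I J A (\<lambda>t. ennreal (krn I c t x) * indicator ?K x)" for x
  proof (cases "x \<in> ?K")
    case True
    then have "x \<in> J" using KJ by blast
    then show ?thesis using True by (simp add: Lam_krn[OF cvxD(1)[OF A] c])
  qed (simp add: Lam_def)
  have tint: "(\<integral>\<^sup>+x. ennreal (tilde A c x) * indicator ?K x \<partial>\<kappa>) = Lam I J A (\<lambda>t. \<integral>\<^sup>+x. ennreal (krn I c t x) * indicator ?K x \<partial>\<kappa>)"
    if "finite_first_moment \<kappa>" for \<kappa>
    unfolding Lt using ffmD[OF that] by (intro Lam_nn_integral cvxD(1)[OF A]) measurable
  have kint: "(\<integral>\<^sup>+x. ennreal (krn I c t x) * indicator ?K x \<partial>\<theta>)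
      = (\<integral>\<^sup>+x. ennreal (krn I c t x) * indicator ?K x \<partial>\<mu>) + ennreal (pot_diff \<mu> \<theta> t)" if t: "t \<in> J" for t
  proof (cases "t \<in> ?K")
    case True
    \<comment> \<open>The parts outside \<open>{a..b}\<close> are equal for both measures and
      finite, so that they cancel in \<open>krn_integral_diff\<close>.\<close>
    have split: "(\<integral>\<^sup>+x. ennreal (krn I c t x) \<partial>\<kappa>) = (\<integral>\<^sup>+x. ennreal (krn I c t x) * indicator ?K x \<partial>\<kappa>)
        + (\<integral>\<^sup>+x. ennreal (krn I c t x) * indicator (J - ?K) x \<partial>\<kappa>)" if "carried \<kappa>" for \<kappa>
    proof -
      have "(\<integral>\<^sup>+x. ennreal (krn I c t x) \<partial>\<kappa>) = (\<integral>\<^sup>+x. ennreal (krn I c t x) * indicator ?K x + ennreal (krn I c t x) * indicator (J - ?K) x \<partial>\<kappa>)"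
        by (rule nn_integral_cong_AE, use carriedD(2)[OF that] in eventually_elim) (auto simp: indicator_def)
      also have "\<dots> = (\<integral>\<^sup>+x. ennreal (krn I c t x) * indicator ?K x \<partial>\<kappa>)
        + (\<integral>\<^sup>+x. ennreal (krn I c t x) * indicator (J - ?K) x \<partial>\<kappa>)"
        by (intro nn_integral_add measurable_carried[OF that]) measurable
      finally show ?thesis .
    qed
    let ?o = "\<integral>\<^sup>+x. ennreal (krn I c t x) * indicator (J - ?K) x \<partial>\<mu>"
    have "?o \<le> (\<integral>\<^sup>+x. ennreal (krn I c t x) \<partial>\<mu>)" by (intro nn_integral_mono) (auto simp: indicator_def)
    also have "\<dots> < \<infinity>"
      using krn_integral_diff(2)[OF carried_\<mu> carried_\<mu> _ t] ffm_\<mu> by (simp add: pot_le_def)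
    finally have fin: "?o \<noteq> \<infinity>" by simp
    have "?o + (\<integral>\<^sup>+x. ennreal (krn I c t x) * indicator ?K x \<partial>\<theta>)
        = ?o + ((\<integral>\<^sup>+x. ennreal (krn I c t x) * indicator ?K x \<partial>\<mu>) + ennreal (pot_diff \<mu> \<theta> t))"
      using krn_integral_diff(1)[OF carried_\<mu> car \<theta>(1) t, of c] split[OF car] split[OF carried_\<mu>] out
      by (simp add: add_ac)
    from iffD1[OF ennreal_add_left_cancel this] fin show ?thesis by blast
  next
    case False
    then have t: "t \<in> J - ?K" using t by blast
    have e: "(\<lambda>x. ennreal (krn I c t x) * indicator ?K x) = (\<lambda>x. 0)"
      using kz[OF t] by (auto simp: fun_eq_iff indicator_def)
    show ?thesis unfolding e using zero t by simp
  qed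
  have mk: "(\<lambda>t. \<integral>\<^sup>+x. ennreal (krn I c t x) * indicator ?K x \<partial>\<mu>) \<in> borel_measurable borel"
  proof -
    interpret finite_measure \<mu> using ffmD(3)[OF ffm_\<mu>] .
    have "(\<lambda>(t, x). ennreal (krn I c t x) * indicator ?K x) \<in> borel_measurable (borel \<Otimes>\<^sub>M \<mu>)"
      by (subst measurable_cong_sets[OF sets_pair_measure_cong[OF refl ffmD(1)[OF ffm_\<mu>]] refl]) measurable
    then show ?thesis by (rule borel_measurable_nn_integral)
  qed
  have E: "(\<integral>\<^sup>+x. ennreal (tilde A c x) * indicator ?K x \<partial>\<theta>)
     = (\<integral>\<^sup>+x. ennreal (tilde A c x) * indicator ?K x \<partial>\<mu>) + gap \<mu> \<theta> A"
    unfolding tint[OF f\<theta>] tint[OF ffm_\<mu>] gap_def using mk measurable_pot_diff[OF ffm_\<mu> f\<theta>]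
    by (subst Lam_add[OF cvxD(1)[OF A], symmetric]) (auto intro!: Lam_cong[OF cvxD(1)[OF A]] simp: kint)
  have t0: "0 \<le> indicator ?K x * tilde A c x" for x
    using tilde_nonneg[OF cvxD(1)[OF A] c] KJ by (auto simp: indicator_def)
  have nt: "(\<integral>\<^sup>+x. ennreal (tilde A c x) * indicator ?K x \<partial>\<kappa>) = ennreal (LINT x|\<kappa>. indicator ?K x * tilde A c x)"
    if "\<kappa> = \<mu> \<or> \<kappa> = \<theta>" for \<kappa>
  proof -
    have "(\<integral>\<^sup>+x. ennreal (tilde A c x) * indicator ?K x \<partial>\<kappa>) = (\<integral>\<^sup>+x. ennreal (indicator ?K x * tilde A c x) \<partial>\<kappa>)"
      by (intro nn_integral_cong) (auto simp: indicator_def)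
    also have "\<dots> = ennreal (LINT x|\<kappa>. indicator ?K x * tilde A c x)"
      by (rule nn_integral_eq_integral[OF intg[OF tcv that]]) (use t0 in auto)
    finally show ?thesis .
  qed
  let ?a = "A c - rderiv A c * c" and ?b = "rderiv A c"
  \<comment> \<open>Total integrals of affine functions agree by equal mass and mean, and the outer
    parts agree as well; hence so do the inner parts, and the tangent drops out of the
    difference.\<close>
  have affK: "(LINT x|\<theta>. indicator ?K x * (?a + ?b * x)) = (LINT x|\<mu>. indicator ?K x * (?a + ?b * x))"
  proof -
    have "(LINT x|\<kappa>. ?a + ?b * x) = (LINT x|\<kappa>. indicator ?K x * (?a + ?b * x)) + (LINT x|\<kappa>. indicator (J - ?K) x * (?a + ?b * x))"
      if "\<kappa> = \<mu> \<or> \<kappa> = \<theta>" for \<kappa>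
    proof -
      have ck: "carried \<kappa>" using that car carried_\<mu> by auto
      have i2: "integrable \<kappa> (\<lambda>x. indicator (J - ?K) x * (?a + ?b * x))"
        using ffm_integrable_affine[OF carriedD(1)[OF ck], of ?a ?b] ffmD(1)[OF carriedD(1)[OF ck]]
        by (intro integrable_real_mult_indicator[where A="J - ?K", unfolded mult.commute[of _ "indicator _ _"]]) auto
      have "(LINT x|\<kappa>. ?a + ?b * x) = (LINT x|\<kappa>. indicator ?K x * (?a + ?b * x) + indicator (J - ?K) x * (?a + ?b * x))"
        by (intro integral_cong_AE measurable_carried[OF ck], measurable, use carriedD(2)[OF ck] in eventually_elim) (auto simp: indicator_def)
      also have "\<dots> = (LINT x|\<kappa>. indicator ?K x * (?a + ?b * x)) + (LINT x|\<kappa>. indicator (J - ?K) x * (?a + ?b * x))"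
        by (rule Bochner_Integration.integral_add[OF intg[OF cvx_affine that] i2])
      finally show ?thesis .
    qed
    moreover have "(LINT x|\<theta>. ?a + ?b * x) = (LINT x|\<mu>. ?a + ?b * x)"
      unfolding integral_affine[OF f\<theta>] integral_affine[OF ffm_\<mu>] using \<theta>(1) by (simp add: pot_le_def)
    ultimately show ?thesis using outl[of "\<lambda>x. ?a + ?b * x"] by simp
  qed
  have dec: "(LINT x|\<kappa>. indicator ?K x * tilde A c x) = (LINT x|\<kappa>. indicator ?K x * A x) - (LINT x|\<kappa>. indicator ?K x * (?a + ?b * x))"
    if "\<kappa> = \<mu> \<or> \<kappa> = \<theta>" for \<kappa>
  proof -
    have e: "indicator ?K x * tilde A c x = indicator ?K x * A x - indicator ?K x * (?a + ?b * x)" for x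
      by (simp add: tilde_def algebra_simps)
    show ?thesis unfolding e by (rule Bochner_Integration.integral_diff[OF intg[OF A that] intg[OF cvx_affine that]])
  qed
  have p0: "0 \<le> (LINT x|\<kappa>. indicator ?K x * tilde A c x)" for \<kappa>
    using t0 by (intro Bochner_Integration.integral_nonneg) auto
  have E2: "ennreal (LINT x|\<theta>. indicator ?K x * tilde A c x) = ennreal (LINT x|\<mu>. indicator ?K x * tilde A c x) + gap \<mu> \<theta> A"
    using E nt by simp
  obtain g where g: "gap \<mu> \<theta> A = ennreal g" "0 \<le> g"
    using E2 by (cases "gap \<mu> \<theta> A") auto
  have "(LINT x|\<theta>. indicator ?K x * tilde A c x) = (LINT x|\<mu>. indicator ?K x * tilde A c x) + g"
    using E2 p0 g by (simp add: ennreal_plus[symmetric] del: ennreal_plus)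
  then have "g = (LINT x|\<theta>. indicator ?K x * A x) - (LINT x|\<mu>. indicator ?K x * A x)"
    using dec affK by simp
  with g show "gap \<mu> \<theta> A = ennreal ((LINT x|\<theta>. indicator ?K x * A x) - (LINT x|\<mu>. indicator ?K x * A x))"
    "(LINT x|\<mu>. indicator ?K x * A x) \<le> (LINT x|\<theta>. indicator ?K x * A x)" by auto
qed

text \<open>On \<open>{a..b}\<close> all integrals are finite and the identity is a rearrangement:
  both sides equal the integral of C against \<theta> minus that of A against \<mu>. The outer
  parts, possibly infinite, are common to both sides.\<close>

lemma local_identity:
  assumes \<theta>: "pot_le \<mu> \<theta>" "pot_le \<theta> \<nu>" and ab: "a \<in> J" "b \<in> J" "a < c" "c < b" and c: "c \<in> I"
    and agree: "\<forall>S\<in>sets borel. S \<subseteq> J - {a..b} \<longrightarrow> emeasure \<theta> S = emeasure \<mu> S"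
    and zero: "\<forall>t\<in>J - {a..b}. pot_diff \<mu> \<theta> t = 0"
    and A: "cvx A" and C: "cvx C" and AC: "\<And>x. x \<in> J \<Longrightarrow> A x \<le> C x"
  shows "(\<integral>\<^sup>+x. ennreal (C x - A x) \<partial>\<theta>) + gap \<mu> \<theta> A = (\<integral>\<^sup>+x. ennreal (C x - A x) \<partial>\<mu>) + gap \<mu> \<theta> C"
proof -
  note L = local_outside[OF \<theta> ab c agree zero] local_integrable[OF \<theta> ab c agree zero]
    local_gap[OF \<theta> ab c agree zero] local_gap_nonneg[OF \<theta> ab c agree zero]
  have car: "carried \<theta>" by (rule carried_between[OF \<theta>])
  let ?K = "{a..b}"
  have KJ: "?K \<subseteq> J" using convex_real_mem[OF conv_J ab(1,2)] by auto
  define i where "i B \<kappa> = (LINT x|\<kappa>. indicator ?K x * B x)" for B :: "real \<Rightarrow> real" and \<kappa> :: "real measure"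
  have [measurable]: "A \<in> borel_measurable borel" "C \<in> borel_measurable borel" using cvxD(2) A C by auto
  have w: "(\<integral>\<^sup>+x. ennreal (C x - A x) \<partial>\<kappa>) = ennreal (i C \<kappa> - i A \<kappa>) + (\<integral>\<^sup>+x. ennreal (C x - A x) * indicator (J - ?K) x \<partial>\<kappa>)"
    and le: "i A \<kappa> \<le> i C \<kappa>" if \<kappa>: "\<kappa> = \<mu> \<or> \<kappa> = \<theta>" for \<kappa>
  proof -
    have ck: "carried \<kappa>" using that car carried_\<mu> by auto
    have "(\<integral>\<^sup>+x. ennreal (C x - A x) \<partial>\<kappa>) = (\<integral>\<^sup>+x. ennreal (indicator ?K x * C x - indicator ?K x * A x) + ennreal (C x - A x) * indicator (J - ?K) x \<partial>\<kappa>)"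
      by (rule nn_integral_cong_AE, use carriedD(2)[OF ck] in eventually_elim) (auto simp: indicator_def)
    also have "\<dots> = (\<integral>\<^sup>+x. ennreal (indicator ?K x * C x - indicator ?K x * A x) \<partial>\<kappa>) + (\<integral>\<^sup>+x. ennreal (C x - A x) * indicator (J - ?K) x \<partial>\<kappa>)"
      by (intro nn_integral_add measurable_carried[OF ck]) measurable
    also have "(\<integral>\<^sup>+x. ennreal (indicator ?K x * C x - indicator ?K x * A x) \<partial>\<kappa>) = ennreal (LINT x|\<kappa>. indicator ?K x * C x - indicator ?K x * A x)"
    proof (intro nn_integral_eq_integral Bochner_Integration.integrable_diff L(2) A C \<kappa> AE_I2)
      show "0 \<le> indicator ?K x * C x - indicator ?K x * A x" for x
        using AC[of x] KJ by (auto simp: indicator_def)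
    qed
    also have "(LINT x|\<kappa>. indicator ?K x * C x - indicator ?K x * A x) = i C \<kappa> - i A \<kappa>"
      unfolding i_def by (intro Bochner_Integration.integral_diff L(2) A C \<kappa>)
    finally show "(\<integral>\<^sup>+x. ennreal (C x - A x) \<partial>\<kappa>) = ennreal (i C \<kappa> - i A \<kappa>) + (\<integral>\<^sup>+x. ennreal (C x - A x) * indicator (J - ?K) x \<partial>\<kappa>)" .
    show "i A \<kappa> \<le> i C \<kappa>" unfolding i_def
      using AC KJ by (intro integral_mono L(2) A C \<kappa>) (auto simp: indicator_def)
  qed
  have o: "(\<integral>\<^sup>+x. ennreal (C x - A x) * indicator (J - ?K) x \<partial>\<theta>) = (\<integral>\<^sup>+x. ennreal (C x - A x) * indicator (J - ?K) x \<partial>\<mu>)"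
    by (rule L(1)) measurable
  have "ennreal (i C \<theta> - i A \<theta>) + ennreal (i A \<theta> - i A \<mu>) = ennreal (i C \<mu> - i A \<mu>) + ennreal (i C \<theta> - i C \<mu>)"
    using le[of \<theta>] le[of \<mu>] L(4)[OF A] L(4)[OF C] by (simp add: i_def ennreal_plus[symmetric] del: ennreal_plus)
  then show ?thesis
    using w[of \<theta>] w[of \<mu>] o L(3)[OF A] L(3)[OF C] by (simp add: i_def add_ac)
qed

text \<open>For fixed k the gap between \<mu> and \<open>\<theta> k\<close> is a difference of
  integrals over a compact interval. It is continuous along the sequence, since nonnegative convex
  functions with bounded end values are uniformly bounded there. Fatou in k then reaches
  \<nu>.\<close>

lemma gap_lsc:
  assumes A: "\<And>n. cvx (A n)" and A0: "\<And>n x. x \<in> J \<Longrightarrow> 0 \<le> A n x" and B: "cvx B"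
    and lim: "\<And>x. x \<in> J \<Longrightarrow> (\<lambda>n. A n x) \<longlonglongrightarrow> B x"
  shows "gap \<mu> \<nu> B \<le> liminf (\<lambda>n. gap \<mu> \<nu> (A n))"
proof (rule intermediate_measures)
  fix \<theta> :: "nat \<Rightarrow> real measure"
  assume le: "\<And>k. pot_le \<mu> (\<theta> k)" "\<And>k. pot_le (\<theta> k) \<nu>"
    and loc: "\<And>k c. c \<in> I \<Longrightarrow> \<exists>a b. a \<in> J \<and> b \<in> J \<and> a < c \<and> c < b \<and>
        (\<forall>S\<in>sets borel. S \<subseteq> J - {a..b} \<longrightarrow> emeasure (\<theta> k) S = emeasure \<mu> S) \<and>
        (\<forall>t\<in>J - {a..b}. pot_diff \<mu> (\<theta> k) t = 0)"
    and pd: "\<And>t. t \<in> J \<Longrightarrow> (\<lambda>k. pot_diff \<mu> (\<theta> k) t) \<longlonglongrightarrow> pot_diff \<mu> \<nu> t"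
  obtain c where c: "c \<in> I" using I_ne by auto
  have step: "gap \<mu> (\<theta> k) B \<le> liminf (\<lambda>n. gap \<mu> \<nu> (A n))" for k
  proof -
    obtain a b where ab: "a \<in> J" "b \<in> J" "a < c" "c < b"
      and ag: "\<forall>S\<in>sets borel. S \<subseteq> J - {a..b} \<longrightarrow> emeasure (\<theta> k) S = emeasure \<mu> S" "\<forall>t\<in>J - {a..b}. pot_diff \<mu> (\<theta> k) t = 0"
      using loc[OF c, of k] by blast
    have KJ: "{a..b} \<subseteq> J" using convex_real_mem[OF conv_J ab(1,2)] by auto
    note L = local_gap[OF le ab c ag]
    have car: "carried (\<theta> k)" by (rule carried_between[OF le])
    obtain M where M: "\<And>n. \<bar>A n a\<bar> \<le> M" "\<And>n. \<bar>A n b\<bar> \<le> M"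
    proof -
      obtain M1 where M1: "\<And>n. \<bar>A n a\<bar> \<le> M1" using convergent_imp_Bseq[OF convergentI[OF lim[OF ab(1)]]] by (auto simp: Bseq_def)
      obtain M2 where M2: "\<And>n. \<bar>A n b\<bar> \<le> M2" using convergent_imp_Bseq[OF convergentI[OF lim[OF ab(2)]]] by (auto simp: Bseq_def)
      show ?thesis by (rule that[of "max M1 M2"]) (auto intro: le_max_iff_disj[THEN iffD2] M1 M2)
    qed
    have bnd: "norm (indicator {a..b} x * A n x) \<le> M" for n x
    proof (cases "x \<in> {a..b}")
      case True
      have "A n x \<le> max (A n a) (A n b)"
        using convex_on_le_max[OF convex_on_subset[OF cvxD(1)[OF A] KJ]] True by auto
      then show ?thesis using A0[of x n] KJ True M[of n] by auto
    qed (use M(1)[of n] in auto)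
    have conv: "(\<lambda>n. LINT x|\<kappa>. indicator {a..b} x * A n x) \<longlonglongrightarrow> (LINT x|\<kappa>. indicator {a..b} x * B x)" if "carried \<kappa>" for \<kappa>
    proof (rule integral_dominated_convergence[where w="\<lambda>_. M"])
      interpret finite_measure \<kappa> using ffmD(3)[OF carriedD(1)[OF that]] .
      show "integrable \<kappa> (\<lambda>_. M)" by simp
      show "AE x in \<kappa>. (\<lambda>n. indicator {a..b} x * A n x) \<longlonglongrightarrow> indicator {a..b} x * B x"
        using carriedD(2)[OF that] by eventually_elim (intro tendsto_intros lim)
      show "AE x in \<kappa>. norm (indicator {a..b} x * A n x) \<le> M" for n by (intro AE_I2 bnd)
      show "(\<lambda>x. indicator {a..b} x * B x) \<in> borel_measurable \<kappa>"
        using cvxD(2)[OF B] by (intro measurable_carried[OF that]) measurable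
      show "(\<lambda>x. indicator {a..b} x * A n x) \<in> borel_measurable \<kappa>" for n
        using cvxD(2)[OF A[of n]] by (intro measurable_carried[OF that]) measurable
    qed
    have "(\<lambda>n. gap \<mu> (\<theta> k) (A n)) \<longlonglongrightarrow> gap \<mu> (\<theta> k) B"
      unfolding L[OF A] L[OF B] by (intro tendsto_ennrealI tendsto_diff conv car carried_\<mu>)
    then have "gap \<mu> (\<theta> k) B = liminf (\<lambda>n. gap \<mu> (\<theta> k) (A n))" by (simp add: lim_imp_Liminf)
    also have "\<dots> \<le> liminf (\<lambda>n. gap \<mu> \<nu> (A n))"
      by (intro Liminf_mono always_eventually allI gap_mono cvxD(1)[OF A] le)
    finally show ?thesis .
  qed
  have "gap \<mu> \<nu> B \<le> liminf (\<lambda>k. gap \<mu> (\<theta> k) B)"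
    unfolding gap_def
  proof (rule Lam_liminf[OF cvxD(1)[OF B]])
    show "(\<lambda>t. ennreal (pot_diff \<mu> (\<theta> n) t)) \<in> borel_measurable borel" for n
      using measurable_pot_diff[OF ffm_\<mu>, of "\<theta> n"] le(1)[of n] by (auto simp: pot_le_def)
    show "ennreal (pot_diff \<mu> \<nu> t) \<le> liminf (\<lambda>n. ennreal (pot_diff \<mu> (\<theta> n) t))" if "t \<in> J" for t
      using lim_imp_Liminf[OF _ tendsto_ennrealI[OF pd[OF that]]] by simp
  qed
  also have "\<dots> \<le> liminf (\<lambda>k::nat. liminf (\<lambda>n. gap \<mu> \<nu> (A n)))"
    by (intro Liminf_mono always_eventually allI step)
  finally show ?thesis by (simp add: Liminf_const)
qed

text \<open>Neither side need be finite. Truncating the measures (rather than the functions) gives one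
  inequality through Fatou's lemma and the other one through weak duality.\<close>

lemma duality_identity:
  assumes A: "cvx A" and C: "cvx C" and AC: "\<And>x. x \<in> J \<Longrightarrow> A x \<le> C x"
  shows "(\<integral>\<^sup>+x. ennreal (C x - A x) \<partial>\<nu>) + gap \<mu> \<nu> A = (\<integral>\<^sup>+x. ennreal (C x - A x) \<partial>\<mu>) + gap \<mu> \<nu> C"
proof (rule intermediate_measures)
  fix \<theta> :: "nat \<Rightarrow> real measure"
  assume le: "\<And>k. pot_le \<mu> (\<theta> k)" "\<And>k. pot_le (\<theta> k) \<nu>"
    and loc: "\<And>k c. c \<in> I \<Longrightarrow> \<exists>a b. a \<in> J \<and> b \<in> J \<and> a < c \<and> c < b \<and>
        (\<forall>S\<in>sets borel. S \<subseteq> J - {a..b} \<longrightarrow> emeasure (\<theta> k) S = emeasure \<mu> S) \<and>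
        (\<forall>t\<in>J - {a..b}. pot_diff \<mu> (\<theta> k) t = 0)"
    and pd: "\<And>t. t \<in> J \<Longrightarrow> (\<lambda>k. pot_diff \<mu> (\<theta> k) t) \<longlonglongrightarrow> pot_diff \<mu> \<nu> t"
    and fat: "\<And>f. f \<in> borel_measurable borel \<Longrightarrow> (\<integral>\<^sup>+x. f x \<partial>\<nu>) \<le> liminf (\<lambda>k. \<integral>\<^sup>+x. f x \<partial>\<theta> k)"
  have [measurable]: "A \<in> borel_measurable borel" "C \<in> borel_measurable borel" using cvxD(2) A C by auto
  obtain c where c: "c \<in> I" using I_ne by auto
  let ?w = "\<lambda>\<kappa>. \<integral>\<^sup>+x. ennreal (C x - A x) \<partial>\<kappa>"
  have car: "carried (\<theta> k)" for k by (rule carried_between[OF le])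
  have id: "?w (\<theta> k) + gap \<mu> (\<theta> k) A = ?w \<mu> + gap \<mu> (\<theta> k) C" for k
  proof -
    obtain a b where ab: "a \<in> J" "b \<in> J" "a < c" "c < b"
      and ag: "\<forall>S\<in>sets borel. S \<subseteq> J - {a..b} \<longrightarrow> emeasure (\<theta> k) S = emeasure \<mu> S" "\<forall>t\<in>J - {a..b}. pot_diff \<mu> (\<theta> k) t = 0"
      using loc[OF c, of k] by blast
    show ?thesis by (rule local_identity[OF le ab c ag A C AC])
  qed
  have gl: "gap \<mu> \<nu> B \<le> liminf (\<lambda>k. gap \<mu> (\<theta> k) B)" if B: "cvx B" for B
    unfolding gap_def
  proof (rule Lam_liminf[OF cvxD(1)[OF B]])
    show "(\<lambda>t. ennreal (pot_diff \<mu> (\<theta> n) t)) \<in> borel_measurable borel" for n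
      using measurable_pot_diff[OF ffm_\<mu>, of "\<theta> n"] le(1)[of n] by (auto simp: pot_le_def)
    show "ennreal (pot_diff \<mu> \<nu> t) \<le> liminf (\<lambda>n. ennreal (pot_diff \<mu> (\<theta> n) t))" if "t \<in> J" for t
      using lim_imp_Liminf[OF _ tendsto_ennrealI[OF pd[OF that]]] by simp
  qed
  show ?thesis
  proof (rule antisym)
    show "?w \<nu> + gap \<mu> \<nu> A \<le> ?w \<mu> + gap \<mu> \<nu> C"
    proof (rule liminf_add_le_const)
      show "?w \<nu> \<le> liminf (\<lambda>k. ?w (\<theta> k))" by (rule fat) measurable
      show "gap \<mu> \<nu> A \<le> liminf (\<lambda>k. gap \<mu> (\<theta> k) A)" by (rule gl[OF A])
      show "?w (\<theta> k) + gap \<mu> (\<theta> k) A \<le> ?w \<mu> + gap \<mu> \<nu> C" for k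
        unfolding id by (intro add_left_mono gap_mono cvxD(1)[OF C] le)
    qed
    show "?w \<mu> + gap \<mu> \<nu> C \<le> ?w \<nu> + gap \<mu> \<nu> A"
    proof (rule liminf_add_le_const)
      show "?w \<mu> \<le> liminf (\<lambda>k::nat. ?w \<mu>)" by (simp add: Liminf_const)
      show "gap \<mu> \<nu> C \<le> liminf (\<lambda>k. gap \<mu> (\<theta> k) C)" by (rule gl[OF C])
      \<comment> \<open>Here the integral against \<open>\<theta> k\<close> must be bounded by that
        against \<nu>, the direction opposite to Fatou; weak duality between
        \<open>\<theta> k\<close> and \<nu> gives this at the price of a gap, which
        \<open>gap_add\<close> absorbs.\<close>
      show "?w \<mu> + gap \<mu> (\<theta> k) C \<le> ?w \<nu> + gap \<mu> \<nu> A" for k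
      proof -
        have "?w \<mu> + gap \<mu> (\<theta> k) C = ?w (\<theta> k) + gap \<mu> (\<theta> k) A" by (rule id[symmetric])
        also have "\<dots> \<le> (?w \<nu> + gap (\<theta> k) \<nu> A) + gap \<mu> (\<theta> k) A"
          by (intro add_right_mono weak_duality[OF A C AC car carried_\<nu> le(2)])
        also have "\<dots> = ?w \<nu> + (gap \<mu> (\<theta> k) A + gap (\<theta> k) \<nu> A)" by (simp add: add_ac)
        also have "gap \<mu> (\<theta> k) A + gap (\<theta> k) \<nu> A = gap \<mu> \<nu> A"
          by (rule gap_add[OF cvxD(1)[OF A] carried_\<mu> car carried_\<nu> le])
        finally show ?thesis .
      qed
    qed
  qed
qed

end

section \<open>Moderators and the dual problem\<close>

lemma ext_L1_real: "(\<lambda>x. ereal (g x)) \<in> ext_L1 M \<longleftrightarrow> integrable M g"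
proof -
  have e: "e2ennreal \<bar>ereal r\<bar> = ennreal (norm r)" for r by (simp add: ennreal.abs_eq[symmetric])
  show ?thesis unfolding ext_L1_def integrable_iff_bounded mem_Collect_eq borel_measurable_ereal_iff e ..
qed

lemma ext_L1_cong:
  assumes "\<And>x. x \<in> space M \<Longrightarrow> f x = g x"
  shows "f \<in> ext_L1 M \<longleftrightarrow> g \<in> ext_L1 M"
proof -
  have "f \<in> borel_measurable M \<longleftrightarrow> g \<in> borel_measurable M" using assms by (rule measurable_cong)
  moreover have "(\<integral>\<^sup>+ x. e2ennreal \<bar>f x\<bar> \<partial>M) = (\<integral>\<^sup>+ x. e2ennreal \<bar>g x\<bar> \<partial>M)"
    using assms by (intro nn_integral_cong) simp
  ultimately show ?thesis by (simp add: ext_L1_def)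
qed

lemma ext_integral_cong:
  assumes "\<And>x. x \<in> space M \<Longrightarrow> f x = g x"
  shows "ext_integral M f = ext_integral M g"
  using assms unfolding ext_integral_def by (intro arg_cong2[where f="(-)"] arg_cong[where f=enn2ereal] nn_integral_cong) auto

context irreducible
begin

text \<open>The moderated value of the pair (-A, C) for the moderator -A, whose first integrand is
  0.\<close>

definition primal_dual_value :: "(real \<Rightarrow> real) \<Rightarrow> (real \<Rightarrow> real) \<Rightarrow> ennreal" where
  "primal_dual_value A C = (\<integral>\<^sup>+x. ennreal (C x - A x) \<partial>\<nu>) + gap \<mu> \<nu> A"

text \<open>The factor 1/2 sits inside \<open>pot_diff\<close> on one side and outside the integral
  on the other; the jump terms of \<mu> vanish because \<mu> is concentrated on I.\<close>

lemma concave_gap_eq: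
  assumes h: "concave_on J h"
  shows "concave_gap I J \<mu> \<nu> h = enn2ereal (gap \<mu> \<nu> (\<lambda>x. - h x))"
proof -
  have A: "convex_on J (\<lambda>x. - h x)" using h by (simp add: concave_on_def)
  obtain c where c: "c \<in> I" using I_ne by auto
  let ?M = "second_deriv_measure I (\<lambda>x. - h x)"
  have bj: "\<bar>boundary_jump I (\<lambda>x. - h x) e\<bar> = \<bar>boundary_jump I h e\<bar>" if e: "e \<in> J - I" for e
  proof -
    obtain l where l: "((\<lambda>x. - h x) \<longlongrightarrow> l) (at e within I)" using convex_end_limit[OF A c e] by blast
    have "(h \<longlongrightarrow> - l) (at e within I)" using tendsto_minus[OF l] by simp
    then show ?thesis
      using tendsto_Lim[OF hinge_integral_end(3)[OF A c e] l] tendsto_Lim[OF hinge_integral_end(3)[OF A c e], of h]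
      by (simp add: boundary_jump_def)
  qed
  have lint: "(LINT x:J - I|\<theta>. g x) = (\<Sum>e\<in>J - I. g e * measure \<theta> {e})" if "finite_first_moment \<theta>" for \<theta> and g :: "real \<Rightarrow> real"
  proof -
    interpret finite_measure \<theta> using ffmD(3)[OF that] .
    have "indicator (J - I) x *\<^sub>R g x = (\<Sum>e\<in>J - I. g e * indicator {e} x)" for x
    proof -
      have "(\<Sum>e\<in>J - I. g e * indicator {e} x) = (\<Sum>e\<in>J - I. if e = x then g x else 0)"
        by (intro sum.cong) auto
      then show ?thesis using finite_ends by (simp add: sum.delta indicator_def)
    qed
    then have "(LINT x:J - I|\<theta>. g x) = (LINT x|\<theta>. (\<Sum>e\<in>J - I. g e * indicator {e} x))"
      by (simp add: set_lebesgue_integral_def)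
    also have "\<dots> = (\<Sum>e\<in>J - I. (LINT x|\<theta>. g e * indicator {e} x))"
      using ffmD(1,2)[OF that] by (intro Bochner_Integration.integral_sum integrable_mult_right integrable_real_indicator) (auto simp: less_top[symmetric])
    also have "\<dots> = (\<Sum>e\<in>J - I. g e * measure \<theta> {e})" using ffmD(2)[OF that] by simp
    finally show ?thesis .
  qed
  have sp: "space ?M = I" using space_second_deriv_measure[OF convex_on_I[OF A] open_I] .
  have [measurable]: "potential \<mu> \<in> borel_measurable borel" "potential \<nu> \<in> borel_measurable borel"
    using continuous_potential(2) ffm_\<mu> ffm_\<nu> by (auto intro!: borel_measurable_continuous_onI)
  define Q where "Q = (\<integral>\<^sup>+t. ennreal (potential \<nu> t - potential \<mu> t) \<partial>?M)"
  have "(\<integral>\<^sup>+t. ennreal (pot_diff \<mu> \<nu> t) \<partial>?M) = (\<integral>\<^sup>+t. ennreal (1/2) * ennreal (potential \<nu> t - potential \<mu> t) \<partial>?M)"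
  proof (intro nn_integral_cong)
    fix t assume "t \<in> space ?M"
    then have "t \<in> I" by (simp add: sp)
    moreover have "ennreal (y / 2) = ennreal (1/2) * ennreal y" if "0 \<le> y" for y
      using that by (subst ennreal_mult[symmetric]) auto
    moreover have "0 \<le> potential \<nu> t - potential \<mu> t" using d_nonneg[of t] by (simp add: d_def)
    ultimately show "ennreal (pot_diff \<mu> \<nu> t) = ennreal (1/2) * ennreal (potential \<nu> t - potential \<mu> t)"
      by (metis pot_diff_def)
  qed
  also have "\<dots> = ennreal (1/2) * Q"
    unfolding Q_def by (intro nn_integral_cmult measurable_sdm[OF A]) measurable
  finally have 1: "(\<integral>\<^sup>+t. ennreal (pot_diff \<mu> \<nu> t) \<partial>?M) = ennreal (1/2) * Q" .
  have 2: "(\<Sum>e\<in>J - I. ennreal \<bar>boundary_jump I (\<lambda>x. - h x) e\<bar> * ennreal (pot_diff \<mu> \<nu> e))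
      = ennreal (\<Sum>e\<in>J - I. \<bar>boundary_jump I h e\<bar> * measure \<nu> {e})"
    using \<mu>_end by (subst sum_ennreal[symmetric]) (auto simp: bj pot_diff_def ennreal_mult intro!: sum.cong)
  have 3: "enn2ereal (ennreal (1/2) * q) = enn2ereal q / 2" for q
  proof (cases q)
    case (real r)
    have "ennreal (1/2) * ennreal r = ennreal (r / 2)" using real(1) by (subst ennreal_mult[symmetric]) auto
    then show ?thesis using real by (simp only: enn2ereal_ennreal) simp
  next
    case top
    have "ennreal (1/2) * top = top" by (subst ennreal_mult_top) simp
    then show ?thesis unfolding top by (simp only: enn2ereal_top) simp
  qed
  have s0: "0 \<le> (\<Sum>e\<in>J - I. \<bar>boundary_jump I h e\<bar> * measure \<nu> {e})" by (intro sum_nonneg) auto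
  have "enn2ereal (gap \<mu> \<nu> (\<lambda>x. - h x)) = enn2ereal Q / 2 + ereal (\<Sum>e\<in>J - I. \<bar>boundary_jump I h e\<bar> * measure \<nu> {e})"
    unfolding gap_def Lam_def 1 2 plus_ennreal.rep_eq 3 using s0 by simp
  moreover have "(\<Sum>e\<in>J - I. \<bar>boundary_jump I h e\<bar> * measure \<mu> {e}) = 0" using \<mu>_end by (intro sum.neutral) auto
  ultimately show ?thesis by (simp add: concave_gap_def lint[OF ffm_\<mu>] lint[OF ffm_\<nu>] Q_def)
qed

text \<open>Independence of the moderator: -H stands for an arbitrary one and is compared with -A.
  The integrability assumptions on H - A and C - H make the differences with G integrable, so that
  the duality identities can be solved for the gaps.\<close>

lemma moderator_finite:
  assumes A: "cvx A" and C: "cvx C" and H: "cvx H" and AC: "\<And>x. x \<in> J \<Longrightarrow> A x \<le> C x"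
    and i\<mu>: "integrable \<mu> (\<lambda>x. H x - A x)" and i\<nu>: "integrable \<nu> (\<lambda>x. C x - H x)"
  shows moderator_value_finite: "gap \<mu> \<nu> H < \<infinity> \<Longrightarrow> primal_dual_value A C < \<infinity>"
    and moderator_value: "primal_dual_value A C < \<infinity> \<Longrightarrow>
      ereal (LINT x|\<mu>. H x - A x) + ereal (LINT x|\<nu>. C x - H x) + enn2ereal (gap \<mu> \<nu> H) = enn2ereal (primal_dual_value A C)"
proof -
  \<comment> \<open>G dominates both A and H, so that \<open>duality_identity\<close> compares each of them with G.\<close>
  define G where "G x = max (A x) (H x)" for x
  have G: "cvx G" unfolding G_def by (rule cvx_max[OF A H])
  note [measurable] = cvxD(2)[OF A] cvxD(2)[OF C] cvxD(2)[OF H] cvxD(2)[OF G]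
  have m\<mu>: "f \<in> borel_measurable \<mu>" and m\<nu>: "f \<in> borel_measurable \<nu>" if "f \<in> borel_measurable borel" for f :: "real \<Rightarrow> real"
    using measurable_carried[OF carried_\<mu> that] measurable_carried[OF carried_\<nu> that] .
  have id1: "(\<integral>\<^sup>+x. ennreal (G x - H x) \<partial>\<nu>) + gap \<mu> \<nu> H = (\<integral>\<^sup>+x. ennreal (G x - H x) \<partial>\<mu>) + gap \<mu> \<nu> G"
    by (rule duality_identity[OF H G]) (simp add: G_def)
  have id2: "(\<integral>\<^sup>+x. ennreal (G x - A x) \<partial>\<nu>) + gap \<mu> \<nu> A = (\<integral>\<^sup>+x. ennreal (G x - A x) \<partial>\<mu>) + gap \<mu> \<nu> G"
    by (rule duality_identity[OF A G]) (simp add: G_def)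
  have a: "integrable \<mu> (\<lambda>x. G x - A x)"
    by (rule Bochner_Integration.integrable_bound[OF i\<mu>]) (auto intro!: m\<mu> AE_I2 simp: G_def)
  have b: "integrable \<mu> (\<lambda>x. G x - H x)"
    by (rule Bochner_Integration.integrable_bound[OF i\<mu>]) (auto intro!: m\<mu> AE_I2 simp: G_def)
  have c: "integrable \<nu> (\<lambda>x. G x - H x)"
  proof (rule Bochner_Integration.integrable_bound[OF i\<nu>])
    show "AE x in \<nu>. norm (G x - H x) \<le> norm (C x - H x)"
      using carriedD(2)[OF carried_\<nu>]
    proof eventually_elim
      case (elim x)
      then show ?case using AC[OF elim] by (auto simp: G_def)
    qed
  qed (auto intro!: m\<nu>)
  have pos: "0 \<le> G x - A x" "0 \<le> G x - H x" for x by (auto simp: G_def)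
  have na: "(\<integral>\<^sup>+x. ennreal (G x - A x) \<partial>\<mu>) = ennreal (LINT x|\<mu>. G x - A x)"
    by (intro nn_integral_eq_integral a AE_I2 pos)
  have nb: "(\<integral>\<^sup>+x. ennreal (G x - H x) \<partial>\<mu>) = ennreal (LINT x|\<mu>. G x - H x)"
    by (intro nn_integral_eq_integral b AE_I2 pos)
  have nc: "(\<integral>\<^sup>+x. ennreal (G x - H x) \<partial>\<nu>) = ennreal (LINT x|\<nu>. G x - H x)"
    by (intro nn_integral_eq_integral c AE_I2 pos)
  have AE_AC: "AE x in \<nu>. 0 \<le> C x - A x" using carriedD(2)[OF carried_\<nu>] by eventually_elim (use AC in simp)
  show "primal_dual_value A C < \<infinity>" if g: "gap \<mu> \<nu> H < \<infinity>"
  proof -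
    have "gap \<mu> \<nu> G < \<infinity>" using id1 g nb nc by (metis ennreal_add_less_top ennreal_less_top infinity_ennreal_def)
    then have f: "gap \<mu> \<nu> A < \<infinity>" "(\<integral>\<^sup>+x. ennreal (G x - A x) \<partial>\<nu>) < \<infinity>"
      using id2 na by (metis ennreal_add_less_top ennreal_less_top infinity_ennreal_def)+
    then have d: "integrable \<nu> (\<lambda>x. G x - A x)"
      using pos by (intro integrableI_bounded m\<nu>) auto
    have "integrable \<nu> (\<lambda>x. (C x - H x) - (G x - H x) + (G x - A x))"
      by (intro Bochner_Integration.integrable_add Bochner_Integration.integrable_diff i\<nu> c d)
    then have "integrable \<nu> (\<lambda>x. C x - A x)" by simp
    then have "(\<integral>\<^sup>+x. ennreal (C x - A x) \<partial>\<nu>) < \<infinity>" by (auto simp: real_integrable_def less_top)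
    with f show ?thesis by (simp add: primal_dual_value_def)
  qed
  assume fin: "primal_dual_value A C < \<infinity>"
  then have f: "(\<integral>\<^sup>+x. ennreal (C x - A x) \<partial>\<nu>) < \<infinity>" "gap \<mu> \<nu> A < \<infinity>" by (auto simp: primal_dual_value_def)
  have e: "integrable \<nu> (\<lambda>x. C x - A x)"
  proof (rule integrableI_bounded)
    have "(\<integral>\<^sup>+x. ennreal (norm (C x - A x)) \<partial>\<nu>) = (\<integral>\<^sup>+x. ennreal (C x - A x) \<partial>\<nu>)"
      by (rule nn_integral_cong_AE, use AE_AC in eventually_elim) simp
    then show "(\<integral>\<^sup>+x. ennreal (norm (C x - A x)) \<partial>\<nu>) < \<infinity>" using f(1) by simp
  qed (auto intro!: m\<nu>)
  have "integrable \<nu> (\<lambda>x. (C x - A x) - (C x - H x))" by (intro Bochner_Integration.integrable_diff e i\<nu>)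
  then have d: "integrable \<nu> (\<lambda>x. G x - A x)"
    by (rule Bochner_Integration.integrable_bound) (auto intro!: m\<nu> AE_I2 simp: G_def)
  have nd: "(\<integral>\<^sup>+x. ennreal (G x - A x) \<partial>\<nu>) = ennreal (LINT x|\<nu>. G x - A x)"
    by (intro nn_integral_eq_integral d AE_I2 pos)
  have gG: "gap \<mu> \<nu> G < \<infinity>" using id2 f nd by (metis ennreal_add_less_top ennreal_less_top infinity_ennreal_def)
  then have gH: "gap \<mu> \<nu> H < \<infinity>" using id1 nb by (metis ennreal_add_less_top ennreal_less_top infinity_ennreal_def)
  obtain gA gg gh where g: "gap \<mu> \<nu> A = ennreal gA" "gap \<mu> \<nu> G = ennreal gg" "gap \<mu> \<nu> H = ennreal gh" "0 \<le> gA" "0 \<le> gg" "0 \<le> gh"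
    using f(2) gG gH by (cases "gap \<mu> \<nu> A"; cases "gap \<mu> \<nu> G"; cases "gap \<mu> \<nu> H") auto
  have nn: "0 \<le> (LINT x|\<kappa>. G x - A x)" "0 \<le> (LINT x|\<kappa>. G x - H x)" for \<kappa>
    using pos by (auto intro!: Bochner_Integration.integral_nonneg)
  have r1: "(LINT x|\<nu>. G x - H x) + gh = (LINT x|\<mu>. G x - H x) + gg"
    using id1 nb nc g nn by (simp add: ennreal_plus[symmetric] del: ennreal_plus)
  have r2: "(LINT x|\<nu>. G x - A x) + gA = (LINT x|\<mu>. G x - A x) + gg"
    using id2 na nd g nn by (simp add: ennreal_plus[symmetric] del: ennreal_plus)
  have l1: "(LINT x|\<mu>. H x - A x) = (LINT x|\<mu>. G x - A x) - (LINT x|\<mu>. G x - H x)"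
    using Bochner_Integration.integral_diff[OF a b] by simp
  have l2: "(LINT x|\<nu>. C x - H x) = (LINT x|\<nu>. C x - A x) - (LINT x|\<nu>. G x - A x) + (LINT x|\<nu>. G x - H x)"
    using Bochner_Integration.integral_add[OF Bochner_Integration.integrable_diff[OF e d] c] Bochner_Integration.integral_diff[OF e d] by simp
  have v: "primal_dual_value A C = ennreal ((LINT x|\<nu>. C x - A x) + gA)"
  proof -
    have "(\<integral>\<^sup>+x. ennreal (C x - A x) \<partial>\<nu>) = ennreal (LINT x|\<nu>. C x - A x)" by (rule nn_integral_eq_integral[OF e AE_AC])
    moreover have "0 \<le> (LINT x|\<nu>. C x - A x)" using AE_AC by (rule integral_nonneg_AE)
    ultimately show ?thesis using g by (simp add: primal_dual_value_def)
  qed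
  have "0 \<le> (LINT x|\<nu>. C x - A x)" using AE_AC by (rule integral_nonneg_AE)
  then show "ereal (LINT x|\<mu>. H x - A x) + ereal (LINT x|\<nu>. C x - H x) + enn2ereal (gap \<mu> \<nu> H) = enn2ereal (primal_dual_value A C)"
    unfolding v g(3) using l1 l2 r1 r2 g by (simp del: ennreal_plus)
qed

lemma mass_pos: "0 < mass \<mu>"
proof (rule ccontr)
  assume "\<not> ?thesis"
  then have z: "mass \<mu> = 0" "mass \<nu> = 0" using pot_le_\<mu>\<nu> by (auto simp: pot_le_def zero_less_measure_iff)
  have "potential \<theta> t = 0" if "finite_first_moment \<theta>" "mass \<theta> = 0" for \<theta> t
  proof -
    interpret finite_measure \<theta> using ffmD(3)[OF that(1)] .
    have "emeasure \<theta> (space \<theta>) = 0" using that ffmD(2)[OF that(1)] by (simp add: emeasure_eq_measure)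
    then have "AE x in \<theta>. \<bar>t - x\<bar> = 0" by (intro AE_I[of _ _ "space \<theta>"]) auto
    then show ?thesis unfolding potential_def by (rule integral_eq_zero_AE)
  qed
  then show False using z ffm_\<mu> ffm_\<nu> dom_ne by (auto simp: dom_I_def)
qed

text \<open>If no such point existed on one side of x, the hinge integral of \<nu> opening to that
  side would vanish, contradicting the strict inequality of potentials at x.\<close>

lemma \<nu>_both_sides:
  assumes x: "x \<in> I" and P: "AE y in \<nu>. P y" and s: "\<bar>s\<bar> = 1"
  obtains y where "y \<in> J" "0 < s * (y - x)" "P y"
proof (rule ccontr)
  assume no: "\<not> thesis"
  have "AE y in \<nu>. max 0 (s * (y - x)) = 0"
    using P carriedD(2)[OF carried_\<nu>]
  proof eventually_elim
    case (elim y)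
    then have "\<not> 0 < s * (y - x)" using no that[of y] by blast
    then show ?case by (simp only: not_less max_absorb1)
  qed
  then have "(LINT y|\<nu>. max 0 (s * (y - x))) = 0" by (rule integral_eq_zero_AE)
  moreover have "0 \<le> (LINT y|\<mu>. max 0 (s * (y - x)))" by (intro Bochner_Integration.integral_nonneg) auto
  moreover have "0 < potential \<nu> x - potential \<mu> x" using x by (simp add: dom_I_def)
  moreover have "(LINT y|\<nu>. max 0 (s * (y - x))) = (LINT y|\<mu>. max 0 (s * (y - x))) + (potential \<nu> x - potential \<mu> x) / 2"
    using pot_le_hinge[OF pot_le_\<mu>\<nu>, of s x] s by simp
  moreover have "z = 0 \<Longrightarrow> 0 \<le> a \<Longrightarrow> 0 < b \<Longrightarrow> z = a + b / 2 \<Longrightarrow> False" for a b z :: real by linarith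
  ultimately show False by blast
qed

lemma AE_\<mu>_exists:
  assumes "AE x in \<mu>. P x"
  obtains x where "x \<in> I" "P x"
proof (rule ccontr)
  assume no: "\<not> thesis"
  have "AE x in \<mu>. False" using assms AE_\<mu>_I by eventually_elim (use no that in auto)
  then have "AE x in \<mu>. (1::real) = 0" by eventually_elim simp
  then have "(LINT x|\<mu>. (1::real)) = 0" by (rule integral_eq_zero_AE)
  then show False using mass_pos ffmD(2)[OF ffm_\<mu>] by simp
qed

lemma ext_L1_AE_finite:
  assumes \<theta>: "carried \<theta>" and L: "f \<in> ext_L1 (restrict_space \<theta> J)"
  shows "AE x in \<theta>. \<bar>f x\<bar> \<noteq> \<infinity>"
proof -
  have [measurable]: "f \<in> borel_measurable (restrict_space \<theta> J)" using L by (simp add: ext_L1_def)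
  have "(\<integral>\<^sup>+x. e2ennreal \<bar>f x\<bar> \<partial>restrict_space \<theta> J) \<noteq> \<infinity>" using L by (auto simp: ext_L1_def)
  moreover have "(\<lambda>x. e2ennreal \<bar>f x\<bar>) \<in> borel_measurable (restrict_space \<theta> J)" by measurable
  ultimately have "AE x in restrict_space \<theta> J. e2ennreal \<bar>f x\<bar> \<noteq> \<infinity>"
    by (intro nn_integral_PInf_AE)
  then have "AE x in \<theta>. x \<in> J \<longrightarrow> e2ennreal \<bar>f x\<bar> \<noteq> \<infinity>"
    using ffmD(1,2)[OF carriedD(1)[OF \<theta>]] by (subst (asm) AE_restrict_space_iff) auto
  with carriedD(2)[OF \<theta>] show ?thesis
    by eventually_elim (auto simp: e2ennreal_infty)
qed

lemma ext_convex_finite: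
  assumes "ext_convex_on J \<phi>" "\<And>x. x \<in> J \<Longrightarrow> \<phi> x = ereal (A x)"
  shows "convex_on J A"
proof -
  have "{(x, t). x \<in> J \<and> \<phi> x \<le> ereal t} = {(x, t). x \<in> J \<and> ereal (A x) \<le> ereal t}" using assms(2) by auto
  then have "ext_convex_on J (\<lambda>x. ereal (A x))" using assms(1) by (simp add: ext_convex_on_def)
  then show ?thesis by (simp add: ext_convex_on_ereal)
qed

lemma ext_convexD:
  assumes "ext_convex_on J \<phi>" "x \<in> J" "y \<in> J" "\<phi> x \<le> ereal a" "\<phi> y \<le> ereal b" "0 \<le> s" "s \<le> 1"
  shows "\<phi> ((1 - s) * x + s * y) \<le> ereal ((1 - s) * a + s * b)"
  using convexD[OF assms(1)[unfolded ext_convex_on_def], of "(x, a)" "(y, b)" "1 - s" s] assms(2-) by simp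

text \<open>Four bounds in turn. \<psi> is below infinity on I, since x lies between two points of
  finite value, and at ends, since \<nu> has atoms there. As the sum is nonnegative, \<phi> is above
  minus infinity. An infinite value of the concave \<phi> would spread to points where \<phi> is
  finite, so \<phi> is below infinity; the sum then bounds \<psi> from below.\<close>

lemma dual_pair_real:
  assumes D: "(\<phi>, \<psi>) \<in> aux_dual_set \<mu> \<nu> f" and f0: "\<And>x. 0 \<le> f x"
  obtains A C where "cvx A" "cvx C" "\<And>x. x \<in> J \<Longrightarrow> \<phi> x = ereal (- A x)" "\<And>x. x \<in> J \<Longrightarrow> \<psi> x = ereal (C x)"
proof -
  obtain h where h: "concave_moderator J \<mu> \<nu> \<phi> \<psi> h" and cc: "ext_convex_on J (\<lambda>x. - \<phi> x)" "ext_convex_on J \<psi>"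
    and fl: "\<And>x. x \<in> J \<Longrightarrow> f x \<le> \<phi> x + \<psi> x"
    using D by (auto simp: aux_dual_set_def Lc_def ext_concave_on_def)
  have fin\<phi>: "AE x in \<mu>. \<bar>\<phi> x\<bar> \<noteq> \<infinity>"
    using ext_L1_AE_finite[OF carried_\<mu>, of "\<lambda>x. \<phi> x - ereal (h x)"] h unfolding concave_moderator_def
    by (auto elim!: eventually_mono)
  have fin\<psi>: "AE x in \<nu>. \<bar>\<psi> x\<bar> \<noteq> \<infinity>"
    using ext_L1_AE_finite[OF carried_\<nu>, of "\<lambda>x. \<psi> x + ereal (h x)"] h unfolding concave_moderator_def
    by (auto elim!: eventually_mono)
  have \<psi>up: "\<psi> x < \<infinity>" if x: "x \<in> J" for x
  proof (cases "x \<in> I")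
    case True
    obtain y where y: "y \<in> J" "0 < 1 * (y - x)" "\<bar>\<psi> y\<bar> \<noteq> \<infinity>" using \<nu>_both_sides[OF True fin\<psi>, of 1] by auto
    obtain z where z: "z \<in> J" "0 < -1 * (z - x)" "\<bar>\<psi> z\<bar> \<noteq> \<infinity>" using \<nu>_both_sides[OF True fin\<psi>, of "-1"] by auto
    obtain a b where ab: "\<psi> z = ereal a" "\<psi> y = ereal b" using y(3) z(3) by auto
    define s where "s = (x - z) / (y - z)"
    have zy: "z < x" "x < y" using y z by auto
    then have s: "0 \<le> s" "s \<le> 1" by (auto simp: s_def divide_simps)
    have "s * (y - z) = x - z" using zy by (simp add: s_def)
    then have xs: "(1 - s) * z + s * y = x" by (simp add: algebra_simps)
    have "\<psi> x \<le> ereal ((1 - s) * a + s * b)"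
      using ext_convexD[OF cc(2) z(1) y(1), of a b s] ab s by (simp add: xs)
    then show ?thesis by (cases "\<psi> x") auto
  next
    case False
    then have "0 < measure \<nu> {x}" using \<nu>_end_pos x by auto
    then have "\<not> (AE y in \<nu>. y \<noteq> x)"
    proof (intro notI)
      assume pos: "0 < measure \<nu> {x}" and ae: "AE y in \<nu>. y \<noteq> x"
      have "{x} \<in> null_sets \<nu>"
        using ae ffmD(1,2)[OF ffm_\<nu>] by (subst AE_iff_null_sets) auto
      then show False using pos by (simp add: measure_eq_0_null_sets)
    qed
    then have "\<bar>\<psi> x\<bar> \<noteq> \<infinity>"
    proof (rule contrapos_nn)
      assume "\<bar>\<psi> x\<bar> = \<infinity>"
      then show "AE y in \<nu>. y \<noteq> x" using fin\<psi> by (auto elim!: eventually_mono)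
    qed
    then show ?thesis by auto
  qed
  have sum0: "0 \<le> \<phi> x + \<psi> x" if "x \<in> J" for x using f0[of x] fl[OF that] by (rule order_trans)
  have \<phi>lo: "- \<infinity> < \<phi> x" if "x \<in> J" for x
    using sum0[OF that] \<psi>up[OF that] by (cases "\<phi> x"; cases "\<psi> x") auto
  have \<phi>up: "\<phi> x < \<infinity>" if x: "x \<in> J" for x
  proof (rule ccontr)
    assume "\<not> ?thesis"
    then have inf: "\<phi> x = \<infinity>" by simp
    obtain z where z: "z \<in> I" "\<bar>\<phi> z\<bar> \<noteq> \<infinity>" using AE_\<mu>_exists[OF fin\<phi>] by blast
    then have zx: "z \<noteq> x" using inf by auto
    obtain e where e: "e > 0" "\<And>y. \<bar>y - z\<bar> < e \<Longrightarrow> y \<in> I" using open_I z(1) by (auto simp: open_real)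
    define r where "r = e / 2 / \<bar>z - x\<bar>"
    have r0: "0 < r" using e(1) zx by (simp add: r_def)
    \<comment> \<open>The point y lies beyond z as seen from x, at a distance that keeps it in I, so
      that z is a proper convex combination of x and y.\<close>
    define y where "y = z + r * (z - x)"
    have "\<bar>y - z\<bar> = e / 2" using zx e(1) by (simp add: y_def r_def abs_mult)
    then have yI: "y \<in> I" using e by auto
    then have yJ: "y \<in> J" using I_J by auto
    obtain b where b: "- \<phi> y \<le> ereal b" using \<phi>lo[OF yJ] by (cases "\<phi> y") auto
    define s where "s = 1 / (1 + r)"
    have s: "0 < s" "s < 1" using r0 by (auto simp: s_def)
    have sr: "s * (1 + r) = 1" using r0 by (simp add: s_def)
    have "(1 - s) * x + s * y = x * (1 - s * (1 + r)) + z * (s * (1 + r))" by (simp add: y_def algebra_simps)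
    then have zs: "(1 - s) * x + s * y = z" unfolding sr by simp
    have le: "- \<phi> z \<le> ereal ((1 - s) * t + s * b)" for t
      using ext_convexD[OF cc(1) x yJ, of t b s] inf b s by (simp add: zs)
    obtain w where w: "\<phi> z = ereal w" using z(2) by auto
    have "- w \<le> (1 - s) * ((- w - 1 - s * b) / (1 - s)) + s * b" using le[of "(- w - 1 - s * b) / (1 - s)"] w by simp
    then show False using s by simp
  qed
  have \<psi>lo: "- \<infinity> < \<psi> x" if "x \<in> J" for x
    using sum0[OF that] \<phi>up[OF that] by (cases "\<phi> x"; cases "\<psi> x") auto
  define A0 C0 where "A0 x = - real_of_ereal (\<phi> x)" and "C0 x = real_of_ereal (\<psi> x)" for x
  have A0: "\<phi> x = ereal (- A0 x)" if "x \<in> J" for x using \<phi>lo[OF that] \<phi>up[OF that] by (cases "\<phi> x") (auto simp: A0_def)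
  have C0: "\<psi> x = ereal (C0 x)" if "x \<in> J" for x using \<psi>lo[OF that] \<psi>up[OF that] by (cases "\<psi> x") (auto simp: C0_def)
  have "convex_on J A0" by (rule ext_convex_finite[OF cc(1)]) (simp add: A0)
  moreover have "convex_on J C0" by (rule ext_convex_finite[OF cc(2)]) (simp add: C0)
  ultimately show thesis
    using A0 C0 by (intro that[OF cvx_restrict cvx_restrict]) auto
qed

lemma restrict_J:
  fixes g :: "real \<Rightarrow> real"
  assumes \<theta>: "carried \<theta>" and g[measurable]: "g \<in> borel_measurable borel"
  shows "integrable (restrict_space \<theta> J) g \<longleftrightarrow> integrable \<theta> g"
    and "integral\<^sup>L (restrict_space \<theta> J) g = integral\<^sup>L \<theta> g"
proof -
  have s: "J \<inter> space \<theta> \<in> sets \<theta>" using ffmD(1,2)[OF carriedD(1)[OF \<theta>]] by simp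
  have ae: "AE x in \<theta>. indicator J x *\<^sub>R g x = g x" using carriedD(2)[OF \<theta>] by eventually_elim simp
  have m: "g \<in> borel_measurable \<theta>" "(\<lambda>x. indicator J x *\<^sub>R g x) \<in> borel_measurable \<theta>"
    by (rule measurable_carried[OF \<theta>], measurable)+
  show "integrable (restrict_space \<theta> J) g \<longleftrightarrow> integrable \<theta> g"
    unfolding integrable_restrict_space[OF s] by (rule integrable_cong_AE[OF m(2,1) ae])
  show "integral\<^sup>L (restrict_space \<theta> J) g = integral\<^sup>L \<theta> g"
    unfolding integral_restrict_space[OF s] by (rule integral_cong_AE[OF m(2,1) ae])
qed

lemma ext_restrict_J:
  assumes \<theta>: "carried \<theta>" and g[measurable]: "g \<in> borel_measurable borel" and eq: "\<And>x. x \<in> J \<Longrightarrow> k x = ereal (g x)"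
  shows "k \<in> ext_L1 (restrict_space \<theta> J) \<longleftrightarrow> integrable \<theta> g"
    and "integrable \<theta> g \<Longrightarrow> ext_integral (restrict_space \<theta> J) k = ereal (LINT x|\<theta>. g x)"
proof -
  have sp: "space (restrict_space \<theta> J) = J" using ffmD(2)[OF carriedD(1)[OF \<theta>]] by (simp add: space_restrict_space)
  show "k \<in> ext_L1 (restrict_space \<theta> J) \<longleftrightarrow> integrable \<theta> g"
    using ext_L1_cong[of "restrict_space \<theta> J" k "\<lambda>x. ereal (g x)"] eq restrict_J(1)[OF \<theta> g]
    by (simp add: sp ext_L1_real)
  assume "integrable \<theta> g"
  then have "integrable (restrict_space \<theta> J) g" using restrict_J(1)[OF \<theta> g] by simp
  then have "ext_integral (restrict_space \<theta> J) (\<lambda>x. ereal (g x)) = ereal (LINT x|\<theta>. g x)"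
    by (simp add: ext_integral_real restrict_J(2)[OF \<theta> g])
  then show "ext_integral (restrict_space \<theta> J) k = ereal (LINT x|\<theta>. g x)"
    using ext_integral_cong[of "restrict_space \<theta> J" k "\<lambda>x. ereal (g x)"] eq by (simp add: sp)
qed

lemma moderator_real:
  assumes A: "cvx A" and C: "cvx C"
    and \<phi>: "\<And>x. x \<in> J \<Longrightarrow> \<phi> x = ereal (- A x)" and \<psi>: "\<And>x. x \<in> J \<Longrightarrow> \<psi> x = ereal (C x)"
    and h: "concave_moderator J \<mu> \<nu> \<phi> \<psi> h"
  obtains H where "cvx H" "integrable \<mu> (\<lambda>x. H x - A x)" "integrable \<nu> (\<lambda>x. C x - H x)"
    "moderated_value I J \<mu> \<nu> \<phi> \<psi> h = ereal (LINT x|\<mu>. H x - A x) + ereal (LINT x|\<nu>. C x - H x) + enn2ereal (gap \<mu> \<nu> H)"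
    "concave_gap I J \<mu> \<nu> h = enn2ereal (gap \<mu> \<nu> H)"
proof -
  have hc: "concave_on J h" using h by (simp add: concave_moderator_def)
  define H where "H x = (if x \<in> J then - h x else 0)" for x
  have H: "cvx H" unfolding H_def using hc by (intro cvx_restrict) (simp add: concave_on_def)
  note [measurable] = cvxD(2)[OF A] cvxD(2)[OF C] cvxD(2)[OF H]
  have 1: "\<phi> x - ereal (h x) = ereal (H x - A x)" "\<psi> x + ereal (h x) = ereal (C x - H x)" if "x \<in> J" for x
    using that \<phi> \<psi> by (auto simp: H_def)
  have m: "(\<lambda>x. H x - A x) \<in> borel_measurable borel" "(\<lambda>x. C x - H x) \<in> borel_measurable borel" by measurable
  have i: "integrable \<mu> (\<lambda>x. H x - A x)" "integrable \<nu> (\<lambda>x. C x - H x)"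
    using h ext_restrict_J(1)[OF carried_\<mu> m(1) 1(1)] ext_restrict_J(1)[OF carried_\<nu> m(2) 1(2)]
    by (simp_all add: concave_moderator_def)
  have "Lam I J (\<lambda>x. - h x) = Lam I J H" by (rule Lam_fun_cong) (simp add: H_def)
  then have g: "concave_gap I J \<mu> \<nu> h = enn2ereal (gap \<mu> \<nu> H)"
    unfolding concave_gap_eq[OF hc] by (simp add: gap_def)
  show thesis
  proof (rule that[OF H i _ g])
    show "moderated_value I J \<mu> \<nu> \<phi> \<psi> h = ereal (LINT x|\<mu>. H x - A x) + ereal (LINT x|\<nu>. C x - H x) + enn2ereal (gap \<mu> \<nu> H)"
      using ext_restrict_J(2)[OF carried_\<mu> m(1) 1(1) i(1)] ext_restrict_J(2)[OF carried_\<nu> m(2) 1(2) i(2)]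
      by (simp only: moderated_value_def g)
  qed
qed

text \<open>\<open>pair_integral\<close> chooses some moderator, perhaps not the one whose gap is
  known to be finite. Finiteness is derived from the latter; then \<open>moderator_value\<close>
  evaluates the former.\<close>

lemma dual_setD:
  assumes D: "(\<phi>, \<psi>) \<in> aux_dual_set \<mu> \<nu> f" and f0: "\<And>x. 0 \<le> f x"
  obtains A C where "cvx A" "cvx C" "\<And>x. x \<in> J \<Longrightarrow> f x \<le> ereal (C x - A x)"
    "primal_dual_value A C < \<infinity>" "pair_integral I J \<mu> \<nu> \<phi> \<psi> = enn2ereal (primal_dual_value A C)"
proof -
  obtain A C where A: "cvx A" and C: "cvx C" and \<phi>: "\<And>x. x \<in> J \<Longrightarrow> \<phi> x = ereal (- A x)" and \<psi>: "\<And>x. x \<in> J \<Longrightarrow> \<psi> x = ereal (C x)"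
    using dual_pair_real[OF D f0] by metis
  obtain h where h: "concave_moderator J \<mu> \<nu> \<phi> \<psi> h" "concave_gap I J \<mu> \<nu> h < \<infinity>"
    using D by (auto simp: aux_dual_set_def Lc_def)
  have fl: "f x \<le> ereal (C x - A x)" if "x \<in> J" for x
    using D that \<phi>[OF that] \<psi>[OF that] by (auto simp: aux_dual_set_def)
  have AC: "A x \<le> C x" if "x \<in> J" for x
    using order_trans[OF f0 fl[OF that]] by simp
  obtain H where H: "cvx H" "integrable \<mu> (\<lambda>x. H x - A x)" "integrable \<nu> (\<lambda>x. C x - H x)"
    "concave_gap I J \<mu> \<nu> h = enn2ereal (gap \<mu> \<nu> H)"
    by (rule moderator_real[OF A C \<phi> \<psi> h(1)])
  have "gap \<mu> \<nu> H < \<infinity>" using h(2) H(4) by (cases "gap \<mu> \<nu> H") auto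
  then have fin: "primal_dual_value A C < \<infinity>" using moderator_value_finite[OF A C H(1) AC H(2,3)] by blast
  let ?k = "SOME h. concave_moderator J \<mu> \<nu> \<phi> \<psi> h"
  have k: "concave_moderator J \<mu> \<nu> \<phi> \<psi> ?k" by (rule someI[of "\<lambda>h. concave_moderator J \<mu> \<nu> \<phi> \<psi> h", OF h(1)])
  obtain K where K: "cvx K" "integrable \<mu> (\<lambda>x. K x - A x)" "integrable \<nu> (\<lambda>x. C x - K x)"
    "moderated_value I J \<mu> \<nu> \<phi> \<psi> ?k = ereal (LINT x|\<mu>. K x - A x) + ereal (LINT x|\<nu>. C x - K x) + enn2ereal (gap \<mu> \<nu> K)"
    by (rule moderator_real[OF A C \<phi> \<psi> k])
  have "pair_integral I J \<mu> \<nu> \<phi> \<psi> = enn2ereal (primal_dual_value A C)"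
    unfolding pair_integral_def K(4) by (rule moderator_value[OF A C K(1) AC K(2,3) fin])
  then show thesis using that[OF A C fl fin] by blast
qed

text \<open>The concave function -A is itself a moderator: it leaves 0 to integrate against \<mu>
  and C - A against \<nu>.\<close>

lemma dual_setI:
  assumes A: "cvx A" and C: "cvx C" and fl: "\<And>x. x \<in> J \<Longrightarrow> f x \<le> ereal (C x - A x)" and f0: "\<And>x. 0 \<le> f x"
    and fin: "primal_dual_value A C < \<infinity>"
  shows "(\<lambda>x. ereal (- A x), \<lambda>x. ereal (C x)) \<in> aux_dual_set \<mu> \<nu> f"
    and "pair_integral I J \<mu> \<nu> (\<lambda>x. ereal (- A x)) (\<lambda>x. ereal (C x)) = enn2ereal (primal_dual_value A C)"
proof -
  let ?\<phi> = "\<lambda>x. ereal (- A x)" and ?\<psi> = "\<lambda>x. ereal (C x)"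
  note [measurable] = cvxD(2)[OF A] cvxD(2)[OF C]
  have AC: "A x \<le> C x" if "x \<in> J" for x
    using order_trans[OF f0 fl[OF that]] by simp
  have AE_AC: "AE x in \<nu>. 0 \<le> C x - A x" using carriedD(2)[OF carried_\<nu>] by eventually_elim (use AC in simp)
  have i: "integrable \<nu> (\<lambda>x. C x - A x)"
  proof (rule integrableI_bounded)
    have "(\<integral>\<^sup>+x. ennreal (norm (C x - A x)) \<partial>\<nu>) = (\<integral>\<^sup>+x. ennreal (C x - A x) \<partial>\<nu>)"
      by (rule nn_integral_cong_AE, use AE_AC in eventually_elim) simp
    then show "(\<integral>\<^sup>+x. ennreal (norm (C x - A x)) \<partial>\<nu>) < \<infinity>" using fin by (simp add: primal_dual_value_def)
    show "(\<lambda>x. C x - A x) \<in> borel_measurable \<nu>" by (rule measurable_carried[OF carried_\<nu>]) measurable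
  qed
  have hc: "concave_on J (\<lambda>x. - A x)" using cvxD(1)[OF A] by (simp add: concave_on_def)
  have m: "(\<lambda>x. 0) \<in> borel_measurable borel" "(\<lambda>x. C x - A x) \<in> borel_measurable borel" by measurable
  have mod: "concave_moderator J \<mu> \<nu> ?\<phi> ?\<psi> (\<lambda>x. - A x)"
    unfolding concave_moderator_def
    using hc i ext_restrict_J(1)[OF carried_\<mu> m(1), of "\<lambda>x. ?\<phi> x - ereal (- A x)"]
      ext_restrict_J(1)[OF carried_\<nu> m(2), of "\<lambda>x. ?\<psi> x + ereal (- A x)"] by simp
  have gf: "gap \<mu> \<nu> A < \<infinity>" using fin by (simp add: primal_dual_value_def)
  then have "concave_gap I J \<mu> \<nu> (\<lambda>x. - A x) < \<infinity>"
    unfolding concave_gap_eq[OF hc] by (cases "gap \<mu> \<nu> A") auto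
  then show D: "(?\<phi>, ?\<psi>) \<in> aux_dual_set \<mu> \<nu> f"
    unfolding aux_dual_set_def Lc_def ext_concave_on_def
    using mod fl cvxD(1)[OF A] cvxD(1)[OF C]
    by (auto intro!: measurable_restrict_space1 simp: ext_convex_on_ereal)
  let ?k = "SOME h. concave_moderator J \<mu> \<nu> ?\<phi> ?\<psi> h"
  have k: "concave_moderator J \<mu> \<nu> ?\<phi> ?\<psi> ?k" by (rule someI[of "\<lambda>h. concave_moderator J \<mu> \<nu> ?\<phi> ?\<psi> h", OF mod])
  obtain K where K: "cvx K" "integrable \<mu> (\<lambda>x. K x - A x)" "integrable \<nu> (\<lambda>x. C x - K x)"
    "moderated_value I J \<mu> \<nu> ?\<phi> ?\<psi> ?k = ereal (LINT x|\<mu>. K x - A x) + ereal (LINT x|\<nu>. C x - K x) + enn2ereal (gap \<mu> \<nu> K)"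
    by (rule moderator_real[OF A C _ _ k]) auto
  show "pair_integral I J \<mu> \<nu> ?\<phi> ?\<psi> = enn2ereal (primal_dual_value A C)"
    unfolding pair_integral_def K(4) by (rule moderator_value[OF A C K(1) AC K(2,3) fin])
qed

end

section \<open>Compactness and dual attainment\<close>

lemma liminf_superadd:
  fixes f g :: "nat \<Rightarrow> ennreal"
  shows "liminf f + liminf g \<le> liminf (\<lambda>k. f k + g k)"
proof -
  have "liminf f + liminf g = (SUP n. (INF m\<in>{n..}. f m) + (INF m\<in>{n..}. g m))"
    unfolding liminf_SUP_INF by (intro ennreal_SUP_add[symmetric] incseq_SucI INF_superset_mono) auto
  also have "\<dots> \<le> (SUP n. INF m\<in>{n..}. f m + g m)"
    by (intro SUP_mono' INF_greatest add_mono INF_lower) auto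
  finally show ?thesis by (simp add: liminf_SUP_INF)
qed

text \<open>Bounds at three points p < x < q give a Lipschitz bound around x that is uniform in n;
  convergence at a rational point close to x then makes the values at x a Cauchy sequence.\<close>

lemma convex_pointwise_convergent:
  fixes F :: "nat \<Rightarrow> real \<Rightarrow> real"
  assumes F: "\<And>n. convex_on I (F n)" and I: "open I" and x: "x \<in> I"
    and bnd: "\<And>y. y \<in> I \<Longrightarrow> \<exists>M. \<forall>n. \<bar>F n y\<bar> \<le> M"
    and conv: "\<And>y. y \<in> \<rat> \<inter> I \<Longrightarrow> convergent (\<lambda>n. F n y)"
  shows "convergent (\<lambda>n. F n x)"
proof -
  obtain e where e: "e > 0" "\<And>y. \<bar>y - x\<bar> < e \<Longrightarrow> y \<in> I" using I x by (auto simp: open_real)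
  define p q where "p = x - e / 2" and "q = x + e / 2"
  have pq: "p \<in> I" "q \<in> I" "p < x" "x < q" using e by (auto simp: p_def q_def intro!: e(2))
  obtain Mp Mx Mq where M: "\<And>n. \<bar>F n p\<bar> \<le> Mp" "\<And>n. \<bar>F n x\<bar> \<le> Mx" "\<And>n. \<bar>F n q\<bar> \<le> Mq"
    using bnd[OF pq(1)] bnd[OF x] bnd[OF pq(2)] by blast
  \<comment> \<open>Bounds the slopes over both intervals of length e / 2 next to x; by convexity
    these enclose every slope from x to a point between p and q.\<close>
  define L where "L = (Mp + Mx + Mq) / (e / 2)"
  have M0: "0 \<le> Mp" "0 \<le> Mx" "0 \<le> Mq" using M[of 0] abs_ge_zero order_trans by blast+
  have L0: "0 \<le> L" using e(1) M0 by (simp add: L_def)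
  have lip: "\<bar>F n x - F n y\<bar> \<le> L * \<bar>x - y\<bar>" if y: "p < y" "y < q" for n y
  proof (cases "y = x")
    case False
    have yI: "y \<in> I" using y by (intro e(2)) (auto simp: p_def q_def)
    note sl = convex_on_slope_le[OF F[of n]]
    have s: "(F n p - F n x) / (p - x) \<le> (F n x - F n y) / (x - y) \<and> (F n x - F n y) / (x - y) \<le> (F n x - F n q) / (x - q)"
    proof (cases "y < x")
      case True
      have "(F n y - F n x) / (y - x) = (F n x - F n y) / (x - y)" by (metis minus_diff_eq minus_divide_divide)
      then show ?thesis
        using sl(2)[OF pq(1) x y(1) True] order_trans[OF sl(1)[OF yI pq(2) True pq(4)] sl(2)[OF yI pq(2) True pq(4)]] by simp
    next
      case F': False
      then have xy: "x < y" using False by simp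
      show ?thesis
        using sl(1)[OF x pq(2) xy y(2)] order_trans[OF sl(1)[OF pq(1) yI pq(3) xy] sl(2)[OF pq(1) yI pq(3) xy]] by simp
    qed
    have 1: "- L \<le> (F n p - F n x) / (p - x)"
    proof -
      have "\<bar>F n p - F n x\<bar> \<le> Mp + Mx + Mq" using M[of n] M0 by linarith
      then have "\<bar>(F n p - F n x) / (p - x)\<bar> \<le> L"
        using e(1) by (simp add: L_def p_def abs_divide divide_right_mono)
      then show ?thesis by linarith
    qed
    have 2: "(F n x - F n q) / (x - q) \<le> L"
    proof -
      have "\<bar>F n x - F n q\<bar> \<le> Mp + Mx + Mq" using M[of n] M0 by linarith
      then have "\<bar>(F n x - F n q) / (x - q)\<bar> \<le> L"
        using e(1) by (simp add: L_def q_def abs_divide divide_right_mono)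
      then show ?thesis by linarith
    qed
    have "\<bar>(F n x - F n y) / (x - y)\<bar> \<le> L" using s 1 2 by linarith
    then show ?thesis using False by (simp add: abs_divide pos_divide_le_eq)
  qed simp
  have "Cauchy (\<lambda>n. F n x)"
  proof (rule metric_CauchyI)
    fix \<epsilon> :: real assume \<epsilon>: "0 < \<epsilon>"
    \<comment> \<open>Each of the two passages from x to the rational y costs at most \<epsilon>/4,
      and the difference at y is below \<epsilon>/2.\<close>
    define \<delta> where "\<delta> = min (e / 2) (\<epsilon> / (4 * (L + 1)))"
    have \<delta>: "0 < \<delta>" using e \<epsilon> L0 by (simp add: \<delta>_def)
    obtain r where r: "x < of_rat r" "of_rat r < x + \<delta>" using of_rat_dense[of x "x + \<delta>"] \<delta> by auto
    define y where "y = real_of_rat r"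
    have y: "p < y" "y < q" "\<bar>x - y\<bar> < \<delta>" using r e(1) by (auto simp: y_def p_def q_def \<delta>_def)
    have "y \<in> I" using y by (intro e(2)) (auto simp: p_def q_def)
    then have "Cauchy (\<lambda>n. F n y)" using conv[of y] by (simp add: y_def Cauchy_convergent_iff)
    then obtain N where N: "\<And>m n. m \<ge> N \<Longrightarrow> n \<ge> N \<Longrightarrow> dist (F m y) (F n y) < \<epsilon> / 2"
      using \<epsilon> unfolding Cauchy_def by (metis half_gt_zero)
    have Ld: "L * \<bar>x - y\<bar> \<le> \<epsilon> / 4"
    proof -
      have "L * \<bar>x - y\<bar> \<le> (L + 1) * (\<epsilon> / (4 * (L + 1)))"
        using y(3) L0 by (intro mult_mono) (auto simp: \<delta>_def)
      also have "\<dots> = \<epsilon> / 4" using L0 by (simp add: field_simps)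
      finally show ?thesis .
    qed
    show "\<exists>M. \<forall>m\<ge>M. \<forall>n\<ge>M. dist (F m x) (F n x) < \<epsilon>"
    proof (intro exI[of _ N] allI impI)
      fix m n assume "N \<le> m" "N \<le> n"
      then have "\<bar>F m y - F n y\<bar> < \<epsilon> / 2" using N by (simp add: dist_real_def)
      then show "dist (F m x) (F n x) < \<epsilon>" using lip[OF y(1,2), of m] lip[OF y(1,2), of n] Ld \<epsilon> unfolding dist_real_def by linarith
    qed
  qed
  then show ?thesis by (simp add: Cauchy_convergent_iff)
qed

context irreducible
begin

lemma cvx_limit:
  assumes A: "\<And>n. cvx (A n)" and lim: "\<And>x. x \<in> J \<Longrightarrow> (\<lambda>n. A n x) \<longlonglongrightarrow> B x"
  shows "cvx (\<lambda>x. if x \<in> J then B x else 0)"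
proof (rule cvx_restrict, rule convex_onI)
  fix t x y :: real assume t: "0 < t" "t < 1" and xy: "x \<in> J" "y \<in> J"
  have z: "(1 - t) *\<^sub>R x + t *\<^sub>R y \<in> J" using convexD[OF conv_J xy, of "1 - t" t] t by simp
  show "B ((1 - t) *\<^sub>R x + t *\<^sub>R y) \<le> (1 - t) * B x + t * B y"
  proof (rule LIMSEQ_le[OF lim[OF z]])
    show "(\<lambda>n. (1 - t) * A n x + t * A n y) \<longlonglongrightarrow> (1 - t) * B x + t * B y"
      by (intro tendsto_intros lim xy)
    show "\<exists>N. \<forall>n\<ge>N. A n ((1 - t) *\<^sub>R x + t *\<^sub>R y) \<le> (1 - t) * A n x + t * A n y"
      using convex_onD[OF cvxD(1)[OF A], of t x y] t xy by auto
  qed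
qed (rule conv_J)

text \<open>A diagonal sequence on the countable set S of rational points of I and ends; convexity
  extends convergence to the rest of I, and ends lie in S because convexity does not determine
  values there.\<close>

lemma convex_subsequence:
  assumes A: "\<And>n. cvx (A n)" and C: "\<And>n. cvx (C n)"
    and bnd: "\<And>x. x \<in> J \<Longrightarrow> \<exists>M. \<forall>n::nat. \<bar>A n x\<bar> \<le> M \<and> \<bar>C n x\<bar> \<le> M"
  obtains r where "strict_mono (r :: nat \<Rightarrow> nat)"
    "\<And>x. x \<in> J \<Longrightarrow> convergent (\<lambda>n. A (r n) x)" "\<And>x. x \<in> J \<Longrightarrow> convergent (\<lambda>n. C (r n) x)"
proof -
  obtain M where M: "\<And>x n. x \<in> J \<Longrightarrow> \<bar>A n x\<bar> \<le> M x \<and> \<bar>C n x\<bar> \<le> M x" using bnd by metis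
  \<comment> \<open>Dividing by D turns the pointwise bounds into the uniform bound that
    \<open>function_convergent_subsequence\<close> takes as input.\<close>
  define D where "D x = \<bar>M x\<bar> + 1" for x
  have D: "0 < D x" for x by (simp add: D_def)
  define S where "S = (\<rat> \<inter> I) \<union> (J - I)"
  have SJ: "S \<subseteq> J" using I_J by (auto simp: S_def)
  have cS: "countable S" using countable_rat finite_ends by (auto simp: S_def countable_finite countable_Int1)
  define f where "f n x = (A n x / D x, C n x / D x)" for n x
  have nb: "norm (f n x) \<le> 2" if "x \<in> S" for n x
  proof -
    have "\<bar>A n x\<bar> \<le> D x" "\<bar>C n x\<bar> \<le> D x" 
    proof -
      have "x \<in> J" using SJ that by blast
      from M[OF this, of n] show "\<bar>A n x\<bar> \<le> D x" "\<bar>C n x\<bar> \<le> D x" unfolding D_def by linarith+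
    qed
    then have "\<bar>A n x / D x\<bar> \<le> 1" "\<bar>C n x / D x\<bar> \<le> 1" using D[of x] by (auto simp: abs_divide)
    then show ?thesis using norm_Pair_le[of "A n x / D x" "C n x / D x"] by (simp add: f_def)
  qed
  obtain r where r: "strict_mono (r :: nat \<Rightarrow> nat)" "\<And>x. x \<in> S \<Longrightarrow> \<exists>l. (\<lambda>n. f (r n) x) \<longlonglongrightarrow> l"
    by (rule function_convergent_subsequence[of S f 2]) (use cS nb in auto)
  have cc: "convergent (\<lambda>n. A (r n) x) \<and> convergent (\<lambda>n. C (r n) x)" if x: "x \<in> S" for x
  proof -
    obtain l where l: "(\<lambda>n. f (r n) x) \<longlonglongrightarrow> l" using r(2)[OF x] by blast
    have "(\<lambda>n. fst (f (r n) x) * D x) \<longlonglongrightarrow> fst l * D x" "(\<lambda>n. snd (f (r n) x) * D x) \<longlonglongrightarrow> snd l * D x"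
      by (intro tendsto_intros l)+
    moreover have "fst (f n x) * D x = A n x" "snd (f n x) * D x = C n x" for n using D[of x] by (auto simp: f_def)
    ultimately show ?thesis unfolding convergent_def by auto
  qed
  have all: "convergent (\<lambda>n. G (r n) x)"
    if G: "\<And>n. cvx (G n)" and Gb: "\<And>x n. x \<in> J \<Longrightarrow> \<bar>G n x\<bar> \<le> M x" and Gc: "\<And>x. x \<in> S \<Longrightarrow> convergent (\<lambda>n. G (r n) x)" and x: "x \<in> J" for G x
  proof (cases "x \<in> I")
    case True
    show ?thesis
    proof (rule convex_pointwise_convergent[OF _ open_I True])
      show "convex_on I (G (r n))" for n by (rule convex_on_I[OF cvxD(1)[OF G]])
      show "\<exists>M. \<forall>n. \<bar>G (r n) y\<bar> \<le> M" if "y \<in> I" for y using Gb that I_J by blast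
      show "convergent (\<lambda>n. G (r n) y)" if "y \<in> \<rat> \<inter> I" for y using Gc that by (simp add: S_def)
    qed
  next
    case False
    then show ?thesis using Gc x by (simp add: S_def)
  qed
  show thesis
  proof (rule that[OF r(1)])
    show "convergent (\<lambda>n. A (r n) x)" if "x \<in> J" for x by (rule all[OF A _ _ that]) (use M cc in auto)
    show "convergent (\<lambda>n. C (r n) x)" if "x \<in> J" for x by (rule all[OF C _ _ that]) (use M cc in auto)
  qed
qed

text \<open>\<mu> lives on I and is not zero, and I is a countable union of such intervals. The
  interval is where the affine part of C is bounded from above in
  \<open>dual_compactness\<close>.\<close>

lemma \<mu>_charges_interval:
  obtains p q where "p \<in> I" "q \<in> I" "0 < measure \<mu> {p<..<q}"
proof (rule exhausting_intervals)
  fix a b :: "nat \<Rightarrow> real"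
  assume ab: "\<And>k. a k \<in> I" "\<And>k. b k \<in> I" "\<And>x. x \<in> I \<Longrightarrow> \<forall>\<^sub>F k in sequentially. a k < x \<and> x < b k"
  interpret finite_measure \<mu> using ffmD(3)[OF ffm_\<mu>] .
  show thesis
  proof (rule ccontr)
    assume no: "\<not> thesis"
    have "measure \<mu> {a k<..<b k} = 0" for k using no that[OF ab(1,2), of k k] by (auto simp: zero_less_measure_iff)
    then have "{a k<..<b k} \<in> null_sets \<mu>" for k using ffmD(1)[OF ffm_\<mu>] by (auto simp: null_sets_def emeasure_eq_measure)
    then have "AE x in \<mu>. x \<notin> {a k<..<b k}" for k by (rule AE_not_in)
    then have "AE x in \<mu>. \<forall>k. x \<notin> {a k<..<b k}" by (subst AE_all_countable) blast
    moreover obtain P where P: "P = (\<lambda>x. \<forall>k. x \<notin> {a k<..<b k})" by blast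
    ultimately have "AE x in \<mu>. P x" by simp
    then obtain x where x: "x \<in> I" "P x" by (rule AE_\<mu>_exists)
    have "\<exists>k. a k < x \<and> x < b k" using ab(3)[OF x(1)] by (auto simp: eventually_sequentially)
    then show False using x(2) by (auto simp: P)
  qed
qed

text \<open>Controls the tangents of the second functions: a bound from above at one point y between
  p and q and bounds from below at p' and q' limit the slope in both directions, with constants
  independent of y.\<close>

lemma affine_bound:
  fixes \<alpha> \<beta> :: real
  assumes p: "p' < p" "p < q" "q < q'" and y: "p < y" "y < q"
    and up: "\<alpha> + \<beta> * y \<le> M" and lo: "- N \<le> \<alpha> + \<beta> * p'" "- N \<le> \<alpha> + \<beta> * q'" and N: "0 \<le> N" and M: "0 \<le> M"
  shows "\<bar>\<alpha> + \<beta> * x\<bar> \<le> (M + N) + ((M + N) / (p - p') + (M + N) / (q' - q)) * (\<bar>x\<bar> + \<bar>p\<bar> + \<bar>q\<bar>)"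
proof -
  let ?R = "(M + N) / (p - p') + (M + N) / (q' - q)"
  have R0: "0 \<le> (M + N) / (p - p')" "0 \<le> (M + N) / (q' - q)" using p N M by auto
  have b1: "\<beta> \<le> (M + N) / (p - p')"
  proof (cases "0 \<le> \<beta>")
    case True
    have "\<beta> * (p - p') \<le> \<beta> * (y - p')" using True y by (intro mult_left_mono) auto
    also have "\<dots> \<le> M + N" using up lo(1) by (simp add: algebra_simps)
    finally show ?thesis using p by (simp add: pos_le_divide_eq)
  qed (use R0 in linarith)
  have b2: "- \<beta> \<le> (M + N) / (q' - q)"
  proof (cases "0 \<le> - \<beta>")
    case True
    have "- \<beta> * (q' - q) \<le> - \<beta> * (q' - y)" using True y by (intro mult_left_mono) auto
    also have "\<dots> \<le> M + N" using up lo(2) by (simp add: algebra_simps)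
    finally show ?thesis using p by (simp add: pos_le_divide_eq)
  qed (use R0 in linarith)
  have b: "\<bar>\<beta>\<bar> \<le> ?R" using b1 b2 R0 by linarith
  have "- N \<le> \<alpha> + \<beta> * y"
  proof (cases "0 \<le> \<beta>")
    case True
    then have "\<beta> * p' \<le> \<beta> * y" using p y by (intro mult_left_mono) auto
    then show ?thesis using lo by linarith
  next
    case False
    then have "\<beta> * q' \<le> \<beta> * y" using p y by (intro mult_left_mono_neg) auto
    then show ?thesis using lo by linarith
  qed
  then have "\<bar>\<alpha> + \<beta> * y\<bar> \<le> M + N" using up N M by linarith
  moreover have "\<bar>\<beta> * (x - y)\<bar> \<le> ?R * (\<bar>x\<bar> + \<bar>p\<bar> + \<bar>q\<bar>)"
    unfolding abs_mult using b y R0 by (intro mult_mono) auto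
  moreover have "\<alpha> + \<beta> * x = (\<alpha> + \<beta> * y) + \<beta> * (x - y)" by (simp add: algebra_simps)
  ultimately show ?thesis by linarith
qed

text \<open>After subtraction of the tangent of \<open>A n\<close> at c, the first function is
  nonnegative and bounded by \<open>tilde_le_gap\<close>. The duality identity bounds the gap of the
  second function too, so only its tangent needs a separate bound. The limit value is controlled by
  \<open>gap_lsc\<close> and Fatou.\<close>

lemma dual_compactness:
  assumes A: "\<And>n. cvx (A n)" and C: "\<And>n. cvx (C n)" and AC: "\<And>n x. x \<in> J \<Longrightarrow> A n x \<le> C n x"
    and val: "\<And>n::nat. primal_dual_value (A n) (C n) \<le> ennreal (e n)" and e: "e \<longlonglongrightarrow> v"
  obtains r A' C' where "strict_mono (r :: nat \<Rightarrow> nat)" "cvx A'" "cvx C'"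
    "\<And>x. x \<in> J \<Longrightarrow> (\<lambda>n. C (r n) x - A (r n) x) \<longlonglongrightarrow> C' x - A' x" "primal_dual_value A' C' \<le> ennreal v"
proof -
  obtain V0 where V0: "\<And>n. \<bar>e n\<bar> \<le> V0" using convergent_imp_Bseq[OF convergentI[OF e]] by (auto simp: Bseq_def)
  define V where "V = V0"
  have V: "\<And>n. e n \<le> V" "0 \<le> V" using V0 abs_ge_self abs_ge_zero unfolding V_def by (blast intro: order_trans)+
  obtain c where c: "c \<in> I" using I_ne by auto
  define a b where "a n = - (A n c - rderiv (A n) c * c)" and "b n = - rderiv (A n) c" for n
  define A1 C1 where "A1 n x = A n x + (a n + b n * x)" and "C1 n x = C n x + (a n + b n * x)" for n x
  have A1: "cvx (A1 n)" and C1: "cvx (C1 n)" for n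
    unfolding A1_def C1_def by (intro cvx_add cvx_affine A C)+
  have A1t: "A1 n x = tilde (A n) c x" for n x by (simp add: A1_def a_def b_def tilde_def algebra_simps)
  have A10: "0 \<le> A1 n x" if "x \<in> J" for n x unfolding A1t by (rule tilde_nonneg[OF cvxD(1)[OF A] c that])
  have AC1: "A1 n x \<le> C1 n x" if "x \<in> J" for n x using AC[OF that, of n] by (simp add: A1_def C1_def)
  have d1: "C1 n x - A1 n x = C n x - A n x" for n x by (simp add: A1_def C1_def)
  have gA: "gap \<mu> \<nu> (A1 n) = gap \<mu> \<nu> (A n)" for n unfolding A1_def by (rule gap_affine[OF A])
  have pd: "primal_dual_value (A1 n) (C1 n) = primal_dual_value (A n) (C n)" for n
    unfolding primal_dual_value_def d1 gA ..
  have pdV: "primal_dual_value (A1 n) (C1 n) \<le> ennreal V" for n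
    unfolding pd using val[of n] V(1)[of n] ennreal_leI order_trans by blast
  have gAV: "gap \<mu> \<nu> (A1 n) \<le> ennreal V" for n
    using pdV[of n] unfolding primal_dual_value_def by (meson add_increasing order_refl order_trans zero_le)
  \<comment> \<open>The second expression for the value, which involves the gap of
    \<open>C1 n\<close> and the integral against \<mu>.\<close>
  have pd2: "(\<integral>\<^sup>+x. ennreal (C1 n x - A1 n x) \<partial>\<mu>) + gap \<mu> \<nu> (C1 n) \<le> ennreal V" for n
    using pdV[of n] duality_identity[OF A1 C1 AC1] by (simp add: primal_dual_value_def)
  have gCV: "gap \<mu> \<nu> (C1 n) \<le> ennreal V" and wV: "(\<integral>\<^sup>+x. ennreal (C1 n x - A1 n x) \<partial>\<mu>) \<le> ennreal V" for n
    using pd2[of n] by (meson add_increasing add_increasing2 order_refl order_trans zero_le)+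
  have "\<exists>B. 0 \<le> B \<and> (\<forall>G. convex_on J G \<longrightarrow> ennreal (tilde G c x) \<le> ennreal B * gap \<mu> \<nu> G)" if "x \<in> J" for x
    using tilde_le_gap[OF c that] by metis
  then obtain B where B: "\<And>x. x \<in> J \<Longrightarrow> 0 \<le> B x" "\<And>x G. x \<in> J \<Longrightarrow> convex_on J G \<Longrightarrow> ennreal (tilde G c x) \<le> ennreal (B x) * gap \<mu> \<nu> G"
    by metis
  have tb: "tilde G c x \<le> B x * V" if "x \<in> J" "convex_on J G" "gap \<mu> \<nu> G \<le> ennreal V" for x G
  proof -
    have "ennreal (tilde G c x) \<le> ennreal (B x) * ennreal V"
      using B(2)[OF that(1,2)] that(3) by (meson mult_left_mono order_trans zero_le)
    also have "\<dots> = ennreal (B x * V)" using B(1)[OF that(1)] V(2) by (simp add: ennreal_mult)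
    finally show ?thesis using B(1)[OF that(1)] V(2) by (simp add: ennreal_le_iff)
  qed
  have A1b: "A1 n x \<le> B x * V" if "x \<in> J" for n x
    unfolding A1t by (rule tb[OF that cvxD(1)[OF A]]) (use gAV[of n] gA in simp)
  define \<alpha> \<beta> where "\<alpha> n = C1 n c - rderiv (C1 n) c * c" and "\<beta> n = rderiv (C1 n) c" for n
  have C1t: "C1 n x = \<alpha> n + \<beta> n * x + tilde (C1 n) c x" for n x by (simp add: \<alpha>_def \<beta>_def tilde_def algebra_simps)
  have Ct: "0 \<le> tilde (C1 n) c x" "tilde (C1 n) c x \<le> B x * V" if "x \<in> J" for n x
    using tilde_nonneg[OF cvxD(1)[OF C1] c that] tb[OF that cvxD(1)[OF C1] gCV] by auto
  have lo: "- (B x * V) \<le> \<alpha> n + \<beta> n * x" if "x \<in> J" for n x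
    using C1t[of n x] Ct[OF that, of n] A10[OF that, of n] AC1[OF that, of n] by linarith
  obtain p q where pq: "p \<in> I" "q \<in> I" "0 < measure \<mu> {p<..<q}" by (rule \<mu>_charges_interval)
  have plq: "p < q" using pq(3) by (rule_tac ccontr) simp
  obtain p' where p': "p' \<in> I" "p' < p"
  proof -
    obtain \<delta> where \<delta>: "\<delta> > 0" "\<And>y. \<bar>y - p\<bar> < \<delta> \<Longrightarrow> y \<in> I" using open_I pq(1) by (auto simp: open_real)
    show ?thesis by (rule that[of "p - \<delta> / 2"]) (use \<delta>(1) in \<open>auto intro!: \<delta>(2)\<close>)
  qed
  obtain q' where q': "q' \<in> I" "q < q'"
  proof -
    obtain \<delta> where \<delta>: "\<delta> > 0" "\<And>y. \<bar>y - q\<bar> < \<delta> \<Longrightarrow> y \<in> I" using open_I pq(2) by (auto simp: open_real)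
    show ?thesis by (rule that[of "q + \<delta> / 2"]) (use \<delta>(1) in \<open>auto intro!: \<delta>(2)\<close>)
  qed
  \<comment> \<open>The first term bounds C1 - A1 at some point of the interval by averaging against
    \<mu>; the other two bound A1 on the interval through its end values.\<close>
  define M where "M = V / measure \<mu> {p<..<q} + (B p * V + B q * V)"
  define N where "N = B p' * V + B q' * V"
  have in_J: "p \<in> J" "q \<in> J" "p' \<in> J" "q' \<in> J" using pq p' q' I_J by auto
  have BV: "0 \<le> B x * V" if "x \<in> J" for x using B(1)[OF that] V(2) by simp
  have M0: "0 \<le> M" using BV[OF in_J(1)] BV[OF in_J(2)] V(2) by (simp add: M_def)
  have N0: "0 \<le> N" using BV[OF in_J(3)] BV[OF in_J(4)] by (simp add: N_def)
  have ex: "\<exists>y. p < y \<and> y < q \<and> \<alpha> n + \<beta> n * y \<le> M" for n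
  proof (rule ccontr)
    assume "\<not> ?thesis"
    then have big: "\<And>y. p < y \<Longrightarrow> y < q \<Longrightarrow> M < \<alpha> n + \<beta> n * y" by auto
    interpret finite_measure \<mu> using ffmD(3)[OF ffm_\<mu>] .
    let ?m = "V / measure \<mu> {p<..<q}"
    have gt: "?m < C1 n y - A1 n y" if y: "p < y" "y < q" for y
    proof -
      have yJ: "y \<in> J" using convex_real_mem[OF conv_J in_J(1,2), of y] y by simp
      have KJ: "{p..q} \<subseteq> J" using convex_real_mem[OF conv_J in_J(1,2)] by auto
      have "A1 n y \<le> max (A1 n p) (A1 n q)"
        using convex_on_le_max[OF convex_on_subset[OF cvxD(1)[OF A1] KJ]] y by auto
      also have "\<dots> \<le> B p * V + B q * V"
        using A1b[OF in_J(1), of n] A1b[OF in_J(2), of n] BV[OF in_J(1)] BV[OF in_J(2)] by auto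
      finally show ?thesis using big[OF y] C1t[of n y] Ct(1)[OF yJ, of n] by (simp add: M_def)
    qed
    have "emeasure \<mu> {p<..<q} \<noteq> 0" using pq(3) by (simp add: emeasure_eq_measure)
    have m: "(\<lambda>x. ennreal (C1 n x - A1 n x - ?m) * indicator {p<..<q} x) \<in> borel_measurable \<mu>"
    proof (rule measurable_carried[OF carried_\<mu>])
      note [measurable] = cvxD(2)[OF A1] cvxD(2)[OF C1]
      show "(\<lambda>x. ennreal (C1 n x - A1 n x - ?m) * indicator {p<..<q} x) \<in> borel_measurable borel" by measurable
    qed
    have mV: "ennreal ?m * emeasure \<mu> {p<..<q} = ennreal V"
      using pq(3) V(2) by (simp add: emeasure_eq_measure ennreal_mult[symmetric])
    \<comment> \<open>If C1 - A1 exceeded \<open>?m\<close> on the whole interval, its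
      \<mu>-integral would be at least V + \<open>?r\<close>. The bound V forces \<open>?r\<close> =
      0, although its integrand is positive on a set of positive measure.\<close>
    let ?r = "\<integral>\<^sup>+x. ennreal (C1 n x - A1 n x - ?m) * indicator {p<..<q} x \<partial>\<mu>"
    have "ennreal V + ?r = (\<integral>\<^sup>+x. ennreal ?m * indicator {p<..<q} x + ennreal (C1 n x - A1 n x - ?m) * indicator {p<..<q} x \<partial>\<mu>)"
      using ffmD(1)[OF ffm_\<mu>] m by (subst nn_integral_add) (auto simp: nn_integral_cmult_indicator mV)
    also have "\<dots> \<le> (\<integral>\<^sup>+x. ennreal (C1 n x - A1 n x) \<partial>\<mu>)"
    proof (rule nn_integral_mono)
      fix x
      have m0: "0 \<le> ?m" using V(2) by simp
      show "ennreal ?m * indicator {p<..<q} x + ennreal (C1 n x - A1 n x - ?m) * indicator {p<..<q} x \<le> ennreal (C1 n x - A1 n x)"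
      proof (cases "x \<in> {p<..<q}")
        case True
        then have "?m < C1 n x - A1 n x" using gt by simp
        then show ?thesis using True m0 by (simp add: ennreal_plus[symmetric] del: ennreal_plus)
      qed simp
    qed
    also have "\<dots> \<le> ennreal V + 0" using wV[of n] by simp
    finally have "?r = 0" by (simp add: ennreal_add_left_cancel_le)
    then have "AE x in \<mu>. ennreal (C1 n x - A1 n x - ?m) * indicator {p<..<q} x = 0"
      using m by (simp add: nn_integral_0_iff_AE)
    then have "AE x in \<mu>. x \<notin> {p<..<q}"
    proof eventually_elim
      case (elim x)
      show ?case
      proof
        assume x: "x \<in> {p<..<q}"
        then have "0 < C1 n x - A1 n x - ?m" using gt[of x] by simp
        then show False using elim x by (simp add: ennreal_eq_0_iff)
      qed
    qed
    then have "{p<..<q} \<in> null_sets \<mu>" using ffmD(1)[OF ffm_\<mu>] by (subst AE_iff_null_sets) auto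
    then show False using pq(3) by (simp add: measure_eq_0_null_sets)
  qed
  define W where "W x = (M + N) + ((M + N) / (p - p') + (M + N) / (q' - q)) * (\<bar>x\<bar> + \<bar>p\<bar> + \<bar>q\<bar>)" for x
  have affb: "\<bar>\<alpha> n + \<beta> n * x\<bar> \<le> W x" for n x
  proof -
    obtain y where y: "p < y" "y < q" "\<alpha> n + \<beta> n * y \<le> M" using ex[of n] by blast
    show ?thesis unfolding W_def
      by (rule affine_bound[OF p'(2) plq q'(2) y])
         (use lo[OF in_J(3), of n] lo[OF in_J(4), of n] BV[OF in_J(3)] BV[OF in_J(4)] N0 M0 in \<open>auto simp: N_def\<close>)
  qed
  have bnd: "\<exists>M. \<forall>n::nat. \<bar>A1 n x\<bar> \<le> M \<and> \<bar>C1 n x\<bar> \<le> M" if x: "x \<in> J" for x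
  proof (intro exI[of _ "B x * V + \<bar>W x\<bar>"] allI conjI)
    fix n
    show "\<bar>A1 n x\<bar> \<le> B x * V + \<bar>W x\<bar>" using A10[OF x, of n] A1b[OF x, of n] by linarith
    show "\<bar>C1 n x\<bar> \<le> B x * V + \<bar>W x\<bar>" using C1t[of n x] Ct[OF x, of n] affb[of n x] by linarith
  qed
  obtain r where r: "strict_mono (r :: nat \<Rightarrow> nat)"
    "\<And>x. x \<in> J \<Longrightarrow> convergent (\<lambda>n. A1 (r n) x)" "\<And>x. x \<in> J \<Longrightarrow> convergent (\<lambda>n. C1 (r n) x)"
    using convex_subsequence[OF A1 C1 bnd] by blast
  define A2 C2 where "A2 x = (if x \<in> J then lim (\<lambda>n. A1 (r n) x) else 0)" and "C2 x = (if x \<in> J then lim (\<lambda>n. C1 (r n) x) else 0)" for x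
  have lA: "(\<lambda>n. A1 (r n) x) \<longlonglongrightarrow> A2 x" and lC: "(\<lambda>n. C1 (r n) x) \<longlonglongrightarrow> C2 x" if "x \<in> J" for x
    using r(2,3)[OF that] that by (simp_all add: A2_def C2_def convergent_LIMSEQ_iff)
  have A2: "cvx A2" unfolding A2_def using r(2) by (intro cvx_limit[OF A1]) (simp add: convergent_LIMSEQ_iff)
  have C2: "cvx C2" unfolding C2_def using r(3) by (intro cvx_limit[OF C1]) (simp add: convergent_LIMSEQ_iff)
  have lw: "(\<lambda>n. C1 (r n) x - A1 (r n) x) \<longlonglongrightarrow> C2 x - A2 x" if "x \<in> J" for x by (intro tendsto_diff lA lC that)
  have g: "gap \<mu> \<nu> A2 \<le> liminf (\<lambda>n. gap \<mu> \<nu> (A1 (r n)))"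
    by (rule gap_lsc[OF A1 A10 A2 lA])
  have i: "(\<integral>\<^sup>+x. ennreal (C2 x - A2 x) \<partial>\<nu>) \<le> liminf (\<lambda>n. \<integral>\<^sup>+x. ennreal (C1 (r n) x - A1 (r n) x) \<partial>\<nu>)"
  proof -
    have "(\<integral>\<^sup>+x. ennreal (C2 x - A2 x) \<partial>\<nu>) = (\<integral>\<^sup>+x. liminf (\<lambda>n. ennreal (C1 (r n) x - A1 (r n) x)) \<partial>\<nu>)"
      by (rule nn_integral_cong_AE, use carriedD(2)[OF carried_\<nu>] in eventually_elim)
         (intro lim_imp_Liminf[symmetric] tendsto_ennrealI lw, auto)
    also have "\<dots> \<le> liminf (\<lambda>n. \<integral>\<^sup>+x. ennreal (C1 (r n) x - A1 (r n) x) \<partial>\<nu>)"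
    proof (intro nn_integral_liminf measurable_carried[OF carried_\<nu>])
      fix n show "(\<lambda>x. ennreal (C1 (r n) x - A1 (r n) x)) \<in> borel_measurable borel"
        using cvxD(2)[OF A1] cvxD(2)[OF C1] by measurable
    qed
    finally show ?thesis .
  qed
  have "primal_dual_value A2 C2 \<le> liminf (\<lambda>n. \<integral>\<^sup>+x. ennreal (C1 (r n) x - A1 (r n) x) \<partial>\<nu>) + liminf (\<lambda>n. gap \<mu> \<nu> (A1 (r n)))"
    unfolding primal_dual_value_def by (intro add_mono i g)
  also have "\<dots> \<le> liminf (\<lambda>n. primal_dual_value (A1 (r n)) (C1 (r n)))"
    unfolding primal_dual_value_def by (rule liminf_superadd)
  also have "\<dots> \<le> liminf (\<lambda>n. ennreal (e (r n)))"
    unfolding pd by (intro Liminf_mono always_eventually allI val)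
  also have "\<dots> = ennreal v"
    using LIMSEQ_subseq_LIMSEQ[OF e r(1)] by (intro lim_imp_Liminf tendsto_ennrealI) (auto simp: comp_def)
  finally show thesis using that[OF r(1) A2 C2] lw by (simp add: d1)
qed

lemma dual_value_nonneg:
  assumes "\<And>x. 0 \<le> f x"
  shows "0 \<le> aux_dual \<mu> \<nu> f"
  unfolding aux_dual_def
proof (rule INF_greatest, clarify)
  fix \<phi> \<psi> assume "(\<phi>, \<psi>) \<in> aux_dual_set \<mu> \<nu> f"
  then show "0 \<le> pair_integral I J \<mu> \<nu> \<phi> \<psi>" by (rule dual_setD[OF _ assms]) simp
qed

text \<open>Almost optimal pairs for \<open>f n\<close>, with slack 1/(n+1), have a limit by
  \<open>dual_compactness\<close>; monotonicity in n lets it dominate every \<open>f n\<close>. A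
  constant sequence gives attainment, an increasing one the continuity that capacitability
  uses.\<close>

lemma dual_limit_attained:
  assumes f0: "\<And>n x. 0 \<le> f n x" and mono: "\<And>n x. f n x \<le> f (Suc n) x"
    and le: "\<And>n::nat. aux_dual \<mu> \<nu> (f n) \<le> ereal v"
  obtains \<phi> \<psi> where "(\<phi>, \<psi>) \<in> aux_dual_set \<mu> \<nu> (\<lambda>x. SUP n. f n x)" "pair_integral I J \<mu> \<nu> \<phi> \<psi> \<le> ereal v"
proof -
  have "0 \<le> aux_dual \<mu> \<nu> (f 0)" by (rule dual_value_nonneg) (rule f0)
  then have v0: "0 \<le> v" using order_trans[OF _ le[of 0], of 0] by simp
  have "\<exists>A C. cvx A \<and> cvx C \<and> (\<forall>x\<in>J. f n x \<le> ereal (C x - A x)) \<and> primal_dual_value A C \<le> ennreal (v + inverse (real (Suc n)))" for n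
  proof -
    have "aux_dual \<mu> \<nu> (f n) < ereal (v + inverse (real (Suc n)))"
      using le[of n] by (rule order_le_less_trans) simp
    then obtain \<phi> \<psi> where D: "(\<phi>, \<psi>) \<in> aux_dual_set \<mu> \<nu> (f n)" "pair_integral I J \<mu> \<nu> \<phi> \<psi> < ereal (v + inverse (real (Suc n)))"
      unfolding aux_dual_def by (auto simp: INF_less_iff)
    from D(1) show ?thesis
    proof (rule dual_setD[OF _ f0])
      fix A C assume *: "cvx A" "cvx C" "\<And>x. x \<in> J \<Longrightarrow> f n x \<le> ereal (C x - A x)"
        "primal_dual_value A C < \<infinity>" "pair_integral I J \<mu> \<nu> \<phi> \<psi> = enn2ereal (primal_dual_value A C)"
      have "primal_dual_value A C \<le> ennreal (v + inverse (real (Suc n)))"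
        using D(2) *(5) v0 by (cases "primal_dual_value A C") (auto intro!: ennreal_leI simp del: of_nat_Suc ennreal_plus)
      with * show ?thesis by blast
    qed
  qed
  then obtain A C where AC: "\<And>n. cvx (A n)" "\<And>n. cvx (C n)" "\<And>n x. x \<in> J \<Longrightarrow> f n x \<le> ereal (C n x - A n x)"
    "\<And>n. primal_dual_value (A n) (C n) \<le> ennreal (v + inverse (real (Suc n)))" by metis
  have le': "A n x \<le> C n x" if "x \<in> J" for n x using order_trans[OF f0 AC(3)[OF that, of n]] by simp
  have lim: "(\<lambda>n. v + inverse (real (Suc n))) \<longlonglongrightarrow> v"
    using tendsto_add[OF tendsto_const[of v] LIMSEQ_inverse_real_of_nat] by simp
  obtain r A' C' where r: "strict_mono (r :: nat \<Rightarrow> nat)" "cvx A'" "cvx C'"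
    "\<And>x. x \<in> J \<Longrightarrow> (\<lambda>n. C (r n) x - A (r n) x) \<longlonglongrightarrow> C' x - A' x" "primal_dual_value A' C' \<le> ennreal v"
    by (rule dual_compactness[OF AC(1,2) le' AC(4) lim]) auto
  have f_mono: "f n x \<le> f m x" if "n \<le> m" for n m x by (rule lift_Suc_mono_le[where f="\<lambda>n. f n x", OF mono that])
  have fl: "(SUP n. f n x) \<le> ereal (C' x - A' x)" if x: "x \<in> J" for x
  proof (rule SUP_least)
    fix n
    show "f n x \<le> ereal (C' x - A' x)"
    proof (rule LIMSEQ_le_const[of "\<lambda>n. ereal (C (r n) x - A (r n) x)"])
      show "(\<lambda>n. ereal (C (r n) x - A (r n) x)) \<longlonglongrightarrow> ereal (C' x - A' x)" using r(4)[OF x] by simp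
      have "f n x \<le> ereal (C (r m) x - A (r m) x)" if "n \<le> m" for m
        using order_trans[OF f_mono AC(3)[OF x, of "r m"]] seq_suble[OF r(1), of m] that by simp
      then show "\<exists>N. \<forall>m\<ge>N. f n x \<le> ereal (C (r m) x - A (r m) x)" by blast
    qed
  qed
  have F0: "0 \<le> (SUP n. f n x)" for x using f0[of 0 x] by (rule SUP_upper2[of 0, rotated]) simp
  have fin: "primal_dual_value A' C' < \<infinity>" using r(5) by (simp add: order_le_less_trans)
  show thesis
  proof (rule that[OF dual_setI(1)[OF r(2,3) fl F0 fin]])
    show "pair_integral I J \<mu> \<nu> (\<lambda>x. ereal (- A' x)) (\<lambda>x. ereal (C' x)) \<le> ereal v"
      using dual_setI(2)[OF r(2,3) fl F0 fin] r(5) v0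
      by (cases "primal_dual_value A' C'") (auto simp: ennreal_le_iff top_unique)
  qed
qed

end

section \<open>Positive functionals of linear growth\<close>

text \<open>Large enough to contain all |t - x|, and every member is integrable for each measure
  with finite first moment.\<close>

definition lin_growth :: "(real \<Rightarrow> real) set" where
  "lin_growth = {g \<in> borel_measurable borel. \<exists>a b. \<forall>x. \<bar>g x\<bar> \<le> a + b * \<bar>x\<bar>}"

lemma lin_growthI: "g \<in> borel_measurable borel \<Longrightarrow> (\<And>x. \<bar>g x\<bar> \<le> a + b * \<bar>x\<bar>) \<Longrightarrow> g \<in> lin_growth"
  by (auto simp: lin_growth_def)

lemma lin_growthE:
  assumes "g \<in> lin_growth"
  obtains a b where "g \<in> borel_measurable borel" "0 \<le> a" "0 \<le> b" "\<And>x. \<bar>g x\<bar> \<le> a + b * \<bar>x\<bar>"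
proof -
  obtain a b where ab: "g \<in> borel_measurable borel" "\<And>x. \<bar>g x\<bar> \<le> a + b * \<bar>x\<bar>" using assms by (auto simp: lin_growth_def)
  have "\<bar>g x\<bar> \<le> \<bar>a\<bar> + \<bar>b\<bar> * \<bar>x\<bar>" for x
  proof -
    have "b * \<bar>x\<bar> \<le> \<bar>b\<bar> * \<bar>x\<bar>" by (intro mult_right_mono) auto
    then show ?thesis using ab(2)[of x] by linarith
  qed
  then show thesis using that[OF ab(1), of "\<bar>a\<bar>" "\<bar>b\<bar>"] by simp
qed

lemma lin_growth_add:
  assumes "f \<in> lin_growth" "g \<in> lin_growth"
  shows "(\<lambda>x. f x + g x) \<in> lin_growth"
proof -
  obtain a b where f: "f \<in> borel_measurable borel" "\<And>x. \<bar>f x\<bar> \<le> a + b * \<bar>x\<bar>" by (rule lin_growthE[OF assms(1)]) auto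
  obtain c d where g: "g \<in> borel_measurable borel" "\<And>x. \<bar>g x\<bar> \<le> c + d * \<bar>x\<bar>" by (rule lin_growthE[OF assms(2)]) auto
  have "\<bar>f x + g x\<bar> \<le> (a + c) + (b + d) * \<bar>x\<bar>" for x
    using f(2)[of x] g(2)[of x] by (simp add: algebra_simps)
  then show ?thesis using f(1) g(1) by (intro lin_growthI) auto
qed

lemma lin_growth_cmult:
  assumes "f \<in> lin_growth"
  shows "(\<lambda>x. t * f x) \<in> lin_growth"
proof -
  obtain a b where f: "f \<in> borel_measurable borel" "\<And>x. \<bar>f x\<bar> \<le> a + b * \<bar>x\<bar>" by (rule lin_growthE[OF assms]) auto
  have "\<bar>t * f x\<bar> \<le> \<bar>t\<bar> * a + (\<bar>t\<bar> * b) * \<bar>x\<bar>" for x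
    using mult_left_mono[OF f(2)[of x] abs_ge_zero[of t]] by (simp add: abs_mult algebra_simps)
  then show ?thesis using f(1) by (intro lin_growthI) auto
qed

lemma lin_growth_minus: "f \<in> lin_growth \<Longrightarrow> (\<lambda>x. - f x) \<in> lin_growth"
  using lin_growth_cmult[of f "-1"] by simp

lemma lin_growth_const: "(\<lambda>x. c) \<in> lin_growth"
  by (rule lin_growthI[of _ "\<bar>c\<bar>" 0]) auto

lemma lin_growth_abs: "(\<lambda>x. \<bar>t - x\<bar>) \<in> lin_growth"
  by (rule lin_growthI[of _ "\<bar>t\<bar>" 1]) auto

lemma lin_growth_sum: "finite S \<Longrightarrow> (\<And>i. i \<in> S \<Longrightarrow> f i \<in> lin_growth) \<Longrightarrow> (\<lambda>x. \<Sum>i\<in>S. f i x) \<in> lin_growth"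
  by (induction S rule: finite_induct) (auto intro: lin_growth_add lin_growth_const)

lemma lin_growth_integrable:
  assumes "finite_first_moment \<theta>" "f \<in> lin_growth"
  shows "integrable \<theta> f"
proof -
  obtain a b where f: "f \<in> borel_measurable borel" "\<And>x. \<bar>f x\<bar> \<le> a + b * \<bar>x\<bar>" by (rule lin_growthE[OF assms(2)]) auto
  show ?thesis by (rule ffm_integrable[OF assms(1) f(1) AE_I2[OF f(2)]])
qed

definition positive_functional :: "((real \<Rightarrow> real) \<Rightarrow> real) \<Rightarrow> bool" where
  "positive_functional L \<longleftrightarrow>
     (\<forall>f\<in>lin_growth. \<forall>g\<in>lin_growth. L (\<lambda>x. f x + g x) = L f + L g) \<and>
     (\<forall>f\<in>lin_growth. \<forall>t. L (\<lambda>x. t * f x) = t * L f) \<and>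
     (\<forall>f\<in>lin_growth. (\<forall>x. 0 \<le> f x) \<longrightarrow> 0 \<le> L f)"

lemma positive_functionalD:
  assumes "positive_functional L"
  shows "f \<in> lin_growth \<Longrightarrow> g \<in> lin_growth \<Longrightarrow> L (\<lambda>x. f x + g x) = L f + L g"
    "f \<in> lin_growth \<Longrightarrow> L (\<lambda>x. t * f x) = t * L f"
    "f \<in> lin_growth \<Longrightarrow> g \<in> lin_growth \<Longrightarrow> (\<And>x. f x \<le> g x) \<Longrightarrow> L f \<le> L g"
    "finite S \<Longrightarrow> (\<And>i. i \<in> S \<Longrightarrow> h i \<in> lin_growth) \<Longrightarrow> L (\<lambda>x. \<Sum>i\<in>S. h i x) = (\<Sum>i\<in>S. L (h i))"
proof -
  have add: "L (\<lambda>x. f x + g x) = L f + L g" if "f \<in> lin_growth" "g \<in> lin_growth" for f g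
    using assms that by (simp add: positive_functional_def)
  have scale: "L (\<lambda>x. t * f x) = t * L f" if "f \<in> lin_growth" for f t
    using assms that by (simp add: positive_functional_def)
  show "f \<in> lin_growth \<Longrightarrow> g \<in> lin_growth \<Longrightarrow> L (\<lambda>x. f x + g x) = L f + L g" by (rule add)
  show "f \<in> lin_growth \<Longrightarrow> L (\<lambda>x. t * f x) = t * L f" by (rule scale)
  show "L f \<le> L g" if fg: "f \<in> lin_growth" "g \<in> lin_growth" "\<And>x. f x \<le> g x"
  proof -
    have n: "(\<lambda>x. (-1) * f x) \<in> lin_growth" using lin_growth_cmult[OF fg(1), of "-1"] .
    have "0 \<le> L (\<lambda>x. g x + (-1) * f x)"
      using assms lin_growth_add[OF fg(2) n] fg(3) by (simp add: positive_functional_def)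
    then show ?thesis using add[OF fg(2) n] scale[OF fg(1), of "-1"] by simp
  qed
  show "L (\<lambda>x. \<Sum>i\<in>S. h i x) = (\<Sum>i\<in>S. L (h i))" if "finite S" "\<And>i. i \<in> S \<Longrightarrow> h i \<in> lin_growth"
    using that
  proof (induction S rule: finite_induct)
    case empty
    then show ?case using scale[OF lin_growth_const[of 0], of 0] by simp
  next
    case (insert i S)
    then show ?case using add[of "h i" "\<lambda>x. \<Sum>i\<in>S. h i x"] lin_growth_sum[of S h] by simp
  qed
qed

lemma positive_functional_integral:
  assumes \<theta>: "finite_first_moment \<theta>"
  shows "positive_functional (\<lambda>f. LINT x|\<theta>. f x)"
  unfolding positive_functional_def using lin_growth_integrable[OF \<theta>]
  by (auto intro: Bochner_Integration.integral_nonneg)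

text \<open>Second differences of \<open>\<bar>t - x\<bar>\<close> are hat functions, and hat functions on a fine grid
  interpolate Lipschitz functions.\<close>

lemma positive_functional_unique:
  assumes L: "positive_functional L" and T: "positive_functional T"
    and one: "L (\<lambda>x. 1) = T (\<lambda>x. 1)" and abs: "\<And>t. L (\<lambda>x. \<bar>t - x\<bar>) = T (\<lambda>x. \<bar>t - x\<bar>)"
    and lip: "\<And>x y. \<bar>g x - g y\<bar> \<le> K * \<bar>x - y\<bar>" and const: "\<And>x. R \<le> \<bar>x\<bar> \<Longrightarrow> g x = \<kappa>"
  shows "L g = T g"
proof -
  have K0: "0 \<le> K" using order_trans[OF abs_ge_zero lip[of 1 0]] by simp
  have cont: "continuous_on UNIV g"
  proof (rule continuous_onI)
    fix x e :: real assume e: "0 < e"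
    show "\<exists>d>0. \<forall>x'\<in>UNIV. dist x' x < d \<longrightarrow> dist (g x') (g x) \<le> e"
    proof (intro exI[of _ "e / (K + 1)"] conjI ballI impI)
      fix y assume "dist y x < e / (K + 1)"
      then have "K * \<bar>y - x\<bar> \<le> K * (e / (K + 1))" using K0 by (intro mult_left_mono) (auto simp: dist_real_def)
      also have "\<dots> \<le> e" using e K0 by (simp add: field_simps)
      finally show "dist (g y) (g x) \<le> e" using lip[of y x] by (simp add: dist_real_def)
    qed (use e K0 in simp)
  qed
  have gV: "g \<in> lin_growth"
  proof (rule lin_growthI)
    show "g \<in> borel_measurable borel" by (rule borel_measurable_continuous_onI[OF cont])
    show "\<bar>g x\<bar> \<le> \<bar>g 0\<bar> + K * \<bar>x\<bar>" for x using lip[of x 0] abs_triangle_ineq[of "g x - g 0" "g 0"] by simp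
  qed
  have main: "\<bar>L g - T g\<bar> \<le> 2 * (K * \<delta>) * L (\<lambda>x. 1)" if \<delta>: "0 < \<delta>" for \<delta>
  proof -
    obtain N0 :: nat where N0: "\<bar>R\<bar> / \<delta> < real N0" using reals_Archimedean2 by blast
    define N where "N = int N0"
    have far: "g (of_int i * \<delta>) = \<kappa>" if "i \<notin> {-N..N}" for i :: int
    proof (rule const)
      have "\<bar>R\<bar> < real N0 * \<delta>" using N0 \<delta> by (simp add: pos_divide_less_eq)
      also have "\<dots> \<le> \<bar>of_int i\<bar> * \<delta>" using that \<delta> by (intro mult_right_mono) (auto simp: N_def)
      finally show "R \<le> \<bar>of_int i * \<delta>\<bar>" using \<delta> by (simp add: abs_mult)
    qed
    define h where "h i x = (1 / (2 * \<delta>)) * (\<bar>(of_int i + 1) * \<delta> - x\<bar> + ((-2) * \<bar>of_int i * \<delta> - x\<bar> + \<bar>(of_int i - 1) * \<delta> - x\<bar>))" for i :: int and x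
    have hV: "h i \<in> lin_growth" for i
      unfolding h_def by (intro lin_growth_add lin_growth_cmult lin_growth_abs)
    have hLT: "L (h i) = T (h i)" for i
    proof -
      have "M (h i) = (1 / (2 * \<delta>)) * (M (\<lambda>x. \<bar>(of_int i + 1) * \<delta> - x\<bar>) + ((-2) * M (\<lambda>x. \<bar>of_int i * \<delta> - x\<bar>) + M (\<lambda>x. \<bar>(of_int i - 1) * \<delta> - x\<bar>)))"
        if M: "positive_functional M" for M
        unfolding h_def
        by (subst positive_functionalD(2)[OF M], intro lin_growth_add lin_growth_cmult lin_growth_abs,
            subst positive_functionalD(1)[OF M], rule lin_growth_abs, intro lin_growth_add lin_growth_cmult lin_growth_abs,
            subst positive_functionalD(1)[OF M], intro lin_growth_cmult lin_growth_abs, rule lin_growth_abs,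
            subst positive_functionalD(2)[OF M], rule lin_growth_abs) (rule refl)
      from this[OF L] this[OF T] show ?thesis unfolding abs by (rule trans[OF _ sym])
    qed
    have hval: "h i x = max 0 (1 - \<bar>x / \<delta> - of_int i\<bar>)" for i x
    proof -
      have e: "\<bar>r * \<delta> - x\<bar> = \<delta> * \<bar>x / \<delta> - r\<bar>" for r
      proof -
        have "r * \<delta> - x = \<delta> * (r - x / \<delta>)" using \<delta> by (simp add: field_simps)
        then show ?thesis using \<delta> by (simp add: abs_mult abs_minus_commute)
      qed
      have "h i x = (\<bar>x / \<delta> - (of_int i + 1)\<bar> + ((-2) * \<bar>x / \<delta> - of_int i\<bar> + \<bar>x / \<delta> - (of_int i - 1)\<bar>)) / 2"
        unfolding h_def e using \<delta> by (simp add: field_simps)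
      also have "\<dots> = max 0 (1 - \<bar>x / \<delta> - of_int i\<bar>)" by (auto simp: max_def abs_if)
      finally show ?thesis .
    qed
    \<comment> \<open>The interpolation of g on the grid of width \<delta>; subtracting the constant
      \<kappa> leaves finitely many hats.\<close>
    define s where "s x = \<kappa> * 1 + (\<Sum>i\<in>{-N..N}. (g (of_int i * \<delta>) - \<kappa>) * h i x)" for x
    have sV: "s \<in> lin_growth" unfolding s_def
      by (intro lin_growth_add lin_growth_cmult lin_growth_const lin_growth_sum hV) auto
    have MS: "M s = \<kappa> * M (\<lambda>x. 1) + (\<Sum>i\<in>{-N..N}. (g (of_int i * \<delta>) - \<kappa>) * M (h i))" if M: "positive_functional M" for M
      unfolding s_def
      by (subst positive_functionalD(1)[OF M], intro lin_growth_cmult lin_growth_const, intro lin_growth_sum lin_growth_cmult hV, simp,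
          subst positive_functionalD(2)[OF M], rule lin_growth_const, subst positive_functionalD(4)[OF M], simp, intro lin_growth_cmult hV)
         (simp add: positive_functionalD(2)[OF M] hV)
    have sLT: "L s = T s" unfolding MS[OF L] MS[OF T] one hLT ..
    have close: "\<bar>g x - s x\<bar> \<le> K * \<delta>" for x
    proof -
      define j where "j = \<lfloor>x / \<delta>\<rfloor>"
      define l where "l = x / \<delta> - of_int j"
      have l: "0 \<le> l" "l < 1" unfolding l_def j_def by linarith+
      have h0: "h i x = 0" if "i \<noteq> j" "i \<noteq> j + 1" for i
      proof -
        have "i \<le> j - 1 \<or> i \<ge> j + 2" using that by linarith
        then have "1 \<le> \<bar>x / \<delta> - of_int i\<bar>" using l unfolding l_def by (auto simp: abs_if)
        then show ?thesis unfolding hval by simp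
      qed
      have hj: "h j x = 1 - l" "h (j + 1) x = l" using l unfolding hval l_def by (auto simp: abs_if)
      have "(\<Sum>i\<in>{-N..N}. (g (of_int i * \<delta>) - \<kappa>) * h i x) = (\<Sum>i\<in>{-N..N} \<union> {j, j+1}. (g (of_int i * \<delta>) - \<kappa>) * h i x)"
        using far by (intro sum.mono_neutral_left) auto
      also have "\<dots> = (\<Sum>i\<in>{j, j+1}. (g (of_int i * \<delta>) - \<kappa>) * h i x)"
        using h0 by (intro sum.mono_neutral_right) auto
      also have "\<dots> = (g (of_int j * \<delta>) - \<kappa>) * (1 - l) + (g (of_int (j + 1) * \<delta>) - \<kappa>) * l" using hj by simp
      finally have sx: "s x = g (of_int j * \<delta>) * (1 - l) + g (of_int (j + 1) * \<delta>) * l"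
        unfolding s_def by (simp add: algebra_simps)
      have xj: "x - of_int j * \<delta> = l * \<delta>" using \<delta> by (simp add: l_def field_simps)
      have "\<bar>g x - g (of_int j * \<delta>)\<bar> \<le> K * \<bar>x - of_int j * \<delta>\<bar>" by (rule lip)
      also have "\<dots> \<le> K * \<delta>" unfolding xj using l \<delta> K0 by (intro mult_left_mono) (auto simp: abs_mult)
      finally have 1: "\<bar>g x - g (of_int j * \<delta>)\<bar> \<le> K * \<delta>" .
      have xj1: "x - of_int (j + 1) * \<delta> = - ((1 - l) * \<delta>)" using xj by (simp add: algebra_simps)
      have "\<bar>g x - g (of_int (j + 1) * \<delta>)\<bar> \<le> K * \<bar>x - of_int (j + 1) * \<delta>\<bar>" by (rule lip)
      also have "\<dots> \<le> K * \<delta>" unfolding xj1 using l \<delta> K0 by (intro mult_left_mono) (auto simp: abs_mult)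
      finally have 2: "\<bar>g x - g (of_int (j + 1) * \<delta>)\<bar> \<le> K * \<delta>" .
      have "g x - s x = (g x - g (of_int j * \<delta>)) * (1 - l) + (g x - g (of_int (j + 1) * \<delta>)) * l"
        unfolding sx by (simp add: algebra_simps)
      also have "\<bar>\<dots>\<bar> \<le> \<bar>g x - g (of_int j * \<delta>)\<bar> * (1 - l) + \<bar>g x - g (of_int (j + 1) * \<delta>)\<bar> * l"
        using l by (intro order_trans[OF abs_triangle_ineq]) (simp add: abs_mult)
      also have "\<dots> \<le> K * \<delta> * (1 - l) + K * \<delta> * l" using 1 2 l by (intro add_mono mult_right_mono) auto
      finally show ?thesis by (simp add: algebra_simps)
    qed
    have near: "\<bar>M g - M s\<bar> \<le> K * \<delta> * M (\<lambda>x. 1)" if M: "positive_functional M" for M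
    proof -
      have cV: "(\<lambda>x. r * 1) \<in> lin_growth" for r :: real by (intro lin_growth_cmult lin_growth_const)
      have "M g \<le> M (\<lambda>x. s x + K * \<delta> * 1)"
        using close by (intro positive_functionalD(3)[OF M] gV lin_growth_add sV cV) (auto simp: abs_le_iff algebra_simps)
      moreover have "M s \<le> M (\<lambda>x. g x + K * \<delta> * 1)"
        using close by (intro positive_functionalD(3)[OF M] gV lin_growth_add sV cV) (auto simp: abs_le_iff algebra_simps)
      ultimately show ?thesis
        unfolding positive_functionalD(1)[OF M sV cV] positive_functionalD(1)[OF M gV cV] positive_functionalD(2)[OF M lin_growth_const]
        by linarith
    qed
    have "2 * (K * \<delta>) * L (\<lambda>x. 1) = K * \<delta> * L (\<lambda>x. 1) + K * \<delta> * T (\<lambda>x. 1)" unfolding one by simp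
    then show ?thesis using near[OF L] near[OF T] sLT by linarith
  qed
  have L1: "0 \<le> L (\<lambda>x. 1)" using L lin_growth_const[of 1] by (simp add: positive_functional_def)
  show ?thesis
  proof (rule ccontr)
    assume "L g \<noteq> T g"
    then have pos: "0 < \<bar>L g - T g\<bar>" by simp
    \<comment> \<open>With \<delta> = |L g - T g| / (2 * B) the bound \<open>main\<close> falls to
      half of |L g - T g|.\<close>
    define B where "B = 2 * K * L (\<lambda>x. 1) + 1"
    have B: "0 < B" using K0 L1 by (simp add: B_def add_nonneg_pos)
    have "\<bar>L g - T g\<bar> \<le> 2 * (K * (\<bar>L g - T g\<bar> / (2 * B))) * L (\<lambda>x. 1)"
      by (rule main) (use pos B in simp)
    also have "\<dots> = (2 * K * L (\<lambda>x. 1)) * \<bar>L g - T g\<bar> / (2 * B)" by simp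
    also have "\<dots> \<le> B * \<bar>L g - T g\<bar> / (2 * B)"
      using B by (intro divide_right_mono mult_right_mono) (auto simp: B_def)
    also have "\<dots> = \<bar>L g - T g\<bar> / 2" using B by simp
    finally show False using pos by simp
  qed
qed

section \<open>A Hahn-Banach argument\<close>

text \<open>The last condition is properness: it keeps the infimum over each fibre from being minus
  infinity.\<close>

definition fun_cone :: "((real \<Rightarrow> real) \<times> real) set \<Rightarrow> bool" where
  "fun_cone E \<longleftrightarrow> (\<forall>f r g s. (f, r) \<in> E \<longrightarrow> (g, s) \<in> E \<longrightarrow> ((\<lambda>x. f x + g x), r + s) \<in> E) \<and>
     (\<forall>f r t. (f, r) \<in> E \<longrightarrow> 0 < t \<longrightarrow> ((\<lambda>x. t * f x), t * r) \<in> E) \<and>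
     (\<forall>r. ((\<lambda>x. 0), r) \<in> E \<longrightarrow> 0 \<le> r)"

text \<open>E plays the role of the epigraph of a sublinear functional; a maximal cone above E is the
  epigraph of a linear functional.\<close>

lemma hahn_banach_cone:
  assumes E: "fun_cone E" and zero: "((\<lambda>x. 0), 0) \<in> E" and dom: "\<And>f. f \<in> lin_growth \<Longrightarrow> \<exists>r. (f, r) \<in> E"
  obtains L where "\<And>f g. f \<in> lin_growth \<Longrightarrow> g \<in> lin_growth \<Longrightarrow> L (\<lambda>x. f x + g x) = L f + L g"
    "\<And>f t. f \<in> lin_growth \<Longrightarrow> L (\<lambda>x. t * f x) = t * L f" "\<And>f r. f \<in> lin_growth \<Longrightarrow> (f, r) \<in> E \<Longrightarrow> L f \<le> r"
proof -
  define F where "F = {M. E \<subseteq> M \<and> fun_cone M}"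
  have "\<exists>M\<in>F. \<forall>X\<in>F. M \<subseteq> X \<longrightarrow> X = M"
  proof (rule subset_Zorn_nonempty)
    show "F \<noteq> {}" using E by (auto simp: F_def)
    fix c assume c: "c \<noteq> {}" "subset.chain F c"
    have cF: "\<And>X. X \<in> c \<Longrightarrow> X \<in> F" and tot: "\<And>X Y. X \<in> c \<Longrightarrow> Y \<in> c \<Longrightarrow> X \<subseteq> Y \<or> Y \<subseteq> X"
      using c(2) by (auto simp: subset.chain_def)
    have "fun_cone (\<Union>c)"
      unfolding fun_cone_def
    proof (intro conjI allI impI)
      fix f r g s assume "(f, r) \<in> \<Union>c" "(g, s) \<in> \<Union>c"
      then obtain X Y where "X \<in> c" "Y \<in> c" "(f, r) \<in> X" "(g, s) \<in> Y" by auto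
      then obtain Z where Z: "Z \<in> c" "(f, r) \<in> Z" "(g, s) \<in> Z" using tot by blast
      have "fun_cone Z" using cF[OF Z(1)] by (simp add: F_def)
      then have "((\<lambda>x. f x + g x), r + s) \<in> Z" using Z(2,3) unfolding fun_cone_def by blast
      then show "((\<lambda>x. f x + g x), r + s) \<in> \<Union>c" using Z(1) by blast
    next
      fix f r and t :: real assume "(f, r) \<in> \<Union>c" "0 < t"
      moreover have "fun_cone Z" if "Z \<in> c" for Z using cF[OF that] by (simp add: F_def)
      ultimately show "((\<lambda>x. t * f x), t * r) \<in> \<Union>c" unfolding fun_cone_def by blast
    next
      fix r assume "((\<lambda>x. 0), r) \<in> \<Union>c"
      moreover have "fun_cone Z" if "Z \<in> c" for Z using cF[OF that] by (simp add: F_def)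
      ultimately show "0 \<le> r" unfolding fun_cone_def by blast
    qed
    then show "\<Union>c \<in> F" using c(1) cF by (auto simp: F_def)
  qed
  then obtain M where M: "M \<in> F" and max: "\<And>X. X \<in> F \<Longrightarrow> M \<subseteq> X \<Longrightarrow> X = M" by blast
  have EM: "E \<subseteq> M" and Madd: "\<And>f r g s. (f, r) \<in> M \<Longrightarrow> (g, s) \<in> M \<Longrightarrow> ((\<lambda>x. f x + g x), r + s) \<in> M"
    and Mscale: "\<And>f r t. (f, r) \<in> M \<Longrightarrow> 0 < t \<Longrightarrow> ((\<lambda>x. t * f x), t * r) \<in> M" and Mzero: "\<And>r. ((\<lambda>x. 0), r) \<in> M \<Longrightarrow> 0 \<le> r"
    using M by (auto simp: F_def fun_cone_def)
  define L where "L f = Inf {r. (f, r) \<in> M}" for f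
  have opp: "0 \<le> r + s" if "(f, r) \<in> M" "((\<lambda>x. - f x), s) \<in> M" for f r s
    using Madd[OF that] by (intro Mzero) simp
  have ne: "{r. (f, r) \<in> M} \<noteq> {}" if "f \<in> lin_growth" for f using dom[OF that] EM by blast
  have bdd: "bdd_below {r. (f, r) \<in> M}" if f: "f \<in> lin_growth" for f
  proof -
    obtain s where "((\<lambda>x. - f x), s) \<in> M" using ne[OF lin_growth_minus[OF f]] by auto
    then have "- s \<le> r" if "(f, r) \<in> M" for r using opp[OF that] by force
    then show ?thesis by (intro bdd_belowI[of _ "- s"]) auto
  qed
  have Lle: "L f \<le> r" if "f \<in> lin_growth" "(f, r) \<in> M" for f r
    unfolding L_def using bdd[OF that(1)] that(2) by (intro cInf_lower) auto
  have neg: "((\<lambda>x. - f x), - L f) \<in> M" if f: "f \<in> lin_growth" for f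
  proof -
    \<comment> \<open>The ray through (-f, - L f) is added to M. The larger cone is still proper,
      because L f is the infimum of the fibre over f, so maximality puts the ray into M.\<close>
    define M' where "M' = {((\<lambda>x. h x + t * - f x), r - t * L f) | h r t. (h, r) \<in> M \<and> 0 \<le> t}"
    have M'I: "((\<lambda>x. h x + t * - f x), r - t * L f) \<in> M'" if "(h, r) \<in> M" "0 \<le> t" for h r t
      using that by (auto simp: M'_def)
    have sub: "M \<subseteq> M'"
    proof
      fix z assume "z \<in> M"
      then show "z \<in> M'" using M'I[of "fst z" "snd z" 0] by simp
    qed
    have "fun_cone M'"
      unfolding fun_cone_def
    proof (intro conjI allI impI)
      fix a r b s assume "(a, r) \<in> M'" "(b, s) \<in> M'"
      then obtain h1 r1 t1 h2 r2 t2 where 1: "a = (\<lambda>x. h1 x + t1 * - f x)" "r = r1 - t1 * L f" "(h1, r1) \<in> M" "0 \<le> t1"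
        and 2: "b = (\<lambda>x. h2 x + t2 * - f x)" "s = r2 - t2 * L f" "(h2, r2) \<in> M" "0 \<le> t2" by (auto simp: M'_def)
      have e: "(\<lambda>x. a x + b x) = (\<lambda>x. (h1 x + h2 x) + (t1 + t2) * - f x)" "r + s = (r1 + r2) - (t1 + t2) * L f"
        using 1 2 by (auto simp: algebra_simps)
      show "((\<lambda>x. a x + b x), r + s) \<in> M'" unfolding e using 1 2 by (intro M'I Madd) auto
    next
      fix a r and k :: real assume "(a, r) \<in> M'" "0 < k"
      then obtain h1 r1 t1 where 1: "a = (\<lambda>x. h1 x + t1 * - f x)" "r = r1 - t1 * L f" "(h1, r1) \<in> M" "0 \<le> t1"
        by (auto simp: M'_def)
      have e: "(\<lambda>x. k * a x) = (\<lambda>x. k * h1 x + (k * t1) * - f x)" "k * r = k * r1 - (k * t1) * L f"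
        using 1 by (auto simp: algebra_simps)
      show "((\<lambda>x. k * a x), k * r) \<in> M'" unfolding e using 1 \<open>0 < k\<close> by (intro M'I Mscale) auto
    next
      fix r assume "((\<lambda>x. 0), r) \<in> M'"
      then obtain h1 r1 t1 where 1: "(\<lambda>x. 0) = (\<lambda>x. h1 x + t1 * - f x)" "r = r1 - t1 * L f" "(h1, r1) \<in> M" "0 \<le> t1"
        by (auto simp: M'_def)
      have h1: "h1 = (\<lambda>x. t1 * f x)"
      proof
        fix x show "h1 x = t1 * f x" using fun_cong[OF 1(1), of x] by simp
      qed
      show "0 \<le> r"
      proof (cases "t1 = 0")
        case True
        then show ?thesis using 1 h1 Mzero by simp
      next
        case False
        then have "((\<lambda>x. (1 / t1) * (t1 * f x)), (1 / t1) * r1) \<in> M" using 1 h1 by (intro Mscale) auto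
        then have "L f \<le> r1 / t1" using False by (intro Lle[OF f]) simp
        then show ?thesis using False 1 by (simp add: field_simps)
      qed
    qed
    then have "M' \<in> F" using sub EM by (auto simp: F_def)
    then have "M' = M" using sub by (rule max)
    moreover have "((\<lambda>x. 0 + 1 * - f x), 0 - 1 * L f) \<in> M'" using zero EM by (intro M'I) auto
    ultimately show ?thesis by simp
  qed
  have Lneg: "L (\<lambda>x. - f x) = - L f" if f: "f \<in> lin_growth" for f
  proof (rule antisym)
    show "L (\<lambda>x. - f x) \<le> - L f" by (rule Lle[OF lin_growth_minus[OF f] neg[OF f]])
    show "- L f \<le> L (\<lambda>x. - f x)"
      unfolding L_def[of "\<lambda>x. - f x"]
    proof (rule cInf_greatest[OF ne[OF lin_growth_minus[OF f]]])
      fix s assume "s \<in> {r. ((\<lambda>x. - f x), r) \<in> M}"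
      then have "- s \<le> r" if "(f, r) \<in> M" for r using opp[OF that, of s] by simp
      then have "- s \<le> L f" unfolding L_def by (intro cInf_greatest[OF ne[OF f]]) auto
      then show "- L f \<le> s" by simp
    qed
  qed
  have inM: "(f, L f) \<in> M" if f: "f \<in> lin_growth" for f
    using neg[OF lin_growth_minus[OF f]] Lneg[OF f] by simp
  have Ladd: "L (\<lambda>x. f x + g x) = L f + L g" if fg: "f \<in> lin_growth" "g \<in> lin_growth" for f g
  proof (rule antisym)
    show "L (\<lambda>x. f x + g x) \<le> L f + L g" by (rule Lle[OF lin_growth_add[OF fg] Madd[OF inM inM]]) (use fg in auto)
    have "L (\<lambda>x. - f x + - g x) \<le> - L f + - L g"
      by (rule Lle[OF lin_growth_add[OF fg[THEN lin_growth_minus]] Madd[OF neg neg]]) (use fg in auto)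
    moreover have "(\<lambda>x. - f x + - g x) = (\<lambda>x. - (f x + g x))" by auto
    ultimately show "L f + L g \<le> L (\<lambda>x. f x + g x)" using Lneg[OF lin_growth_add[OF fg]] by simp
  qed
  have Lpos: "L (\<lambda>x. t * f x) = t * L f" if f: "f \<in> lin_growth" and t: "0 < t" for f t
  proof (rule antisym)
    show "L (\<lambda>x. t * f x) \<le> t * L f" by (rule Lle[OF lin_growth_cmult[OF f] Mscale[OF inM[OF f] t]])
    have "L (\<lambda>x. t * - f x) \<le> t * - L f" by (rule Lle[OF lin_growth_cmult[OF lin_growth_minus[OF f]] Mscale[OF neg[OF f] t]])
    then show "t * L f \<le> L (\<lambda>x. t * f x)" using Lneg[OF lin_growth_cmult[OF f, of t]] by simp
  qed
  show thesis
  proof (rule that[OF Ladd])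
    show "L (\<lambda>x. t * f x) = t * L f" if f: "f \<in> lin_growth" for f t
    proof (cases "0 < t")
      case False
      have z: "L (\<lambda>x. 0) = 0" using Lneg[OF lin_growth_const[of 0]] by simp
      have "L (\<lambda>x. (- t) * - f x) = (- t) * L (\<lambda>x. - f x)" if "0 < - t" by (rule Lpos[OF lin_growth_minus[OF f] that])
      then show ?thesis using False z Lneg[OF f] by (cases "t = 0") auto
    qed (rule Lpos[OF f])
    show "L f \<le> r" if "f \<in> lin_growth" "(f, r) \<in> E" for f r using Lle that EM by blast
  qed
qed

text \<open>E is the epigraph of the infimum of \<nu>(C) - \<mu>(A) - t * a over all h + t * g k <=
  C - A, and \<open>bound\<close> makes it proper. A linear L below it satisfies \<mu>(A) <= L A and
  L C <= \<nu>(C) by t = 0, and L (g k) >= a by t = 1 and h = - g k, for all k at once.\<close>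

lemma integral_functional_extension:
  assumes le: "pot_le \<mu> \<nu>"
    and gL: "\<And>k::nat. \<exists>K R \<kappa>. (\<forall>x y. \<bar>g k x - g k y\<bar> \<le> K * \<bar>x - y\<bar>) \<and> (\<forall>x. R \<le> \<bar>x\<bar> \<longrightarrow> g k x = \<kappa>)"
    and gV: "\<And>k. g k \<in> lin_growth" and dec: "\<And>k x. g (Suc k) x \<le> g k x"
    and bound: "\<And>k A C. convex_on UNIV A \<Longrightarrow> convex_on UNIV C \<Longrightarrow> A \<in> lin_growth \<Longrightarrow> C \<in> lin_growth \<Longrightarrow>
        (\<And>x. g k x \<le> C x - A x) \<Longrightarrow> a \<le> (LINT x|\<nu>. C x) - (LINT x|\<mu>. A x)"
  obtains \<theta> where "pot_le \<mu> \<theta>" "pot_le \<theta> \<nu>" "\<And>k. a \<le> (LINT x|\<theta>. g k x)"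
proof -
  have f: "finite_first_moment \<mu>" "finite_first_moment \<nu>" and eqs: "mass \<mu> = mass \<nu>" "mean \<mu> = mean \<nu>"
    using le by (auto simp: pot_le_def)
  have gdec: "g m x \<le> g k x" if "k \<le> m" for k m x
    using lift_Suc_antimono_le[where f="\<lambda>k. g k x", OF dec that] .
  define good where "good A \<longleftrightarrow> convex_on UNIV A \<and> A \<in> lin_growth" for A :: "real \<Rightarrow> real"
  have good0: "good (\<lambda>x. 0)" by (simp add: good_def lin_growth_const convex_on_const)
  have good_add: "good (\<lambda>x. A x + B x)" if "good A" "good B" for A B
    using that by (auto simp: good_def intro: lin_growth_add convex_on_add)
  have good_mult: "good (\<lambda>x. t * A x)" if "good A" "0 \<le> t" for A t
    using that by (auto simp: good_def intro: lin_growth_cmult convex_on_cmul)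
  have gi: "integrable \<theta> A" if "good A" "finite_first_moment \<theta>" for A \<theta>
    using that lin_growth_integrable by (auto simp: good_def)
  have gmono: "(LINT x|\<mu>. A x) \<le> (LINT x|\<nu>. A x)" if "good A" for A
    using convex_order_integral_le[OF pot_le_imp_convex_order[OF le] _ gi[OF that f(1)] gi[OF that f(2)]] that by (simp add: good_def)
  define E where "E = {(h, r). \<exists>k t A C. 0 \<le> t \<and> good A \<and> good C \<and> (\<forall>x. h x + t * g k x \<le> C x - A x) \<and>
      (LINT x|\<nu>. C x) - (LINT x|\<mu>. A x) - t * a \<le> r}"
  have EI: "(h, r) \<in> E" if "0 \<le> t" "good A" "good C" "\<And>x. h x + t * g k x \<le> C x - A x" "(LINT x|\<nu>. C x) - (LINT x|\<mu>. A x) - t * a \<le> r" for h r k t A C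
    using that by (auto simp: E_def)
  have cone: "fun_cone E"
    unfolding fun_cone_def
  proof (intro conjI allI impI)
    fix h1 r1 h2 r2 assume "(h1, r1) \<in> E" "(h2, r2) \<in> E"
    then obtain k1 t1 A1 C1 k2 t2 A2 C2 where
      1: "0 \<le> t1" "good A1" "good C1" "\<And>x. h1 x + t1 * g k1 x \<le> C1 x - A1 x" "(LINT x|\<nu>. C1 x) - (LINT x|\<mu>. A1 x) - t1 * a \<le> r1" and
      2: "0 \<le> t2" "good A2" "good C2" "\<And>x. h2 x + t2 * g k2 x \<le> C2 x - A2 x" "(LINT x|\<nu>. C2 x) - (LINT x|\<mu>. A2 x) - t2 * a \<le> r2"
      unfolding E_def by blast
    show "((\<lambda>x. h1 x + h2 x), r1 + r2) \<in> E"
    \<comment> \<open>As g decreases in its index, both inequalities remain valid for the larger of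
      k1 and k2; this is how one cone can hold all indices.\<close>
    proof (rule EI[of "t1 + t2" "\<lambda>x. A1 x + A2 x" "\<lambda>x. C1 x + C2 x" _ "max k1 k2"])
      fix x
      have "t1 * g (max k1 k2) x \<le> t1 * g k1 x" "t2 * g (max k1 k2) x \<le> t2 * g k2 x"
        using 1(1) 2(1) gdec by (auto intro!: mult_left_mono)
      then show "h1 x + h2 x + (t1 + t2) * g (max k1 k2) x \<le> C1 x + C2 x - (A1 x + A2 x)"
        using 1(4)[of x] 2(4)[of x] by (simp add: distrib_right)
      show "(LINT x|\<nu>. C1 x + C2 x) - (LINT x|\<mu>. A1 x + A2 x) - (t1 + t2) * a \<le> r1 + r2"
        using 1 2 gi f by (simp add: distrib_right)
    qed (use 1 2 good_add in auto)
  next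
    fix h r and s :: real assume "(h, r) \<in> E" and s: "0 < s"
    then obtain k t A C where 1: "0 \<le> t" "good A" "good C" "\<And>x. h x + t * g k x \<le> C x - A x" "(LINT x|\<nu>. C x) - (LINT x|\<mu>. A x) - t * a \<le> r"
      unfolding E_def by blast
    show "((\<lambda>x. s * h x), s * r) \<in> E"
    proof (rule EI[of "s * t" "\<lambda>x. s * A x" "\<lambda>x. s * C x" _ k])
      show "s * h x + s * t * g k x \<le> s * C x - s * A x" for x
        using mult_left_mono[OF 1(4)[of x], of s] s by (simp add: algebra_simps)
      show "(LINT x|\<nu>. s * C x) - (LINT x|\<mu>. s * A x) - s * t * a \<le> s * r"
        using mult_left_mono[OF 1(5), of s] s by (simp add: algebra_simps)
    qed (use 1 s good_mult in auto)
  next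
    fix r assume "((\<lambda>x. 0), r) \<in> E"
    then obtain k t A C where 1: "0 \<le> t" "good A" "good C" "\<And>x. 0 + t * g k x \<le> C x - A x" "(LINT x|\<nu>. C x) - (LINT x|\<mu>. A x) - t * a \<le> r"
      unfolding E_def by blast
    show "0 \<le> r"
    proof (cases "t = 0")
      case True
      have "(LINT x|\<mu>. A x) \<le> (LINT x|\<mu>. C x)"
        using 1(4) True by (intro integral_mono gi 1 f) simp
      then show ?thesis using gmono[OF 1(3)] 1(5) True by simp
    next
      case False
      then have t: "0 < t" using 1(1) by simp
      have g': "good (\<lambda>x. (1 / t) * A x)" "good (\<lambda>x. (1 / t) * C x)" using good_mult[OF 1(2), of "1 / t"] good_mult[OF 1(3), of "1 / t"] t by simp_all
      have "g k x \<le> (1 / t) * C x - (1 / t) * A x" for x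
        using 1(4)[of x] t by (simp add: field_simps)
      then have "a \<le> (LINT x|\<nu>. (1 / t) * C x) - (LINT x|\<mu>. (1 / t) * A x)"
        using g' by (intro bound[of _ _ k]) (auto simp: good_def)
      then have "t * a \<le> (LINT x|\<nu>. C x) - (LINT x|\<mu>. A x)" using t by (simp add: field_simps)
      then show ?thesis using 1(5) by simp
    qed
  qed
  have E0: "((\<lambda>x. 0), 0) \<in> E" by (rule EI[of 0 "\<lambda>x. 0" "\<lambda>x. 0" _ 0]) (auto intro: good0)
  have Edom: "\<exists>r. (h, r) \<in> E" if h: "h \<in> lin_growth" for h
  proof -
    obtain b c where bc: "0 \<le> b" "0 \<le> c" "\<And>x. \<bar>h x\<bar> \<le> b + c * \<bar>x\<bar>" by (rule lin_growthE[OF h]) auto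
    have gd: "good (\<lambda>x. b + c * \<bar>0 - x\<bar>)"
      using bc(2) by (auto simp: good_def intro!: lin_growth_add lin_growth_const lin_growth_cmult lin_growth_abs convex_on_add convex_on_cmul convex_on_abs_diff simp del: diff_0)
         (simp add: convex_on_const)
    have "(h, (LINT x|\<nu>. b + c * \<bar>0 - x\<bar>) - (LINT x|\<mu>. 0) - 0 * a) \<in> E"
      by (rule EI[OF order_refl good0 gd, of _ 0]) (use bc(3) in \<open>auto simp: abs_le_iff\<close>)
    then show ?thesis by blast
  qed
  obtain L where L: "\<And>f g. f \<in> lin_growth \<Longrightarrow> g \<in> lin_growth \<Longrightarrow> L (\<lambda>x. f x + g x) = L f + L g"
    "\<And>f t. f \<in> lin_growth \<Longrightarrow> L (\<lambda>x. t * f x) = t * L f" "\<And>f r. f \<in> lin_growth \<Longrightarrow> (f, r) \<in> E \<Longrightarrow> L f \<le> r"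
    using hahn_banach_cone[OF cone E0 Edom] by blast
  have Lm: "L (\<lambda>x. - h x) = - L h" if "h \<in> lin_growth" for h using L(2)[OF that, of "-1"] by simp
  have pf: "positive_functional L"
    unfolding positive_functional_def
  proof (intro conjI ballI allI impI L(1,2))
    fix h assume h: "h \<in> lin_growth" "\<forall>x. 0 \<le> h x"
    have "((\<lambda>x. - h x), 0) \<in> E" by (rule EI[of 0 "\<lambda>x. 0" "\<lambda>x. 0" _ 0]) (use h good0 in auto)
    then show "0 \<le> L h" using L(3)[OF lin_growth_minus[OF h(1)]] Lm[OF h(1)] by force
  qed
  have Lup: "L C \<le> (LINT x|\<nu>. C x)" if "good C" for C
    using that by (intro L(3) EI[of 0 "\<lambda>x. 0" C _ 0] good0) (auto simp: good_def)
  have Llo: "(LINT x|\<mu>. A x) \<le> L A" if A: "good A" for A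
  proof -
    have V: "A \<in> lin_growth" using A by (simp add: good_def)
    have "L (\<lambda>x. - A x) \<le> - (LINT x|\<mu>. A x)"
      by (intro L(3) lin_growth_minus[OF V] EI[of 0 A "\<lambda>x. 0" _ 0] good0 A) auto
    then show ?thesis using Lm[OF V] by simp
  qed
  \<comment> \<open>The potential of the functional L. It is convex and lies between the potentials
    of \<mu> and \<nu>, so it is the potential of a measure.\<close>
  define u where "u t = L (\<lambda>x. \<bar>t - x\<bar>)" for t
  have gabs: "good (\<lambda>x. \<bar>t - x\<bar>)" for t by (simp add: good_def lin_growth_abs convex_on_abs_diff)
  have u1: "potential \<mu> t \<le> u t" for t unfolding u_def potential_def by (rule Llo[OF gabs])
  have u2: "u t \<le> potential \<nu> t" for t unfolding u_def potential_def by (rule Lup[OF gabs])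
  have ucv: "convex_on UNIV u"
  proof (rule convex_onI)
    fix t x y :: real assume t: "0 < t" "t < 1"
    have "u ((1 - t) *\<^sub>R x + t *\<^sub>R y) \<le> L (\<lambda>z. (1 - t) * \<bar>x - z\<bar> + t * \<bar>y - z\<bar>)"
      unfolding u_def
    proof (intro positive_functionalD(3)[OF pf] lin_growth_add lin_growth_cmult lin_growth_abs)
      fix z
      have "\<bar>(1 - t) *\<^sub>R x + t *\<^sub>R y - z\<bar> = \<bar>(1 - t) * (x - z) + t * (y - z)\<bar>" by (simp add: algebra_simps)
      also have "\<dots> \<le> (1 - t) * \<bar>x - z\<bar> + t * \<bar>y - z\<bar>"
        using t by (intro order_trans[OF abs_triangle_ineq]) (simp add: abs_mult)
      finally show "\<bar>(1 - t) *\<^sub>R x + t *\<^sub>R y - z\<bar> \<le> (1 - t) * \<bar>x - z\<bar> + t * \<bar>y - z\<bar>" .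
    qed
    also have "\<dots> = (1 - t) * u x + t * u y"
      unfolding u_def by (simp add: L(1) L(2) lin_growth_cmult lin_growth_abs)
    finally show "u ((1 - t) *\<^sub>R x + t *\<^sub>R y) \<le> (1 - t) * u x + t * u y" .
  qed simp
  obtain \<theta> where \<theta>: "finite_first_moment \<theta>" "potential \<theta> = u" "mass \<theta> = mass \<mu>" "mean \<theta> = mean \<mu>"
    by (rule exists_measure_of_potential[OF le ucv u1 u2])
  have "good (\<lambda>x. 1)" "good (\<lambda>x. -1)" by (simp_all add: good_def lin_growth_const convex_on_const)
  then have "L (\<lambda>x. 1) \<le> mass \<nu>" "mass \<mu> \<le> L (\<lambda>x. 1)"
    using Lup[of "\<lambda>x. 1"] Llo[of "\<lambda>x. 1"] ffmD(2)[OF f(1)] ffmD(2)[OF f(2)] by simp_all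
  then have L1: "L (\<lambda>x. 1) = (LINT x|\<theta>. 1)" using eqs \<theta>(3) ffmD(2)[OF \<theta>(1)] by simp
  have Labs: "L (\<lambda>x. \<bar>t - x\<bar>) = (LINT x|\<theta>. \<bar>t - x\<bar>)" for t
    using fun_cong[OF \<theta>(2), of t] by (simp add: potential_def u_def)
  show thesis
  proof (rule that[of \<theta>])
    show "pot_le \<mu> \<theta>" using \<theta> f u1 by (simp add: pot_le_def)
    show "pot_le \<theta> \<nu>" using \<theta> f u2 eqs by (simp add: pot_le_def)
    fix k
    obtain K R \<kappa> where k: "\<forall>x y. \<bar>g k x - g k y\<bar> \<le> K * \<bar>x - y\<bar>" "\<forall>x. R \<le> \<bar>x\<bar> \<longrightarrow> g k x = \<kappa>"
      using gL[of k] by (elim exE conjE) (rule that)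
    have "L (g k) = (LINT x|\<theta>. g k x)"
      by (rule positive_functional_unique[OF pf positive_functional_integral[OF \<theta>(1)] L1 Labs k(1)[rule_format] k(2)[rule_format]])
    moreover have "L (\<lambda>x. - g k x) \<le> - a"
      by (intro L(3) lin_growth_minus gV EI[of 1 "\<lambda>x. 0" "\<lambda>x. 0" _ k] good0) auto
    ultimately show "a \<le> (LINT x|\<theta>. g k x)" using Lm[OF gV[of k]] by simp
  qed
qed

section \<open>Weak duality for the auxiliary problems\<close>

lemma ext_integral_nonneg:
  assumes "\<And>x. 0 \<le> g x"
  shows "ext_integral M g = enn2ereal (\<integral>\<^sup>+x. e2ennreal (g x) \<partial>M)"
proof -
  have "e2ennreal (- g x) = 0" for x using assms[of x] by (intro e2ennreal_neg) simp
  then show ?thesis by (simp add: ext_integral_def zero_ennreal.rep_eq)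
qed

context irreducible
begin

text \<open>C - A majorizes f on J, which carries \<theta>, so its integral bounds the outer
  integral of f; \<open>weak_duality\<close> between \<theta> and \<nu> gives the rest, since the
  gap from \<theta> to \<nu> is at most that from \<mu> to \<nu>.\<close>

lemma aux_primal_le_aux_dual:
  assumes f0: "\<And>x. 0 \<le> f x"
  shows "aux_primal \<mu> \<nu> f \<le> aux_dual \<mu> \<nu> f"
  unfolding aux_primal_def aux_dual_def
proof (intro SUP_least INF_greatest, clarify)
  fix \<theta> \<phi> \<psi>
  assume f: "finite_first_moment \<theta>" and o: "\<mu> \<le>\<^sub>c \<theta>" "\<theta> \<le>\<^sub>c \<nu>" and D: "(\<phi>, \<psi>) \<in> aux_dual_set \<mu> \<nu> f"
  have le: "pot_le \<mu> \<theta>" "pot_le \<theta> \<nu>"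
    using convex_order_imp_pot_le[OF ffm_\<mu> f o(1)] convex_order_imp_pot_le[OF f ffm_\<nu> o(2)] .
  note \<theta> = carried_between[OF le]
  show "outer_integral \<theta> f \<le> pair_integral I J \<mu> \<nu> \<phi> \<psi>"
  proof (rule dual_setD[OF D f0])
    fix A C assume A: "cvx A" and C: "cvx C" and fl: "\<And>x. x \<in> J \<Longrightarrow> f x \<le> ereal (C x - A x)"
      and v: "pair_integral I J \<mu> \<nu> \<phi> \<psi> = enn2ereal (primal_dual_value A C)"
    note [measurable] = cvxD(2)[OF A] cvxD(2)[OF C]
    have AC: "A x \<le> C x" if "x \<in> J" for x using order_trans[OF f0 fl[OF that]] by simp
    \<comment> \<open>The outer integral wants a majorant on the whole line; the infinite value off
      J does not contribute, as that set is \<theta>-null.\<close>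
    define g where "g x = (if x \<in> J then ereal (C x - A x) else \<infinity>)" for x
    have g0: "0 \<le> g x" for x using AC[of x] by (simp add: g_def)
    have "g \<in> borel_measurable borel" unfolding g_def by measurable
    then have "g \<in> borel_measurable \<theta>" by (rule measurable_carried[OF \<theta>])
    then have "outer_integral \<theta> f \<le> ext_integral \<theta> g"
      unfolding outer_integral_def using fl by (intro INF_lower) (auto simp: g_def)
    also have "\<dots> = enn2ereal (\<integral>\<^sup>+x. e2ennreal (g x) \<partial>\<theta>)" by (rule ext_integral_nonneg[OF g0])
    also have "(\<integral>\<^sup>+x. e2ennreal (g x) \<partial>\<theta>) = (\<integral>\<^sup>+x. ennreal (C x - A x) \<partial>\<theta>)"
      by (rule nn_integral_cong_AE, use carriedD(2)[OF \<theta>] in eventually_elim) (simp add: g_def)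
    also have "(\<integral>\<^sup>+x. ennreal (C x - A x) \<partial>\<theta>) \<le> (\<integral>\<^sup>+x. ennreal (C x - A x) \<partial>\<nu>) + gap \<theta> \<nu> A"
      by (rule weak_duality[OF A C AC \<theta> carried_\<nu> le(2)])
    also have "\<dots> \<le> primal_dual_value A C"
      unfolding primal_dual_value_def gap_add[OF cvxD(1)[OF A] carried_\<mu> \<theta> carried_\<nu> le, symmetric]
      by (intro add_mono) (simp_all add: add_increasing)
    finally show ?thesis unfolding v by (simp add: less_eq_ennreal.rep_eq)
  qed
qed

lemma dual_attained:
  assumes f0: "\<And>x. 0 \<le> f x" and fin: "aux_dual \<mu> \<nu> f < \<infinity>"
  obtains \<phi> \<psi> where "(\<phi>, \<psi>) \<in> aux_dual_set \<mu> \<nu> f" "pair_integral I J \<mu> \<nu> \<phi> \<psi> = aux_dual \<mu> \<nu> f"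
proof -
  obtain v where v: "aux_dual \<mu> \<nu> f = ereal v"
    using fin dual_value_nonneg[OF f0] by (cases "aux_dual \<mu> \<nu> f") auto
  obtain \<phi> \<psi> where p: "(\<phi>, \<psi>) \<in> aux_dual_set \<mu> \<nu> (\<lambda>x. SUP n::nat. f x)" "pair_integral I J \<mu> \<nu> \<phi> \<psi> \<le> ereal v"
    by (rule dual_limit_attained[of "\<lambda>n. f" v]) (use f0 v in auto)
  have D: "(\<phi>, \<psi>) \<in> aux_dual_set \<mu> \<nu> f" using p(1) by simp
  have "aux_dual \<mu> \<nu> f \<le> pair_integral I J \<mu> \<nu> \<phi> \<psi>"
    unfolding aux_dual_def using INF_lower[OF D, of "\<lambda>(\<phi>, \<psi>). pair_integral I J \<mu> \<nu> \<phi> \<psi>"] by simp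
  then show thesis using that[OF D] p(2) v by (simp add: order_antisym)
qed

lemma aux_dual_mono:
  assumes "\<And>x. f x \<le> g x"
  shows "aux_dual \<mu> \<nu> f \<le> aux_dual \<mu> \<nu> g"
  unfolding aux_dual_def
  by (rule INF_superset_mono) (use assms order_trans in \<open>fastforce simp: aux_dual_set_def\<close>)+

text \<open>For functions of linear growth all integrals are finite and the gap is \<nu>(A) -
  \<mu>(A), so the pair (-A, C) has the value \<nu>(C) - \<mu>(A).\<close>

lemma aux_dual_le_integrals:
  assumes A: "convex_on UNIV A" "A \<in> lin_growth" and C: "convex_on UNIV C" "C \<in> lin_growth"
    and f0: "\<And>x. 0 \<le> f x" and fl: "\<And>x. f x \<le> ereal (C x - A x)"
  shows "aux_dual \<mu> \<nu> f \<le> ereal ((LINT x|\<nu>. C x) - (LINT x|\<mu>. A x))"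
proof -
  obtain c where c: "c \<in> I" using I_ne by auto
  have cv: "cvx A" "cvx C"
    using A C by (auto simp: cvx_def lin_growth_def intro: convex_on_subset[OF _ subset_UNIV conv_J])
  have AC: "A x \<le> C x" for x using order_trans[OF f0 fl] by simp
  have iA: "integrable \<theta> A" if "finite_first_moment \<theta>" for \<theta> by (rule lin_growth_integrable[OF that A(2)])
  have tilde_eq: "tilde A c = (\<lambda>x. A x - ((A c - rderiv A c * c) + rderiv A c * x))"
    by (simp add: fun_eq_iff tilde_def algebra_simps)
  have t: "(\<integral>\<^sup>+x. ennreal (tilde A c x) \<partial>\<theta>) =
      ennreal ((LINT x|\<theta>. A x) - ((A c - rderiv A c * c) * mass \<theta> + rderiv A c * mean \<theta>))"
    and t0: "0 \<le> (LINT x|\<theta>. A x) - ((A c - rderiv A c * c) * mass \<theta> + rderiv A c * mean \<theta>)" if \<theta>: "carried \<theta>" for \<theta>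
  proof -
    let ?r = "(LINT x|\<theta>. A x) - ((A c - rderiv A c * c) * mass \<theta> + rderiv A c * mean \<theta>)"
    have f: "finite_first_moment \<theta>" by (rule carriedD(1)[OF \<theta>])
    have nn: "AE x in \<theta>. 0 \<le> tilde A c x"
      using carriedD(2)[OF \<theta>] by eventually_elim (rule tilde_nonneg[OF cvxD(1)[OF cv(1)] c])
    have i: "integrable \<theta> (tilde A c)" and e: "(LINT x|\<theta>. tilde A c x) = ?r"
      unfolding tilde_eq integral_affine[OF f, symmetric]
      by (rule Bochner_Integration.integrable_diff[OF iA[OF f] ffm_integrable_affine[OF f]],
          rule Bochner_Integration.integral_diff[OF iA[OF f] ffm_integrable_affine[OF f]])
    show "(\<integral>\<^sup>+x. ennreal (tilde A c x) \<partial>\<theta>) = ennreal ?r" unfolding e[symmetric] by (rule nn_integral_eq_integral[OF i nn])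
    show "0 \<le> ?r" unfolding e[symmetric] using nn by (rule integral_nonneg_AE)
  qed
  have eqs: "mass \<nu> = mass \<mu>" "mean \<nu> = mean \<mu>" using pot_le_\<mu>\<nu> by (simp_all add: pot_le_def)
  have le: "(LINT x|\<mu>. A x) \<le> (LINT x|\<nu>. A x)"
    by (rule convex_order_integral_le[OF pot_le_imp_convex_order[OF pot_le_\<mu>\<nu>] A(1) iA[OF ffm_\<mu>] iA[OF ffm_\<nu>]])
  have "ennreal ((LINT x|\<nu>. A x) - ((A c - rderiv A c * c) * mass \<nu> + rderiv A c * mean \<nu>)) =
      ennreal ((LINT x|\<mu>. A x) - ((A c - rderiv A c * c) * mass \<mu> + rderiv A c * mean \<mu>)) + gap \<mu> \<nu> A"
    using tilde_integral_order[OF cvxD(1)[OF cv(1)] c carried_\<mu> carried_\<nu> pot_le_\<mu>\<nu>] unfolding t[OF carried_\<mu>] t[OF carried_\<nu>] .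
  then have g: "gap \<mu> \<nu> A = ennreal ((LINT x|\<nu>. A x) - (LINT x|\<mu>. A x))"
    using t0[OF carried_\<mu>] t0[OF carried_\<nu>] le unfolding eqs
    by (cases "gap \<mu> \<nu> A") (auto simp: ennreal_plus[symmetric] simp del: ennreal_plus)
  have iC: "integrable \<nu> C" by (rule lin_growth_integrable[OF ffm_\<nu> C(2)])
  have CA: "(LINT x|\<nu>. A x) \<le> (LINT x|\<nu>. C x)" using AC by (intro integral_mono iA[OF ffm_\<nu>] iC)
  have "(\<integral>\<^sup>+x. ennreal (C x - A x) \<partial>\<nu>) = ennreal ((LINT x|\<nu>. C x) - (LINT x|\<nu>. A x))"
    using AC iA[OF ffm_\<nu>] iC by (subst nn_integral_eq_integral) auto
  then have pv: "primal_dual_value A C = ennreal ((LINT x|\<nu>. C x) - (LINT x|\<mu>. A x))"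
    unfolding primal_dual_value_def g using le CA by (simp add: ennreal_plus[symmetric] del: ennreal_plus)
  have fin: "primal_dual_value A C < \<infinity>" by (simp add: pv)
  have "aux_dual \<mu> \<nu> f \<le> pair_integral I J \<mu> \<nu> (\<lambda>x. ereal (- A x)) (\<lambda>x. ereal (C x))"
    unfolding aux_dual_def
    using INF_lower[OF dual_setI(1)[OF cv fl f0 fin], of "\<lambda>(\<phi>, \<psi>). pair_integral I J \<mu> \<nu> \<phi> \<psi>"] by simp
  also have "\<dots> = ereal ((LINT x|\<nu>. C x) - (LINT x|\<mu>. A x))"
    using dual_setI(2)[OF cv fl f0 fin] le CA by (simp add: pv)
  finally show ?thesis .
qed

end

section \<open>Capacitability\<close>

lemma compact_le_sequence: "compact {z :: nat \<Rightarrow> nat. \<forall>i. z i \<le> s i}"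
proof -
  have "compactin (product_topology (\<lambda>i. euclidean) UNIV) (PiE UNIV (\<lambda>i. {..s i}))"
    unfolding compactin_PiE by (simp add: finite_imp_compact)
  moreover have "PiE UNIV (\<lambda>i. {..s i}) = {z. \<forall>i. z i \<le> s i}" by auto
  ultimately show ?thesis by (simp add: euclidean_product_topology)
qed

lemma open_contains_cylinder:
  fixes V :: "(nat \<Rightarrow> nat) set"
  assumes "open V" "z \<in> V"
  shows "\<exists>n. {w. \<forall>i<n. w i = z i} \<subseteq> V"
proof -
  have "openin (product_topology (\<lambda>i. euclidean) UNIV) V" using assms(1) by (simp add: euclidean_product_topology)
  from product_topology_open_contains_basis[OF this assms(2)] obtain X where
    X: "z \<in> (\<Pi>\<^sub>E i\<in>UNIV. X i)" "finite {i. X i \<noteq> UNIV}" "(\<Pi>\<^sub>E i\<in>UNIV. X i) \<subseteq> V" by auto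
  obtain n where n: "\<forall>i\<in>{i. X i \<noteq> UNIV}. i < n" using X(2) by (meson finite_nat_set_iff_bounded)
  have "{w. \<forall>i<n. w i = z i} \<subseteq> (\<Pi>\<^sub>E i\<in>UNIV. X i)"
  proof
    fix w assume w: "w \<in> {w. \<forall>i<n. w i = z i}"
    have "w i \<in> X i" for i using n w X(1) by (cases "X i = UNIV") (auto simp: PiE_iff)
    then show "w \<in> (\<Pi>\<^sub>E i\<in>UNIV. X i)" by auto
  qed
  from order_trans[OF this X(3)] show ?thesis by (rule exI)
qed

text \<open>Finitely many cylinders inside V cover the compact set, and the longest of them
  determines n. It permits the passage from the compact set back to a finite stage of the
  capacitability construction.\<close>

lemma compact_sequences_neighbourhood:
  fixes V :: "(nat \<Rightarrow> nat) set"
  assumes V: "open V" and sub: "{z. \<forall>i. z i \<le> s i} \<subseteq> V"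
  obtains n where "{z. \<forall>i<n. z i \<le> s i} \<subseteq> V"
proof -
  let ?K = "{z. \<forall>i. z i \<le> s i}"
  have "\<exists>n. z \<in> V \<longrightarrow> {w. \<forall>i<n. w i = z i} \<subseteq> V" for z using open_contains_cylinder[OF V, of z] by blast
  then have "\<forall>z. \<exists>n. z \<in> V \<longrightarrow> {w. \<forall>i<n. w i = z i} \<subseteq> V" by (rule allI)
  from choice[OF this] obtain N where N: "\<forall>z. z \<in> V \<longrightarrow> {w. \<forall>i<N z. w i = z i} \<subseteq> V" ..
  have op: "open {w :: nat \<Rightarrow> nat. \<forall>i<N z. w i = z i}" for z
  proof -
    have "open ((\<lambda>w :: nat \<Rightarrow> nat. w i) -` {z i})" for i
      by (rule open_vimage) (auto simp: open_discrete)
    then have "open (\<Inter>i\<in>{..<N z}. (\<lambda>w :: nat \<Rightarrow> nat. w i) -` {z i})" by (intro open_INT) auto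
    moreover have "(\<Inter>i\<in>{..<N z}. (\<lambda>w :: nat \<Rightarrow> nat. w i) -` {z i}) = {w. \<forall>i<N z. w i = z i}" by auto
    ultimately show ?thesis by simp
  qed
  obtain Z where Z: "Z \<subseteq> ?K" "finite Z" "?K \<subseteq> (\<Union>z\<in>Z. {w. \<forall>i<N z. w i = z i})"
    by (rule compactE_image[OF compact_le_sequence[of s], of ?K "\<lambda>z. {w. \<forall>i<N z. w i = z i}"]) (use op in auto)
  define n where "n = Max (insert 0 (N ` Z))"
  have n: "N z \<le> n" if "z \<in> Z" for z using that Z(2) by (auto simp: n_def intro!: Max_ge)
  have "{z. \<forall>i<n. z i \<le> s i} \<subseteq> V"
  proof
    fix w assume w: "w \<in> {z. \<forall>i<n. z i \<le> s i}"
    \<comment> \<open>The truncation of w by s lies in the compact set and agrees with w below n;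
      the cylinder that covers it looks only at coordinates below n and hence contains w.\<close>
    have "(\<lambda>i. min (w i) (s i)) \<in> ?K" by simp
    then have "(\<lambda>i. min (w i) (s i)) \<in> (\<Union>z\<in>Z. {w. \<forall>i<N z. w i = z i})" by (rule subsetD[OF Z(3)])
    then obtain z where z: "z \<in> Z" "\<forall>i<N z. min (w i) (s i) = z i" by auto
    have "w i = z i" if "i < N z" for i using z(2) w that n[OF z(1)] by (auto simp: min_def)
    moreover have "z \<in> V" using z(1) Z(1) sub by blast
    ultimately show "w \<in> V" using N by (simp add: subset_iff)
  qed
  then show thesis by (rule that)
qed

text \<open>The first coordinate of z selects a rational level, the remaining ones parametrize the
  superlevel set for it. All points produced lie strictly below the graph of f, and every
  nonnegative height below it is reached or exceeded.\<close>

lemma upper_semianalytic_parametrization: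
  fixes f :: "real \<Rightarrow> ereal"
  assumes f: "upper_semianalytic f" and f0: "\<And>x. 0 \<le> f x"
  obtains G :: "(nat \<Rightarrow> nat) \<Rightarrow> real \<times> real" where "continuous_on UNIV G" "\<And>z. ereal (snd (G z)) < f (fst (G z))"
    "\<And>x c. 0 \<le> c \<Longrightarrow> ereal c < f x \<Longrightarrow> \<exists>z. fst (G z) = x \<and> c \<le> snd (G z)"
proof -
  define q where "q i = real_of_rat (from_nat i)" for i :: nat
  \<comment> \<open>Level -1 replaces the levels with empty strict superlevel set, which are not images of the Baire space.\<close>
  define c where "c i = (if {x. ereal (q i) < f x} = {} then -1 else q i)" for i
  have ne: "{x. ereal (c i) < f x} \<noteq> {}" for i
  proof (cases "{x. ereal (q i) < f x} = {}")
    case True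
    then have "ereal (c i) < 0" by (simp add: c_def)
    then have "ereal (c i) < f 0" using f0[of 0] by (rule less_le_trans)
    then show ?thesis by blast
  next
    case False
    then show ?thesis by (simp only: c_def if_False simp_thms)
  qed
  have "\<exists>g :: (nat \<Rightarrow> nat) \<Rightarrow> real. continuous_on UNIV g \<and> range g = {x. ereal (c i) < f x}" for i
    using f ne[of i] by (auto simp: upper_semianalytic_def analytic_set_def)
  then obtain g where g: "\<And>i. continuous_on UNIV (g i :: (nat \<Rightarrow> nat) \<Rightarrow> real)" "\<And>i. range (g i) = {x. ereal (c i) < f x}" by metis
  define G where "G z = (g (z 0) (\<lambda>i. z (Suc i)), c (z 0))" for z
  show thesis
  proof (rule that[of G])
    have "continuous_on (\<Union>i\<in>UNIV. (\<lambda>z. z 0) -` {i}) G"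
    proof (rule continuous_on_open_UN)
      show "open ((\<lambda>z. z 0 :: nat) -` {i})" for i by (rule open_vimage) (auto simp: open_discrete)
      fix i :: nat
      have s: "continuous_on UNIV (\<lambda>z :: nat \<Rightarrow> nat. \<lambda>i. z (Suc i))" by (intro continuous_on_coordinatewise_then_product) simp
      have "continuous_on UNIV (\<lambda>z :: nat \<Rightarrow> nat. (g i (\<lambda>i. z (Suc i)), c i))"
        by (intro continuous_on_Pair continuous_on_const continuous_on_compose2[OF g(1) s]) auto
      then have "continuous_on ((\<lambda>z. z 0) -` {i}) (\<lambda>z :: nat \<Rightarrow> nat. (g i (\<lambda>i. z (Suc i)), c i))"
        by (rule continuous_on_subset) simp
      then show "continuous_on ((\<lambda>z. z 0) -` {i}) G"
        by (rule continuous_on_eq) (auto simp: G_def)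
    qed
    moreover have "(\<Union>i\<in>UNIV. (\<lambda>z. z 0) -` {i}) = (UNIV :: (nat \<Rightarrow> nat) set)" by auto
    ultimately show "continuous_on UNIV G" by simp
    show "ereal (snd (G z)) < f (fst (G z))" for z
      using g(2)[of "z 0"] by (auto simp: G_def)
    fix x k assume "0 \<le> k" "ereal k < f x"
    then obtain r where r: "ereal k < ereal r" "ereal r < f x" using ereal_dense2 by blast
    obtain p where p: "k < real_of_rat p" "real_of_rat p < r" using r(1) of_rat_dense by auto
    define i where "i = to_nat p"
    have qi: "q i = real_of_rat p" by (simp add: q_def i_def)
    have lt: "ereal (q i) < f x" using p(2) r(2) by (intro less_trans[OF _ r(2)]) (simp add: qi)
    then have ci: "c i = q i" by (auto simp: c_def)
    then obtain w where w: "g i w = x" using g(2)[of i] lt by (metis (mono_tags) imageE mem_Collect_eq)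
    show "\<exists>z. fst (G z) = x \<and> k \<le> snd (G z)"
      by (rule exI[of _ "case_nat i w"]) (use w p(1) ci qi in \<open>simp add: G_def\<close>)
  qed
qed

text \<open>Lipschitz functions lying strictly above the points of a compact set S in the plane and
  decreasing to the upper boundary of S.\<close>

definition lip_hull :: "(real \<times> real) set \<Rightarrow> nat \<Rightarrow> real \<Rightarrow> real" where
  "lip_hull S k x = (SUP p\<in>S. max 0 (snd p - real (Suc k) * \<bar>x - fst p\<bar>)) + inverse (real (Suc k))"

context
  fixes S :: "(real \<times> real) set"
  assumes S: "compact S" "S \<noteq> {}"
begin

lemma compact_plane_bound: obtains R where "0 \<le> R" "\<And>p. p \<in> S \<Longrightarrow> \<bar>fst p\<bar> \<le> R" "\<And>p. p \<in> S \<Longrightarrow> \<bar>snd p\<bar> \<le> R"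
proof -
  obtain R where R: "\<And>p. p \<in> S \<Longrightarrow> norm p \<le> R" using compact_imp_bounded[OF S(1)] by (auto simp: bounded_iff)
  have "\<bar>fst p\<bar> \<le> R" "\<bar>snd p\<bar> \<le> R" if "p \<in> S" for p
    using R[OF that] norm_fst_le[of "fst p" "snd p"] norm_snd_le[of "snd p" "fst p"] by simp_all
  moreover have "0 \<le> R" using R S(2) norm_ge_zero order_trans by blast
  ultimately show thesis using that by blast
qed

lemma lip_hull_bdd: "bdd_above ((\<lambda>p. max 0 (snd p - real (Suc k) * \<bar>x - fst p\<bar>)) ` S)"
proof -
  obtain R where R: "0 \<le> R" "\<And>p. p \<in> S \<Longrightarrow> \<bar>snd p\<bar> \<le> R" by (rule compact_plane_bound) auto
  have "snd p - real (Suc k) * \<bar>x - fst p\<bar> \<le> R" if "p \<in> S" for p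
  proof -
    have "0 \<le> real (Suc k) * \<bar>x - fst p\<bar>" by simp
    then show ?thesis using R(2)[OF that] by linarith
  qed
  then show ?thesis using R(1) by (intro bdd_aboveI[of _ R]) auto
qed

lemma lip_hull_ge: "p \<in> S \<Longrightarrow> max 0 (snd p - real (Suc k) * \<bar>x - fst p\<bar>) + inverse (real (Suc k)) \<le> lip_hull S k x"
  unfolding lip_hull_def by (intro add_mono cSUP_upper lip_hull_bdd) auto

lemma lip_hull_le:
  "(\<And>p. p \<in> S \<Longrightarrow> max 0 (snd p - real (Suc k) * \<bar>x - fst p\<bar>) + inverse (real (Suc k)) \<le> b) \<Longrightarrow> lip_hull S k x \<le> b"
proof -
  assume b: "\<And>p. p \<in> S \<Longrightarrow> max 0 (snd p - real (Suc k) * \<bar>x - fst p\<bar>) + inverse (real (Suc k)) \<le> b"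
  have "(SUP p\<in>S. max 0 (snd p - real (Suc k) * \<bar>x - fst p\<bar>)) \<le> b - inverse (real (Suc k))"
    by (rule cSUP_least[OF S(2)]) (use b in \<open>simp add: le_diff_eq del: of_nat_Suc\<close>)
  then show ?thesis unfolding lip_hull_def by linarith
qed

lemma lip_hull_pos: "0 < lip_hull S k x"
proof -
  obtain p where "p \<in> S" using S(2) by blast
  from lip_hull_ge[OF this, of k x] have "inverse (real (Suc k)) \<le> lip_hull S k x" by linarith
  then show ?thesis by (rule less_le_trans[rotated]) simp
qed

lemma lip_hull_above: "p \<in> S \<Longrightarrow> max 0 (snd p) < lip_hull S k (fst p)"
proof -
  assume "p \<in> S"
  from lip_hull_ge[OF this, of k "fst p"] have "max 0 (snd p) + inverse (real (Suc k)) \<le> lip_hull S k (fst p)" by simp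
  then show ?thesis by (rule less_le_trans[rotated]) simp
qed

lemma lip_hull_lipschitz: "\<bar>lip_hull S k x - lip_hull S k y\<bar> \<le> real (Suc k) * \<bar>x - y\<bar>"
proof -
  have "lip_hull S k x \<le> lip_hull S k y + real (Suc k) * \<bar>x - y\<bar>" for x y
  proof (rule lip_hull_le)
    fix p assume p: "p \<in> S"
    have "real (Suc k) * \<bar>y - fst p\<bar> \<le> real (Suc k) * (\<bar>x - fst p\<bar> + \<bar>x - y\<bar>)" by (intro mult_left_mono) auto
    then have "real (Suc k) * \<bar>y - fst p\<bar> \<le> real (Suc k) * \<bar>x - fst p\<bar> + real (Suc k) * \<bar>x - y\<bar>" by (simp only: distrib_left)
    moreover have "0 \<le> real (Suc k) * \<bar>x - y\<bar>" by simp
    ultimately show "max 0 (snd p - real (Suc k) * \<bar>x - fst p\<bar>) + inverse (real (Suc k)) \<le> lip_hull S k y + real (Suc k) * \<bar>x - y\<bar>"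
      using lip_hull_ge[OF p, of k y] by linarith
  qed
  from this[of x y] this[of y x] show ?thesis by (simp add: abs_le_iff abs_minus_commute algebra_simps)
qed

lemma lip_hull_decreasing: "lip_hull S (Suc k) x \<le> lip_hull S k x"
proof (rule lip_hull_le)
  fix p assume p: "p \<in> S"
  have "real (Suc k) * \<bar>x - fst p\<bar> \<le> real (Suc (Suc k)) * \<bar>x - fst p\<bar>" by (intro mult_right_mono) auto
  moreover have "inverse (real (Suc (Suc k))) \<le> inverse (real (Suc k))" by (intro le_imp_inverse_le) auto
  ultimately show "max 0 (snd p - real (Suc (Suc k)) * \<bar>x - fst p\<bar>) + inverse (real (Suc (Suc k))) \<le> lip_hull S k x"
    using lip_hull_ge[OF p, of k x] by linarith
qed

lemma lip_hull_constant: obtains R where "\<And>x k. R \<le> \<bar>x\<bar> \<Longrightarrow> lip_hull S k x = inverse (real (Suc k))"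
proof -
  obtain R where R: "0 \<le> R" "\<And>p. p \<in> S \<Longrightarrow> \<bar>fst p\<bar> \<le> R" "\<And>p. p \<in> S \<Longrightarrow> \<bar>snd p\<bar> \<le> R" by (rule compact_plane_bound) auto
  show thesis
  proof (rule that)
    fix x k assume x: "2 * R \<le> \<bar>x\<bar>"
    have "max 0 (snd p - real (Suc k) * \<bar>x - fst p\<bar>) = 0" if "p \<in> S" for p
    proof -
      have "1 * \<bar>x - fst p\<bar> \<le> real (Suc k) * \<bar>x - fst p\<bar>" by (intro mult_right_mono) auto
      moreover have "max 0 s = 0" if "s \<le> 0" for s :: real using that by simp
      ultimately show ?thesis using R(2,3)[OF that] x by (smt (verit))
    qed
    then have "(SUP p\<in>S. max 0 (snd p - real (Suc k) * \<bar>x - fst p\<bar>)) = (SUP p\<in>S. 0)" by (intro SUP_cong) auto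
    then show "lip_hull S k x = inverse (real (Suc k))" using S(2) by (simp add: lip_hull_def)
  qed
qed

lemma lip_hull_continuous: "continuous_on UNIV (lip_hull S k)"
proof -
  have "(real (Suc k))-lipschitz_on UNIV (lip_hull S k)"
    by (rule lipschitz_onI) (use lip_hull_lipschitz in \<open>auto simp: dist_real_def\<close>)
  then show ?thesis by (rule lipschitz_on_continuous_on)
qed

lemma lip_hull_lin_growth: "lip_hull S k \<in> lin_growth"
proof (rule lin_growthI)
  show "lip_hull S k \<in> borel_measurable borel" by (rule borel_measurable_continuous_onI[OF lip_hull_continuous])
  show "\<bar>lip_hull S k x\<bar> \<le> \<bar>lip_hull S k 0\<bar> + real (Suc k) * \<bar>x\<bar>" for x
    using lip_hull_lipschitz[of k x 0] abs_triangle_ineq[of "lip_hull S k x - lip_hull S k 0" "lip_hull S k 0"] by simp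
qed

text \<open>A value that stays above r' comes, for each slope, from points of S close to x whose
  height exceeds r. The sets of such points are compact and nested, and a common point has first
  coordinate x.\<close>

lemma lip_hull_limit:
  assumes r: "0 \<le> r" "r < r'" and le: "\<And>k. r' \<le> lip_hull S k x"
  obtains c where "(x, c) \<in> S" "r \<le> c"
proof -
  obtain m where m: "inverse (real (Suc m)) < r' - r" using reals_Archimedean[of "r' - r"] r(2) by auto
  define F where "F k = {p\<in>S. r + real k * \<bar>x - fst p\<bar> \<le> snd p}" for k
  have "\<Inter>(range F) \<noteq> {}"
  proof (rule compact_nest)
    fix k
    have "closed {p :: real \<times> real. r + real k * \<bar>x - fst p\<bar> \<le> snd p}"
      by (intro closed_Collect_le continuous_intros)
    moreover have "F k = S \<inter> {p. r + real k * \<bar>x - fst p\<bar> \<le> snd p}" by (auto simp: F_def)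
    ultimately show "compact (F k)" using compact_Int_closed[OF S(1)] by simp
    show "F l \<subseteq> F k" if "k \<le> l" for l
    proof
      fix p assume p: "p \<in> F l"
      have "real k * \<bar>x - fst p\<bar> \<le> real l * \<bar>x - fst p\<bar>" using that by (intro mult_right_mono) auto
      then show "p \<in> F k" using p by (auto simp: F_def)
    qed
    \<comment> \<open>An index of at least m makes the additive term of \<open>lip_hull\<close>
      smaller than r' - r.\<close>
    define l where "l = max k m"
    have "inverse (real (Suc l)) \<le> inverse (real (Suc m))" unfolding l_def by (intro le_imp_inverse_le) auto
    then have "r < (SUP p\<in>S. max 0 (snd p - real (Suc l) * \<bar>x - fst p\<bar>))" using le[of l] m unfolding lip_hull_def by linarith
    then obtain p where p: "p \<in> S" "r < max 0 (snd p - real (Suc l) * \<bar>x - fst p\<bar>)"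
      unfolding less_cSUP_iff[OF S(2) lip_hull_bdd] by blast
    have "real k * \<bar>x - fst p\<bar> \<le> real (Suc l) * \<bar>x - fst p\<bar>" unfolding l_def by (intro mult_right_mono) auto
    then have "p \<in> F k" using p r(1) unfolding F_def by auto
    then show "F k \<noteq> {}" by blast
  qed
  then obtain p where p: "\<And>k. p \<in> F k" by auto
  have "fst p = x"
  proof (rule ccontr)
    assume "fst p \<noteq> x"
    then obtain k :: nat where "snd p - r < real k * \<bar>x - fst p\<bar>" using reals_Archimedean3[of "\<bar>x - fst p\<bar>"] by auto
    then show False using p[of k] by (simp add: F_def)
  qed
  then have "(x, snd p) \<in> S" "r \<le> snd p" using p[of 0] by (auto simp: F_def)
  then show thesis by (rule that)
qed

end

section \<open>Strong duality\<close>

context irreducible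
begin

text \<open>If a separated the two values, the dual value could be kept above a while the
  coordinates of the parameter are bounded one after the other. The compact set that remains lies
  strictly below the graph of f, and a measure that gives all its Lipschitz hulls integral at least
  a gives f an outer integral of at least a.\<close>

lemma aux_dual_le_aux_primal:
  assumes f: "upper_semianalytic f" and f0: "\<And>x. 0 \<le> f x"
  shows "aux_dual \<mu> \<nu> f \<le> aux_primal \<mu> \<nu> f"
proof (rule ccontr)
  assume "\<not> ?thesis"
  then obtain a where a: "aux_primal \<mu> \<nu> f < ereal a" "ereal a < aux_dual \<mu> \<nu> f" using ereal_dense2 by (auto simp: not_le)
  obtain G :: "(nat \<Rightarrow> nat) \<Rightarrow> real \<times> real" where G: "continuous_on UNIV G" "\<And>z. ereal (snd (G z)) < f (fst (G z))"
    "\<And>x c. 0 \<le> c \<Longrightarrow> ereal c < f x \<Longrightarrow> \<exists>z. fst (G z) = x \<and> c \<le> snd (G z)"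
    using upper_semianalytic_parametrization[OF f f0] by metis
  \<comment> \<open>\<open>F N\<close> is the upper boundary of the part of the hypograph
    parametrized by N, cut off at 0 from below; \<open>F UNIV\<close> dominates f.\<close>
  define t where "t N x z = (if z \<in> N \<and> fst (G z) = x then ereal (max 0 (snd (G z))) else 0)" for N x z
  define F where "F N x = (SUP z. t N x z)" for N x
  have t0: "0 \<le> t N x z" for N x z by (simp add: t_def le_max_iff_disj)
  have F0: "0 \<le> F N x" for N x unfolding F_def by (rule SUP_upper2[OF UNIV_I]) (rule t0)
  have t_mono: "t N x z \<le> t N' x z" if "N \<subseteq> N'" for N N' x z using that by (auto simp: t_def le_max_iff_disj)
  have F_mono: "F N x \<le> F N' x" if "N \<subseteq> N'" for N N' x unfolding F_def by (rule SUP_mono') (rule t_mono[OF that])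
  have f_le: "f x \<le> F UNIV x" for x
  proof (rule ccontr)
    assume "\<not> ?thesis"
    then obtain c where c: "F UNIV x < ereal c" "ereal c < f x" using ereal_dense2 by (auto simp: not_le)
    have "0 \<le> c" using order_le_less_trans[OF F0 c(1)] by simp
    then obtain z where z: "fst (G z) = x" "c \<le> snd (G z)" using G(3) c(2) by blast
    have "ereal c \<le> t UNIV x z" using z by (simp add: t_def le_max_iff_disj)
    also have "\<dots> \<le> F UNIV x" unfolding F_def by (rule SUP_upper) simp
    finally show False using c(1) by simp
  qed
  \<comment> \<open>The sets with \<open>z n <= b\<close> increase to N as b grows. Were all their
    values at most a, \<open>dual_limit_attained\<close> would yield a pair for the supremum, hence
    for \<open>F N\<close>, of value at most a.\<close>
  have step: "\<exists>b. ereal a < aux_dual \<mu> \<nu> (F (N \<inter> {z. z n \<le> b}))" if N: "ereal a < aux_dual \<mu> \<nu> (F N)" for N n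
  proof (rule ccontr)
    assume "\<not> ?thesis"
    then have le: "aux_dual \<mu> \<nu> (F (N \<inter> {z. z n \<le> b})) \<le> ereal a" for b by (auto simp: not_less)
    obtain \<phi> \<psi> where p: "(\<phi>, \<psi>) \<in> aux_dual_set \<mu> \<nu> (\<lambda>x. SUP b. F (N \<inter> {z. z n \<le> b}) x)" "pair_integral I J \<mu> \<nu> \<phi> \<psi> \<le> ereal a"
      by (rule dual_limit_attained[of "\<lambda>b. F (N \<inter> {z. z n \<le> b})" a]) (auto intro: F0 F_mono le)
    have "F N x \<le> (SUP b. F (N \<inter> {z. z n \<le> b}) x)" for x
      unfolding F_def[of N]
    proof (rule SUP_least)
      fix z
      have "t N x z \<le> t (N \<inter> {w. w n \<le> z n}) x z" by (simp add: t_def)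
      also have "\<dots> \<le> F (N \<inter> {w. w n \<le> z n}) x" unfolding F_def by (rule SUP_upper) simp
      also have "\<dots> \<le> (SUP b. F (N \<inter> {z. z n \<le> b}) x)" by (rule SUP_upper) simp
      finally show "t N x z \<le> (SUP b. F (N \<inter> {z. z n \<le> b}) x)" .
    qed
    then have "aux_dual \<mu> \<nu> (F N) \<le> aux_dual \<mu> \<nu> (\<lambda>x. SUP b. F (N \<inter> {z. z n \<le> b}) x)" by (rule aux_dual_mono)
    also have "\<dots> \<le> pair_integral I J \<mu> \<nu> \<phi> \<psi>"
      unfolding aux_dual_def using INF_lower[OF p(1), of "\<lambda>(\<phi>, \<psi>). pair_integral I J \<mu> \<nu> \<phi> \<psi>"] by simp
    finally show False using N p(2) by simp
  qed
  have "\<exists>NN. \<forall>n. (ereal a < aux_dual \<mu> \<nu> (F (NN n)) \<and> (n = 0 \<longrightarrow> NN n = UNIV)) \<and> (\<exists>b. NN (Suc n) = NN n \<inter> {z. z n \<le> b})"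
  proof (rule dependent_nat_choice)
    show "\<exists>N. ereal a < aux_dual \<mu> \<nu> (F N) \<and> (0 = (0::nat) \<longrightarrow> N = UNIV)"
      using less_le_trans[OF a(2) aux_dual_mono[OF f_le]] by auto
    fix N and n :: nat assume "ereal a < aux_dual \<mu> \<nu> (F N) \<and> (n = 0 \<longrightarrow> N = UNIV)"
    then obtain b where "ereal a < aux_dual \<mu> \<nu> (F (N \<inter> {z. z n \<le> b}))" using step by blast
    then show "\<exists>N'. (ereal a < aux_dual \<mu> \<nu> (F N') \<and> (Suc n = 0 \<longrightarrow> N' = UNIV)) \<and> (\<exists>b. N' = N \<inter> {z. z n \<le> b})"
      by (intro exI[of _ "N \<inter> {z. z n \<le> b}"]) auto
  qed
  then obtain NN where NN: "\<And>n. ereal a < aux_dual \<mu> \<nu> (F (NN n))" "NN 0 = UNIV" "\<forall>n. \<exists>b. NN (Suc n) = NN n \<inter> {z. z n \<le> b}"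
    by auto
  from choice[OF NN(3)] obtain s where s: "\<And>n. NN (Suc n) = NN n \<inter> {z. z n \<le> s n}" by auto
  have NN_eq: "NN n = {z. \<forall>i<n. z i \<le> s i}" for n
    by (induction n) (auto simp: NN(2) s less_Suc_eq)
  define S where "S = G ` {z. \<forall>i. z i \<le> s i}"
  have "compact S" unfolding S_def
    by (rule compact_continuous_image[OF continuous_on_subset[OF G(1) subset_UNIV] compact_le_sequence])
  moreover have "G (\<lambda>i. 0) \<in> S" by (auto simp: S_def)
  ultimately have S: "compact S" "S \<noteq> {}" by auto
  \<comment> \<open>The hull lies strictly above S, so the parameters whose points lie below it form
    an open neighbourhood of the compact parameter set and contain some stage \<open>NN n\<close>;
    the bound of that stage is inherited.\<close>
  have big: "ereal a < aux_dual \<mu> \<nu> (\<lambda>x. ereal (lip_hull S k x))" for k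
  proof -
    have cG: "continuous_on UNIV (\<lambda>z. fst (G z))" "continuous_on UNIV (\<lambda>z. snd (G z))"
      using G(1) by (auto intro: continuous_intros)
    have "open {z. snd (G z) < lip_hull S k (fst (G z))}"
      by (intro open_Collect_less cG continuous_on_compose2[OF lip_hull_continuous[OF S] cG(1)]) auto
    moreover have "{z. \<forall>i. z i \<le> s i} \<subseteq> {z. snd (G z) < lip_hull S k (fst (G z))}"
    proof
      fix z assume "z \<in> {z. \<forall>i. z i \<le> s i}"
      then have "G z \<in> S" by (simp add: S_def)
      from lip_hull_above[OF S this, of k] show "z \<in> {z. snd (G z) < lip_hull S k (fst (G z))}" by simp
    qed
    ultimately obtain n where n: "{z. \<forall>i<n. z i \<le> s i} \<subseteq> {z. snd (G z) < lip_hull S k (fst (G z))}"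
      by (rule compact_sequences_neighbourhood)
    have "F (NN n) x \<le> ereal (lip_hull S k x)" for x
      unfolding F_def
    proof (rule SUP_least)
      fix z
      show "t (NN n) x z \<le> ereal (lip_hull S k x)"
        using subsetD[OF n, of z] lip_hull_pos[OF S, of k x] by (auto simp: t_def NN_eq simp del: ereal_max)
    qed
    then show ?thesis by (rule less_le_trans[OF NN(1) aux_dual_mono])
  qed
  obtain \<theta> where \<theta>: "pot_le \<mu> \<theta>" "pot_le \<theta> \<nu>" "\<And>k. a \<le> (LINT x|\<theta>. lip_hull S k x)"
  proof (rule integral_functional_extension[OF pot_le_\<mu>\<nu>, of "lip_hull S" a])
    obtain R where R: "\<And>x k. R \<le> \<bar>x\<bar> \<Longrightarrow> lip_hull S k x = inverse (real (Suc k))" using lip_hull_constant[OF S] by blast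
    show "\<exists>K R \<kappa>. (\<forall>x y. \<bar>lip_hull S k x - lip_hull S k y\<bar> \<le> K * \<bar>x - y\<bar>) \<and> (\<forall>x. R \<le> \<bar>x\<bar> \<longrightarrow> lip_hull S k x = \<kappa>)" for k
      by (intro exI[of _ "real (Suc k)"] exI[of _ R] exI[of _ "inverse (real (Suc k))"] conjI allI impI lip_hull_lipschitz[OF S] R)
    show "lip_hull S k \<in> lin_growth" for k by (rule lip_hull_lin_growth[OF S])
    show "lip_hull S (Suc k) x \<le> lip_hull S k x" for k x by (rule lip_hull_decreasing[OF S])
    fix k A C assume "convex_on UNIV A" "convex_on UNIV C" "A \<in> lin_growth" "C \<in> lin_growth" and le: "\<And>x. lip_hull S k x \<le> C x - A x"
    then have "aux_dual \<mu> \<nu> (\<lambda>x. ereal (lip_hull S k x)) \<le> ereal ((LINT x|\<nu>. C x) - (LINT x|\<mu>. A x))"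
      using lip_hull_pos[OF S, of k] by (intro aux_dual_le_integrals) (auto simp: less_imp_le)
    from less_le_trans[OF big this] show "a \<le> (LINT x|\<nu>. C x) - (LINT x|\<mu>. A x)" by simp
  next
    fix \<theta> assume "pot_le \<mu> \<theta>" "pot_le \<theta> \<nu>" "\<And>k. a \<le> (LINT x|\<theta>. lip_hull S k x)"
    then show thesis by (rule that)
  qed
  have ff: "finite_first_moment \<theta>" using \<theta>(1) by (simp add: pot_le_def)
  \<comment> \<open>The hulls decrease to the upper boundary of S, and all points of S lie below f
    by the choice of G; off the projection of S the limit is 0.\<close>
  have lim: "(INF k. ennreal (lip_hull S k x)) \<le> e2ennreal (f x)" for x
  proof (rule ccontr)
    assume "\<not> ?thesis"
    then have "e2ennreal (f x) < (INF k. ennreal (lip_hull S k x))" by simp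
    then obtain r' where r': "e2ennreal (f x) < r'" "r' < (INF k. ennreal (lip_hull S k x))" using dense by blast
    obtain r where r: "e2ennreal (f x) < r" "r < r'" using dense[OF r'(1)] by blast
    obtain q' where q': "r' = ennreal q'" "0 \<le> q'" using less_le_trans[OF r'(2) top_greatest] by (cases r') auto
    obtain q where q: "r = ennreal q" "0 \<le> q" using r(2) by (cases r) auto
    have "q < q'" using r(2) q q' by (simp add: ennreal_less_iff)
    moreover have "q' \<le> lip_hull S k x" for k
    proof -
      have "ennreal q' \<le> ennreal (lip_hull S k x)" using less_le_trans[OF r'(2) INF_lower[of k]] q'(1) by simp
      then show ?thesis using lip_hull_pos[OF S, of k x] by (simp add: ennreal_le_iff)
    qed
    ultimately obtain c where c: "(x, c) \<in> S" "q \<le> c" using lip_hull_limit[OF S q(2)] by blast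
    then obtain z where "G z = (x, c)" by (auto simp: S_def)
    then have "ereal c < f x" using G(2)[of z] by simp
    then have "ennreal c \<le> e2ennreal (f x)" using e2ennreal_mono[of "ereal c" "f x"] by simp
    moreover have "ennreal q \<le> ennreal c" using c(2) by (rule ennreal_leI)
    ultimately show False using r(1) q(1) by simp
  qed
  have "ereal a \<le> outer_integral \<theta> f"
    unfolding outer_integral_def
  \<comment> \<open>f itself need not be measurable; an arbitrary measurable majorant g is compared
    with the decreasing limit of the hulls, whose integrals are finite and at least a.\<close>
  proof (rule INF_greatest, clarify)
    fix g assume g: "g \<in> borel_measurable \<theta>" "\<forall>x\<in>space \<theta>. f x \<le> g x"
    then have fg: "f x \<le> g x" for x using ffmD(2)[OF ff] by simp
    have int: "(\<integral>\<^sup>+x. ennreal (lip_hull S k x) \<partial>\<theta>) = ennreal (LINT x|\<theta>. lip_hull S k x)" for k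
      using lip_hull_pos[OF S] by (intro nn_integral_eq_integral lin_growth_integrable[OF ff lip_hull_lin_growth[OF S]]) (simp add: less_imp_le)
    have "ennreal a \<le> (INF k. \<integral>\<^sup>+x. ennreal (lip_hull S k x) \<partial>\<theta>)"
      unfolding int by (intro INF_greatest ennreal_leI \<theta>(3))
    also have "\<dots> = (\<integral>\<^sup>+x. (INF k. ennreal (lip_hull S k x)) \<partial>\<theta>)"
    proof (rule nn_integral_monotone_convergence_INF_decseq[symmetric])
      show "decseq (\<lambda>k x. ennreal (lip_hull S k x))"
        by (intro decseq_SucI le_funI ennreal_leI lip_hull_decreasing[OF S])
      fix k
      have "lip_hull S k \<in> borel_measurable \<theta>"
        using lin_growth_integrable[OF ff lip_hull_lin_growth[OF S, of k]] by (rule borel_measurable_integrable)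
      then show "(\<lambda>x. ennreal (lip_hull S k x)) \<in> borel_measurable \<theta>" by measurable
      show "(\<integral>\<^sup>+x. ennreal (lip_hull S k x) \<partial>\<theta>) < \<infinity>" unfolding int by simp
    qed
    also have "\<dots> \<le> (\<integral>\<^sup>+x. e2ennreal (g x) \<partial>\<theta>)"
      by (intro nn_integral_mono order_trans[OF lim e2ennreal_mono[OF fg]])
    finally have "enn2ereal (ennreal a) \<le> ext_integral \<theta> g"
      unfolding ext_integral_nonneg[OF order_trans[OF f0 fg]] by (simp only: less_eq_ennreal.rep_eq)
    moreover have "ereal a \<le> enn2ereal (ennreal a)" by (simp add: ennreal.rep_eq)
    ultimately show "ereal a \<le> ext_integral \<theta> g" by (rule order_trans[rotated])
  qed
  also have "\<dots> \<le> aux_primal \<mu> \<nu> f"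
    unfolding aux_primal_def using ff pot_le_imp_convex_order[OF \<theta>(1)] pot_le_imp_convex_order[OF \<theta>(2)] by (intro SUP_upper) simp
  finally show False using a(1) by simp
qed

end

lemma zero_measure_nn_integral:
  assumes "emeasure M (space M) = 0"
  shows "(\<integral>\<^sup>+x. f x \<partial>M) = 0"
proof -
  have "AE x in M. False" by (rule AE_I[of _ _ "space M"]) (use assms in auto)
  then have "(\<integral>\<^sup>+x. f x \<partial>M) = (\<integral>\<^sup>+x. 0 \<partial>M)" by (intro nn_integral_cong_AE) (auto elim: eventually_mono)
  then show ?thesis by simp
qed

text \<open>Irreducibility does not exclude that I is empty; then both measures vanish.\<close>

lemma degenerate_duality:
  assumes ff: "finite_first_moment \<mu>" "finite_first_moment \<nu>" and irr: "irreducible_pair \<mu> \<nu>" and E: "dom_I \<mu> \<nu> = {}"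
  shows "aux_primal \<mu> \<nu> f = 0" "aux_dual \<mu> \<nu> f = 0"
    "((\<lambda>x. 0), (\<lambda>x. 0)) \<in> aux_dual_set \<mu> \<nu> f" "pair_integral (dom_I \<mu> \<nu>) (dom_J \<mu> \<nu>) \<mu> \<nu> \<phi> \<psi> = 0"
proof -
  have J: "dom_J \<mu> \<nu> = {}" by (simp add: dom_J_def E)
  have \<mu>0: "emeasure \<mu> UNIV = 0" and co: "\<mu> \<le>\<^sub>c \<nu>" using irr by (auto simp: irreducible_pair_def E)
  have primal: "outer_integral \<theta> f = 0" if \<theta>: "finite_first_moment \<theta>" "\<mu> \<le>\<^sub>c \<theta>" for \<theta>
  proof -
    interpret finite_measure \<theta> using ffmD(3)[OF \<theta>(1)] .
    have "mass \<mu> = 0" using \<mu>0 by (simp add: measure_def)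
    then have "mass \<theta> = 0" using convex_order_imp_pot_le[OF ff(1) \<theta>] by (simp add: pot_le_def)
    then have "emeasure \<theta> (space \<theta>) = 0" using ffmD(2)[OF \<theta>(1)] by (simp add: emeasure_eq_measure)
    then have "ext_integral \<theta> g = 0" for g by (simp only: ext_integral_def zero_measure_nn_integral zero_ennreal.rep_eq) simp
    moreover have "{g \<in> borel_measurable \<theta>. \<forall>x\<in>space \<theta>. f x \<le> g x} \<noteq> {}"
      by (intro ex_in_conv[THEN iffD1] exI[of _ "\<lambda>x. \<infinity>"]) simp
    ultimately show ?thesis by (simp add: outer_integral_def)
  qed
  have "\<mu> \<le>\<^sub>c \<mu>" by (simp add: convex_order_def)
  then have "\<mu> \<in> {\<theta>. finite_first_moment \<theta> \<and> \<mu> \<le>\<^sub>c \<theta> \<and> \<theta> \<le>\<^sub>c \<nu>}" using ff co by simp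
  then have ne: "{\<theta>. finite_first_moment \<theta> \<and> \<mu> \<le>\<^sub>c \<theta> \<and> \<theta> \<le>\<^sub>c \<nu>} \<noteq> {}" by blast
  have "aux_primal \<mu> \<nu> f = (SUP \<theta>\<in>{\<theta>. finite_first_moment \<theta> \<and> \<mu> \<le>\<^sub>c \<theta> \<and> \<theta> \<le>\<^sub>c \<nu>}. 0)"
    unfolding aux_primal_def by (intro SUP_cong refl primal) auto
  then show "aux_primal \<mu> \<nu> f = 0" using ne by simp
  have e0: "(\<integral>\<^sup>+x. g x \<partial>restrict_space M {}) = 0" for M :: "real measure" and g
    by (rule zero_measure_nn_integral) (simp add: space_restrict_space)
  have gap0: "concave_gap {} {} \<mu> \<nu> h = 0" for h
  proof -
    have "(\<integral>\<^sup>+x. g x \<partial>second_deriv_measure {} u) = 0" for g u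
      by (rule zero_measure_nn_integral) (simp add: second_deriv_measure_def space_extend_measure)
    then show ?thesis by (simp add: concave_gap_def zero_ennreal.rep_eq set_lebesgue_integral_def zero_ereal_def[symmetric])
  qed
  have pi: "pair_integral (dom_I \<mu> \<nu>) (dom_J \<mu> \<nu>) \<mu> \<nu> \<phi> \<psi> = 0" for \<phi> \<psi>
    unfolding J E pair_integral_def moderated_value_def gap0
    by (simp add: ext_integral_def e0 zero_ennreal.rep_eq)
  then show "pair_integral (dom_I \<mu> \<nu>) (dom_J \<mu> \<nu>) \<mu> \<nu> \<phi> \<psi> = 0" .
  have "concave_moderator {} \<mu> \<nu> (\<lambda>x. 0) (\<lambda>x. 0) (\<lambda>x. 0)"
    by (simp add: concave_moderator_def concave_on_def convex_on_def ext_L1_def e0)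
  then show D: "((\<lambda>x. 0), (\<lambda>x. 0)) \<in> aux_dual_set \<mu> \<nu> f"
    unfolding aux_dual_set_def Lc_def J E by (auto simp: ext_concave_on_def ext_convex_on_def gap0)
  have "aux_dual \<mu> \<nu> f = (INF p\<in>aux_dual_set \<mu> \<nu> f. 0)"
    unfolding aux_dual_def by (intro INF_cong refl) (auto simp: pi)
  moreover have "aux_dual_set \<mu> \<nu> f \<noteq> {}" using D by blast
  ultimately show "aux_dual \<mu> \<nu> f = 0" by simp
qed

theorem theorem4p10:
  fixes \<mu> \<nu> :: "real measure" and f :: "real \<Rightarrow> ereal"
  assumes "finite_first_moment \<mu>" and "finite_first_moment \<nu>"
    and "irreducible_pair \<mu> \<nu>"
    and "\<forall>x. f x \<in> {0..\<infinity>}"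
  shows "(upper_semianalytic f \<longrightarrow>
            aux_primal \<mu> \<nu> f = aux_dual \<mu> \<nu> f \<and> aux_dual \<mu> \<nu> f \<in> {0..\<infinity>}) \<and>
         (aux_dual \<mu> \<nu> f < \<infinity> \<longrightarrow>
            (\<exists>(\<phi>, \<psi>)\<in>aux_dual_set \<mu> \<nu> f.
               pair_integral (dom_I \<mu> \<nu>) (dom_J \<mu> \<nu>) \<mu> \<nu> \<phi> \<psi> = aux_dual \<mu> \<nu> f))"
proof (cases "dom_I \<mu> \<nu> = {}")
  case True
  note d = degenerate_duality[OF assms(1-3) True]
  show ?thesis unfolding d(1,2) using d(3,4) by auto
next
  case False
  then interpret irreducible \<mu> \<nu> using assms(1-3) by unfold_locales
  have f0: "0 \<le> f x" for x using assms(4) by simp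
  show ?thesis
  proof (intro conjI impI)
    assume "upper_semianalytic f"
    then show "aux_primal \<mu> \<nu> f = aux_dual \<mu> \<nu> f"
      using aux_primal_le_aux_dual[OF f0] aux_dual_le_aux_primal f0 by (simp add: order_antisym)
    show "aux_dual \<mu> \<nu> f \<in> {0..\<infinity>}" using dual_value_nonneg[OF f0] by simp
  next
    assume "aux_dual \<mu> \<nu> f < \<infinity>"
    then obtain \<phi> \<psi> where "(\<phi>, \<psi>) \<in> aux_dual_set \<mu> \<nu> f" "pair_integral I J \<mu> \<nu> \<phi> \<psi> = aux_dual \<mu> \<nu> f"
      by (rule dual_attained[OF f0])
    then show "\<exists>(\<phi>, \<psi>)\<in>aux_dual_set \<mu> \<nu> f. pair_integral I J \<mu> \<nu> \<phi> \<psi> = aux_dual \<mu> \<nu> f" by blast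
  qed
qed

end
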